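(* Let $\Lambda$ be an Artin algebra and let $\mathcal{C}$ be an $n$-precluster tilting subcategory of $\operatorname{mod}\Lambda$ for some $n\ge1$. (a) $\mathcal{Z}(\mathcal{C})$ is extension closed. (b) $\mathcal{Z}(\mathcal{C})$ has a structure of a Frobenius category whose short exact sequences are precisely the $F_{\mathcal{C}}$-exact sequences, and whose projective-injective objects are precisely $\mathcal{C}$. (c) $\mathcal{U}(\mathcal{C})$ has a structure of a triangulated category with the suspension functor $[1]=\Omega^{-1}_{F^{\mathcal{C}}}$.
   Context: All modules are finitely generated left modules; $D$ is the standard duality, $\tau=D\operatorname{Tr}$, $\tau^-=\operatorname{Tr}D$, $\Omega_\Lambda^{\pm1}$ minimal (co)syzygies, $\tau_n=\tau\Omega_\Lambda^{n-1}$, $\tau_n^-=\tau^-\Omega_\Lambda^{-(n-1)}$. A subcategory $\mathcal{C}$ of $\operatorname{mod}\Lambda$ (full, closed under isomorphisms, finite direct sums and direct summands) is $n$-precluster tilting if: (i) $\Lambda, D\Lambda\in\mathcal{C}$; (ii) $\tau_n(\mathcal{C})\subseteq\mathcal{C}$, $\tau_n^-(\mathcal{C})\subseteq\mathcal{C}$; (iii) $\operatorname{Ext}^i_\Lambda(\mathcal{C},\mathcal{C})=0$ for $0<i<n$; (iv) $\mathcal{C}$ is functorially finite in $\operatorname{mod}\Lambda$. $\mathcal{Z}(\mathcal{C})=\{X\in\operatorname{mod}\Lambda\mid\operatorname{Ext}^i_\Lambda(\mathcal{C},X)=0,\ 0<i<n\}=\{X\in\operatorname{mod}\Lambda\mid\operatorname{Ext}^i_\Lambda(X,\mathcal{C})=0,\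 0<i<n\}$ (so $\mathcal{Z}(\mathcal{C})=\operatorname{mod}\Lambda$ if $n=1$), and $\mathcal{U}(\mathcal{C})=\mathcal{Z}(\mathcal{C})/[\mathcal{C}]$, where $[\mathcal{C}]$ is the ideal of morphisms factoring through objects of $\mathcal{C}$. An exact sequence $0\to A\to B\to C\to0$ in $\operatorname{mod}\Lambda$ is $F_{\mathcal{C}}$-exact if $\operatorname{Hom}_\Lambda(X,B)\to\operatorname{Hom}_\Lambda(X,C)$ is surjective for all $X\in\mathcal{C}$, and $F^{\mathcal{C}}$-exact if $\operatorname{Hom}_\Lambda(B,X)\to\operatorname{Hom}_\Lambda(A,X)$ is surjective for all $X\in\mathcal{C}$. $\Omega^{-1}_{F^{\mathcal{C}}}(X)$ is the cokernel of a minimal left $\mathcal{C}$-approximation of $X$ (which is injective since $D\Lambda\in\mathcal{C}$). *)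

theory Defs
  imports "HOL-Algebra.Module" "HOL-Algebra.QuotRing" "HOL-Algebra.Elementary_Groups"
begin

section \<open>Left modules over a (not necessarily commutative) ring\<close>

text \<open>The library's locale \<open>module\<close> insists on a commutative ring of scalars; its record type is
  reused here, and the fields \<open>mult\<close> and \<open>one\<close> of a module are never looked at.  Right
  \<open>\<Lambda>\<close>-modules are left modules over \<open>opp \<Lambda>\<close>.\<close>

locale left_module = R?: ring R + M?: abelian_group M
  for R :: "'a ring" (structure) and M :: "('a, 'b) module" (structure) +
  assumes smult_closed:
      "\<lbrakk>a \<in> carrier R; x \<in> carrier M\<rbrakk> \<Longrightarrow> a \<odot>\<^bsub>M\<^esub> x \<in> carrier M"
    and smult_l_distr:
      "\<lbrakk>a \<in> carrier R; b \<in> carrier R; x \<in> carrier M\<rbrakk> \<Longrightarrow>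
        (a \<oplus> b) \<odot>\<^bsub>M\<^esub> x = a \<odot>\<^bsub>M\<^esub> x \<oplus>\<^bsub>M\<^esub> b \<odot>\<^bsub>M\<^esub> x"
    and smult_r_distr:
      "\<lbrakk>a \<in> carrier R; x \<in> carrier M; y \<in> carrier M\<rbrakk> \<Longrightarrow>
        a \<odot>\<^bsub>M\<^esub> (x \<oplus>\<^bsub>M\<^esub> y) = a \<odot>\<^bsub>M\<^esub> x \<oplus>\<^bsub>M\<^esub> a \<odot>\<^bsub>M\<^esub> y"
    and smult_assoc:
      "\<lbrakk>a \<in> carrier R; b \<in> carrier R; x \<in> carrier M\<rbrakk> \<Longrightarrow>
        (a \<otimes> b) \<odot>\<^bsub>M\<^esub> x = a \<odot>\<^bsub>M\<^esub> (b \<odot>\<^bsub>M\<^esub> x)"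
    and smult_one: "x \<in> carrier M \<Longrightarrow> \<one> \<odot>\<^bsub>M\<^esub> x = x"

definition opp :: "'a ring \<Rightarrow> 'a ring" where
  "opp \<Lambda> = \<Lambda>\<lparr>mult := (\<lambda>x y. y \<otimes>\<^bsub>\<Lambda>\<^esub> x)\<rparr>"

definition fin_gen :: "'a ring \<Rightarrow> ('a, 'b) module \<Rightarrow> bool" where
  "fin_gen \<Lambda> M \<longleftrightarrow> (\<exists>A. finite A \<and> A \<subseteq> carrier M \<and>
     (\<forall>m\<in>carrier M. \<exists>c\<in>A \<rightarrow> carrier \<Lambda>. m = (\<Oplus>\<^bsub>M\<^esub>a\<in>A. c a \<odot>\<^bsub>M\<^esub> a)))"

definition fg_mod :: "'a ring \<Rightarrow> ('a, 'b) module set" where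
  "fg_mod \<Lambda> = {M. left_module \<Lambda> M \<and> fin_gen \<Lambda> M}"

text \<open>Homomorphisms are extensional functions, so that equality of homomorphisms is equality
  of functions.\<close>

definition lmod_hom :: "'a ring \<Rightarrow> ('a, 'b) module \<Rightarrow> ('a, 'c) module \<Rightarrow> ('b \<Rightarrow> 'c) set" where
  "lmod_hom \<Lambda> M N = {f \<in> carrier M \<rightarrow>\<^sub>E carrier N.
     (\<forall>x\<in>carrier M. \<forall>y\<in>carrier M. f (x \<oplus>\<^bsub>M\<^esub> y) = f x \<oplus>\<^bsub>N\<^esub> f y) \<and>
     (\<forall>a\<in>carrier \<Lambda>. \<forall>x\<in>carrier M. f (a \<odot>\<^bsub>M\<^esub> x) = a \<odot>\<^bsub>N\<^esub> f x)}"

definition mod_iso :: "'a ring \<Rightarrow> ('a, 'b) module \<Rightarrow> ('a, 'c) module \<Rightarrow> bool" where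
  "mod_iso \<Lambda> M N \<longleftrightarrow> (\<exists>f\<in>lmod_hom \<Lambda> M N. bij_betw f (carrier M) (carrier N))"

text \<open>The group \<open>Hom(M,N)\<close>; its operation, pointwise addition, is the \<open>mult\<close> field.\<close>

definition hom_group :: "'a ring \<Rightarrow> ('a, 'b) module \<Rightarrow> ('a, 'c) module \<Rightarrow> ('b \<Rightarrow> 'c) monoid" where
  "hom_group \<Lambda> M N = \<lparr>carrier = lmod_hom \<Lambda> M N,
     monoid.mult = (\<lambda>f g. \<lambda>x\<in>carrier M. f x \<oplus>\<^bsub>N\<^esub> g x),
     one = (\<lambda>x\<in>carrier M. \<zero>\<^bsub>N\<^esub>)\<rparr>"

definition reg_mod :: "'a ring \<Rightarrow> ('a, 'a) module" where
  "reg_mod \<Lambda> = \<lparr>carrier = carrier \<Lambda>, monoid.mult = undefined, one = undefined,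
     ring.zero = \<zero>\<^bsub>\<Lambda>\<^esub>, add = add \<Lambda>, smult = (\<lambda>a x. a \<otimes>\<^bsub>\<Lambda>\<^esub> x)\<rparr>"

definition restrict_scalars :: "('r \<Rightarrow> 'a) \<Rightarrow> ('a, 'b) module \<Rightarrow> ('r, 'b) module" where
  "restrict_scalars \<phi> M = \<lparr>carrier = carrier M, monoid.mult = undefined, one = undefined,
     ring.zero = \<zero>\<^bsub>M\<^esub>, add = add M, smult = (\<lambda>r x. \<phi> r \<odot>\<^bsub>M\<^esub> x)\<rparr>"

definition sub_mod :: "('a, 'b) module \<Rightarrow> 'b set \<Rightarrow> ('a, 'b) module" where
  "sub_mod M N = M\<lparr>carrier := N\<rparr>"

definition quot_mod :: "('a, 'b) module \<Rightarrow> 'b set \<Rightarrow> ('a, 'b set) module" where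
  "quot_mod M N = \<lparr>carrier = a_rcosets\<^bsub>M\<^esub> N, monoid.mult = undefined, one = undefined,
     ring.zero = N, add = set_add M, smult = (\<lambda>a U. \<Union>u\<in>U. N +>\<^bsub>M\<^esub> (a \<odot>\<^bsub>M\<^esub> u))\<rparr>"

definition dsum :: "('a, 'b) module \<Rightarrow> ('a, 'c) module \<Rightarrow> ('a, 'b \<times> 'c) module" where
  "dsum M N = \<lparr>carrier = carrier M \<times> carrier N, monoid.mult = undefined, one = undefined,
     ring.zero = (\<zero>\<^bsub>M\<^esub>, \<zero>\<^bsub>N\<^esub>),
     add = (\<lambda>(x, y) (x', y'). (x \<oplus>\<^bsub>M\<^esub> x', y \<oplus>\<^bsub>N\<^esub> y')),
     smult = (\<lambda>a (x, y). (a \<odot>\<^bsub>M\<^esub> x, a \<odot>\<^bsub>N\<^esub> y))\<rparr>"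

definition short_exact ::
  "'a ring \<Rightarrow> ('a, 'b) module \<Rightarrow> ('b \<Rightarrow> 'c) \<Rightarrow> ('a, 'c) module \<Rightarrow> ('c \<Rightarrow> 'd) \<Rightarrow> ('a, 'd) module \<Rightarrow> bool"
  where "short_exact \<Lambda> A f B g C \<longleftrightarrow>
     f \<in> lmod_hom \<Lambda> A B \<and> g \<in> lmod_hom \<Lambda> B C \<and>
     inj_on f (carrier A) \<and> f ` carrier A = a_kernel B C g \<and> g ` carrier B = carrier C"


section \<open>The category of finitely generated modules\<close>

text \<open>A finitely generated \<open>\<Lambda>\<close>-module has at most as many elements as there are lists over
  \<open>\<Lambda>\<close>.  Hence modules carried by sets of such lists form, up to isomorphism, all of \<open>mod \<Lambda>\<close>;
  the lemma below shows that nothing is lost.  Modules arising in other types (the regular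
  module, duals, quotients, direct sums) are compared with objects of \<open>mod \<Lambda>\<close> via
  \<^const>\<open>mod_iso\<close>.\<close>

type_synonym 'a fgm = "('a, 'a list) module"

abbreviation modules :: "'a ring \<Rightarrow> 'a fgm set" where
  "modules \<Lambda> \<equiv> fg_mod \<Lambda>"

lemma finsum_transport:
  assumes M: "abelian_monoid M" and N: "abelian_monoid N"
    and h: "h \<in> carrier M \<rightarrow> carrier N"
    and add: "\<And>x y. x \<in> carrier M \<Longrightarrow> y \<in> carrier M \<Longrightarrow> h (x \<oplus>\<^bsub>M\<^esub> y) = h x \<oplus>\<^bsub>N\<^esub> h y"
    and zero: "h \<zero>\<^bsub>M\<^esub> = \<zero>\<^bsub>N\<^esub>"
    and fin: "finite A" and u: "u \<in> A \<rightarrow> carrier M"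
  shows "h (finsum M u A) = finsum N (\<lambda>a. h (u a)) A"
  using fin u
proof (induction A)
  case empty
  then show ?case
    using zero by (simp add: abelian_monoid.finsum_empty[OF M] abelian_monoid.finsum_empty[OF N])
next
  case (insert a A)
  have ua: "u a \<in> carrier M" "u \<in> A \<rightarrow> carrier M" using insert.prems by auto
  have "finsum M u A \<in> carrier M" by (rule abelian_monoid.finsum_closed[OF M ua(2)])
  moreover have "h (u a) \<in> carrier N" "(\<lambda>a. h (u a)) \<in> A \<rightarrow> carrier N"
    using ua h by auto
  ultimately show ?case
    using insert ua by (simp add: abelian_monoid.finsum_insert[OF M] abelian_monoid.finsum_insert[OF N] add)
qed

lemma modules_universal:
  fixes M :: "('a, 'b) module"
  assumes "M \<in> fg_mod \<Lambda>"
  shows "\<exists>N\<in>modules \<Lambda>. mod_iso \<Lambda> M N"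
proof -
  interpret M: left_module \<Lambda> M using assms by (simp add: fg_mod_def)
  from assms obtain A where A: "finite A" "A \<subseteq> carrier M"
    and gen: "\<forall>m\<in>carrier M. \<exists>c\<in>A \<rightarrow> carrier \<Lambda>. m = (\<Oplus>\<^bsub>M\<^esub>a\<in>A. c a \<odot>\<^bsub>M\<^esub> a)"
    by (auto simp: fg_mod_def fin_gen_def)
  from gen obtain c where c: "\<And>m. m \<in> carrier M \<Longrightarrow>
      c m \<in> A \<rightarrow> carrier \<Lambda> \<and> m = (\<Oplus>\<^bsub>M\<^esub>a\<in>A. c m a \<odot>\<^bsub>M\<^esub> a)"
    by metis
  have cA: "c m a \<odot>\<^bsub>M\<^esub> a \<in> carrier M" if "m \<in> carrier M" "a \<in> A" for m a
    using c[OF that(1)] that A(2) by (auto simp: Pi_iff intro!: M.smult_closed)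
  obtain xs where xs: "set xs = A" using finite_list[OF A(1)] by blast
  define f where "f m = map (c m) xs" for m
  have inj: "inj_on f (carrier M)"
  proof (rule inj_onI)
    fix x y assume xy: "x \<in> carrier M" "y \<in> carrier M" "f x = f y"
    then have eq: "\<And>a. a \<in> A \<Longrightarrow> c x a = c y a" by (auto simp: f_def xs)
    have "(\<Oplus>\<^bsub>M\<^esub>a\<in>A. c x a \<odot>\<^bsub>M\<^esub> a) = (\<Oplus>\<^bsub>M\<^esub>a\<in>A. c y a \<odot>\<^bsub>M\<^esub> a)"
      by (rule M.M.finsum_cong') (use eq c[OF xy(2)] A(2) in \<open>auto simp: Pi_iff subset_iff intro!: M.smult_closed\<close>)
    then show "x = y" using c[OF xy(1)] c[OF xy(2)] by simp
  qed
  define g where "g = inv_into (carrier M) f"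
  have gf: "g (f x) = x" if "x \<in> carrier M" for x
    using that inj by (simp add: g_def)
  define N :: "'a fgm" where "N = \<lparr>carrier = f ` carrier M, monoid.mult = undefined,
    one = undefined, ring.zero = f \<zero>\<^bsub>M\<^esub>, add = (\<lambda>x y. f (g x \<oplus>\<^bsub>M\<^esub> g y)),
    smult = (\<lambda>a x. f (a \<odot>\<^bsub>M\<^esub> g x))\<rparr>"
  have Nsimps: "carrier N = f ` carrier M" "\<zero>\<^bsub>N\<^esub> = f \<zero>\<^bsub>M\<^esub>"
    "\<And>x y. x \<oplus>\<^bsub>N\<^esub> y = f (g x \<oplus>\<^bsub>M\<^esub> g y)" "\<And>a x. a \<odot>\<^bsub>N\<^esub> x = f (a \<odot>\<^bsub>M\<^esub> g x)"
    by (simp_all add: N_def)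
  have Ngrp: "abelian_group N"
  proof (rule abelian_groupI)
    fix x assume "x \<in> carrier N"
    then obtain x' where x': "x' \<in> carrier M" "x = f x'" by (auto simp: Nsimps)
    then have "f (\<ominus>\<^bsub>M\<^esub> x') \<oplus>\<^bsub>N\<^esub> x = \<zero>\<^bsub>N\<^esub>"
      by (simp add: Nsimps gf M.M.l_neg)
    then show "\<exists>y\<in>carrier N. y \<oplus>\<^bsub>N\<^esub> x = \<zero>\<^bsub>N\<^esub>" using x' by (auto simp: Nsimps)
  qed (auto simp: Nsimps gf M.M.a_ac)
  have Nmod: "left_module \<Lambda> N"
  proof (intro left_module.intro left_module_axioms.intro)
    show "ring \<Lambda>" by (rule M.R.ring_axioms)
    show "abelian_group N" by (rule Ngrp)
  qed (auto simp: Nsimps gf M.smult_closed M.smult_l_distr M.smult_r_distr M.smult_assoc M.smult_one)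
  have fgN: "fin_gen \<Lambda> N"
    unfolding fin_gen_def
  proof (intro exI[of _ "f ` A"] conjI ballI)
    show "finite (f ` A)" using A by simp
    show "f ` A \<subseteq> carrier N" using A by (auto simp: Nsimps)
    fix n assume "n \<in> carrier N"
    then obtain m where m: "m \<in> carrier M" "n = f m" by (auto simp: Nsimps)
    have injA: "inj_on f A" using inj A(2) inj_on_subset by blast
    have "n = f (\<Oplus>\<^bsub>M\<^esub>a\<in>A. c m a \<odot>\<^bsub>M\<^esub> a)" using c[OF m(1)] m(2) by simp
    also have "\<dots> = (\<Oplus>\<^bsub>N\<^esub>a\<in>A. f (c m a \<odot>\<^bsub>M\<^esub> a))"
    proof (rule finsum_transport)
      show "abelian_monoid M" by (rule M.M.abelian_monoid_axioms)
      show "abelian_monoid N" using Ngrp by (simp add: abelian_group_def)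
      show "(\<lambda>a. c m a \<odot>\<^bsub>M\<^esub> a) \<in> A \<rightarrow> carrier M"
        using cA[OF m(1)] by auto
    qed (use A in \<open>auto simp: Nsimps gf\<close>)
    also have "\<dots> = (\<Oplus>\<^bsub>N\<^esub>a\<in>A. c m (g (f a)) \<odot>\<^bsub>N\<^esub> f a)"
    proof (rule abelian_monoid.finsum_cong')
      show "abelian_monoid N" using Ngrp by (simp add: abelian_group_def)
      show "(\<lambda>a. c m (g (f a)) \<odot>\<^bsub>N\<^esub> f a) \<in> A \<rightarrow> carrier N"
        using cA[OF m(1)] A(2) by (auto simp: Nsimps gf subset_iff)
      show "\<And>a. a \<in> A \<Longrightarrow> f (c m a \<odot>\<^bsub>M\<^esub> a) = c m (g (f a)) \<odot>\<^bsub>N\<^esub> f a"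
        using A(2) by (auto simp: Nsimps gf subset_iff)
    qed simp
    also have "\<dots> = (\<Oplus>\<^bsub>N\<^esub>b\<in>f ` A. c m (g b) \<odot>\<^bsub>N\<^esub> b)"
    proof (rule abelian_monoid.finsum_reindex[symmetric])
      show "abelian_monoid N" using Ngrp by (simp add: abelian_group_def)
      show "(\<lambda>b. c m (g b) \<odot>\<^bsub>N\<^esub> b) \<in> f ` A \<rightarrow> carrier N"
        using cA[OF m(1)] A(2) by (auto simp: Nsimps gf subset_iff)
    qed (rule injA)
    finally have "n = (\<Oplus>\<^bsub>N\<^esub>b\<in>f ` A. c m (g b) \<odot>\<^bsub>N\<^esub> b)" .
    moreover have "(\<lambda>b. c m (g b)) \<in> f ` A \<rightarrow> carrier \<Lambda>"
      using c[OF m(1)] A(2) by (auto simp: gf subset_iff)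
    ultimately show "\<exists>c\<in>f ` A \<rightarrow> carrier \<Lambda>. n = (\<Oplus>\<^bsub>N\<^esub>a\<in>f ` A. c a \<odot>\<^bsub>N\<^esub> a)"
      by (intro bexI[of _ "\<lambda>b. c m (g b)"]) auto
  qed
  have "restrict f (carrier M) \<in> lmod_hom \<Lambda> M N"
    using M.smult_closed by (auto simp: lmod_hom_def Nsimps gf)
  moreover have "bij_betw (restrict f (carrier M)) (carrier M) (carrier N)"
    using inj by (auto simp: bij_betw_def Nsimps inj_on_def)
  ultimately show ?thesis
    using Nmod fgN unfolding mod_iso_def fg_mod_def by blast
qed


section \<open>Homological notions in \<open>mod \<Lambda>\<close>\<close>

definition projective_mod :: "'a ring \<Rightarrow> 'a fgm \<Rightarrow> bool" where
  "projective_mod \<Lambda> P \<longleftrightarrow> P \<in> modules \<Lambda> \<and>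
     (\<forall>A\<in>modules \<Lambda>. \<forall>B\<in>modules \<Lambda>. \<forall>g\<in>lmod_hom \<Lambda> A B. \<forall>f\<in>lmod_hom \<Lambda> P B.
        g ` carrier A = carrier B \<longrightarrow> (\<exists>h\<in>lmod_hom \<Lambda> P A. compose (carrier P) g h = f))"

definition injective_mod :: "'a ring \<Rightarrow> ('a, 'b) module \<Rightarrow> bool" where
  "injective_mod \<Lambda> I \<longleftrightarrow> I \<in> fg_mod \<Lambda> \<and>
     (\<forall>A\<in>modules \<Lambda>. \<forall>B\<in>modules \<Lambda>. \<forall>g\<in>lmod_hom \<Lambda> A B. \<forall>f\<in>lmod_hom \<Lambda> A I.
        inj_on g (carrier A) \<longrightarrow> (\<exists>h\<in>lmod_hom \<Lambda> B I. compose (carrier A) h g = f))"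

definition projective_cover ::
  "'a ring \<Rightarrow> 'a fgm \<Rightarrow> ('a list \<Rightarrow> 'b) \<Rightarrow> ('a, 'b) module \<Rightarrow> bool" where
  "projective_cover \<Lambda> P e M \<longleftrightarrow> projective_mod \<Lambda> P \<and> e \<in> lmod_hom \<Lambda> P M \<and>
     e ` carrier P = carrier M \<and>
     (\<forall>N. submodule N \<Lambda> P \<and> e ` N = carrier M \<longrightarrow> N = carrier P)"

definition injective_envelope ::
  "'a ring \<Rightarrow> ('a, 'b) module \<Rightarrow> ('b \<Rightarrow> 'c) \<Rightarrow> ('a, 'c) module \<Rightarrow> bool" where
  "injective_envelope \<Lambda> M i I \<longleftrightarrow> injective_mod \<Lambda> I \<and> i \<in> lmod_hom \<Lambda> M I \<and>
     inj_on i (carrier M) \<and>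
     (\<forall>N. submodule N \<Lambda> I \<and> N \<inter> i ` carrier M = {\<zero>\<^bsub>I\<^esub>} \<longrightarrow> N = {\<zero>\<^bsub>I\<^esub>})"

text \<open>\<open>Y\<close> is a minimal syzygy, respectively cosyzygy, of \<open>X\<close>.  Like the translates below, these
  are defined up to isomorphism and are therefore rendered as relations.\<close>

definition is_syzygy :: "'a ring \<Rightarrow> 'a fgm \<Rightarrow> 'a fgm \<Rightarrow> bool" where
  "is_syzygy \<Lambda> X Y \<longleftrightarrow> Y \<in> modules \<Lambda> \<and>
     (\<exists>P e. projective_cover \<Lambda> P e X \<and> mod_iso \<Lambda> Y (sub_mod P (a_kernel P X e)))"

definition is_cosyzygy :: "'a ring \<Rightarrow> 'a fgm \<Rightarrow> 'a fgm \<Rightarrow> bool" where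
  "is_cosyzygy \<Lambda> X Y \<longleftrightarrow> Y \<in> modules \<Lambda> \<and>
     (\<exists>I i. (I :: 'a fgm) \<in> modules \<Lambda> \<and> injective_envelope \<Lambda> X i I \<and>
        mod_iso \<Lambda> Y (quot_mod I (i ` carrier X)))"

definition projective_resolution ::
  "'a ring \<Rightarrow> ('a, 'b) module \<Rightarrow> (nat \<Rightarrow> 'a fgm) \<Rightarrow> (nat \<Rightarrow> 'a list \<Rightarrow> 'a list) \<Rightarrow> ('a list \<Rightarrow> 'b) \<Rightarrow> bool"
  where "projective_resolution \<Lambda> X P d e \<longleftrightarrow>
     (\<forall>k. projective_mod \<Lambda> (P k)) \<and>
     e \<in> lmod_hom \<Lambda> (P 0) X \<and> e ` carrier (P 0) = carrier X \<and>
     (\<forall>k. d k \<in> lmod_hom \<Lambda> (P (Suc k)) (P k)) \<and>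
     d 0 ` carrier (P 1) = a_kernel (P 0) X e \<and>
     (\<forall>k. d (Suc k) ` carrier (P (Suc (Suc k))) = a_kernel (P (Suc k)) (P k) (d k))"

definition ext_cocycles ::
  "'a ring \<Rightarrow> (nat \<Rightarrow> 'a fgm) \<Rightarrow> (nat \<Rightarrow> 'a list \<Rightarrow> 'a list) \<Rightarrow> nat \<Rightarrow> ('a, 'c) module \<Rightarrow> ('a list \<Rightarrow> 'c) set"
  where "ext_cocycles \<Lambda> P d i Y = {f \<in> lmod_hom \<Lambda> (P i) Y.
     compose (carrier (P (Suc i))) f (d i) = \<one>\<^bsub>hom_group \<Lambda> (P (Suc i)) Y\<^esub>}"

definition ext_coboundaries ::
  "'a ring \<Rightarrow> (nat \<Rightarrow> 'a fgm) \<Rightarrow> (nat \<Rightarrow> 'a list \<Rightarrow> 'a list) \<Rightarrow> nat \<Rightarrow> ('a, 'c) module \<Rightarrow> ('a list \<Rightarrow> 'c) set"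
  where "ext_coboundaries \<Lambda> P d i Y = (case i of
       0 \<Rightarrow> {\<one>\<^bsub>hom_group \<Lambda> (P 0) Y\<^esub>}
     | Suc j \<Rightarrow> (\<lambda>h. compose (carrier (P i)) h (d j)) ` lmod_hom \<Lambda> (P j) Y)"

definition ext_via ::
  "'a ring \<Rightarrow> (nat \<Rightarrow> 'a fgm) \<Rightarrow> (nat \<Rightarrow> 'a list \<Rightarrow> 'a list) \<Rightarrow> nat \<Rightarrow> ('a, 'c) module
    \<Rightarrow> ('a list \<Rightarrow> 'c) set monoid"
  where "ext_via \<Lambda> P d i Y =
     (hom_group \<Lambda> (P i) Y)\<lparr>carrier := ext_cocycles \<Lambda> P d i Y\<rparr> Mod ext_coboundaries \<Lambda> P d i Y"

definition Ext :: "'a ring \<Rightarrow> nat \<Rightarrow> ('a, 'b) module \<Rightarrow> ('a, 'c) module \<Rightarrow> ('a list \<Rightarrow> 'c) set monoid" where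
  "Ext \<Lambda> i X Y = (let Q = (SOME Q. \<exists>e. projective_resolution \<Lambda> X (fst Q) (snd Q) e)
     in ext_via \<Lambda> (fst Q) (snd Q) i Y)"


section \<open>Artin algebras, the duality \<open>D\<close>, and the higher translates\<close>

locale artin_algebra = R?: cring R + A?: ring \<Lambda>
  for R :: "'r ring" (structure) and \<Lambda> :: "'a ring" (structure) and \<phi> :: "'r \<Rightarrow> 'a" +
  assumes artinian: "\<lbrakk>\<And>k::nat. ideal (I k) R; \<And>k. I (Suc k) \<subseteq> I k\<rbrakk> \<Longrightarrow> \<exists>N. \<forall>k\<ge>N. I k = I N"
    and structure_map: "\<phi> \<in> ring_hom R \<Lambda>"
    and central: "\<lbrakk>r \<in> carrier R; x \<in> carrier \<Lambda>\<rbrakk> \<Longrightarrow> \<phi> r \<otimes>\<^bsub>\<Lambda>\<^esub> x = x \<otimes>\<^bsub>\<Lambda>\<^esub> \<phi> r"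
    and module_finite: "fin_gen R (restrict_scalars \<phi> (reg_mod \<Lambda>))"

definition jacobson_radical :: "'r ring \<Rightarrow> 'r set" where
  "jacobson_radical R = carrier R \<inter> \<Inter>{I. maximalideal I R}"

text \<open>\<open>J\<close> is an injective envelope of \<open>R/rad R\<close> over the commutative artinian ring \<open>R\<close>; the
  standard duality is \<open>D = Hom\<^sub>R(-, J)\<close>.  Such a \<open>J\<close> exists, is finitely generated, and is unique
  up to isomorphism.\<close>

definition dualizing_module :: "'r ring \<Rightarrow> ('r, 'j) module \<Rightarrow> bool" where
  "dualizing_module R J \<longleftrightarrow>
     (\<exists>i. injective_envelope R (quot_mod (reg_mod R) (jacobson_radical R)) i J)"

text \<open>For a left \<open>\<Lambda>\<close>-module \<open>M\<close> this is the left \<open>opp \<Lambda>\<close>-module \<open>D M\<close>, with action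
  \<open>(f a)(x) = f (a x)\<close>, and conversely with \<open>\<Lambda>\<close> and \<open>opp \<Lambda>\<close> exchanged.\<close>

definition dual :: "'r ring \<Rightarrow> ('r \<Rightarrow> 'a) \<Rightarrow> ('r, 'j) module \<Rightarrow> ('a, 'b) module \<Rightarrow> ('a, 'b \<Rightarrow> 'j) module" where
  "dual R \<phi> J M = \<lparr>carrier = lmod_hom R (restrict_scalars \<phi> M) J,
     monoid.mult = undefined, one = undefined,
     ring.zero = (\<lambda>x\<in>carrier M. \<zero>\<^bsub>J\<^esub>),
     add = (\<lambda>f g. \<lambda>x\<in>carrier M. f x \<oplus>\<^bsub>J\<^esub> g x),
     smult = (\<lambda>a f. \<lambda>x\<in>carrier M. f (a \<odot>\<^bsub>M\<^esub> x))\<rparr>"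

text \<open>For a left \<open>\<Lambda>\<close>-module \<open>P\<close>, the left \<open>opp \<Lambda>\<close>-module \<open>Hom(P, \<Lambda>)\<close>, with \<open>(f a)(x) = f(x) a\<close>.\<close>

definition star :: "'a ring \<Rightarrow> ('a, 'b) module \<Rightarrow> ('a, 'b \<Rightarrow> 'a) module" where
  "star \<Lambda> P = \<lparr>carrier = lmod_hom \<Lambda> P (reg_mod \<Lambda>), monoid.mult = undefined, one = undefined,
     ring.zero = (\<lambda>x\<in>carrier P. \<zero>\<^bsub>\<Lambda>\<^esub>),
     add = (\<lambda>f g. \<lambda>x\<in>carrier P. f x \<oplus>\<^bsub>\<Lambda>\<^esub> g x),
     smult = (\<lambda>a f. \<lambda>x\<in>carrier P. f x \<otimes>\<^bsub>\<Lambda>\<^esub> a)\<rparr>"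

definition minimal_presentation ::
  "'a ring \<Rightarrow> 'a fgm \<Rightarrow> ('a list \<Rightarrow> 'a list) \<Rightarrow> 'a fgm \<Rightarrow> ('a list \<Rightarrow> 'b) \<Rightarrow> ('a, 'b) module \<Rightarrow> bool" where
  "minimal_presentation \<Lambda> P1 d P0 e M \<longleftrightarrow> projective_cover \<Lambda> P0 e M \<and>
     projective_cover \<Lambda> P1 d (sub_mod P0 (a_kernel P0 M e))"

text \<open>\<open>T\<close> is isomorphic to \<open>Tr M\<close>, the cokernel of \<open>Hom(P0, \<Lambda>) \<rightarrow> Hom(P1, \<Lambda>)\<close> for a minimal
  projective presentation \<open>P1 \<rightarrow> P0 \<rightarrow> M \<rightarrow> 0\<close>.\<close>

definition is_transpose :: "'a ring \<Rightarrow> ('a, 'b) module \<Rightarrow> ('a, 'c) module \<Rightarrow> bool" where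
  "is_transpose \<Lambda> M T \<longleftrightarrow> (\<exists>P1 d P0 e. minimal_presentation \<Lambda> P1 d P0 e M \<and>
     mod_iso (opp \<Lambda>) T
       (quot_mod (star \<Lambda> P1) ((\<lambda>f. compose (carrier P1) f d) ` carrier (star \<Lambda> P0))))"

definition is_tau ::
  "'r ring \<Rightarrow> ('r \<Rightarrow> 'a) \<Rightarrow> ('r, 'j) module \<Rightarrow> 'a ring \<Rightarrow> 'a fgm \<Rightarrow> 'a fgm \<Rightarrow> bool" where
  "is_tau R \<phi> J \<Lambda> X Y \<longleftrightarrow>
     (\<exists>T\<in>modules (opp \<Lambda>). is_transpose \<Lambda> X T \<and> mod_iso \<Lambda> Y (dual R \<phi> J T))"

definition is_tau_inv ::
  "'r ring \<Rightarrow> ('r \<Rightarrow> 'a) \<Rightarrow> ('r, 'j) module \<Rightarrow> 'a ring \<Rightarrow> 'a fgm \<Rightarrow> 'a fgm \<Rightarrow> bool" where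
  "is_tau_inv R \<phi> J \<Lambda> X Y \<longleftrightarrow> is_transpose (opp \<Lambda>) (dual R \<phi> J X) Y"

definition is_tau_n ::
  "'r ring \<Rightarrow> ('r \<Rightarrow> 'a) \<Rightarrow> ('r, 'j) module \<Rightarrow> 'a ring \<Rightarrow> nat \<Rightarrow> 'a fgm \<Rightarrow> 'a fgm \<Rightarrow> bool" where
  "is_tau_n R \<phi> J \<Lambda> n X Y \<longleftrightarrow> (\<exists>Z. (is_syzygy \<Lambda> ^^ (n - 1)) X Z \<and> is_tau R \<phi> J \<Lambda> Z Y)"

definition is_tau_n_inv ::
  "'r ring \<Rightarrow> ('r \<Rightarrow> 'a) \<Rightarrow> ('r, 'j) module \<Rightarrow> 'a ring \<Rightarrow> nat \<Rightarrow> 'a fgm \<Rightarrow> 'a fgm \<Rightarrow> bool" where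
  "is_tau_n_inv R \<phi> J \<Lambda> n X Y \<longleftrightarrow> (\<exists>Z. (is_cosyzygy \<Lambda> ^^ (n - 1)) X Z \<and> is_tau_inv R \<phi> J \<Lambda> Z Y)"


section \<open>\<open>n\<close>-precluster tilting subcategories\<close>

definition mod_subcategory :: "'a ring \<Rightarrow> 'a fgm set \<Rightarrow> bool" where
  "mod_subcategory \<Lambda> C \<longleftrightarrow> C \<subseteq> modules \<Lambda> \<and>
     (\<forall>X\<in>C. \<forall>Y\<in>modules \<Lambda>. mod_iso \<Lambda> X Y \<longrightarrow> Y \<in> C) \<and>
     (\<forall>X\<in>modules \<Lambda>. carrier X = {\<zero>\<^bsub>X\<^esub>} \<longrightarrow> X \<in> C) \<and>
     (\<forall>X\<in>modules \<Lambda>. \<forall>Y\<in>modules \<Lambda>. \<forall>Z\<in>modules \<Lambda>.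
        mod_iso \<Lambda> Z (dsum X Y) \<longrightarrow> (Z \<in> C \<longleftrightarrow> X \<in> C \<and> Y \<in> C))"

definition left_approximation ::
  "'a ring \<Rightarrow> 'a fgm set \<Rightarrow> 'a fgm \<Rightarrow> ('a list \<Rightarrow> 'a list) \<Rightarrow> 'a fgm \<Rightarrow> bool" where
  "left_approximation \<Lambda> C X i E \<longleftrightarrow> E \<in> C \<and> i \<in> lmod_hom \<Lambda> X E \<and>
     (\<forall>E'\<in>C. \<forall>f\<in>lmod_hom \<Lambda> X E'. \<exists>g\<in>lmod_hom \<Lambda> E E'. compose (carrier X) g i = f)"

definition right_approximation ::
  "'a ring \<Rightarrow> 'a fgm set \<Rightarrow> 'a fgm \<Rightarrow> ('a list \<Rightarrow> 'a list) \<Rightarrow> 'a fgm \<Rightarrow> bool" where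
  "right_approximation \<Lambda> C E p X \<longleftrightarrow> E \<in> C \<and> p \<in> lmod_hom \<Lambda> E X \<and>
     (\<forall>E'\<in>C. \<forall>f\<in>lmod_hom \<Lambda> E' X. \<exists>g\<in>lmod_hom \<Lambda> E' E. compose (carrier E') p g = f)"

definition functorially_finite :: "'a ring \<Rightarrow> 'a fgm set \<Rightarrow> bool" where
  "functorially_finite \<Lambda> C \<longleftrightarrow> (\<forall>X\<in>modules \<Lambda>.
     (\<exists>i E. left_approximation \<Lambda> C X i E) \<and> (\<exists>E p. right_approximation \<Lambda> C E p X))"

definition precluster_tilting ::
  "'r ring \<Rightarrow> ('r \<Rightarrow> 'a) \<Rightarrow> ('r, 'j) module \<Rightarrow> 'a ring \<Rightarrow> nat \<Rightarrow> 'a fgm set \<Rightarrow> bool" where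
  "precluster_tilting R \<phi> J \<Lambda> n C \<longleftrightarrow>
     mod_subcategory \<Lambda> C \<and>
     (\<exists>X\<in>C. mod_iso \<Lambda> X (reg_mod \<Lambda>)) \<and>
     (\<exists>X\<in>C. mod_iso \<Lambda> X (dual R \<phi> J (reg_mod (opp \<Lambda>)))) \<and>
     (\<forall>X\<in>C. \<forall>Y\<in>modules \<Lambda>. is_tau_n R \<phi> J \<Lambda> n X Y \<longrightarrow> Y \<in> C) \<and>
     (\<forall>X\<in>C. \<forall>Y\<in>modules \<Lambda>. is_tau_n_inv R \<phi> J \<Lambda> n X Y \<longrightarrow> Y \<in> C) \<and>
     (\<forall>X\<in>C. \<forall>Y\<in>C. \<forall>i. 0 < i \<and> i < n \<longrightarrow> trivial_group (Ext \<Lambda> i X Y)) \<and>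
     functorially_finite \<Lambda> C"

text \<open>\<open>\<Z>(C)\<close>, defined by vanishing in the second argument; for precluster tilting \<open>C\<close> vanishing of
  \<open>Ext\<^sup>i(X, C)\<close> for \<open>0 < i < n\<close> describes the same subcategory.\<close>

definition Zcat :: "'a ring \<Rightarrow> nat \<Rightarrow> 'a fgm set \<Rightarrow> 'a fgm set" where
  "Zcat \<Lambda> n C = {X \<in> modules \<Lambda>. \<forall>Y\<in>C. \<forall>i. 0 < i \<and> i < n \<longrightarrow> trivial_group (Ext \<Lambda> i Y X)}"

definition extension_closed :: "'a ring \<Rightarrow> 'a fgm set \<Rightarrow> bool" where
  "extension_closed \<Lambda> S \<longleftrightarrow> (\<forall>A\<in>S. \<forall>B\<in>modules \<Lambda>. \<forall>D\<in>S. \<forall>f g.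
     short_exact \<Lambda> A f B g D \<longrightarrow> B \<in> S)"

definition F_sub_exact ::
  "'a ring \<Rightarrow> 'a fgm set \<Rightarrow> 'a fgm \<Rightarrow> ('a list \<Rightarrow> 'a list) \<Rightarrow> 'a fgm \<Rightarrow> ('a list \<Rightarrow> 'a list) \<Rightarrow> 'a fgm \<Rightarrow> bool"
  where "F_sub_exact \<Lambda> C A f B g D \<longleftrightarrow> short_exact \<Lambda> A f B g D \<and>
     (\<forall>X\<in>C. (\<lambda>h. compose (carrier X) g h) ` lmod_hom \<Lambda> X B = lmod_hom \<Lambda> X D)"


section \<open>Additive, exact and Frobenius categories\<close>

text \<open>A preadditive category has abelian groups \<open>Mor X Y\<close>, written multiplicatively as library
  groups: \<open>\<otimes>\<close> is the addition of morphisms and \<open>\<one>\<close> the zero morphism.  Morphism groups for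
  different objects may overlap, so composition is indexed by objects: \<open>Cmp X Y Z g f\<close> is
  the composite of \<open>f : X \<rightarrow> Y\<close> and \<open>g : Y \<rightarrow> Z\<close>.\<close>

record ('o, 'm) preadd_cat =
  Ob :: "'o set"
  Mor :: "'o \<Rightarrow> 'o \<Rightarrow> 'm monoid"
  Cmp :: "'o \<Rightarrow> 'o \<Rightarrow> 'o \<Rightarrow> 'm \<Rightarrow> 'm \<Rightarrow> 'm"
  Idn :: "'o \<Rightarrow> 'm"

abbreviation Arr :: "('o, 'm) preadd_cat \<Rightarrow> 'o \<Rightarrow> 'o \<Rightarrow> 'm set" where
  "Arr K X Y \<equiv> carrier (Mor K X Y)"

abbreviation zero_arr :: "('o, 'm) preadd_cat \<Rightarrow> 'o \<Rightarrow> 'o \<Rightarrow> 'm" where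
  "zero_arr K X Y \<equiv> \<one>\<^bsub>Mor K X Y\<^esub>"

definition zero_object :: "('o, 'm) preadd_cat \<Rightarrow> 'o \<Rightarrow> bool" where
  "zero_object K Z \<longleftrightarrow> Z \<in> Ob K \<and>
     (\<forall>X\<in>Ob K. Arr K X Z = {zero_arr K X Z} \<and> Arr K Z X = {zero_arr K Z X})"

definition biproduct ::
  "('o, 'm) preadd_cat \<Rightarrow> 'o \<Rightarrow> 'o \<Rightarrow> 'o \<Rightarrow> 'm \<Rightarrow> 'm \<Rightarrow> 'm \<Rightarrow> 'm \<Rightarrow> bool" where
  "biproduct K X Y B i j p q \<longleftrightarrow> B \<in> Ob K \<and>
     i \<in> Arr K X B \<and> j \<in> Arr K Y B \<and> p \<in> Arr K B X \<and> q \<in> Arr K B Y \<and>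
     Cmp K X B X p i = Idn K X \<and> Cmp K Y B Y q j = Idn K Y \<and>
     Cmp K X B Y q i = zero_arr K X Y \<and> Cmp K Y B X p j = zero_arr K Y X \<and>
     Cmp K B X B i p \<otimes>\<^bsub>Mor K B B\<^esub> Cmp K B Y B j q = Idn K B"

locale preadditive_category =
  fixes K :: "('o, 'm) preadd_cat"
  assumes Mor_group: "\<lbrakk>X \<in> Ob K; Y \<in> Ob K\<rbrakk> \<Longrightarrow> comm_group (Mor K X Y)"
    and Idn_Arr: "X \<in> Ob K \<Longrightarrow> Idn K X \<in> Arr K X X"
    and Cmp_Arr: "\<lbrakk>X \<in> Ob K; Y \<in> Ob K; Z \<in> Ob K; f \<in> Arr K X Y; g \<in> Arr K Y Z\<rbrakk>
      \<Longrightarrow> Cmp K X Y Z g f \<in> Arr K X Z"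
    and Cmp_Idn_right: "\<lbrakk>X \<in> Ob K; Y \<in> Ob K; f \<in> Arr K X Y\<rbrakk> \<Longrightarrow> Cmp K X X Y f (Idn K X) = f"
    and Cmp_Idn_left: "\<lbrakk>X \<in> Ob K; Y \<in> Ob K; f \<in> Arr K X Y\<rbrakk> \<Longrightarrow> Cmp K X Y Y (Idn K Y) f = f"
    and Cmp_assoc: "\<lbrakk>W \<in> Ob K; X \<in> Ob K; Y \<in> Ob K; Z \<in> Ob K;
        f \<in> Arr K W X; g \<in> Arr K X Y; h \<in> Arr K Y Z\<rbrakk>
      \<Longrightarrow> Cmp K W Y Z h (Cmp K W X Y g f) = Cmp K W X Z (Cmp K X Y Z h g) f"
    and Cmp_add_right: "\<lbrakk>X \<in> Ob K; Y \<in> Ob K; Z \<in> Ob K; f \<in> Arr K X Y; f' \<in> Arr K X Y; g \<in> Arr K Y Z\<rbrakk>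
      \<Longrightarrow> Cmp K X Y Z g (f \<otimes>\<^bsub>Mor K X Y\<^esub> f') = Cmp K X Y Z g f \<otimes>\<^bsub>Mor K X Z\<^esub> Cmp K X Y Z g f'"
    and Cmp_add_left: "\<lbrakk>X \<in> Ob K; Y \<in> Ob K; Z \<in> Ob K; f \<in> Arr K X Y; g \<in> Arr K Y Z; g' \<in> Arr K Y Z\<rbrakk>
      \<Longrightarrow> Cmp K X Y Z (g \<otimes>\<^bsub>Mor K Y Z\<^esub> g') f = Cmp K X Y Z g f \<otimes>\<^bsub>Mor K X Z\<^esub> Cmp K X Y Z g' f"

locale additive_category = preadditive_category +
  assumes has_zero: "\<exists>Z. zero_object K Z"
    and has_biproducts: "\<lbrakk>X \<in> Ob K; Y \<in> Ob K\<rbrakk> \<Longrightarrow> \<exists>B i j p q. biproduct K X Y B i j p q"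

definition iso_arr :: "('o, 'm) preadd_cat \<Rightarrow> 'o \<Rightarrow> 'o \<Rightarrow> 'm \<Rightarrow> bool" where
  "iso_arr K X Y f \<longleftrightarrow> f \<in> Arr K X Y \<and>
     (\<exists>g\<in>Arr K Y X. Cmp K X Y X g f = Idn K X \<and> Cmp K Y X Y f g = Idn K Y)"

definition kernel_of :: "('o, 'm) preadd_cat \<Rightarrow> 'o \<Rightarrow> 'm \<Rightarrow> 'o \<Rightarrow> 'm \<Rightarrow> 'o \<Rightarrow> bool" where
  "kernel_of K A f B g C \<longleftrightarrow> f \<in> Arr K A B \<and> g \<in> Arr K B C \<and> Cmp K A B C g f = zero_arr K A C \<and>
     (\<forall>X\<in>Ob K. \<forall>h\<in>Arr K X B. Cmp K X B C g h = zero_arr K X C \<longrightarrow>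
        (\<exists>!k. k \<in> Arr K X A \<and> Cmp K X A B f k = h))"

definition cokernel_of :: "('o, 'm) preadd_cat \<Rightarrow> 'o \<Rightarrow> 'm \<Rightarrow> 'o \<Rightarrow> 'm \<Rightarrow> 'o \<Rightarrow> bool" where
  "cokernel_of K A f B g C \<longleftrightarrow> f \<in> Arr K A B \<and> g \<in> Arr K B C \<and> Cmp K A B C g f = zero_arr K A C \<and>
     (\<forall>X\<in>Ob K. \<forall>h\<in>Arr K B X. Cmp K A B X h f = zero_arr K A X \<longrightarrow>
        (\<exists>!k. k \<in> Arr K C X \<and> Cmp K B C X k g = h))"

definition pushout ::
  "('o, 'm) preadd_cat \<Rightarrow> 'o \<Rightarrow> 'm \<Rightarrow> 'o \<Rightarrow> 'm \<Rightarrow> 'o \<Rightarrow> 'm \<Rightarrow> 'm \<Rightarrow> 'o \<Rightarrow> bool"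
  \<comment> \<open>\<open>f : A \<rightarrow> B\<close>, \<open>h : A \<rightarrow> A'\<close>, with pushout \<open>f' : A' \<rightarrow> B'\<close>, \<open>h' : B \<rightarrow> B'\<close>\<close>
  where "pushout K A f B h A' f' h' B' \<longleftrightarrow> B' \<in> Ob K \<and> f' \<in> Arr K A' B' \<and> h' \<in> Arr K B B' \<and>
     Cmp K A A' B' f' h = Cmp K A B B' h' f \<and>
     (\<forall>X\<in>Ob K. \<forall>u\<in>Arr K A' X. \<forall>v\<in>Arr K B X. Cmp K A A' X u h = Cmp K A B X v f \<longrightarrow>
        (\<exists>!w. w \<in> Arr K B' X \<and> Cmp K A' B' X w f' = u \<and> Cmp K B B' X w h' = v))"

definition pullback ::
  "('o, 'm) preadd_cat \<Rightarrow> 'o \<Rightarrow> 'm \<Rightarrow> 'o \<Rightarrow> 'm \<Rightarrow> 'o \<Rightarrow> 'm \<Rightarrow> 'm \<Rightarrow> 'o \<Rightarrow> bool"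
  \<comment> \<open>\<open>g : B \<rightarrow> C\<close>, \<open>h : C' \<rightarrow> C\<close>, with pullback \<open>g' : B' \<rightarrow> C'\<close>, \<open>h' : B' \<rightarrow> B\<close>\<close>
  where "pullback K B g C h C' g' h' B' \<longleftrightarrow> B' \<in> Ob K \<and> g' \<in> Arr K B' C' \<and> h' \<in> Arr K B' B \<and>
     Cmp K B' C' C h g' = Cmp K B' B C g h' \<and>
     (\<forall>X\<in>Ob K. \<forall>u\<in>Arr K X C'. \<forall>v\<in>Arr K X B. Cmp K X C' C h u = Cmp K X B C g v \<longrightarrow>
        (\<exists>!w. w \<in> Arr K X B' \<and> Cmp K X B' C' g' w = u \<and> Cmp K X B' B h' w = v))"

text \<open>A class of would-be short exact sequences \<open>A \<rightarrow> B \<rightarrow> C\<close> is a set of tuples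
  \<open>(A, f, B, g, C)\<close>.\<close>

type_synonym ('o, 'm) seqs = "('o \<times> 'm \<times> 'o \<times> 'm \<times> 'o) set"

definition inflation :: "('o, 'm) seqs \<Rightarrow> 'o \<Rightarrow> 'm \<Rightarrow> 'o \<Rightarrow> bool" where
  "inflation E A f B \<longleftrightarrow> (\<exists>g C. (A, f, B, g, C) \<in> E)"

definition deflation :: "('o, 'm) seqs \<Rightarrow> 'o \<Rightarrow> 'm \<Rightarrow> 'o \<Rightarrow> bool" where
  "deflation E B g C \<longleftrightarrow> (\<exists>A f. (A, f, B, g, C) \<in> E)"

text \<open>Exact categories in the sense of Quillen.\<close>

locale exact_category = additive_category K for K :: "('o, 'm) preadd_cat" +
  fixes E :: "('o, 'm) seqs"
  assumes kernel_cokernel_pair: "(A, f, B, g, C) \<in> E \<Longrightarrow>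
      A \<in> Ob K \<and> B \<in> Ob K \<and> C \<in> Ob K \<and> kernel_of K A f B g C \<and> cokernel_of K A f B g C"
    and iso_closed: "\<lbrakk>(A, f, B, g, C) \<in> E; A' \<in> Ob K; B' \<in> Ob K; C' \<in> Ob K;
        iso_arr K A A' a; iso_arr K B B' b; iso_arr K C C' c; f' \<in> Arr K A' B'; g' \<in> Arr K B' C';
        Cmp K A B B' b f = Cmp K A A' B' f' a; Cmp K B C C' c g = Cmp K B B' C' g' b\<rbrakk>
      \<Longrightarrow> (A', f', B', g', C') \<in> E"
    and inflation_Idn: "A \<in> Ob K \<Longrightarrow> inflation E A (Idn K A) A"
    and deflation_Idn: "A \<in> Ob K \<Longrightarrow> deflation E A (Idn K A) A"
    and inflation_Cmp: "\<lbrakk>inflation E A f B; inflation E B g C\<rbrakk> \<Longrightarrow> inflation E A (Cmp K A B C g f) C"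
    and deflation_Cmp: "\<lbrakk>deflation E A f B; deflation E B g C\<rbrakk> \<Longrightarrow> deflation E A (Cmp K A B C g f) C"
    and inflation_pushout: "\<lbrakk>inflation E A f B; A' \<in> Ob K; h \<in> Arr K A A'\<rbrakk>
      \<Longrightarrow> \<exists>f' h' B'. pushout K A f B h A' f' h' B' \<and> inflation E A' f' B'"
    and deflation_pullback: "\<lbrakk>deflation E B g C; C' \<in> Ob K; h \<in> Arr K C' C\<rbrakk>
      \<Longrightarrow> \<exists>g' h' B'. pullback K B g C h C' g' h' B' \<and> deflation E B' g' C'"

definition projectives :: "('o, 'm) preadd_cat \<Rightarrow> ('o, 'm) seqs \<Rightarrow> 'o set" where
  "projectives K E = {P \<in> Ob K. \<forall>A f B g C. (A, f, B, g, C) \<in> E \<longrightarrow>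
     (\<forall>h\<in>Arr K P C. \<exists>k\<in>Arr K P B. Cmp K P B C g k = h)}"

definition injectives :: "('o, 'm) preadd_cat \<Rightarrow> ('o, 'm) seqs \<Rightarrow> 'o set" where
  "injectives K E = {I \<in> Ob K. \<forall>A f B g C. (A, f, B, g, C) \<in> E \<longrightarrow>
     (\<forall>h\<in>Arr K A I. \<exists>k\<in>Arr K B I. Cmp K A B I k f = h)}"

locale frobenius_category = exact_category +
  assumes enough_projectives: "X \<in> Ob K \<Longrightarrow> \<exists>P\<in>projectives K E. \<exists>g. deflation E P g X"
    and enough_injectives: "X \<in> Ob K \<Longrightarrow> \<exists>I\<in>injectives K E. \<exists>f. inflation E X f I"
    and projectives_eq_injectives: "projectives K E = injectives K E"


section \<open>Triangulated categories\<close>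

text \<open>The suspension is an additive auto-equivalence with object map \<open>S\<close> and morphism maps
  \<open>s X Y\<close>.  Distinguished triangles \<open>X \<rightarrow> Y \<rightarrow> Z \<rightarrow> S X\<close> are tuples \<open>(X, Y, Z, u, v, w)\<close>.  The
  axioms are Verdier's, \<open>TR4\<close> being the octahedral axiom.\<close>

locale suspended_category = additive_category K for K :: "('o, 'm) preadd_cat" +
  fixes S :: "'o \<Rightarrow> 'o" and s :: "'o \<Rightarrow> 'o \<Rightarrow> 'm \<Rightarrow> 'm"
  assumes S_Ob: "X \<in> Ob K \<Longrightarrow> S X \<in> Ob K"
    and s_hom: "\<lbrakk>X \<in> Ob K; Y \<in> Ob K\<rbrakk> \<Longrightarrow> s X Y \<in> hom (Mor K X Y) (Mor K (S X) (S Y))"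
    and s_Idn: "X \<in> Ob K \<Longrightarrow> s X X (Idn K X) = Idn K (S X)"
    and s_Cmp: "\<lbrakk>X \<in> Ob K; Y \<in> Ob K; Z \<in> Ob K; f \<in> Arr K X Y; g \<in> Arr K Y Z\<rbrakk>
      \<Longrightarrow> s X Z (Cmp K X Y Z g f) = Cmp K (S X) (S Y) (S Z) (s Y Z g) (s X Y f)"
    and s_bij: "\<lbrakk>X \<in> Ob K; Y \<in> Ob K\<rbrakk> \<Longrightarrow> bij_betw (s X Y) (Arr K X Y) (Arr K (S X) (S Y))"
    and S_dense: "Y \<in> Ob K \<Longrightarrow> \<exists>X\<in>Ob K. \<exists>f. iso_arr K (S X) Y f"

type_synonym ('o, 'm) triangles = "('o \<times> 'o \<times> 'o \<times> 'm \<times> 'm \<times> 'm) set"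

locale triangulated_category = suspended_category K S s
  for K :: "('o, 'm) preadd_cat" and S :: "'o \<Rightarrow> 'o" and s :: "'o \<Rightarrow> 'o \<Rightarrow> 'm \<Rightarrow> 'm" +
  fixes \<Delta> :: "('o, 'm) triangles"
  assumes triangle_type: "(X, Y, Z, u, v, w) \<in> \<Delta> \<Longrightarrow> X \<in> Ob K \<and> Y \<in> Ob K \<and> Z \<in> Ob K \<and>
      u \<in> Arr K X Y \<and> v \<in> Arr K Y Z \<and> w \<in> Arr K Z (S X)"
    and TR1_iso: "\<lbrakk>(X, Y, Z, u, v, w) \<in> \<Delta>; X' \<in> Ob K; Y' \<in> Ob K; Z' \<in> Ob K;
        u' \<in> Arr K X' Y'; v' \<in> Arr K Y' Z'; w' \<in> Arr K Z' (S X');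
        iso_arr K X X' a; iso_arr K Y Y' b; iso_arr K Z Z' c;
        Cmp K X Y Y' b u = Cmp K X X' Y' u' a; Cmp K Y Z Z' c v = Cmp K Y Y' Z' v' b;
        Cmp K Z (S X) (S X') (s X X' a) w = Cmp K Z Z' (S X') w' c\<rbrakk>
      \<Longrightarrow> (X', Y', Z', u', v', w') \<in> \<Delta>"
    and TR1_Idn: "\<lbrakk>X \<in> Ob K; zero_object K Z\<rbrakk>
      \<Longrightarrow> (X, X, Z, Idn K X, zero_arr K X Z, zero_arr K Z (S X)) \<in> \<Delta>"
    and TR1_cone: "\<lbrakk>X \<in> Ob K; Y \<in> Ob K; u \<in> Arr K X Y\<rbrakk> \<Longrightarrow> \<exists>Z v w. (X, Y, Z, u, v, w) \<in> \<Delta>"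
    and TR2: "\<lbrakk>X \<in> Ob K; Y \<in> Ob K; Z \<in> Ob K; u \<in> Arr K X Y; v \<in> Arr K Y Z; w \<in> Arr K Z (S X)\<rbrakk>
      \<Longrightarrow> (X, Y, Z, u, v, w) \<in> \<Delta> \<longleftrightarrow>
          (Y, Z, S X, v, w, inv\<^bsub>Mor K (S X) (S Y)\<^esub> (s X Y u)) \<in> \<Delta>"
    and TR3: "\<lbrakk>(X, Y, Z, u, v, w) \<in> \<Delta>; (X', Y', Z', u', v', w') \<in> \<Delta>;
        a \<in> Arr K X X'; b \<in> Arr K Y Y'; Cmp K X Y Y' b u = Cmp K X X' Y' u' a\<rbrakk>
      \<Longrightarrow> \<exists>c\<in>Arr K Z Z'. Cmp K Y Z Z' c v = Cmp K Y Y' Z' v' b \<and>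
            Cmp K Z (S X) (S X') (s X X' a) w = Cmp K Z Z' (S X') w' c"
    and TR4: "\<lbrakk>(X, Y, Z', u, i, i') \<in> \<Delta>; (Y, Z, X', v, j, j') \<in> \<Delta>;
        (X, Z, Y', Cmp K X Y Z v u, k, k') \<in> \<Delta>\<rbrakk>
      \<Longrightarrow> \<exists>f\<in>Arr K Z' Y'. \<exists>g\<in>Arr K Y' X'.
            (Z', Y', X', f, g, Cmp K X' (S Y) (S Z') (s Y Z' i) j') \<in> \<Delta> \<and>
            Cmp K Y Z' Y' f i = Cmp K Y Z Y' k v \<and>
            Cmp K Z' Y' (S X) k' f = i' \<and>
            Cmp K Z Y' X' g k = j \<and>
            Cmp K Y' X' (S Y) j' g = Cmp K Y' (S X) (S Y) (s X Y u) k'"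


section \<open>The categories \<open>\<Z>(C)\<close> and \<open>\<U>(C)\<close>\<close>

definition mod_cat :: "'a ring \<Rightarrow> ('a fgm, 'a list \<Rightarrow> 'a list) preadd_cat" where
  "mod_cat \<Lambda> = \<lparr>Ob = modules \<Lambda>, Mor = hom_group \<Lambda>,
     Cmp = (\<lambda>X Y Z g f. compose (carrier X) g f), Idn = (\<lambda>X. \<lambda>x\<in>carrier X. x)\<rparr>"

definition full_subcategory :: "('o, 'm) preadd_cat \<Rightarrow> 'o set \<Rightarrow> ('o, 'm) preadd_cat" where
  "full_subcategory K S = K\<lparr>Ob := S\<rparr>"

definition factor_ideal :: "('o, 'm) preadd_cat \<Rightarrow> 'o set \<Rightarrow> 'o \<Rightarrow> 'o \<Rightarrow> 'm set" where
  "factor_ideal K S X Y = {Cmp K X W Y h g | W g h. W \<in> S \<and> g \<in> Arr K X W \<and> h \<in> Arr K W Y}"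

text \<open>The union in \<open>Cmp\<close> is the coset of any composite of representatives, once \<open>I\<close> is an ideal.\<close>

definition quotient_category ::
  "('o, 'm) preadd_cat \<Rightarrow> ('o \<Rightarrow> 'o \<Rightarrow> 'm set) \<Rightarrow> ('o, 'm set) preadd_cat" where
  "quotient_category K I = \<lparr>Ob = Ob K, Mor = (\<lambda>X Y. Mor K X Y Mod I X Y),
     Cmp = (\<lambda>X Y Z G F. \<Union>g\<in>G. \<Union>f\<in>F. I X Z #>\<^bsub>Mor K X Z\<^esub> Cmp K X Y Z g f),
     Idn = (\<lambda>X. I X X #>\<^bsub>Mor K X X\<^esub> Idn K X)\<rparr>"

abbreviation Z_category :: "'a ring \<Rightarrow> nat \<Rightarrow> 'a fgm set \<Rightarrow> ('a fgm, 'a list \<Rightarrow> 'a list) preadd_cat" where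
  "Z_category \<Lambda> n C \<equiv> full_subcategory (mod_cat \<Lambda>) (Zcat \<Lambda> n C)"

abbreviation U_category :: "'a ring \<Rightarrow> nat \<Rightarrow> 'a fgm set \<Rightarrow> ('a fgm, ('a list \<Rightarrow> 'a list) set) preadd_cat" where
  "U_category \<Lambda> n C \<equiv> quotient_category (Z_category \<Lambda> n C) (factor_ideal (Z_category \<Lambda> n C) C)"

definition minimal_left_approximation ::
  "'a ring \<Rightarrow> 'a fgm set \<Rightarrow> 'a fgm \<Rightarrow> ('a list \<Rightarrow> 'a list) \<Rightarrow> 'a fgm \<Rightarrow> bool" where
  "minimal_left_approximation \<Lambda> C X i E \<longleftrightarrow> left_approximation \<Lambda> C X i E \<and>
     (\<forall>h\<in>lmod_hom \<Lambda> E E. compose (carrier X) h i = i \<longrightarrow> bij_betw h (carrier E) (carrier E))"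

text \<open>\<open>(S, s)\<close> is the functor \<open>X \<mapsto> \<Omega>\<close>-inverse of \<open>X\<close> relative to \<open>C\<close> on the quotient category:
  for some choice of minimal left approximations \<open>i X : X \<rightarrow> E X\<close> with cokernels
  \<open>p X : E X \<rightarrow> S X\<close>, it sends the class of \<open>f : X \<rightarrow> Y\<close> to the class of any \<open>h\<close> that completes
  \<open>f\<close> to a commutative diagram \<open>X \<rightarrow> E X \<rightarrow> S X\<close> over \<open>Y \<rightarrow> E Y \<rightarrow> S Y\<close> with vertical maps \<open>f, g, h\<close>.\<close>

definition relative_cosyzygy_functor ::
  "'a ring \<Rightarrow> nat \<Rightarrow> 'a fgm set \<Rightarrow> ('a fgm \<Rightarrow> 'a fgm)
    \<Rightarrow> ('a fgm \<Rightarrow> 'a fgm \<Rightarrow> ('a list \<Rightarrow> 'a list) set \<Rightarrow> ('a list \<Rightarrow> 'a list) set) \<Rightarrow> bool" where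
  "relative_cosyzygy_functor \<Lambda> n C S s \<longleftrightarrow> (\<exists>E i p.
     (\<forall>X\<in>Zcat \<Lambda> n C. minimal_left_approximation \<Lambda> C X (i X) (E X) \<and> S X \<in> modules \<Lambda> \<and>
        p X \<in> lmod_hom \<Lambda> (E X) (S X) \<and> p X ` carrier (E X) = carrier (S X) \<and>
        a_kernel (E X) (S X) (p X) = i X ` carrier X) \<and>
     (\<forall>X\<in>Zcat \<Lambda> n C. \<forall>Y\<in>Zcat \<Lambda> n C.
        \<forall>f\<in>lmod_hom \<Lambda> X Y. \<forall>g\<in>lmod_hom \<Lambda> (E X) (E Y). \<forall>h\<in>lmod_hom \<Lambda> (S X) (S Y).
          compose (carrier X) g (i X) = compose (carrier X) (i Y) f \<longrightarrow>
          compose (carrier (E X)) h (p X) = compose (carrier (E X)) (p Y) g \<longrightarrow>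
          s X Y (factor_ideal (Z_category \<Lambda> n C) C X Y #>\<^bsub>hom_group \<Lambda> X Y\<^esub> f) =
            factor_ideal (Z_category \<Lambda> n C) C (S X) (S Y) #>\<^bsub>hom_group \<Lambda> (S X) (S Y)\<^esub> h))"

end

theory Submission imports Defs
begin

text \<open>The \<open>F\<close>-exact sequences for both relative structures coincide on \<open>\<Z>(C)\<close>: by higher
 Auslander--Reiten duality, obtained from the defect formula by dimension shifting, a short exact
 sequence in \<open>\<Z>(C)\<close> stays exact under \<open>Hom(X, -)\<close> for all \<open>X\<close> in \<open>C\<close> iff it does under
 \<open>Hom(-, X)\<close>.  As \<open>C\<close>-approximations exist and their kernels and cokernels stay in \<open>\<Z>(C)\<close>, this
 is a Frobenius structure, and Happel's construction triangulates its stable category.\<close>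

text \<open>Two one-way implications carry the argument. If maps from the left end of a short exact
  sequence into \<open>\<tau> Z\<close> extend, then maps from \<open>Z\<close> to its right end
  lift; if maps from the inverse translate of \<open>X\<close> lift, then maps into \<open>X\<close>
  extend. Both rest on reflexivity of \<open>D\<close>, proved from the injective envelope
  \<open>J\<close> by induction along submodules, and on dual bases of projectives. Vanishing of Ext
  is restated as solvability of such problems, so dimension shifting becomes diagram chasing with
  morphisms, without long exact sequences of groups.

  For n > 1 every short exact sequence in Z(C) is F-exact, and duality is spent on showing that Z(C)
  contains the cokernels of left approximations and that Ext of Z(C) and C vanishes in degree one.
  For n = 1 there is no Ext condition, and duality itself compares the two relative structures.

  In the stable category the obstacle is that a morphism from X to Y need not be an inflation.
  Adding the middle term of the suspension of X to Y, which changes nothing stably, makes it one.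
  Hence standard triangles are taken for inflations only, and the distinguished ones are their
  isomorphism closure.\<close>

text \<open>\<open>L\<close> is the algebra called \<open>\<Lambda>\<close> in the definitions.\<close>

abbreviation (input) Hom :: "'a ring => ('a, 'b) module => ('a, 'c) module => ('b => 'c) set" where
 "Hom == lmod_hom"

syntax "_index" :: "logic => index"  ("(\<^sub>_)" [1000])

abbreviation (input) "proj_mod == projective_mod"
abbreviation (input) "inj_mod == injective_mod"
abbreviation (input) "rs == restrict_scalars"
abbreviation (input) iff_ascii (infixr "<->" 25) where "P <-> Q == P \<longleftrightarrow> Q"
lemmas (in left_module) lmod = left_module_axioms
abbreviation (input) mod_add ("(_ +\<^sub>_/ _)" [65, 1000, 66] 65) where "x +\<^sub>M y == x \<oplus>\<^bsub>M\<^esub> y"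
abbreviation (input) mod_smult ("(_ *\<^sub>_/ _)" [71, 1000, 70] 70) where "a *\<^sub>M x == a \<odot>\<^bsub>M\<^esub> x"
abbreviation (input) mod_zero ("0\<^sub>_" [1000] 1000) where "0\<^sub>M == \<zero>\<^bsub>M\<^esub>"

section \<open>Modules and homomorphisms\<close>

lemma Hom_cl: "f : Hom L M N ==> x : carrier M ==> f x : carrier N" by (auto simp: lmod_hom_def)

lemma Hom_add: "f : Hom L M N ==> x : carrier M ==> y : carrier M ==>
 f (x +\<^sub>M y) = f x +\<^sub>N f y" by (auto simp: lmod_hom_def)

lemma Hom_smult: "f : Hom L M N ==> a : carrier L ==> x : carrier M ==>
 f (a *\<^sub>M x) = a *\<^sub>N f x" by (auto simp: lmod_hom_def)

lemma Hom_undefined: "f : Hom L M N ==> x ~: carrier M ==> f x = undefined"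
 by (auto simp: lmod_hom_def)

lemma Hom_eqI: "f : Hom L M N ==> g : Hom L M N' ==> (!!x. x : carrier M ==> f x = g x) ==> f = g"
 by (rule ext) (metis Hom_undefined)

lemma lmod_homI: assumes "left_module L M" and "!!x. x : carrier M ==> f x : carrier N"
  and "!!x y. x : carrier M ==> y : carrier M ==> f (x +\<^sub>M y) = f x +\<^sub>N f y"
  and "!!a x. a : carrier L ==> x : carrier M ==> f (a *\<^sub>M x) = a *\<^sub>N f x"
 shows "restrict f (carrier M) : Hom L M N"
proof -
 interpret M: left_module L M by fact
 show ?thesis using assms by (auto simp: lmod_hom_def M.smult_closed)
qed

lemma left_module_group: "left_module L M ==> abelian_group M" by (simp add: left_module_def)

lemma Hom_zero: assumes "left_module L M" "left_module L N" "f : Hom L M N"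
 shows "f 0\<^sub>M = 0\<^sub>N"
proof -
 interpret M: left_module L M by fact
 interpret N: left_module L N by fact
 have "f 0\<^sub>M +\<^sub>N f 0\<^sub>M = f 0\<^sub>M +\<^sub>N 0\<^sub>N"
  using Hom_add[OF assms(3), of "0\<^sub>M" "0\<^sub>M"] Hom_cl[OF assms(3)] by simp
 then show ?thesis using Hom_cl[OF assms(3) M.M.zero_closed] by (simp add: N.M.add.l_cancel_one)
qed

lemma Hom_neg: assumes "left_module L M" "left_module L N" "f : Hom L M N" "x : carrier M"
 shows "f (\<ominus>\<^sub>M x) = \<ominus>\<^sub>N f x"
proof -
 interpret M: left_module L M by fact
 interpret N: left_module L N by fact
 have "f (\<ominus>\<^sub>M x) +\<^sub>N f x = 0\<^sub>N"
  using Hom_add[OF assms(3), of "\<ominus>\<^sub>M x" x] assms(4) Hom_zero[OF assms(1-3)]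
  by (simp add: M.M.l_neg)
 then show ?thesis using Hom_cl[OF assms(3)] assms(4) by (metis M.M.a_inv_closed N.M.minus_equality)
qed

lemma Hom_minus:
 assumes "left_module L M" "left_module L N" "f : Hom L M N" "x : carrier M" "y : carrier M"
 shows "f (x \<ominus>\<^sub>M y) = f x \<ominus>\<^sub>N f y"
proof -
 interpret M: left_module L M by fact
 show ?thesis using assms by (simp add: a_minus_def Hom_add Hom_neg)
qed

lemmas Hom_simps = Hom_add Hom_smult Hom_zero Hom_neg Hom_minus

context left_module
begin

lemma smult_0r: "a : carrier R ==> a *\<^sub>M 0\<^sub>M = 0\<^sub>M"
 using smult_r_distr[of a "0\<^sub>M" "0\<^sub>M"] smult_closed[of a "0\<^sub>M"]
 by (simp add: M.add.l_cancel_one')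

lemma smult_0l: "x : carrier M ==> \<zero> *\<^sub>M x = 0\<^sub>M"
 using smult_l_distr[of "\<zero>" "\<zero>" x] smult_closed[of "\<zero>" x]
 by (simp add: M.add.l_cancel_one')

lemma smult_neg_right: assumes "a : carrier R" "x : carrier M"
 shows "a *\<^sub>M (\<ominus>\<^sub>M x) = \<ominus>\<^sub>M (a *\<^sub>M x)"
proof -
 have "a *\<^sub>M (\<ominus>\<^sub>M x) +\<^sub>M a *\<^sub>M x = 0\<^sub>M"
  using smult_r_distr[of a "\<ominus>\<^sub>M x" x] assms by (simp add: M.l_neg smult_0r)
 then show ?thesis using assms by (metis M.a_inv_closed M.minus_equality smult_closed)
qed

lemma smult_neg_left: assumes "a : carrier R" "x : carrier M"
 shows "(\<ominus> a) *\<^sub>M x = \<ominus>\<^sub>M (a *\<^sub>M x)"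
proof -
 have "(\<ominus> a) *\<^sub>M x +\<^sub>M a *\<^sub>M x = 0\<^sub>M"
  using smult_l_distr[of "\<ominus> a" a x] assms by (simp add: R.l_neg smult_0l)
 then show ?thesis using assms by (metis R.a_inv_closed M.minus_equality smult_closed)
qed

lemma smult_minus_right: "a : carrier R ==> x : carrier M ==> y : carrier M ==>
  a *\<^sub>M (x \<ominus>\<^sub>M y) = a *\<^sub>M x \<ominus>\<^sub>M a *\<^sub>M y"
 by (simp add: a_minus_def smult_r_distr smult_neg_right)

lemma smult_minus_left: "a : carrier R ==> b : carrier R ==> x : carrier M ==>
  (a \<ominus> b) *\<^sub>M x = a *\<^sub>M x \<ominus>\<^sub>M b *\<^sub>M x"
 by (simp add: a_minus_def smult_l_distr smult_neg_left)

lemma minus_0_iff: assumes "x : carrier M" "y : carrier M"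
 shows "x \<ominus>\<^sub>M y = 0\<^sub>M <-> x = y"
 using assms by (metis M.minus_closed M.minus_eq M.a_inv_closed M.minus_equality M.minus_minus M.r_neg)

lemma add_minus: assumes "x : carrier M" "y : carrier M"
 shows "(x \<ominus>\<^sub>M y) +\<^sub>M y = x" "y +\<^sub>M (x \<ominus>\<^sub>M y) = x"
  "(x +\<^sub>M y) \<ominus>\<^sub>M y = x" "(y +\<^sub>M x) \<ominus>\<^sub>M y = x"
 using assms by (simp_all add: a_minus_def M.a_ac M.r_neg M.r_neg1 M.r_neg2 M.l_neg)

lemma minus_add_add: assumes "x : carrier M" "y : carrier M" "x' : carrier M" "y' : carrier M"
 shows "(x +\<^sub>M x') \<ominus>\<^sub>M (y +\<^sub>M y') = (x \<ominus>\<^sub>M y) +\<^sub>M (x' \<ominus>\<^sub>M y')"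
 using assms by (simp add: a_minus_def M.minus_add M.a_ac)

text \<open>Negatives are multiples by -1, so closure under addition and scalars already yields a
  subgroup.\<close>

lemma submoduleI: assumes "N <= carrier M" "0\<^sub>M : N"
  and add: "!!x y. x : N ==> y : N ==> x +\<^sub>M y : N"
  and smult: "!!a x. a : carrier R ==> x : N ==> a *\<^sub>M x : N" shows "submodule N R M"
proof (intro submodule.intro subgroup.intro)
 fix x assume x: "x : N"
 have "(\<ominus> \<one>) *\<^sub>M x = \<ominus>\<^sub>M x"
  using x assms(1) by (subst smult_neg_left) (auto simp: smult_one)
 then show "inv\<^bsub>add_monoid M\<^esub> x : N"
  using smult[of "\<ominus> \<one>" x] x by (simp add: a_inv_def[of M])
qed (use assms in \<open>auto simp: submodule_axioms_def\<close>)

lemma subm_carrier: "submodule (carrier M) R M" by (rule submoduleI) (auto simp: smult_closed)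

lemma zero_submodule: "submodule {0\<^sub>M} R M" by (rule submoduleI) (auto simp: smult_0r)

end

lemma submD: assumes "submodule N L M"
 shows "N <= carrier M" "0\<^sub>M : N" "!!x. x : N ==> x : carrier M"
  "!!x y. x : N ==> y : N ==> x +\<^sub>M y : N" "!!x. x : N ==> \<ominus>\<^sub>M x : N"
  "!!x y. x : N ==> y : N ==> x \<ominus>\<^sub>M y : N"
  "!!a x. a : carrier L ==> x : N ==> a *\<^sub>M x : N"
proof -
 interpret submodule N L M by fact
 show "N <= carrier M" "0\<^sub>M : N" "!!x. x : N ==> x : carrier M"
  "!!x y. x : N ==> y : N ==> x +\<^sub>M y : N" using subset one_closed m_closed by auto
 show neg: "!!x. x : N ==> \<ominus>\<^sub>M x : N" using m_inv_closed by (simp add: a_inv_def)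
 show "!!x y. x : N ==> y : N ==> x \<ominus>\<^sub>M y : N"
  using m_closed neg by (simp add: a_minus_def)
 show "!!a x. a : carrier L ==> x : N ==> a *\<^sub>M x : N" by (rule smult_closed)
qed

lemma aker_eq: "a_kernel M N f = {x : carrier M. f x = 0\<^sub>N}" by (simp add: a_kernel_def')

lemma Hom_comp: assumes "f : Hom L V M" "g : Hom L M N" "left_module L V"
 shows "compose (carrier V) g f : Hom L V N"
proof -
 interpret left_module L V by fact
 show ?thesis using assms unfolding compose_def
  by (intro lmod_homI) (auto simp: Hom_cl Hom_add Hom_smult)
qed

lemma Hom_id: "left_module L M ==> (\<lambda>x\<in>carrier M. x) : Hom L M M"
 by (intro lmod_homI) auto

lemma Hom_0map: assumes "left_module L M" "left_module L N"
 shows "(\<lambda>x\<in>carrier M. 0\<^sub>N) : Hom L M N"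
proof -
 interpret N: left_module L N by fact
 show ?thesis using assms by (intro lmod_homI) (auto simp: N.smult_0r)
qed

lemma Hom_plus: assumes "left_module L M" "left_module L N" "f : Hom L M N" "g : Hom L M N"
 shows "(\<lambda>x\<in>carrier M. f x +\<^sub>N g x) : Hom L M N"
proof -
 interpret N: left_module L N by fact
 have "!!x. x : carrier M ==> f x : carrier N" "!!x. x : carrier M ==> g x : carrier N"
  using assms by (auto simp: Hom_cl)
 then show ?thesis using assms
  by (intro lmod_homI) (simp_all add: Hom_add Hom_smult N.smult_r_distr N.M.a_ac)
qed

lemma Hom_uminus: assumes "left_module L M" "left_module L N" "f : Hom L M N"
 shows "(\<lambda>x\<in>carrier M. \<ominus>\<^sub>N f x) : Hom L M N"
proof -
 interpret N: left_module L N by fact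
 have "!!x. x : carrier M ==> f x : carrier N" using assms by (auto simp: Hom_cl)
 then show ?thesis using assms
  by (intro lmod_homI) (simp_all add: Hom_add Hom_smult N.smult_neg_right N.M.minus_add)
qed

lemma Hom_diff: assumes "left_module L M" "left_module L N" "f : Hom L M N" "g : Hom L M N"
 shows "(\<lambda>x\<in>carrier M. f x \<ominus>\<^sub>N g x) : Hom L M N"
 using Hom_plus[OF assms(1-3) Hom_uminus[OF assms(1,2,4)]]
 by (rule back_subst[of "%h. h : Hom L M N"]) (auto simp: a_minus_def)

section \<open>Submodules, direct sums and quotient modules\<close>

lemma sub_mod_simps [simp]:
 "carrier (sub_mod M N) = N" "\<zero>\<^bsub>sub_mod M N\<^esub> = 0\<^sub>M" "add (sub_mod M N) = add M"
 "smult (sub_mod M N) = smult M" by (simp_all add: sub_mod_def)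

lemma lm_sub: assumes "left_module L M" "submodule N L M" shows "left_module L (sub_mod M N)"
proof -
 interpret M: left_module L M by fact
 note N = submD[OF assms(2)]
 have "abelian_group (sub_mod M N)"
 proof (rule abelian_groupI)
  fix x assume "x : carrier (sub_mod M N)"
  then show "EX y:carrier (sub_mod M N). y \<oplus>\<^bsub>sub_mod M N\<^esub> x = \<zero>\<^bsub>sub_mod M N\<^esub>"
   using N by (intro bexI[of _ "\<ominus>\<^sub>M x"]) (auto simp: M.M.l_neg)
 qed (auto simp: N M.M.a_ac)
 then show ?thesis by (intro left_module.intro left_module_axioms.intro M.R.ring_axioms)
   (auto simp: N M.smult_l_distr M.smult_r_distr M.smult_assoc M.smult_one)
qed

lemma sub_mod_incl: assumes "left_module L M" "submodule N L M"
 shows "(\<lambda>x\<in>N. x) : Hom L (sub_mod M N) M"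
 using lmod_homI[OF lm_sub[OF assms], of "%x. x" M] submD[OF assms(2)] by auto

lemma Hom_into_sub: assumes "f : Hom L V M" "!!x. x : carrier V ==> f x : N"
 shows "f : Hom L V (sub_mod M N)" using assms by (auto simp: lmod_hom_def PiE_def)

lemma Hom_from_sub: assumes "f : Hom L V (sub_mod M N)" "submodule N L M"
 shows "f : Hom L V M" using assms submD[OF assms(2)] by (auto simp: lmod_hom_def PiE_def)

lemma subm_sub_mod_iff: assumes "submodule N L M" "left_module L M"
 shows "submodule K L (sub_mod M N) <-> submodule K L M & K <= N"
proof
 interpret M: left_module L M by fact
 interpret N: left_module L "sub_mod M N" using assms by (intro lm_sub)
 note N = submD[OF assms(1)]
 {
  assume "submodule K L (sub_mod M N)"
  note K = submD[OF this]
  show "submodule K L M & K <= N" using K(1) N(1) K(2,4,7) by (auto intro!: M.submoduleI)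
 next
  assume "submodule K L M & K <= N"
  then have K: "submodule K L M" "K <= N" by auto
  show "submodule K L (sub_mod M N)" using K(2) submD[OF K(1)] by (auto intro!: N.submoduleI)
 }
qed

lemma subm_Int: assumes "left_module L M" "submodule N L M" "submodule N' L M"
 shows "submodule (N \<inter> N') L M"
proof -
 interpret M: left_module L M by fact
 show ?thesis using submD[OF assms(2)] submD[OF assms(3)] by (intro M.submoduleI) auto
qed

lemma subm_image: assumes "left_module L M" "left_module L M'" "f : Hom L M M'" "submodule N L M"
 shows "submodule (f ` N) L M'"
proof -
 interpret M': left_module L M' by fact
 note N = submD[OF assms(4)]
 show ?thesis
 proof (rule M'.submoduleI)
  show "f ` N <= carrier M'" using N assms(3) by (auto simp: Hom_cl)
  show "0\<^sub>M' : f ` N" using N Hom_zero[OF assms(1-3)] by (metis imageI)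
  show "x +\<^sub>M' y : f ` N" if "x : f ` N" "y : f ` N" for x y
   using that N assms(3) by (auto simp: Hom_add[symmetric])
  show "a *\<^sub>M' x : f ` N" if "a : carrier L" "x : f ` N" for a x
   using that N assms(3) by (auto simp: Hom_smult[symmetric])
 qed
qed

lemma subm_range: assumes "left_module L M" "left_module L M'" "f : Hom L M M'"
 shows "submodule (f ` carrier M) L M'"
 by (rule subm_image[OF assms left_module.subm_carrier[OF assms(1)]])

lemma subm_preimage: assumes "left_module L M" "left_module L M'" "f : Hom L M M'" "submodule N L M'"
 shows "submodule {x : carrier M. f x : N} L M"
proof -
 interpret M: left_module L M by fact
 show ?thesis using submD[OF assms(4)] assms Hom_zero[OF assms(1-3)]
  by (intro M.submoduleI) (auto simp: M.smult_closed Hom_simps Hom_cl)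
qed

lemma subm_kernel: assumes "left_module L M" "left_module L M'" "f : Hom L M M'"
 shows "submodule (a_kernel M M' f) L M"
 using subm_preimage[OF assms left_module.zero_submodule[OF assms(2)]] by (simp add: aker_eq)

lemma subm_sum: assumes "left_module L M" "submodule N L M" "submodule N' L M"
 shows "submodule (N <+>\<^sub>M N') L M" "N <= N <+>\<^sub>M N'" "N' <= N <+>\<^sub>M N'"
proof -
 interpret M: left_module L M by fact
 note N = submD[OF assms(2)] and N' = submD[OF assms(3)]
 have mem: "z : N <+>\<^sub>M N' <-> (EX x:N. EX y:N'. z = x +\<^sub>M y)" for z
  by (auto simp: set_add_def')
 show sub: "N <= N <+>\<^sub>M N'" "N' <= N <+>\<^sub>M N'"
  using N N' by (auto simp: mem intro: exI bexI[of _ "0\<^sub>M"])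
   (metis M.M.r_zero, metis M.M.l_zero)
 show "submodule (N <+>\<^sub>M N') L M"
 proof (rule M.submoduleI)
  fix u v assume "u : N <+>\<^sub>M N'" "v : N <+>\<^sub>M N'"
  then obtain x y x' y' where *: "x : N" "y : N'" "u = x +\<^sub>M y" "x' : N" "y' : N'" "v = x' +\<^sub>M y'"
   by (auto simp: mem)
  then have "u +\<^sub>M v = (x +\<^sub>M x') +\<^sub>M (y +\<^sub>M y')" using N N' by (simp add: M.M.a_ac)
  then show "u +\<^sub>M v : N <+>\<^sub>M N'" unfolding mem using N(4) N'(4) * by blast
 next
  fix a u assume a: "a : carrier L" and "u : N <+>\<^sub>M N'"
  then obtain x y where *: "x : N" "y : N'" "u = x +\<^sub>M y" by (auto simp: mem)
  then have "a *\<^sub>M u = a *\<^sub>M x +\<^sub>M a *\<^sub>M y" using N N' a by (simp add: M.smult_r_distr)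
  then show "a *\<^sub>M u : N <+>\<^sub>M N'" unfolding mem using N(7) N'(7) * a by blast
 next
  show "N <+>\<^sub>M N' <= carrier M" "0\<^sub>M : N <+>\<^sub>M N'"
   using N(2,3) N'(3) sub(1) by (auto simp: mem)
 qed
qed

lemma dsum_simps [simp]:
 "carrier (dsum M N) = carrier M \<times> carrier N" "\<zero>\<^bsub>dsum M N\<^esub> = (0\<^sub>M, 0\<^sub>N)"
 "(x, y) \<oplus>\<^bsub>dsum M N\<^esub> (x', y') = (x +\<^sub>M x', y +\<^sub>N y')"
 "a \<odot>\<^bsub>dsum M N\<^esub> (x, y) = (a *\<^sub>M x, a *\<^sub>N y)"
 by (simp_all add: dsum_def)

lemma lm_dsum: assumes "left_module L M" "left_module L N" shows "left_module L (dsum M N)"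
proof -
 interpret M: left_module L M by fact
 interpret N: left_module L N by fact
 have "abelian_group (dsum M N)"
 proof (rule abelian_groupI)
  fix x assume "x : carrier (dsum M N)"
  then show "EX y:carrier (dsum M N). y \<oplus>\<^bsub>dsum M N\<^esub> x = \<zero>\<^bsub>dsum M N\<^esub>"
   by (intro bexI[of _ "(\<ominus>\<^sub>M fst x, \<ominus>\<^sub>N snd x)"]) (auto simp: M.M.l_neg N.M.l_neg)
 qed (auto simp: N.M.a_ac M.M.a_ac)
 then show ?thesis by (intro left_module.intro left_module_axioms.intro M.R.ring_axioms)
   (auto simp: M.smult_closed M.smult_l_distr M.smult_r_distr M.smult_assoc M.smult_one
    N.smult_closed N.smult_l_distr N.smult_r_distr N.smult_assoc N.smult_one)
qed

lemma quot_mod: assumes "left_module L M" "submodule N L M"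
 defines "\<pi> == (\<lambda>x\<in>carrier M. N +>\<^sub>M x)"
 shows "left_module L (quot_mod M N)" "\<pi> : Hom L M (quot_mod M N)"
  "\<pi> ` carrier M = carrier (quot_mod M N)" "a_kernel M (quot_mod M N) \<pi> = N"
proof -
 interpret M: left_module L M by fact
 note N = submD[OF assms(2)]
 interpret N: abelian_subgroup N M using assms(2) M.M.a_comm_group
  by (intro abelian_subgroupI3 additive_subgroup.intro M.M.abelian_group_axioms) (auto simp: submodule_def)
 have car: "carrier (quot_mod M N) = (%x. N +>\<^sub>M x) ` carrier M"
  by (auto simp: quot_mod_def A_RCOSETS_def')
 have eq: "N +>\<^sub>M x = N +>\<^sub>M y <-> x \<ominus>\<^sub>M y : N" if "x : carrier M" "y : carrier M" for x y
  using that N.a_rcos_module[of y x] N.a_repr_independence'[of x y] N.a_repr_independenceD[of x y]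
  unfolding a_minus_def by metis
 have add: "(N +>\<^sub>M x) \<oplus>\<^bsub>quot_mod M N\<^esub> (N +>\<^sub>M y) = N +>\<^sub>M (x +\<^sub>M y)"
  if "x : carrier M" "y : carrier M" for x y using that by (simp add: quot_mod_def N.a_rcos_sum)
 have smult: "a \<odot>\<^bsub>quot_mod M N\<^esub> (N +>\<^sub>M x) = N +>\<^sub>M (a *\<^sub>M x)"
  if "a : carrier L" "x : carrier M" for a x
 proof -
  \<comment> \<open>Two representatives differ by an element of \<open>N\<close>, and so do their
    multiples by \<open>a\<close>; hence the union that defines the scalar action consists of one
    coset only.\<close>
  have "N +>\<^sub>M (a *\<^sub>M u) = N +>\<^sub>M (a *\<^sub>M x)" if u: "u : N +>\<^sub>M x" for u
  proof -
   have uM: "u : carrier M" using u \<open>x : carrier M\<close> N.a_elemrcos_carrier by blast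
   have "u \<ominus>\<^sub>M x : N"
    using u \<open>x : carrier M\<close> uM N.a_rcos_module[of x u] by (simp add: a_minus_def)
   then have "a *\<^sub>M u \<ominus>\<^sub>M a *\<^sub>M x : N"
    using N(7)[OF \<open>a : carrier L\<close>] M.smult_minus_right[OF \<open>a : carrier L\<close> uM \<open>x : carrier M\<close>] by metis
   then show ?thesis
    using eq uM \<open>a : carrier L\<close> \<open>x : carrier M\<close> M.smult_closed by simp
  qed
  then have "a \<odot>\<^bsub>quot_mod M N\<^esub> (N +>\<^sub>M x) = (\<Union>u\<in>N +>\<^sub>M x. N +>\<^sub>M (a *\<^sub>M x))"
   by (simp add: quot_mod_def)
  moreover have "x : N +>\<^sub>M x" using that N.a_rcos_self by simp
  ultimately show ?thesis by (metis UN_constant empty_iff)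
 qed
 have zero: "\<zero>\<^bsub>quot_mod M N\<^esub> = N +>\<^sub>M 0\<^sub>M"
  using N by (simp add: quot_mod_def)
 have "abelian_group (quot_mod M N)"
 proof (rule abelian_groupI)
  fix x assume "x : carrier (quot_mod M N)"
  then obtain x' where x': "x' : carrier M" "x = N +>\<^sub>M x'" by (auto simp: car)
  then show "EX y:carrier (quot_mod M N). y \<oplus>\<^bsub>quot_mod M N\<^esub> x = \<zero>\<^bsub>quot_mod M N\<^esub>"
   by (intro bexI[of _ "N +>\<^sub>M (\<ominus>\<^sub>M x')"]) (auto simp: add car zero M.M.l_neg)
 qed (auto simp: car add zero M.M.a_ac)
 then show "left_module L (quot_mod M N)"
  by (intro left_module.intro left_module_axioms.intro M.R.ring_axioms)
   (auto simp: car add smult M.smult_closed M.smult_l_distr M.smult_r_distr M.smult_assoc M.smult_one)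
 show "\<pi> : Hom L M (quot_mod M N)"
  unfolding \<pi>_def by (rule lmod_homI) (auto simp: assms(1) car add smult M.smult_closed)
 show "\<pi> ` carrier M = carrier (quot_mod M N)" by (simp add: \<pi>_def car)
 show "a_kernel M (quot_mod M N) \<pi> = N"
 proof -
  have "x \<ominus>\<^sub>M 0\<^sub>M = x" if "x : carrier M" for x
   using M.add_minus(1)[OF that M.M.zero_closed] that by simp
  then have "\<pi> x = \<zero>\<^bsub>quot_mod M N\<^esub> <-> x : N" if "x : carrier M" for x
   using eq[OF that M.M.zero_closed] that unfolding zero \<pi>_def by simp
  then show ?thesis using N(1) unfolding aker_eq by blast
 qed
qed

text \<open>Any surjection serves as a quotient map. The preimages chosen by \<open>s\<close> are
  not additive, but they are determined up to the kernel of \<open>q\<close>, which \<open>u\<close>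
  kills.\<close>

lemma hom_factor_surj: assumes "left_module L Q" "left_module L B" "left_module L Y"
  and q: "q : Hom L Q B" "q ` carrier Q = carrier B" and u: "u : Hom L Q Y"
  and ker: "!!x. x : carrier Q ==> q x = 0\<^sub>B ==> u x = 0\<^sub>Y"
 obtains w where "w : Hom L B Y" "!!x. x : carrier Q ==> w (q x) = u x"
proof -
 interpret Q: left_module L Q by fact
 interpret B: left_module L B by fact
 interpret Y: left_module L Y by fact
 define s where "s = inv_into (carrier Q) q"
 have s: "s b : carrier Q" "q (s b) = b" if "b : carrier B" for b
  using that q(2) by (auto simp: s_def inv_into_into f_inv_into_f)
 have eq: "u x = u y" if "x : carrier Q" "y : carrier Q" "q x = q y" for x y
 proof -
  have "q (x \<ominus>\<^sub>Q y) = 0\<^sub>B"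
   using that assms by (simp add: Hom_minus Hom_cl[OF q(1)] B.minus_0_iff)
  then have "u x \<ominus>\<^sub>Y u y = 0\<^sub>Y" using ker that assms by (simp flip: Hom_minus)
  then show ?thesis using that by (simp add: Y.minus_0_iff Hom_cl[OF u])
 qed
 have us: "u (s (q x)) = u x" if "x : carrier Q" for x
  using that by (intro eq) (auto simp: s Hom_cl[OF q(1)])
 have "(\<lambda>b\<in>carrier B. u (s b)) : Hom L B Y"
 proof (rule lmod_homI)
  fix x y assume xy: "x : carrier B" "y : carrier B"
  have "u (s (x +\<^sub>B y)) = u (s x +\<^sub>Q s y)"
   by (rule eq) (use xy s in \<open>auto simp: Hom_add[OF q(1)]\<close>)
  then show "u (s (x +\<^sub>B y)) = u (s x) +\<^sub>Y u (s y)" using xy s by (simp add: Hom_add[OF u])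
 next
  fix a x assume ax: "a : carrier L" "x : carrier B"
  have "u (s (a *\<^sub>B x)) = u (a *\<^sub>Q s x)"
   by (rule eq) (use ax s in \<open>auto simp: Hom_smult[OF q(1)] Q.smult_closed B.smult_closed\<close>)
  then show "u (s (a *\<^sub>B x)) = a *\<^sub>Y u (s x)" using ax s by (simp add: Hom_smult[OF u])
 qed (use s in \<open>auto simp: assms(2) Hom_cl[OF u]\<close>)
 then show ?thesis by (rule that) (auto simp: Hom_cl[OF q(1)] us)
qed

text \<open>Dual to the factorisation through a surjection; injectivity of \<open>f\<close> makes
  the chosen preimages linear.\<close>

lemma hom_factor_inj: assumes "left_module L A" "left_module L B" "left_module L X"
  and f: "f : Hom L A B" "inj_on f (carrier A)" and u: "u : Hom L X B"
  and im: "!!x. x : carrier X ==> u x : f ` carrier A"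
 obtains w where "w : Hom L X A" "!!x. x : carrier X ==> f (w x) = u x"
proof -
 interpret A: left_module L A by fact
 interpret X: left_module L X by fact
 define w where "w x = inv_into (carrier A) f (u x)" for x
 have w: "w x : carrier A" "f (w x) = u x" if "x : carrier X" for x
  using im[OF that] by (auto simp: w_def inv_into_into f_inv_into_f)
 note injD = inj_onD[OF f(2)]
 have "restrict w (carrier X) : Hom L X A"
 proof (rule lmod_homI)
  fix x y assume "x : carrier X" "y : carrier X"
  then show "w (x +\<^sub>X y) = w x +\<^sub>A w y"
   by (intro injD) (auto simp: w Hom_add[OF f(1)] Hom_add[OF u])
 next
  fix a x assume "a : carrier L" "x : carrier X"
  then show "w (a *\<^sub>X x) = a *\<^sub>A w x"
   by (intro injD) (auto simp: w Hom_smult[OF f(1)] Hom_smult[OF u] X.smult_closed A.smult_closed)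
 qed (use w assms in auto)
 then show ?thesis by (rule that) (auto simp: w)
qed

lemma inj_iff_ker: assumes "left_module L A" "left_module L B" and f: "f : Hom L A B"
 shows "inj_on f (carrier A) <-> (ALL x:carrier A. f x = 0\<^sub>B --> x = 0\<^sub>A)"
proof
 interpret A: left_module L A by fact
 interpret B: left_module L B by fact
 show "inj_on f (carrier A) ==> ALL x:carrier A. f x = 0\<^sub>B --> x = 0\<^sub>A"
  using Hom_zero[OF assms] by (metis A.M.zero_closed inj_onD)
 assume *: "ALL x:carrier A. f x = 0\<^sub>B --> x = 0\<^sub>A"
 show "inj_on f (carrier A)"
 proof (rule inj_onI)
  fix x y assume xy: "x : carrier A" "y : carrier A" "f x = f y"
  then have "f (x \<ominus>\<^sub>A y) = 0\<^sub>B"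
   by (simp add: Hom_minus[OF assms] B.minus_0_iff Hom_cl[OF f])
  then have "x \<ominus>\<^sub>A y = 0\<^sub>A" using * xy by blast
  then show "x = y" using xy by (simp add: A.minus_0_iff)
 qed
qed

lemma mod_isoE: assumes "mod_iso L M N" "left_module L M" "left_module L N"
 obtains f g where "f : Hom L M N" "g : Hom L N M"
  "!!x. x : carrier M ==> g (f x) = x" "!!y. y : carrier N ==> f (g y) = y"
proof -
 obtain f where f: "f : Hom L M N" "bij_betw f (carrier M) (carrier N)"
  using assms(1) by (auto simp: mod_iso_def)
 then have inj: "inj_on f (carrier M)" and im: "f ` carrier M = carrier N" by (auto simp: bij_betw_def)
 obtain g where g: "g : Hom L N M" "!!y. y : carrier N ==> f (g y) = restrict (%x. x) (carrier N) y"
  using hom_factor_inj[OF assms(2,3,3) f(1) inj Hom_id[OF assms(3)]] im by auto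
 show ?thesis using f(1) g(1)
 proof (rule that)
  show "g (f x) = x" if "x : carrier M" for x
   using that inj g by (intro inj_onD[OF inj]) (auto simp: Hom_cl[OF f(1)] Hom_cl[OF g(1)])
 qed (use g in auto)
qed

lemma mod_isoI: assumes "f : Hom L M N" "g : Hom L N M"
  "!!x. x : carrier M ==> g (f x) = x" "!!y. y : carrier N ==> f (g y) = y"
 shows "mod_iso L M N" unfolding mod_iso_def
 using assms by (intro bexI[of _ f] bij_betw_byWitness[of _ g]) (auto simp: Hom_cl)

lemma mod_iso_sym: assumes "mod_iso L M N" "left_module L M" "left_module L N"
 shows "mod_iso L N M" by (rule mod_isoE[OF assms]) (rule mod_isoI)

lemma mod_iso_trans:
 assumes "mod_iso L M N" "mod_iso L N P" "left_module L M" "left_module L N" "left_module L P"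
 shows "mod_iso L M P"
proof -
 obtain f g where fg: "f : Hom L M N" "g : Hom L N M"
  "!!x. x : carrier M ==> g (f x) = x" "!!y. y : carrier N ==> f (g y) = y"
  using mod_isoE[OF assms(1,3,4)] by metis
 obtain f' g' where fg': "f' : Hom L N P" "g' : Hom L P N"
  "!!x. x : carrier N ==> g' (f' x) = x" "!!y. y : carrier P ==> f' (g' y) = y"
  using mod_isoE[OF assms(2,4,5)] by metis
 show ?thesis
  by (rule mod_isoI[OF Hom_comp[OF fg(1) fg'(1) assms(3)] Hom_comp[OF fg'(2) fg(2) assms(5)]])
   (auto simp: compose_def Hom_cl[OF fg(1)] Hom_cl[OF fg(2)]
    Hom_cl[OF fg'(1)] Hom_cl[OF fg'(2)] fg(3,4) fg'(3,4))
qed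

text \<open>Trades cosets for a surjection with prescribed kernel onto a module on any carrier, in
  particular one carried by lists.\<close>

lemma quot_mod_isoE:
 assumes M: "left_module L M" and N: "submodule N L M" and T: "left_module L T" and iso: "mod_iso L T (quot_mod M N)"
 obtains \<theta> where "\<theta> : Hom L M T" "\<theta> ` carrier M = carrier T" "a_kernel M T \<theta> = N"
proof -
 define p where "p = (\<lambda>x\<in>carrier M. N +>\<^sub>M x)"
 note Q = quot_mod[OF M N, folded p_def]
 obtain a b where ab: "a : Hom L T (quot_mod M N)" "b : Hom L (quot_mod M N) T"
  "!!x. x : carrier T ==> b (a x) = x" "!!y. y : carrier (quot_mod M N) ==> a (b y) = y"
  by (rule mod_isoE[OF iso T Q(1)]) (rule that)
 have th: "compose (carrier M) b p : Hom L M T" by (rule Hom_comp[OF Q(2) ab(2) M])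
 have "t : compose (carrier M) b p ` carrier M" if t: "t : carrier T" for t
 proof -
  obtain x where "x : carrier M" "a t = p x" using Hom_cl[OF ab(1) t] Q(3) by (metis imageE)
  then show ?thesis using ab(3)[OF t] by (intro image_eqI[of _ _ x]) (auto simp: compose_def)
 qed
 then have onto: "compose (carrier M) b p ` carrier M = carrier T" using Hom_cl[OF th] by blast
 have "b (p x) = 0\<^sub>T <-> p x = \<zero>\<^bsub>quot_mod M N\<^esub>" if "x : carrier M" for x
  using ab(4)[OF Hom_cl[OF Q(2) that]] Hom_zero[OF Q(1) T ab(2)] Hom_zero[OF T Q(1) ab(1)] by metis
 then have "a_kernel M T (compose (carrier M) b p) = a_kernel M (quot_mod M N) p" by (auto simp: aker_eq compose_def)
 then show ?thesis using that[OF th onto] Q(4) by simp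
qed

section \<open>Finite generation and finite length\<close>

lemma finsum_in_submodule:
 assumes "left_module L M" "submodule N L M" "finite A" "f : A \<rightarrow> N"
 shows "finsum M f A : N"
proof -
 interpret M: left_module L M by fact
 note N = submD[OF assms(2)]
 show ?thesis using assms(3,4)
 proof (induction A)
  case (insert x F)
  then have "f : F \<rightarrow> carrier M" "f x : carrier M" using N(1) by auto
  then show ?case using insert N by (auto simp: M.M.finsum_insert)
 qed (use N in auto)
qed

lemma span_submodule: assumes "left_module L M" "finite A" "A <= carrier M"
 defines "S == {m. EX c:A \<rightarrow> carrier L. m = (\<Oplus>\<^bsub>M\<^esub>a\<in>A. c a *\<^sub>M a)}"
 shows "submodule S L M" "A <= S"
proof -
 interpret M: left_module L M by fact
 have cl: "(%a. c a *\<^sub>M a) : A \<rightarrow> carrier M" if "c : A \<rightarrow> carrier L" for c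
  using that assms(3) by (auto intro!: M.smult_closed)
 show "submodule S L M"
 proof (rule M.submoduleI)
  show "S <= carrier M" unfolding S_def using cl by (auto intro!: M.M.finsum_closed)
  have "(\<Oplus>\<^bsub>M\<^esub>a\<in>A. (%_. 0\<^sub>L) a *\<^sub>M a) = 0\<^sub>M"
   using assms(3) by (intro M.M.add.finprod_one_eqI) (auto simp: M.smult_0l)
  then show "0\<^sub>M : S" unfolding S_def by (auto intro!: bexI[of _ "%_. 0\<^sub>L"])
 next
  fix x y assume "x : S" "y : S"
  then obtain c d where c: "c : A \<rightarrow> carrier L" "x = (\<Oplus>\<^bsub>M\<^esub>a\<in>A. c a *\<^sub>M a)"
   and d: "d : A \<rightarrow> carrier L" "y = (\<Oplus>\<^bsub>M\<^esub>a\<in>A. d a *\<^sub>M a)" by (auto simp: S_def)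
  have "x +\<^sub>M y = (\<Oplus>\<^bsub>M\<^esub>a\<in>A. c a *\<^sub>M a +\<^sub>M d a *\<^sub>M a)"
   using cl[OF c(1)] cl[OF d(1)] by (simp add: c(2) d(2) M.M.finsum_addf)
  also have "... = (\<Oplus>\<^bsub>M\<^esub>a\<in>A. (c a +\<^sub>L d a) *\<^sub>M a)"
   using c(1) d(1) assms(3)
   by (intro M.M.finsum_cong') (auto simp: Pi_iff subset_iff M.smult_l_distr intro!: M.smult_closed)
  finally show "x +\<^sub>M y : S"
   unfolding S_def using c(1) d(1) by (auto intro!: bexI[of _ "%a. c a +\<^sub>L d a"])
 next
  fix r x assume r: "r : carrier L" and "x : S"
  then obtain c where c: "c : A \<rightarrow> carrier L" "x = (\<Oplus>\<^bsub>M\<^esub>a\<in>A. c a *\<^sub>M a)" by (auto simp: S_def)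
  have "r *\<^sub>M x = (\<Oplus>\<^bsub>M\<^esub>a\<in>A. r *\<^sub>M (c a *\<^sub>M a))"
   unfolding c(2) using r cl[OF c(1)] assms(2) by (intro finsum_transport M.M.abelian_monoid_axioms)
    (auto simp: M.smult_r_distr M.smult_0r M.smult_closed)
  also have "... = (\<Oplus>\<^bsub>M\<^esub>a\<in>A. (r \<otimes>\<^sub>L c a) *\<^sub>M a)"
   using c(1) r assms(3)
   by (intro M.M.finsum_cong') (auto simp: Pi_iff subset_iff M.smult_assoc intro!: M.smult_closed)
  finally show "r *\<^sub>M x : S"
   unfolding S_def using c(1) r by (auto intro!: bexI[of _ "%a. r \<otimes>\<^sub>L c a"])
 qed
 show "A <= S"
 proof
  fix b assume b: "b : A"
  have "(\<Oplus>\<^bsub>M\<^esub>a\<in>A. (%a. if a = b then \<one>\<^sub>L else 0\<^sub>L) a *\<^sub>M a)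
    = (\<Oplus>\<^bsub>M\<^esub>a\<in>A. if b = a then a else 0\<^sub>M)"
   using assms(3) by (intro M.M.finsum_cong') (auto simp: M.smult_one M.smult_0l)
  also have "... = b" using b assms(2,3) by (intro M.M.add.finprod_singleton) auto
  finally show "b : S"
   unfolding S_def by (auto intro!: bexI[of _ "%a. if a = b then \<one>\<^sub>L else 0\<^sub>L"])
 qed
qed

text \<open>Rephrased without linear combinations: in this form finite generation is easily carried
  through restriction of scalars and passage to the opposite ring.\<close>

lemma fin_gen_iff: assumes "left_module L M" shows "fin_gen L M <-> (EX A. finite A & A <= carrier M &
  (ALL N. submodule N L M --> A <= N --> N = carrier M))"
proof
 interpret M: left_module L M by fact
 assume "fin_gen L M"
 then obtain A where A: "finite A" "A <= carrier M"
  "!!m. m : carrier M ==> EX c:A \<rightarrow> carrier L. m = (\<Oplus>\<^bsub>M\<^esub>a\<in>A. c a *\<^sub>M a)"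
  unfolding fin_gen_def by blast
 have "N = carrier M" if N: "submodule N L M" "A <= N" for N
 proof
  show "carrier M <= N"
  proof
   fix m assume "m : carrier M"
   then obtain c where c: "c : A \<rightarrow> carrier L" "m = (\<Oplus>\<^bsub>M\<^esub>a\<in>A. c a *\<^sub>M a)" using A(3) by blast
   then show "m : N"
    using submD(7)[OF N(1)] N(2) by (auto intro!: finsum_in_submodule[OF assms N(1) A(1)])
  qed
 qed (rule submD[OF N(1)])
 then show "EX A. finite A & A <= carrier M & (ALL N. submodule N L M --> A <= N --> N = carrier M)"
  using A by blast
next
 assume "EX A. finite A & A <= carrier M & (ALL N. submodule N L M --> A <= N --> N = carrier M)"
 then obtain A where A: "finite A" "A <= carrier M" "!!N. submodule N L M ==> A <= N ==> N = carrier M" by blast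
 from A(3)[OF span_submodule[OF assms A(1,2)]] show "fin_gen L M"
  unfolding fin_gen_def using A(1,2) by blast
qed

text \<open>Finite length without composition series: a rank on submodules, strictly monotone with
  values in the natural numbers. The usual length function is such a rank, and conversely the rank
  of the whole module bounds the length of every chain.\<close>

definition finlen :: "'a ring => ('a, 'b) module => bool" where
 "finlen L M <-> (EX l :: 'b set => nat. ALL N N'. submodule N L M --> submodule N' L M -->
  N \<subset> N' --> l N < l N')"

lemma finlen_min: assumes "finlen L M" "submodule N0 L M" "P N0"
 obtains N where "submodule N L M" "P N" "!!N'. submodule N' L M ==> P N' ==> N' <= N ==> N' = N"
proof -
 obtain l :: "_ => nat" where l: "!!N N'. submodule N L M ==> submodule N' L M ==> N \<subset> N' ==> l N < l N'"
  using assms(1) by (auto simp: finlen_def)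
 have "submodule N0 L M & P N0" using assms by simp
 from ex_has_least_nat[where P = "%N. submodule N L M & P N" and m = l, OF this]
 obtain N where "submodule N L M" "P N" "!!N'. submodule N' L M & P N' ==> l N <= l N'" by blast
 then show ?thesis using l that by (metis linorder_not_le psubsetI)
qed

lemma finlen_max: assumes "finlen L M" "left_module L M" "submodule N0 L M" "P N0"
 obtains N where "submodule N L M" "P N" "!!N'. submodule N' L M ==> P N' ==> N <= N' ==> N' = N"
proof -
 interpret M: left_module L M by fact
 obtain l :: "_ => nat" where l: "!!N N'. submodule N L M ==> submodule N' L M ==> N \<subset> N' ==> l N < l N'"
  using assms(1) by (auto simp: finlen_def)
 have bd: "l N <= l (carrier M)" if "submodule N L M" for N
  using l[OF that M.subm_carrier] submD(1)[OF that] less_imp_le by blast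
 have "submodule N0 L M & P N0" using assms by simp
 \<comment> \<open>Ranks are bounded by that of the whole module, so a largest rank is found as a
   least corank.\<close>
 from ex_has_least_nat[where P = "%N. submodule N L M & P N" and m = "%N. l (carrier M) - l N", OF this]
 obtain N where N: "submodule N L M" "P N"
  "!!N'. submodule N' L M & P N' ==> l (carrier M) - l N <= l (carrier M) - l N'" by blast
 have "N' = N" if "submodule N' L M" "P N'" "N <= N'" for N'
 proof (rule ccontr)
  assume "N' ~= N"
  then have "l N < l N'" using l[OF N(1) that(1)] that(3) by auto
  then show False using N(3)[of N'] that bd[OF that(1)] by auto
 qed
 with N(1,2) show ?thesis using that by blast
qed

text \<open>A maximal finitely spanned submodule absorbs every further generator.\<close>

lemma fin_gen_finite_length: assumes "left_module L M" "finlen L M" shows "fin_gen L M"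
proof -
 interpret M: left_module L M by fact
 define P where "P N <-> (EX A. finite A & A <= carrier M & N = {m. EX c:A \<rightarrow> carrier L. m = (\<Oplus>\<^bsub>M\<^esub>a\<in>A. c a *\<^sub>M a)})" for N
 have "submodule {m. EX c:{} \<rightarrow> carrier L. m = (\<Oplus>\<^bsub>M\<^esub>a\<in>{}. c a *\<^sub>M a)} L M"
  by (rule span_submodule[OF assms(1)]) auto
 moreover have "P {m. EX c:{} \<rightarrow> carrier L. m = (\<Oplus>\<^bsub>M\<^esub>a\<in>{}. c a *\<^sub>M a)}"
  unfolding P_def by (rule exI[of _ "{}"]) simp
 ultimately obtain N where N: "submodule N L M" "P N" "!!N'. submodule N' L M ==> P N' ==> N <= N' ==> N' = N"
  by (rule finlen_max[OF assms(2,1), of _ P]) (rule that)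
 obtain A where A: "finite A" "A <= carrier M" "N = {m. EX c:A \<rightarrow> carrier L. m = (\<Oplus>\<^bsub>M\<^esub>a\<in>A. c a *\<^sub>M a)}"
  using N(2) unfolding P_def by blast
 have "carrier M <= N"
 proof
  fix x assume x: "x : carrier M"
  define N' where "N' = {m. EX c:insert x A \<rightarrow> carrier L. m = (\<Oplus>\<^bsub>M\<^esub>a\<in>insert x A. c a *\<^sub>M a)}"
  have N': "submodule N' L M" "insert x A <= N'"
   unfolding N'_def by (rule span_submodule[OF assms(1)]; use A x in auto)+
  have "P N'" unfolding P_def N'_def using A x by (intro exI[of _ "insert x A"]) auto
  moreover have "N <= N'"
  proof
   fix m assume "m : N"
   then obtain c where "c : A \<rightarrow> carrier L" "m = (\<Oplus>\<^bsub>M\<^esub>a\<in>A. c a *\<^sub>M a)" using A(3) by blast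
   then show "m : N'"
    using submD(7)[OF N'(1)] N'(2) by (auto intro!: finsum_in_submodule[OF assms(1) N'(1) A(1)])
  qed
  ultimately have "N' = N" using N(3)[OF N'(1)] by blast
  then show "x : N" using N'(2) by blast
 qed
 then show ?thesis unfolding fin_gen_def using A by blast
qed

lemma finlen_sub: assumes "left_module L M" "finlen L M" "submodule N L M"
 shows "finlen L (sub_mod M N)"
 using assms(2) unfolding finlen_def by (metis subm_sub_mod_iff[OF assms(3,1)])

text \<open>The rank of \<open>N\<close> is the rank of its intersection with the kernel plus the
  rank of its image. By the modular law a proper inclusion shows in at least one of the two.\<close>

lemma finlen_ext: assumes "left_module L B" "left_module L D" "g : Hom L B D"
  and "finlen L (sub_mod B (a_kernel B D g))" "finlen L D" shows "finlen L B"
proof -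
 interpret B: left_module L B by fact
 interpret D: left_module L D by fact
 let ?K = "a_kernel B D g"
 have K: "submodule ?K L B" by (rule subm_kernel[OF assms(1-3)])
 obtain l1 :: "_ => nat" where l1': "ALL N N'. submodule N L B & N <= ?K --> submodule N' L B & N' <= ?K --> N \<subset> N' --> l1 N < l1 N'"
  using assms(4) unfolding finlen_def subm_sub_mod_iff[OF K assms(1)] by (rule exE)
 then have l1: "!!N N'. submodule N L B ==> N <= ?K ==> submodule N' L B ==> N' <= ?K ==> N \<subset> N' ==> l1 N < l1 N'"
  by simp
 obtain l2 :: "_ => nat" where l2: "!!N N'. submodule N L D ==> submodule N' L D ==> N \<subset> N' ==> l2 N < l2 N'"
  using assms(5) unfolding finlen_def by blast
 have "l1 (N \<inter> ?K) + l2 (g ` N) < l1 (N' \<inter> ?K) + l2 (g ` N')"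
  if N: "submodule N L B" "submodule N' L B" "N \<subset> N'" for N N'
 proof -
  note S = submD[OF N(1)] and S' = submD[OF N(2)]
  have a: "l1 (N \<inter> ?K) <= l1 (N' \<inter> ?K)"
  proof (cases "N \<inter> ?K = N' \<inter> ?K")
   case False
   then have "N \<inter> ?K \<subset> N' \<inter> ?K" using N(3) by blast
   then show ?thesis using l1[OF subm_Int[OF assms(1) N(1) K] _ subm_Int[OF assms(1) N(2) K]] by simp
  qed simp
  have b: "l2 (g ` N) <= l2 (g ` N')"
  proof (cases "g ` N = g ` N'")
   case False
   then have "g ` N \<subset> g ` N'" using N(3) by blast
   then show ?thesis
    using l2[OF subm_image[OF assms(1-3) N(1)] subm_image[OF assms(1-3) N(2)]] by simp
  qed simp
  show ?thesis
  proof (cases "g ` N = g ` N'")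
   case False
   then show ?thesis
    using l2[OF subm_image[OF assms(1-3) N(1)] subm_image[OF assms(1-3) N(2)]] N(3) a by fastforce
  next
   case True
   \<comment> \<open>With equal images, an element of \<open>N'\<close> outside \<open>N\<close> is
     moved into the kernel by subtracting an element of \<open>N\<close> with the same
     image.\<close>
   obtain x where x: "x : N'" "x ~: N" using N(3) by blast
   then obtain y where y: "y : N" "g y = g x" using True by (metis imageE imageI)
   have xy: "x : carrier B" "y : carrier B" using x(1) y(1) S(3) S'(3) by auto
   have "g (x \<ominus>\<^sub>B y) = 0\<^sub>D"
    using xy y(2) by (simp add: Hom_minus[OF assms(1-3)] D.minus_0_iff Hom_cl[OF assms(3)])
   then have "x \<ominus>\<^sub>B y : N' \<inter> ?K" using x y N(3) S' xy by (auto simp: aker_eq)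
   moreover have "x \<ominus>\<^sub>B y ~: N"
    using S(4)[of "x \<ominus>\<^sub>B y" y] y(1) x(2) B.add_minus(1)[OF xy] by auto
   ultimately have "N \<inter> ?K \<subset> N' \<inter> ?K" using N(3) by blast
   then have "l1 (N \<inter> ?K) < l1 (N' \<inter> ?K)"
    using l1[OF subm_Int[OF assms(1) N(1) K] _ subm_Int[OF assms(1) N(2) K]] by blast
   then show ?thesis using b by linarith
  qed
 qed
 then show ?thesis unfolding finlen_def by (intro exI[of _ "%N. l1 (N \<inter> ?K) + l2 (g ` N)"]) blast
qed

lemma finlen_zero: assumes "left_module L M" "carrier M = {0\<^sub>M}" shows "finlen L M"
proof -
 have "N = {0\<^sub>M}" if "submodule N L M" for N using submD(1,2)[OF that] assms(2) by blast
 then show ?thesis unfolding finlen_def by (metis psubset_eq)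
qed

lemma finlen_inj:
 assumes "left_module L B" "left_module L D" "g : Hom L B D" "inj_on g (carrier B)" "finlen L D"
 shows "finlen L B"
proof (rule finlen_ext[OF assms(1-3) finlen_zero assms(5)])
 show "left_module L (sub_mod B (a_kernel B D g))" by (intro lm_sub subm_kernel assms)
 show "carrier (sub_mod B (a_kernel B D g)) = {\<zero>\<^bsub>sub_mod B (a_kernel B D g)\<^esub>}"
  using assms(4) submD(2)[OF subm_kernel[OF assms(1-3)]]
  unfolding inj_iff_ker[OF assms(1-3)] by (auto simp: aker_eq)
qed

lemma finlen_surj:
 assumes "left_module L B" "left_module L D" "g : Hom L B D" "g ` carrier B = carrier D" "finlen L B"
 shows "finlen L D"
proof -
 obtain l :: "_ => nat" where l: "!!N N'. submodule N L B ==> submodule N' L B ==> N \<subset> N' ==> l N < l N'"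
  using assms(5) by (auto simp: finlen_def)
 have "{x : carrier B. g x : N} \<subset> {x : carrier B. g x : N'}"
  if NN: "submodule N' L D" "N \<subset> N'" for N N'
 proof -
  obtain y where "y : N'" "y ~: N" using NN(2) by blast
  moreover from this obtain x where "x : carrier B" "y = g x"
   using submD(1)[OF NN(1)] assms(4) by blast
  ultimately show ?thesis using NN(2) by blast
 qed
 then show ?thesis unfolding finlen_def
  by (intro exI[of _ "%N. l {x : carrier B. g x : N}"] allI impI l subm_preimage[OF assms(1-3)]) auto
qed

lemma finlen_dsum: assumes "left_module L M" "left_module L N" "finlen L M" "finlen L N"
 shows "finlen L (dsum M N)"
proof -
 have D: "left_module L (dsum M N)" by (rule lm_dsum[OF assms(1,2)])
 have snd: "restrict snd (carrier (dsum M N)) : Hom L (dsum M N) N" by (rule lmod_homI[OF D]) auto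
 have K: "submodule (a_kernel (dsum M N) N (restrict snd (carrier (dsum M N)))) L (dsum M N)"
  by (rule subm_kernel[OF D assms(2) snd])
 have KL: "left_module L (sub_mod (dsum M N) (a_kernel (dsum M N) N (restrict snd (carrier (dsum M N)))))"
  by (rule lm_sub[OF D K])
 have "restrict fst (carrier (sub_mod (dsum M N) (a_kernel (dsum M N) N (restrict snd (carrier (dsum M N))))))
  : Hom L (sub_mod (dsum M N) (a_kernel (dsum M N) N (restrict snd (carrier (dsum M N))))) M"
  by (rule lmod_homI[OF KL]) (auto simp: aker_eq)
 then have "finlen L (sub_mod (dsum M N) (a_kernel (dsum M N) N (restrict snd (carrier (dsum M N)))))"
  by (rule finlen_inj[OF KL assms(1) _ _ assms(3)]) (auto simp: inj_on_def aker_eq)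
 then show ?thesis by (rule finlen_ext[OF D assms(2) snd _ assms(4)])
qed

lemma reg_mod_simps [simp]:
 "carrier (reg_mod L) = carrier L" "\<zero>\<^bsub>reg_mod L\<^esub> = 0\<^sub>L" "add (reg_mod L) = add L"
 "x \<odot>\<^bsub>reg_mod L\<^esub> y = x \<otimes>\<^sub>L y" by (simp_all add: reg_mod_def)

lemma reg_mod_minus [simp]: "\<ominus>\<^bsub>reg_mod L\<^esub> x = \<ominus>\<^sub>L x" "x \<ominus>\<^bsub>reg_mod L\<^esub> y = x \<ominus>\<^sub>L y"
 by (simp_all add: a_minus_def a_inv_def m_inv_def)

lemma lm_reg: "ring L ==> left_module L (reg_mod L)"
proof -
 assume "ring L"
 then interpret ring L .
 have "abelian_group (reg_mod L)"
  by (rule abelian_groupI) (auto simp: a_ac intro: bexI[of _ "\<ominus>\<^sub>L _"] simp: l_neg)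
 then show ?thesis
  by (intro left_module.intro left_module_axioms.intro ring_axioms) (auto simp: l_distr r_distr m_assoc)
qed

lemma hom_from_reg: assumes "left_module L M" "x : carrier M"
 shows "(\<lambda>a\<in>carrier L. a *\<^sub>M x) : Hom L (reg_mod L) M"
proof -
 interpret M: left_module L M by fact
 show ?thesis using lmod_homI[OF lm_reg[OF M.R.ring_axioms], of "%a. a *\<^sub>M x" M] assms(2)
  by (simp add: M.smult_closed M.smult_l_distr M.smult_assoc)
qed

lemma hom_from_dsum:
 assumes "left_module L M" "left_module L N" "left_module L V" "f : Hom L M V" "g : Hom L N V"
 shows "(\<lambda>(x, y)\<in>carrier M \<times> carrier N. f x +\<^sub>V g y) : Hom L (dsum M N) V"
proof -
 interpret L: left_module L V by fact
 have "restrict (%(x, y). f x +\<^sub>V g y) (carrier (dsum M N)) : Hom L (dsum M N) V"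
  by (rule lmod_homI[OF lm_dsum[OF assms(1,2)]])
   (use assms in \<open>auto simp: Hom_cl Hom_add Hom_smult L.smult_r_distr L.M.a_ac\<close>)
 then show ?thesis by simp
qed

text \<open>Generators are added one at a time: the new submodule is an image of the old one plus a
  copy of the ring, both of finite length.\<close>

lemma finlen_fin_gen: assumes "left_module L M" "fin_gen L M" "finlen L (reg_mod L)"
 shows "finlen L M"
proof -
 interpret M: left_module L M by fact
 obtain A where A: "finite A" "A <= carrier M" "!!N. submodule N L M ==> A <= N ==> N = carrier M"
  using assms(2) unfolding fin_gen_iff[OF assms(1)] by blast
 have "EX N. submodule N L M & A <= N & finlen L (sub_mod M N)" using A(1,2)
 proof (induction A)
  case empty
  show ?case
   by (intro exI[of _ "{0\<^sub>M}"] conjI M.zero_submodule finlen_zero lm_sub assms(1)) auto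
 next
  case (insert x A)
  then obtain N where N: "submodule N L M" "A <= N" "finlen L (sub_mod M N)" by auto
  note S = submD[OF N(1)]
  have x: "x : carrier M" using insert by auto
  define h where "h = (\<lambda>(y, a)\<in>N \<times> carrier L. y +\<^sub>M a *\<^sub>M x)"
  have L: "left_module L (sub_mod M N)" "left_module L (reg_mod L)"
   by (intro lm_sub lm_reg assms(1) N(1) M.R.ring_axioms)+
  have "h = (\<lambda>(y, a)\<in>carrier (sub_mod M N) \<times> carrier (reg_mod L). (\<lambda>x\<in>N. x) y +\<^sub>M (\<lambda>a\<in>carrier L. a *\<^sub>M x) a)"
   by (auto simp: h_def)
  then have h: "h : Hom L (dsum (sub_mod M N) (reg_mod L)) M"
   using hom_from_dsum[OF L assms(1) sub_mod_incl[OF assms(1) N(1)] hom_from_reg[OF assms(1) x]] by simp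
  let ?D = "dsum (sub_mod M N) (reg_mod L)"
  have D: "left_module L ?D" by (rule lm_dsum[OF L])
  have fl: "finlen L ?D" by (rule finlen_dsum[OF L N(3) assms(3)])
  have I: "submodule (h ` carrier ?D) L M" by (rule subm_range[OF D assms(1) h])
  have "finlen L (sub_mod M (h ` carrier ?D))"
   by (rule finlen_surj[OF D lm_sub[OF assms(1) I] Hom_into_sub[OF h] _ fl]) auto
  moreover have "insert x A <= h ` carrier ?D"
  proof -
   have "x = h (0\<^sub>M, \<one>\<^sub>L)" using S x by (simp add: h_def M.smult_one)
   moreover have "y = h (y, 0\<^sub>L)" if "y : A" for y
    using that N(2) S(3)[of y] x by (auto simp: h_def M.smult_0l)
   ultimately show ?thesis using S N(2) by (auto intro!: image_eqI)
  qed
  ultimately show ?case using I by blast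
 qed
 then obtain N where N: "submodule N L M" "A <= N" "finlen L (sub_mod M N)" by blast
 then have "N = carrier M" using A by blast
 then show ?thesis
  using N(3) by (intro finlen_surj[OF _ assms(1) sub_mod_incl[OF assms(1) M.subm_carrier]])
  (auto intro: lm_sub assms(1) M.subm_carrier)
qed

section \<open>Endomorphisms of modules of finite length, in the spirit of Fitting's lemma\<close>

lemma funpow_hom: assumes "left_module L M" "h : Hom L M M"
 shows "restrict (h ^^ k) (carrier M) : Hom L M M" "x : carrier M ==> (h ^^ k) x : carrier M"
proof -
 show cl: "(h ^^ k) x : carrier M" if "x : carrier M" for x k
  using that by (induction k) (auto simp: Hom_cl[OF assms(2)])
 interpret M: left_module L M by fact
 show "restrict (h ^^ k) (carrier M) : Hom L M M"
 proof (rule lmod_homI[OF assms(1)])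
  show "(h ^^ k) (x +\<^sub>M y) = (h ^^ k) x +\<^sub>M (h ^^ k) y" if "x : carrier M" "y : carrier M" for x y
   using that by (induction k) (auto simp: Hom_add[OF assms(2)] cl)
  show "(h ^^ k) (a *\<^sub>M x) = a *\<^sub>M (h ^^ k) x" if "a : carrier L" "x : carrier M" for a x
   using that by (induction k) (auto simp: Hom_smult[OF assms(2)] cl)
 qed (rule cl)
qed

text \<open>The kernels of the powers of \<open>h\<close> become stationary. An element of the
  kernel of \<open>h\<close>, written as a high power applied to \<open>y\<close>, puts
  \<open>y\<close> into the next kernel and therefore into the present one.\<close>

lemma finlen_surj_inj:
 assumes "left_module L M" "finlen L M" "h : Hom L M M" "h ` carrier M = carrier M"
 shows "inj_on h (carrier M)" unfolding inj_iff_ker[OF assms(1,1,3)]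
proof (intro ballI impI)
 interpret M: left_module L M by fact
 define K where "K k = {x : carrier M. (h ^^ k) x = 0\<^sub>M}" for k :: nat
 have K: "submodule (K k) L M" for k
  using subm_kernel[OF assms(1,1) funpow_hom(1)[OF assms(1,3), of k]]
  by (rule back_subst[of "%N. submodule N L M"]) (auto simp: K_def aker_eq)
 obtain N where N: "submodule N L M" "EX k. N = K k" "!!N'. submodule N' L M ==> EX k. N' = K k ==> N <= N' ==> N' = N"
  using finlen_max[OF assms(2,1) K[of 0], of "%N. EX k. N = K k"] by metis
 then obtain k where k: "N = K k" by blast
 have "K k <= K (Suc k)" using Hom_zero[OF assms(1,1,3)] by (auto simp: K_def)
 then have Kk: "K (Suc k) = K k" using N(3)[OF K] k by blast
 fix x assume x: "x : carrier M" "h x = 0\<^sub>M"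
 have "(h ^^ k) ` carrier M = carrier M"
 proof (induction k)
  case (Suc k)
  have "(h ^^ Suc k) ` carrier M = h ` ((h ^^ k) ` carrier M)" by (simp add: image_comp)
  then show ?case using Suc assms(4) by simp
 qed simp
 then obtain y where y: "y : carrier M" "x = (h ^^ k) y" using x(1) by (metis imageE)
 then have "y : K (Suc k)" using x by (simp add: K_def)
 then show "x = 0\<^sub>M" using Kk y by (auto simp: K_def)
qed

text \<open>Here the images of the powers become stationary, and injectivity allows the power to be
  cancelled.\<close>

lemma finlen_inj_surj: assumes "left_module L M" "finlen L M" "h : Hom L M M" "inj_on h (carrier M)"
 shows "h ` carrier M = carrier M"
proof
 interpret M: left_module L M by fact
 define I where "I k = (h ^^ k) ` carrier M" for k :: nat
 have I: "submodule (I k) L M" for k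
  using subm_range[OF assms(1,1) funpow_hom(1)[OF assms(1,3), of k]] by (simp add: I_def)
 obtain N where N: "submodule N L M" "EX k. N = I k" "!!N'. submodule N' L M ==> EX k. N' = I k ==> N' <= N ==> N' = N"
  using finlen_min[OF assms(2) I[of 0], of "%N. EX k. N = I k"] by metis
 then obtain k where k: "N = I k" by blast
 have "I (Suc k) <= I k" using Hom_cl[OF assms(3)] by (auto simp: I_def funpow_swap1)
 then have Ik: "I (Suc k) = I k" using N(3)[OF I] k by blast
 show "carrier M <= h ` carrier M"
 proof
  fix x assume x: "x : carrier M"
  then have "(h ^^ k) x : I (Suc k)" unfolding Ik by (auto simp: I_def)
  then obtain y where y: "y : carrier M" "(h ^^ k) x = (h ^^ k) (h y)" by (auto simp: I_def funpow_swap1)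
  have "inj_on (h ^^ k) (carrier M)"
  proof (induction k)
   case (Suc k)
   then show ?case
    using funpow_hom(2)[OF assms(1,3), of _ k] by (auto intro!: inj_onI dest!: inj_onD[OF assms(4)] dest: inj_onD)
  qed simp
  then have "x = h y" using x y Hom_cl[OF assms(3)] by (auto dest: inj_onD)
  then show "x : h ` carrier M" using y by blast
 qed
qed (use Hom_cl[OF assms(3)] in auto)

lemma set_add_iff: "z : N <+>\<^sub>M N' <-> (EX x:N. EX y:N'. z = x +\<^sub>M y)"
 by (auto simp: set_add_def')

lemma cyclic_submodule: assumes "left_module L M" "x : carrier M"
 shows "submodule ((%a. a *\<^sub>M x) ` carrier L) L M" "x : (%a. a *\<^sub>M x) ` carrier L"
proof -
 interpret M: left_module L M by fact
 show "submodule ((%a. a *\<^sub>M x) ` carrier L) L M"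
  using subm_range[OF lm_reg[OF M.R.ring_axioms] assms(1) hom_from_reg[OF assms]] by simp
 show "x : (%a. a *\<^sub>M x) ` carrier L"
  using assms(2) by (auto intro!: image_eqI[of _ _ "\<one>\<^sub>L"] simp: M.smult_one)
qed

lemma subm_max_avoiding: assumes "left_module L M" "submodule K L M" "K <= I" "y ~: K"
 obtains N where "submodule N L M" "K <= N" "N <= I" "y ~: N"
  "!!N'. submodule N' L M ==> N <= N' ==> N' <= I ==> y ~: N' ==> N' = N"
proof -
 interpret M: left_module L M by fact
 define S where "S = {N. submodule N L M & K <= N & N <= I & y ~: N}"
 have "EX N:S. ALL X:S. N <= X --> X = N"
 proof (rule subset_Zorn_nonempty)
  show "S ~= {}" using assms by (auto simp: S_def)
 next
  fix c assume c: "c ~= {}" "subset.chain S c"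
  then have cS: "!!N. N : c ==> submodule N L M & K <= N & N <= I & y ~: N"
   and ch: "!!N N'. N : c ==> N' : c ==> N <= N' \<or> N' <= N" by (auto simp: subset_chain_def S_def)
  have "submodule (\<Union>c) L M"
  proof (rule M.submoduleI)
   show "\<Union>c <= carrier M" using cS submD(1) by blast
   show "0\<^sub>M : \<Union>c" using cS c(1) submD(2) by blast
   show "u +\<^sub>M v : \<Union>c" if uv: "u : \<Union>c" "v : \<Union>c" for u v
   proof -
    obtain N where N: "N : c" "u : N" "v : N" using uv ch by blast
    then have "submodule N L M" using cS by blast
    from submD(4)[OF this N(2,3)] show ?thesis using N(1) by blast
   qed
   show "a *\<^sub>M u : \<Union>c" if au: "a : carrier L" "u : \<Union>c" for a u
   proof -
    obtain N where N: "N : c" "u : N" using au by blast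
    then have "submodule N L M" using cS by blast
    from submD(7)[OF this au(1) N(2)] show ?thesis using N(1) by blast
   qed
  qed
  moreover obtain N0 where "N0 : c" using c(1) by blast
  then have "K <= \<Union>c" using cS[of N0] by blast
  moreover have "\<Union>c <= I" using cS by (intro Union_least) simp
  moreover have "y ~: \<Union>c" using cS by (meson UnionE)
  ultimately show "\<Union>c\<in> S" by (simp add: S_def)
 qed
 then obtain N where N: "N : S" "!!X. X : S ==> N <= X ==> X = N" by blast
 show ?thesis
 proof (rule that[of N])
  fix N' assume "submodule N' L M" "N <= N'" "N' <= I" "y ~: N'"
  moreover from this have "N' : S" using N(1) by (simp add: S_def subset_trans[of K N N'])
  ultimately show "N' = N" using N(2) by blast
 qed (use N(1) in \<open>auto simp: S_def\<close>)
qed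

lemma submodule_modular:
 assumes "left_module L M" "submodule N L M" "submodule N' L M" "submodule I L M" "N <= N'"
  "N \<inter> I = N' \<inter> I" "N <+>\<^sub>M I = N' <+>\<^sub>M I" shows "N = N'"
proof
 interpret M: left_module L M by fact
 show "N' <= N"
 proof
  fix x assume x: "x : N'"
  then have "x : N <+>\<^sub>M I" using subm_sum(2)[OF assms(1,3,4)] assms(7) by blast
  then obtain n i where ni: "n : N" "i : I" "x = n +\<^sub>M i" by (auto simp: set_add_iff)
  have c: "n : carrier M" "i : carrier M" "x : carrier M"
   using ni x submD(3)[OF assms(2)] submD(3)[OF assms(3)] submD(3)[OF assms(4)] by auto
  have "i = x \<ominus>\<^sub>M n" using ni c by (simp add: M.add_minus)
  then have "i : N" using submD(6)[OF assms(3) x, of n] ni assms(5,6) by blast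
  then show "x : N" using ni submD(4)[OF assms(2)] by blast
 qed
qed (rule assms(5))

section \<open>Lifting properties for modules on arbitrary carriers\<close>

lemma fg_modD: "M : fg_mod L ==> left_module L M" "M : fg_mod L ==> fin_gen L M"
 by (simp_all add: fg_mod_def)

lemma modules_isoE:
 fixes M :: "('a, 'b) module" assumes "M : fg_mod L"
 obtains N :: "'a fgm" and f g where "N : modules L" "f : Hom L M N" "g : Hom L N M"
  "!!x. x : carrier M ==> g (f x) = x" "!!y. y : carrier N ==> f (g y) = y"
proof -
 obtain N where N: "N : modules L" "mod_iso L M N" using modules_universal[OF assms] by blast
 show ?thesis
  by (rule mod_isoE[OF N(2) fg_modD(1)[OF assms] fg_modD(1)[OF N(1)]]) (rule that[OF N(1)])
qed

text \<open>The definition tests injectivity on list-carried modules only; replacing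
  \<open>A\<close> and \<open>B\<close> by isomorphic copies of that kind extends it to every
  carrier.\<close>

lemma inj_mod_extend: assumes "inj_mod L I" "A : fg_mod L" "B : fg_mod L" "g : Hom L A B"
  "inj_on g (carrier A)" "f : Hom L A I"
 obtains h where "h : Hom L B I" "!!x. x : carrier A ==> h (g x) = f x"
proof -
 note lm = fg_modD(1)[OF assms(2)] fg_modD(1)[OF assms(3)]
 obtain A' a a' where A: "A' : modules L" "a : Hom L A A'" "a' : Hom L A' A"
  "!!x. x : carrier A ==> a' (a x) = x" "!!x. x : carrier A' ==> a (a' x) = x"
  using modules_isoE[OF assms(2)] by metis
 obtain B' b b' where B: "B' : modules L" "b : Hom L B B'" "b' : Hom L B' B"
  "!!x. x : carrier B ==> b' (b x) = x" "!!x. x : carrier B' ==> b (b' x) = x"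
  using modules_isoE[OF assms(3)] by metis
 note lm' = fg_modD(1)[OF A(1)] fg_modD(1)[OF B(1)]
 let ?g = "compose (carrier A') b (compose (carrier A') g a')" and ?f = "compose (carrier A') f a'"
 have g: "?g : Hom L A' B'" and f: "?f : Hom L A' I"
  using A(3) B(2) assms(4,6) lm' by (auto intro!: Hom_comp)
 have "inj_on ?g (carrier A')"
 proof (rule inj_onI)
  fix x y assume xy: "x : carrier A'" "y : carrier A'" "?g x = ?g y"
  then have "b' (b (g (a' x))) = b' (b (g (a' y)))" by (simp add: compose_def)
  then have "g (a' x) = g (a' y)" using xy by (simp add: B(4) Hom_cl[OF assms(4)] Hom_cl[OF A(3)])
  then have "a' x = a' y" using xy Hom_cl[OF A(3)] by (auto dest: inj_onD[OF assms(5)])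
  then show "x = y" using xy A(5) by metis
 qed
 then obtain h where h: "h : Hom L B' I" "compose (carrier A') h ?g = ?f"
  using assms(1) A(1) B(1) f g unfolding injective_mod_def by blast
 show ?thesis
 proof (rule that[OF Hom_comp[OF B(2) h(1) lm(2)]])
  fix x assume x: "x : carrier A"
  then have ax: "a x : carrier A'" by (rule Hom_cl[OF A(2)])
  have "h (?g (a x)) = ?f (a x)" using fun_cong[OF h(2), of "a x"] ax by (simp add: compose_def)
  then show "compose (carrier B) h b (g x) = f x"
   using x ax by (simp add: compose_def A(4) Hom_cl[OF assms(4)])
 qed
qed

text \<open>The same transport along isomorphic copies, now for lifting along a surjection.\<close>

lemma proj_mod_lift: assumes "proj_mod L P" "A : fg_mod L" "B : fg_mod L" "g : Hom L A B"
  "g ` carrier A = carrier B" "f : Hom L P B"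
 obtains h where "h : Hom L P A" "!!x. x : carrier P ==> g (h x) = f x"
proof -
 note lm = fg_modD(1)[OF assms(2)] fg_modD(1)[OF assms(3)]
 have P: "P : modules L" "left_module L P" using assms(1) by (auto simp: projective_mod_def fg_modD)
 obtain A' a a' where A: "A' : modules L" "a : Hom L A A'" "a' : Hom L A' A"
  "!!x. x : carrier A ==> a' (a x) = x" "!!x. x : carrier A' ==> a (a' x) = x"
  using modules_isoE[OF assms(2)] by metis
 obtain B' b b' where B: "B' : modules L" "b : Hom L B B'" "b' : Hom L B' B"
  "!!x. x : carrier B ==> b' (b x) = x" "!!x. x : carrier B' ==> b (b' x) = x"
  using modules_isoE[OF assms(3)] by metis
 note lm' = fg_modD(1)[OF A(1)] fg_modD(1)[OF B(1)]
 let ?g = "compose (carrier A') b (compose (carrier A') g a')" and ?f = "compose (carrier P) b f"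
 have g: "?g : Hom L A' B'" and f: "?f : Hom L P B'"
  using A(3) B(2) assms(4,6) lm' P by (auto intro!: Hom_comp)
 have "carrier B' <= ?g ` carrier A'"
 proof
  fix y assume y: "y : carrier B'"
  then obtain x where x: "x : carrier A" "b' y = g x" using Hom_cl[OF B(3)] assms(5) by (metis imageE)
  then have "?g (a x) = y" using y by (simp add: compose_def Hom_cl[OF A(2)] A(4) flip: x(2)) (simp add: B(5))
  then show "y : ?g ` carrier A'" using x(1) Hom_cl[OF A(2)] by blast
 qed
 then have "?g ` carrier A' = carrier B'" using Hom_cl[OF g] by blast
 then obtain h where h: "h : Hom L P A'" "compose (carrier P) ?g h = ?f"
  using assms(1) A(1) B(1) f g unfolding projective_mod_def by blast
 show ?thesis
 proof (rule that[OF Hom_comp[OF h(1) A(3) P(2)]])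
  fix x assume x: "x : carrier P"
  then have hx: "h x : carrier A'" by (rule Hom_cl[OF h(1)])
  have "b (g (a' (h x))) = b (f x)" using fun_cong[OF h(2), of x] x hx by (simp add: compose_def)
  then have "b' (b (g (a' (h x)))) = b' (b (f x))" by simp
  then show "g (compose (carrier P) a' h x) = f x"
   using x hx by (simp add: compose_def B(4) Hom_cl[OF assms(4)] Hom_cl[OF A(3)] Hom_cl[OF assms(6)])
 qed
qed

section \<open>Commutative artinian rings\<close>

locale artinian_cring = cring R for R :: "'r ring" (structure) +
 assumes dcc: "[|!!k::nat. ideal (I k) R; !!k. I (Suc k) <= I k|] ==> EX N. ALL k>=N. I k = I N"
begin

lemma reg: "left_module R (reg_mod R)" by (rule lm_reg[OF ring_axioms])

lemma ideal_iff_submodule: "ideal I R <-> submodule I R (reg_mod R)"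
proof
 interpret M: left_module R "reg_mod R" by (rule reg)
 assume "ideal I R"
 then interpret ideal I R .
 show "submodule I R (reg_mod R)" by (rule M.submoduleI) (auto simp: a_subset I_l_closed)
next
 assume I: "submodule I R (reg_mod R)"
 note S = submD[OF I]
 show "ideal I R"
 proof (rule idealI[OF ring_axioms])
  show "subgroup I (add_monoid R)"
   using I by (simp add: submodule_def subgroup_def a_inv_def[symmetric] reg_mod_def m_inv_def)
  show "x \<otimes> a : I" "a \<otimes> x : I" if "a : I" "x : carrier R" for a x
   using S(7)[of x a] S(3)[of a] that by (auto simp: m_comm)
 qed
qed

text \<open>If there were no minimal element, a choice \<open>f\<close> of strictly smaller ideals
  could be iterated from \<open>I0\<close>, against the descending chain condition.\<close>

lemma submodule_min: assumes "submodule I0 R (reg_mod R)" "P I0"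
 obtains (min) I where "submodule I R (reg_mod R)" "P I"
  "!!I'. submodule I' R (reg_mod R) ==> P I' ==> I' <= I ==> I' = I"
proof (rule ccontr)
 assume contr: "~ thesis"
 have "EX I'. submodule I' R (reg_mod R) & P I' & I' \<subset> I" if "submodule I R (reg_mod R)" "P I" for I
 proof (rule ccontr)
  assume "~ ?thesis"
  with contr min[OF that] show False by blast
 qed
 then obtain f where f: "!!I. submodule I R (reg_mod R) ==> P I ==> submodule (f I) R (reg_mod R) & P (f I) & f I \<subset> I"
  by metis
 define S where "S k = (f ^^ k) I0" for k :: nat
 have S: "submodule (S k) R (reg_mod R) & P (S k)" for k
  by (induction k) (use assms f in \<open>auto simp: S_def\<close>)
 have lt: "S (Suc k) \<subset> S k" for k using f[of "S k"] S[of k] by (simp add: S_def)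
 have "EX N. ALL k>=N. S k = S N"
  by (rule dcc) (use S lt in \<open>auto simp: ideal_iff_submodule\<close>)
 then obtain N where N: "ALL k>=N. S k = S N" by blast
 have "S (Suc N) = S N" by (rule N[rule_format]) simp
 then show False using lt[of N] by simp
qed

text \<open>The commutative case of the Hopkins-Levitzki theorem, without nilpotency of the radical.
  An ideal \<open>I\<close> minimal with quotient of finite length must vanish: otherwise a smaller
  ideal \<open>I'\<close> with simple layer between \<open>I'\<close> and \<open>I\<close> also has
  a quotient of finite length. The layer is found through the annihilator of
  \<open>I\<close>.\<close>

lemma finlen_reg: "finlen R (reg_mod R)"
proof -
 interpret M: left_module R "reg_mod R" by (rule reg)
 let ?S = "%N. submodule N R (reg_mod R)"
 \<comment> \<open>Finite length of \<open>R\<close> modulo \<open>I\<close>, phrased as a rank on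
   the submodules above \<open>I\<close>, so that no quotient has to be formed.\<close>
 define cofin where "cofin I <-> (EX l :: 'r set => nat. ALL N N'. ?S N --> ?S N' -->
  I <= N --> N \<subset> N' --> l N < l N')" for I
 have "cofin (carrier R)" unfolding cofin_def using submD(1)[of _ R "reg_mod R"]
  by (intro exI[of _ "%_. 0"]) fastforce
 then obtain I where I: "?S I" "cofin I" "!!I'. ?S I' ==> cofin I' ==> I' <= I ==> I' = I"
  using submodule_min[of "carrier R" cofin] M.subm_carrier by auto
 note SI = submD[OF I(1), simplified]
 have "I = {\<zero>}"
 proof (rule ccontr)
  assume "I ~= {\<zero>}"
  then obtain z0 where z0: "z0 : I" "z0 ~= \<zero>" using SI(2) by blast
  define A where "A = {r : carrier R. ALL z:I. r \<otimes> z = \<zero>}"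
  have A: "?S A" by (rule M.submoduleI) (auto simp: A_def l_distr m_assoc SI(3))
  note SA = submD[OF A, simplified]
  have "\<one> ~: A" using z0 SI(3) by (auto simp: A_def)
  then have "A \<subset> carrier R" using SA(1) by blast
  \<comment> \<open>Minimality among the ideals strictly above the annihilator \<open>A\<close>
    makes \<open>J\<close> modulo \<open>A\<close> simple.\<close>
  then obtain J where J: "?S J" "A \<subset> J" "!!J'. ?S J' ==> A \<subset> J' ==> J' <= J ==> J' = J"
   using submodule_min[of "carrier R" "%J. A \<subset> J"] M.subm_carrier by auto
  note SJ = submD[OF J(1), simplified]
  obtain x where x: "x : J" "x ~: A" using J(2) by blast
  have xR: "x : carrier R" by (rule SJ(3)[OF x(1)])
  obtain y where y: "y : I" "x \<otimes> y ~= \<zero>" using x(2) xR by (auto simp: A_def)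
  have yR: "y : carrier R" by (rule SI(3)[OF y(1)])
  \<comment> \<open>The kernel of multiplication by \<open>x\<close> on \<open>I\<close>; enlarging
    it as far as possible while avoiding \<open>y\<close> yields the candidate
    \<open>I'\<close>.\<close>
  define K where "K = {z : I. x \<otimes> z = \<zero>}"
  have K: "?S K" by (rule M.submoduleI) (use xR SI in \<open>auto simp: K_def r_distr m_lcomm\<close>)
  have "K <= I" "y ~: K" using y by (auto simp: K_def)
  then obtain I' where I': "?S I'" "K <= I'" "I' <= I" "y ~: I'"
   "!!N'. ?S N' ==> I' <= N' ==> N' <= I ==> y ~: N' ==> N' = I'"
   by (rule subm_max_avoiding[OF reg K]) (rule that)
  note SI' = submD[OF I'(1), simplified]
  \<comment> \<open>The class of \<open>y\<close> generates \<open>I\<close> modulo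
    \<open>I'\<close>. Maximality of \<open>I'\<close> gives \<open>y = i + r z\<close>; then
    \<open>r x\<close> lies outside \<open>A\<close>, and as \<open>J\<close> modulo
    \<open>A\<close> is simple, \<open>x = a + s r x\<close>. Multiplying by \<open>z\<close> puts
    \<open>z - s r z\<close> into \<open>K\<close>, and so \<open>z - s y\<close> into
    \<open>I'\<close>.\<close>
  have key: "EX s:carrier R. z \<ominus> s \<otimes> y : I'" if z: "z : I" "z ~: I'" for z
  proof -
   have zR: "z : carrier R" by (rule SI(3)[OF z(1)])
   have C: "?S ((%a. a \<otimes> z) ` carrier R)" "z : (%a. a \<otimes> z) ` carrier R"
    using cyclic_submodule[OF reg, of z] zR by auto
   note Sum = subm_sum[OF reg I'(1) C(1)]
   have "I' <+>\<^bsub>reg_mod R\<^esub> (%a. a \<otimes> z) ` carrier R <= I"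
    using subsetD[OF I'(3)] SI(4,7) z by (auto simp: set_add_iff)
   then have "y : I' <+>\<^bsub>reg_mod R\<^esub> (%a. a \<otimes> z) ` carrier R"
    using I'(5)[OF Sum(1,2)] Sum(3) C(2) z(2) by blast
   then obtain i r where ir: "i : I'" "r : carrier R" "y = i \<oplus> r \<otimes> z" by (auto simp: set_add_iff)
   have iR: "i : carrier R" by (rule SI'(3)[OF ir(1)])
   have "r \<otimes> x ~: A"
   proof
    assume "r \<otimes> x : A"
    then have "r \<otimes> x \<otimes> z = \<zero>" using z(1) by (auto simp: A_def)
    then have "x \<otimes> (r \<otimes> z) = \<zero>" using xR zR ir(2) by (simp add: m_ac)
    then have "r \<otimes> z : K" using SI(7)[OF ir(2) z(1)] by (simp add: K_def)
    then show False using I'(2,4) SI'(4)[OF ir(1), of "r \<otimes> z"] ir(3) by auto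
   qed
   have rxR: "r \<otimes> x : carrier R" using xR ir(2) by simp
   have D: "?S ((%a. a \<otimes> (r \<otimes> x)) ` carrier R)" "r \<otimes> x : (%a. a \<otimes> (r \<otimes> x)) ` carrier R"
    using cyclic_submodule[OF reg, of "r \<otimes> x"] rxR by auto
   note Sum' = subm_sum[OF reg A D(1)]
   have "A <+>\<^bsub>reg_mod R\<^esub> (%a. a \<otimes> (r \<otimes> x)) ` carrier R <= J"
    using psubsetD[OF J(2)] SJ(4,7) x(1) ir(2) by (auto simp: set_add_iff)
   moreover have "A \<subset> A <+>\<^bsub>reg_mod R\<^esub> (%a. a \<otimes> (r \<otimes> x)) ` carrier R"
    using Sum'(2,3) D(2) \<open>r \<otimes> x ~: A\<close> by blast
   ultimately have "x : A <+>\<^bsub>reg_mod R\<^esub> (%a. a \<otimes> (r \<otimes> x)) ` carrier R"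
    using J(3)[OF Sum'(1)] x(1) by blast
   then obtain a s where as: "a : A" "s : carrier R" "x = a \<oplus> s \<otimes> (r \<otimes> x)" by (auto simp: set_add_iff)
   have aR: "a : carrier R" by (rule SA(3)[OF as(1)])
   have "x \<otimes> z = a \<otimes> z \<oplus> s \<otimes> (r \<otimes> x) \<otimes> z"
    using arg_cong[OF as(3), of "%t. t \<otimes> z"] aR as(2) rxR zR by (simp add: l_distr)
   also have "a \<otimes> z = \<zero>" using as(1) z(1) by (simp add: A_def)
   also have "\<zero> \<oplus> s \<otimes> (r \<otimes> x) \<otimes> z = x \<otimes> (s \<otimes> (r \<otimes> z))"
    using as(2) ir(2) xR zR by (simp add: m_ac)
   finally have eq: "x \<otimes> z = x \<otimes> (s \<otimes> (r \<otimes> z))" .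
   have "x \<otimes> (z \<ominus> s \<otimes> (r \<otimes> z)) = \<zero>"
    using eq as(2) ir(2) xR zR by (simp add: minus_eq r_distr r_minus r_neg)
   then have "z \<ominus> s \<otimes> (r \<otimes> z) : K"
    using SI(6,7) z(1) as(2) ir(2) by (simp add: K_def)
   then have k: "z \<ominus> s \<otimes> (r \<otimes> z) : I'" using I'(2) by blast
   have "z \<ominus> s \<otimes> y = (z \<ominus> s \<otimes> (r \<otimes> z)) \<oplus> (\<ominus> s) \<otimes> i"
    using as(2) ir(2) zR iR by (simp add: ir(3) minus_eq r_distr minus_add l_minus a_ac)
   also have "... : I'" using SI'(4)[OF k SI'(7)[of "\<ominus> s" i]] as(2) ir(1) by simp
   finally show ?thesis using as(2) by blast
  qed
  \<comment> \<open>Simplicity of the layer between \<open>I'\<close> and \<open>I\<close>, stated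
    for the intersection of \<open>I\<close> with any ideal above \<open>I'\<close>.\<close>
  have simple: "N \<inter> I = I' \<or> I <= N" if N: "?S N" "I' <= N" for N
  proof (rule disjCI)
   assume "~ I <= N"
   note SN = submD[OF N(1), simplified]
   show "N \<inter> I = I'"
   proof (rule ccontr)
    assume "N \<inter> I ~= I'"
    then have "N \<inter> I <= I & I' \<subset> N \<inter> I" using N(2) I'(3) by blast
    then have "y : N" using I'(5)[OF subm_Int[OF reg N(1) I(1)]] by blast
    have "z : N" if z: "z : I" for z
    proof (cases "z : I'")
     case False
     then obtain s where s: "s : carrier R" "z \<ominus> s \<otimes> y : I'" using key z by blast
     have "z = (z \<ominus> s \<otimes> y) \<oplus> s \<otimes> y"
      using M.add_minus(1)[of z "s \<otimes> y"] s(1) yR SI(3)[OF z] by simp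
     moreover have "... : N" using SN(4)[of "z \<ominus> s \<otimes> y" "s \<otimes> y"] SN(7)[OF s(1) \<open>y : N\<close>] s(2) N(2) by blast
     ultimately show ?thesis by metis
    qed (use N(2) in blast)
    then show False using \<open>~ I <= N\<close> by blast
   qed
  qed
  obtain l :: "'r set => nat" where l: "!!N N'. ?S N ==> ?S N' ==> I <= N ==> N \<subset> N' ==> l N < l N'"
   using I(2) unfolding cofin_def by blast
  \<comment> \<open>The rank modulo \<open>I\<close> is increased by one as soon as the ideal
    contains the simple layer between \<open>I'\<close> and \<open>I\<close>.\<close>
  let ?l = "%N. l (N <+>\<^bsub>reg_mod R\<^esub> I) + (if I <= N then 1 else 0)"
  have "?l N < ?l N'" if N: "?S N" "?S N'" "I' <= N" "N \<subset> N'" for N N'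
  proof (cases "N <+>\<^bsub>reg_mod R\<^esub> I = N' <+>\<^bsub>reg_mod R\<^esub> I")
   case False
   have "N <+>\<^bsub>reg_mod R\<^esub> I <= N' <+>\<^bsub>reg_mod R\<^esub> I" using N(4) unfolding set_add_def' by blast
   then have "l (N <+>\<^bsub>reg_mod R\<^esub> I) < l (N' <+>\<^bsub>reg_mod R\<^esub> I)"
    using False by (intro l subm_sum[OF reg] I N) auto
   then show ?thesis using N(4) by auto
  next
   case True
   have "N \<inter> I ~= N' \<inter> I" using submodule_modular[OF reg N(1,2) I(1) _ _ True] N(4) by blast
   then have "~ I <= N" "I <= N'" using simple[OF N(1,3)] simple[OF N(2)] N(3,4) by blast+
   then show ?thesis using True by simp
  qed
  then have "cofin I'" unfolding cofin_def by (intro exI[of _ ?l]) blast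
  then have "I' = I" using I(3)[OF I'(1) _ I'(3)] by blast
  then show False using y(1) I'(4) by blast
 qed
 then have I0: "I <= N" if "?S N" for N using submD(2)[OF that] by simp
 obtain l :: "'r set => nat" where l: "ALL N N'. ?S N --> ?S N' --> I <= N --> N \<subset> N' --> l N < l N'"
  using I(2) unfolding cofin_def by (rule exE)
 show ?thesis unfolding finlen_def by (rule exI[of _ l]) (use l I0 in simp)
qed

lemma maximalideal_iff: "maximalideal m R <-> submodule m R (reg_mod R) & \<one> ~: m &
  (ALL N. submodule N R (reg_mod R) --> m <= N --> \<one> ~: N --> N = m)"
proof -
 have one: "\<one> : N <-> N = carrier R" if "submodule N R (reg_mod R)" for N
  using submD(7)[OF that, of _ \<one>] submD(1)[OF that] by auto
 show ?thesis unfolding maximalideal_def maximalideal_axioms_def ideal_iff_submodule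
  using one submD(1)[of _ R "reg_mod R"] by (metis reg_mod_simps(1))
qed

lemma exists_maximalideal: assumes "submodule I R (reg_mod R)" "\<one> ~: I"
 obtains m where "maximalideal m R" "I <= m"
proof -
 obtain m where m: "submodule m R (reg_mod R)" "I <= m & \<one> ~: m"
  "!!N. submodule N R (reg_mod R) ==> I <= N & \<one> ~: N ==> m <= N ==> N = m"
  using finlen_max[OF finlen_reg reg assms(1), of "%N. I <= N & \<one> ~: N"] assms(2) by auto
 then have "maximalideal m R" unfolding maximalideal_iff by blast
 then show ?thesis using m(2) that by blast
qed

lemma radical_submodule: "submodule (jacobson_radical R) R (reg_mod R)"
proof -
 interpret M: left_module R "reg_mod R" by (rule reg)
 have "!!m. maximalideal m R ==> submodule m R (reg_mod R)" by (simp add: maximalideal_iff)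
 note S = submD(2,4,7)[OF this]
 show ?thesis by (rule M.submoduleI) (use S in \<open>auto simp: jacobson_radical_def\<close>)
qed

text \<open>\<open>e\<close> is idempotent modulo the radical. It is taken from an ideal
  \<open>N\<close> minimal among those not contained in \<open>m\<close>: since \<open>m\<close> is
  prime, the intersection of \<open>N\<close> with another maximal ideal is still not contained in
  \<open>m\<close>, and minimality puts \<open>N\<close> inside that ideal.\<close>

lemma maximalideal_idempotent: assumes "maximalideal m R"
 obtains e where "e : carrier R" "\<one> \<ominus> e : m" "!!m'. maximalideal m' R ==> m' ~= m ==> e : m'"
proof -
 interpret M: left_module R "reg_mod R" by (rule reg)
 interpret m: primeideal m R by (rule maximalideal_prime[OF assms])
 have m: "submodule m R (reg_mod R)" "\<one> ~: m" "!!N. submodule N R (reg_mod R) ==> m <= N ==> \<one> ~: N ==> N = m"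
  using assms by (auto simp: maximalideal_iff)
 note Sm = submD[OF m(1), simplified]
 have "~ carrier R <= m" using m(2) by blast
 then obtain N where N: "submodule N R (reg_mod R)" "~ N <= m"
  "!!N'. submodule N' R (reg_mod R) ==> ~ N' <= m ==> N' <= N ==> N' = N"
  using finlen_min[OF finlen_reg, of "carrier R" "%N. ~ N <= m"] M.subm_carrier by auto
 note SN = submD[OF N(1), simplified]
 have sub: "N <= m'" if m': "maximalideal m' R" "m' ~= m" for m'
 proof -
  have m'': "submodule m' R (reg_mod R)" "\<one> ~: m'" "!!N. submodule N R (reg_mod R) ==> m' <= N ==> \<one> ~: N ==> N = m'"
   using m'(1) by (auto simp: maximalideal_iff)
  then have "~ m' <= m" using m m'(2) by blast
  then obtain a where a: "a : m'" "a ~: m" by blast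
  obtain b where b: "b : N" "b ~: m" using N(2) by blast
  have ab: "a : carrier R" "b : carrier R" using submD(3)[OF m''(1)] SN(3) a b by auto
  have "a \<otimes> b : N \<inter> m'" using SN(7)[OF ab(1) b(1)] submD(7)[OF m''(1) ab(2) a(1)] ab by (simp add: m_comm)
  moreover have "a \<otimes> b ~: m" using m.I_prime[OF ab] a b by blast
  ultimately have "~ N \<inter> m' <= m" by blast
  then have "N \<inter> m' = N" using N(3)[OF subm_Int[OF reg N(1) m''(1)]] by blast
  then show ?thesis by blast
 qed
 note Sum = subm_sum[OF reg m(1) N(1)]
 have "\<one> : m <+>\<^bsub>reg_mod R\<^esub> N" using m(3)[OF Sum(1,2)] N(2) Sum(3) by blast
 then obtain a e where ae: "a : m" "e : N" "\<one> = a \<oplus> e" by (auto simp: set_add_iff)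
 have "\<one> \<ominus> e = a" using ae Sm(3)[OF ae(1)] SN(3)[OF ae(2)] by (simp add: minus_eq a_assoc r_neg)
 then show ?thesis using that[of e] ae SN(3) sub by blast
qed

end

section \<open>Rings of finite length: finitely generated modules are those of finite length\<close>

locale finlen_ring = ring L for L :: "'a ring" (structure) +
 assumes finlen_regular: "finlen L (reg_mod L)"
begin

lemma fg_mod_iff: "M : fg_mod L <-> left_module L M & finlen L M"
 unfolding fg_mod_def using finlen_fin_gen[OF _ _ finlen_regular] fin_gen_finite_length by blast

lemma fg_mod_sub: "M : fg_mod L ==> submodule N L M ==> sub_mod M N : fg_mod L"
 by (simp add: fg_mod_iff lm_sub finlen_sub)

lemma fg_mod_image:
 "M : fg_mod L ==> left_module L N ==> f : Hom L M N ==> f ` carrier M = carrier N ==> N : fg_mod L"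
 using finlen_surj[of L M N f] by (simp add: fg_mod_iff)

lemma fg_mod_dsum: "M : fg_mod L ==> N : fg_mod L ==> dsum M N : fg_mod L"
 by (simp add: fg_mod_iff lm_dsum finlen_dsum)

lemma fg_mod_quot: "M : fg_mod L ==> submodule N L M ==> quot_mod M N : fg_mod L"
 by (rule fg_mod_image[OF _ quot_mod(1,2,3)]) (auto simp: fg_modD)

lemma fg_mod_reg: "reg_mod L : fg_mod L" by (simp add: fg_mod_iff lm_reg ring_axioms finlen_regular)

end

sublocale artinian_cring < finlen_ring R by unfold_locales (rule finlen_reg)

text \<open>\<open>H\<close> embeds into finitely many copies of \<open>N\<close>. Splitting off the
  kernel of one map at a time avoids forming the power. It serves for modules of homomorphisms, with
  evaluations at generators as the maps.\<close>

lemma finlen_jointly_injective: assumes "finite A" "left_module R H" "finlen R N" "left_module R N"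
  and "!!a. a : A ==> e a : Hom R H N"
  and "!!f. f : carrier H ==> (!!a. a : A ==> e a f = 0\<^sub>N) ==> f = 0\<^sub>H"
 shows "finlen R H" using assms(1,2,5,6)
proof (induction A arbitrary: H e)
 case empty
 interpret H: left_module R H by fact
 show ?case using empty by (intro finlen_zero) auto
next
 case (insert a A)
 have ea: "e a : Hom R H N" using insert by simp
 let ?K = "a_kernel H N (e a)"
 have K: "submodule ?K R H" by (rule subm_kernel[OF insert.prems(1) assms(4) ea])
 have "finlen R (sub_mod H ?K)"
 proof (rule insert.IH[where e = "%b. compose ?K (e b) (\<lambda>x\<in>?K. x)"])
  show L: "left_module R (sub_mod H ?K)" by (rule lm_sub[OF insert.prems(1) K])
  show "compose ?K (e b) (\<lambda>x\<in>?K. x) : Hom R (sub_mod H ?K) N" if "b : A" for b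
   using Hom_comp[OF sub_mod_incl[OF insert.prems(1) K] insert.prems(2)[of b] L] that by simp
  show "f = \<zero>\<^bsub>sub_mod H ?K\<^esub>" if "f : carrier (sub_mod H ?K)"
   "!!b. b : A ==> compose ?K (e b) (\<lambda>x\<in>?K. x) f = 0\<^sub>N" for f
   using that insert.prems(3)[of f] by (auto simp: aker_eq compose_def)
 qed
 then show ?case by (rule finlen_ext[OF insert.prems(1) assms(4) ea _ assms(3)])
qed

section \<open>The duality\<close>

locale dualizing = artinian_cring R for R :: "'r ring" (structure) +
 fixes J :: "('r, 'j) module" assumes dualizing: "dualizing_module R J"
begin

lemma J_injective: "inj_mod R J" and J_fg: "J : fg_mod R" and J: "left_module R J"
 using dualizing by (auto simp: dualizing_module_def injective_envelope_def injective_mod_def fg_modD)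

text \<open>The essential embedding of \<open>R\<close> modulo its radical into \<open>J\<close>,
  composed with the quotient map; from here on cosets no longer occur.\<close>

lemma socle_map:
 obtains \<iota> where "\<iota> : Hom R (reg_mod R) J"
  "!!r. r : carrier R ==> \<iota> r = 0\<^sub>J <-> r : jacobson_radical R"
  "!!N. submodule N R J ==> N \<inter> \<iota> ` carrier R = {0\<^sub>J} ==> N = {0\<^sub>J}"
proof -
 let ?Q = "quot_mod (reg_mod R) (jacobson_radical R)"
 define p where "p = (\<lambda>x\<in>carrier (reg_mod R). jacobson_radical R +>\<^bsub>reg_mod R\<^esub> x)"
 note Q = quot_mod[OF reg radical_submodule, folded p_def]
 obtain i where i: "injective_envelope R ?Q i J" using dualizing by (auto simp: dualizing_module_def)
 then have ih: "i : Hom R ?Q J" and inj: "inj_on i (carrier ?Q)" and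
  ess: "!!N. submodule N R J ==> N \<inter> i ` carrier ?Q = {0\<^sub>J} ==> N = {0\<^sub>J}"
  by (auto simp: injective_envelope_def)
 let ?c = "compose (carrier (reg_mod R)) i p"
 have im: "?c ` carrier R = i ` carrier ?Q"
  using Q(3) by (auto simp: compose_def image_iff) (metis Q(3) imageE reg_mod_simps(1))
 show ?thesis
 proof (rule that[of ?c])
  show "?c : Hom R (reg_mod R) J" by (rule Hom_comp[OF Q(2) ih reg])
  fix r assume r: "r : carrier R"
  then have pr: "p r : carrier ?Q" using Hom_cl[OF Q(2)] by simp
  have "i (p r) = 0\<^sub>J <-> p r = \<zero>\<^bsub>?Q\<^esub>"
   using inj pr Hom_zero[OF Q(1) J ih] unfolding inj_iff_ker[OF Q(1) J ih] by metis
  also have "... <-> r : jacobson_radical R" using Q(4) r unfolding aker_eq by auto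
  finally show "?c r = 0\<^sub>J <-> r : jacobson_radical R" using r by (simp add: compose_def)
 next
  fix N assume "submodule N R J" "N \<inter> ?c ` carrier R = {0\<^sub>J}"
  then show "N = {0\<^sub>J}" unfolding im by (rule ess)
 qed
qed

lemma maximalideal_inverse: assumes "maximalideal m R" "r : carrier R" "r ~: m"
 obtains s where "s : carrier R" "\<one> \<ominus> s \<otimes> r : m"
proof -
 have m: "submodule m R (reg_mod R)" "\<one> ~: m" "!!N. submodule N R (reg_mod R) ==> m <= N ==> \<one> ~: N ==> N = m"
  using assms by (auto simp: maximalideal_iff)
 have C: "submodule ((%a. a \<otimes> r) ` carrier R) R (reg_mod R)" "r : (%a. a \<otimes> r) ` carrier R"
  using cyclic_submodule[OF reg, of r] assms(2) by auto
 note Sum = subm_sum[OF reg m(1) C(1)]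
 have "\<one> : m <+>\<^bsub>reg_mod R\<^esub> (%a. a \<otimes> r) ` carrier R" using m(3)[OF Sum(1,2)] Sum(3) C(2) assms(3) by blast
 then obtain a s where as: "a : m" "s : carrier R" "\<one> = a \<oplus> s \<otimes> r" by (auto simp: set_add_iff)
 have "\<one> \<ominus> s \<otimes> r = a"
  using as assms(2) submD(3)[OF m(1) as(1)] by (simp add: minus_eq a_assoc r_neg)
 then show ?thesis using that as by blast
qed

text \<open>The elements of \<open>J\<close> killed by \<open>m\<close> form a one-dimensional space
  over the residue field, because they come from one factor of \<open>R\<close> modulo its radical.
  The generator is the image of \<open>e\<close>, which is 1 modulo \<open>m\<close> and 0 modulo
  every other maximal ideal.\<close>

lemma socle_generator: assumes "maximalideal m R"
 obtains j where "j : carrier J" "j ~= 0\<^sub>J" "!!r. r : m ==> r *\<^sub>J j = 0\<^sub>J"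
  "!!x. x : carrier J ==> (!!r. r : m ==> r *\<^sub>J x = 0\<^sub>J) ==> EX s:carrier R. x = s *\<^sub>J j"
proof -
 interpret J: left_module R J by (rule J)
 obtain e where e: "e : carrier R" "\<one> \<ominus> e : m" "!!m'. maximalideal m' R ==> m' ~= m ==> e : m'"
  using maximalideal_idempotent[OF assms] by metis
 have m: "submodule m R (reg_mod R)" "\<one> ~: m" using assms by (auto simp: maximalideal_iff)
 note Sm = submD[OF m(1), simplified]
 obtain i where i: "i : Hom R (reg_mod R) J"
  "!!r. r : carrier R ==> i r = 0\<^sub>J <-> r : jacobson_radical R"
  "!!N. submodule N R J ==> N \<inter> i ` carrier R = {0\<^sub>J} ==> N = {0\<^sub>J}"
  using socle_map by metis
 have ic: "i r : carrier J" if "r : carrier R" for r using Hom_cl[OF i(1)] that by simp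
 have ism: "i (r \<otimes> s) = r *\<^sub>J i s" if "r : carrier R" "s : carrier R" for r s
  using Hom_smult[OF i(1)] that by simp
 have em: "e ~: m"
 proof
  assume "e : m"
  then have "(\<one> \<ominus> e) \<oplus> e : m" using Sm(4)[OF e(2)] by simp
  then show False using m(2) e(1) by (simp add: minus_eq a_assoc l_neg)
 qed
 show ?thesis
 proof (rule that[of "i e"])
  show "i e : carrier J" using ic e by simp
  show "i e ~= 0\<^sub>J" using i(2)[OF e(1)] em assms by (auto simp: jacobson_radical_def)
  show "r *\<^sub>J i e = 0\<^sub>J" if "r : m" for r
  proof -
   have rR: "r : carrier R" using Sm(3) that by simp
   have "r \<otimes> e : m'" if "maximalideal m' R" for m'
   proof -
    have m': "submodule m' R (reg_mod R)" using that by (simp add: maximalideal_iff)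
    show ?thesis using submD(7)[OF m', of e r] submD(7)[OF m', of r e] e rR \<open>r : m\<close> that
     by (cases "m' = m") (auto simp: m_comm)
   qed
   then have "r \<otimes> e : jacobson_radical R" using rR e(1) by (simp add: jacobson_radical_def)
   then show ?thesis using i(2)[of "r \<otimes> e"] ism[OF rR e(1)] rR e(1) by simp
  qed
  fix x assume x: "x : carrier J" "!!r. r : m ==> r *\<^sub>J x = 0\<^sub>J"
  show "EX s:carrier R. x = s *\<^sub>J i e"
  proof (cases "x = 0\<^sub>J")
   case True
   then show ?thesis using ic e(1) by (intro bexI[of _ "\<zero>"]) (auto simp: J.smult_0l)
  next
   case False
   \<comment> \<open>Essentiality makes some nonzero multiple \<open>r x\<close> the image of a ring
     element. As \<open>r\<close> is invertible modulo \<open>m\<close>, already \<open>x\<close> is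
     such an image, and \<open>x = e x\<close> makes it a multiple of \<open>i e\<close>.\<close>
   have C: "submodule ((%a. a *\<^sub>J x) ` carrier R) R J" "x : (%a. a *\<^sub>J x) ` carrier R"
    using cyclic_submodule[OF J x(1)] by auto
   have "0\<^sub>J : i ` carrier R" using Hom_zero[OF reg J i(1)] by force
   then have "EX z. z : (%a. a *\<^sub>J x) ` carrier R \<inter> i ` carrier R & z ~= 0\<^sub>J"
    using i(3)[OF C(1)] submD(2)[OF C(1)] C(2) False by blast
   then obtain r t where rt: "r : carrier R" "t : carrier R" "r *\<^sub>J x = i t" "r *\<^sub>J x ~= 0\<^sub>J" by auto
   then have "r ~: m" using x(2) by blast
   then obtain s where s: "s : carrier R" "\<one> \<ominus> s \<otimes> r : m" using maximalideal_inverse[OF assms rt(1)] by metis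
   have "(\<one> \<ominus> s \<otimes> r) *\<^sub>J x = x \<ominus>\<^sub>J s *\<^sub>J (r *\<^sub>J x)"
    using s(1) rt(1) x(1) by (simp add: J.smult_minus_left J.smult_one J.smult_assoc)
   then have "x = s *\<^sub>J i t"
    using x(2)[OF s(2)] s(1) rt(1,3) ic[OF rt(2)] x(1) J.minus_0_iff[OF x(1), of "s *\<^sub>J (r *\<^sub>J x)"] J.smult_closed by simp
   then have xi: "x = i (s \<otimes> t)" using ism s(1) rt(2) by simp
   have st: "s \<otimes> t : carrier R" using s(1) rt(2) by simp
   have "0\<^sub>J = (\<one> \<ominus> e) *\<^sub>J x" using x(2)[OF e(2)] by simp
   also have "... = x \<ominus>\<^sub>J e *\<^sub>J x" using e(1) x(1) by (simp add: J.smult_minus_left J.smult_one)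
   finally have "x = e *\<^sub>J x" using J.minus_0_iff[OF x(1), of "e *\<^sub>J x"] J.smult_closed e(1) x(1) by metis
   also have "... = i (e \<otimes> (s \<otimes> t))" using ism[OF e(1) st] xi by simp
   also have "... = (s \<otimes> t) *\<^sub>J i e" using ism[OF st e(1)] st e(1) by (simp add: m_comm)
   finally show ?thesis using st by blast
  qed
 qed
qed

text \<open>The prescription of zero on \<open>N\<close> and \<open>j\<close> at \<open>x\<close> is
  consistent on the sum of \<open>N\<close> and the multiples of \<open>x\<close> by the condition
  on annihilators; injectivity of \<open>J\<close> extends it to \<open>M\<close>.\<close>

lemma extend_from_cyclic:
 assumes M: "M : fg_mod R" and N: "submodule N R M" and x: "x : carrier M" and j: "j : carrier J"
  and ann: "!!r. r : carrier R ==> r *\<^sub>M x : N ==> r *\<^sub>J j = 0\<^sub>J"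
 obtains f where "f : Hom R M J" "!!n. n : N ==> f n = 0\<^sub>J" "f x = j"
proof -
 interpret J: left_module R J by (rule J)
 interpret M: left_module R M by (rule fg_modD[OF M])
 note S = submD[OF N]
 have L: "left_module R (sub_mod M N)" by (rule lm_sub[OF M.lmod N])
 let ?D = "dsum (sub_mod M N) (reg_mod R)"
 have D: "left_module R ?D" by (rule lm_dsum[OF L reg])
 define q where "q = (\<lambda>(y, a)\<in>N \<times> carrier R. y +\<^sub>M a *\<^sub>M x)"
 have q: "q : Hom R ?D M"
  using hom_from_dsum[OF L reg M.lmod sub_mod_incl[OF M.lmod N] hom_from_reg[OF M.lmod x]]
  by (rule back_subst[of "%f. f : Hom R ?D M"]) (auto simp: q_def)
 define u where "u = (\<lambda>(y, a)\<in>N \<times> carrier R. a *\<^sub>J j)"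
 have u: "u : Hom R ?D J" using hom_from_dsum[OF L reg J Hom_0map[OF L J] hom_from_reg[OF J j]]
  by (rule back_subst[of "%f. f : Hom R ?D J"]) (auto simp: u_def J.smult_closed j)
 let ?N = "q ` carrier ?D"
 have N1: "submodule ?N R M" by (rule subm_range[OF D M.lmod q])
 obtain w where w: "w : Hom R (sub_mod M ?N) J" "!!d. d : carrier ?D ==> w (q d) = u d"
 proof (rule hom_factor_surj[OF D lm_sub[OF M.lmod N1] J Hom_into_sub[OF q] _ u])
  fix d assume d: "d : carrier ?D" "q d = \<zero>\<^bsub>sub_mod M ?N\<^esub>"
  then obtain y a where ya: "d = (y, a)" "y : N" "a : carrier R" "y +\<^sub>M a *\<^sub>M x = 0\<^sub>M"
   by (auto simp: q_def)
  then have "a *\<^sub>M x = \<ominus>\<^sub>M y"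
   using S(3) x M.smult_closed by (metis M.M.minus_equality M.M.a_comm)
  then have "a *\<^sub>M x : N" using S(5) ya(2) by simp
  then show "u d = 0\<^sub>J" using ann ya by (simp add: u_def)
 qed auto
 obtain f where f: "f : Hom R M J" "!!y. y : carrier (sub_mod M ?N) ==> f ((\<lambda>x\<in>?N. x) y) = w y"
  by (rule inj_mod_extend[OF J_injective fg_mod_sub[OF M N1] M sub_mod_incl[OF M.lmod N1] _ w(1)])
   (auto simp: inj_on_def)
 have fq: "f (q d) = u d" if "d : carrier ?D" for d using f(2)[of "q d"] w(2)[OF that] that by auto
 show ?thesis
 proof (rule that[OF f(1)])
  show "f n = 0\<^sub>J" if "n : N" for n
   using fq[of "(n, \<zero>)"] that S(3)[OF that] x j by (simp add: q_def u_def M.smult_0l J.smult_0l)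
  show "f x = j"
   using fq[of "(0\<^sub>M, \<one>)"] S(2) x j by (simp add: q_def u_def M.smult_one J.smult_one)
 qed
qed

text \<open>\<open>J\<close> is a cogenerator: the annihilator of \<open>x\<close> modulo
  \<open>N\<close> is proper, hence inside a maximal ideal \<open>m\<close>, and \<open>J\<close>
  has a nonzero element killed by \<open>m\<close> to serve as the value at
  \<open>x\<close>.\<close>

lemma separation: assumes M: "M : fg_mod R" and N: "submodule N R M" and x: "x : carrier M" "x ~: N"
 obtains f where "f : Hom R M J" "!!n. n : N ==> f n = 0\<^sub>J" "f x ~= 0\<^sub>J"
proof -
 interpret M: left_module R M by (rule fg_modD[OF M])
 let ?a = "{r : carrier (reg_mod R). (\<lambda>r\<in>carrier R. r *\<^sub>M x) r : N}"
 have "submodule ?a R (reg_mod R)"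
  by (rule subm_preimage[OF reg M.lmod hom_from_reg[OF M.lmod x(1)] N])
 moreover have "\<one> ~: ?a" using x by (simp add: M.smult_one)
 ultimately obtain m where m: "maximalideal m R" "?a <= m" using exists_maximalideal by metis
 obtain j where j: "j : carrier J" "j ~= 0\<^sub>J" "!!r. r : m ==> r *\<^sub>J j = 0\<^sub>J"
  using socle_generator[OF m(1)] by metis
 have "r *\<^sub>J j = 0\<^sub>J" if "r : carrier R" "r *\<^sub>M x : N" for r
  using that m(2) by (intro j(3)) auto
 then show ?thesis using extend_from_cyclic[OF M N x(1) j(1)] j(2) that by metis
qed

text \<open>Linearity of an element of the double dual, stated for arbitrary functions
  \<open>G\<close>, so that differences of functionals can be formed without restricting them to a
  domain.\<close>

definition functional :: "('r, 'b) module => (('b => 'j) => 'j) => bool" where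
 "functional M G <-> (ALL f:Hom R M J. G f : carrier J) &
  (ALL f:Hom R M J. ALL g:Hom R M J. G (\<lambda>x\<in>carrier M. f x +\<^sub>J g x) = G f +\<^sub>J G g) &
  (ALL r:carrier R. ALL f:Hom R M J. G (\<lambda>x\<in>carrier M. r *\<^sub>J f x) = r *\<^sub>J G f)"

lemma Hom_scale: assumes "left_module R M" "left_module R N" "r : carrier R" "f : Hom R M N"
 shows "(\<lambda>x\<in>carrier M. r *\<^sub>N f x) : Hom R M N"
proof (rule lmod_homI[OF assms(1)])
 interpret N: left_module R N by fact
 fix a x assume "a : carrier R" "x : carrier M"
 then show "r *\<^sub>N f (a *\<^sub>M x) = a *\<^sub>N (r *\<^sub>N f x)"
  using assms(3) Hom_cl[OF assms(4)] by (simp add: Hom_smult[OF assms(4)] m_comm flip: N.smult_assoc)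
next
 interpret N: left_module R N by fact
 fix x y assume "x : carrier M" "y : carrier M"
 then show "r *\<^sub>N f (x +\<^sub>M y) = r *\<^sub>N f x +\<^sub>N r *\<^sub>N f y"
  using assms(3) Hom_cl[OF assms(4)] by (simp add: Hom_add[OF assms(4)] N.smult_r_distr)
 show "r *\<^sub>N f x : carrier N"
  using \<open>x : carrier M\<close> assms(3) Hom_cl[OF assms(4)] by (simp add: N.smult_closed)
qed

lemma functionalD: assumes "functional M G" shows "f : Hom R M J ==> G f : carrier J"
  "f : Hom R M J ==> g : Hom R M J ==> G (\<lambda>x\<in>carrier M. f x +\<^sub>J g x) = G f +\<^sub>J G g"
  "r : carrier R ==> f : Hom R M J ==> G (\<lambda>x\<in>carrier M. r *\<^sub>J f x) = r *\<^sub>J G f"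
 using assms by (auto simp: functional_def)

text \<open>Reflexivity of \<open>M\<close>, made inductive by localising it to a submodule
  \<open>N\<close>. The induction runs over the rank of \<open>N\<close>, and each simple layer is
  handled by the one-dimensional part of the socle of \<open>J\<close> that belongs to it.\<close>

lemma functional_eval_on_submodule: assumes M: "M : fg_mod R"
 shows "submodule N R M ==> functional M G ==>
  (!!f. f : Hom R M J ==> (!!n. n : N ==> f n = 0\<^sub>J) ==> G f = 0\<^sub>J) ==>
  EX n:N. ALL f:Hom R M J. G f = f n"
proof -
 interpret J: left_module R J by (rule J)
 interpret M: left_module R M by (rule fg_modD[OF M])
 have fl: "finlen R M" using M by (simp add: fg_mod_iff)
 then obtain l :: "_ => nat" where l: "!!N N'. submodule N R M ==> submodule N' R M ==> N \<subset> N' ==> l N < l N'"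
  by (auto simp: finlen_def)
 show "submodule N R M ==> functional M G ==>
  (!!f. f : Hom R M J ==> (!!n. n : N ==> f n = 0\<^sub>J) ==> G f = 0\<^sub>J) ==>
  EX n:N. ALL f:Hom R M J. G f = f n"
 proof (induction "l N" arbitrary: N G rule: less_induct)
  case less
  note N = less.prems(1) and G = less.prems(2) and van = less.prems(3)
  note S = submD[OF N]
  show ?case
  proof (cases "N = {0\<^sub>M}")
   case True
   then have "ALL f:Hom R M J. G f = f 0\<^sub>M" using van Hom_zero[OF M.lmod J] by simp
   then show ?thesis using True by blast
  next
   case False
   then have "{0\<^sub>M} \<subset> N" using S(2) by blast
   \<comment> \<open>A maximal proper submodule of \<open>N\<close>, so that the layer between them
     is the residue field at the annihilator \<open>m\<close> of the class of
     \<open>x\<close>.\<close>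
   then obtain N' where N': "submodule N' R M" "N' \<subset> N" "!!V. submodule V R M ==> V \<subset> N ==> N' <= V ==> V = N'"
    using finlen_max[OF fl M.lmod M.zero_submodule, of "%V. V \<subset> N"] by metis
   note S' = submD[OF N'(1)]
   obtain x where x: "x : N" "x ~: N'" using N'(2) by blast
   have xM: "x : carrier M" using S(3) x by blast
   define m where "m = {r : carrier R. r *\<^sub>M x : N'}"
   have gen: "EX n:N'. EX s:carrier R. y = n +\<^sub>M s *\<^sub>M z" if "y : N" "z : N" "z ~: N'" for y z
   proof -
    have zM: "z : carrier M" using that S by blast
    have C: "submodule ((%a. a *\<^sub>M z) ` carrier R) R M" "z : (%a. a *\<^sub>M z) ` carrier R"
     using cyclic_submodule[OF M.lmod zM] by auto
    note Sum = subm_sum[OF M.lmod N'(1) C(1)]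
    have "N' <+>\<^sub>M (%a. a *\<^sub>M z) ` carrier R <= N"
     using psubsetD[OF N'(2)] S(4,7) that(2) by (auto simp: set_add_iff)
    then have "N' <+>\<^sub>M (%a. a *\<^sub>M z) ` carrier R = N" using N'(3)[OF Sum(1)] Sum(2,3) C(2) that(3) by blast
    then show ?thesis using that(1) by (auto simp: set_add_iff)
   qed
   have m: "submodule m R (reg_mod R)"
    using subm_preimage[OF reg M.lmod hom_from_reg[OF M.lmod xM] N'(1)]
    by (rule back_subst[of "%f. submodule f R (reg_mod R)"]) (auto simp: m_def)
   have "maximalideal m R" unfolding maximalideal_iff
   proof (intro conjI allI impI)
    show "\<one> ~: m" using x xM by (simp add: m_def M.smult_one)
    fix V assume L: "submodule V R (reg_mod R)" "m <= V" "\<one> ~: V"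
    note SL = submD[OF L(1), simplified]
    show "V = m"
    proof (rule ccontr)
     assume "V ~= m"
     then obtain r where r: "r : V" "r ~: m" using L(2) by blast
     have rR: "r : carrier R" using SL(3) r by blast
     have "r *\<^sub>M x : N" "r *\<^sub>M x ~: N'" using r rR S(7)[OF rR x(1)] by (auto simp: m_def)
     then obtain n s where ns: "n : N'" "s : carrier R" "x = n +\<^sub>M s *\<^sub>M (r *\<^sub>M x)"
      using gen[OF x(1)] by blast
     have "(\<one> \<ominus> s \<otimes> r) *\<^sub>M x = x \<ominus>\<^sub>M s *\<^sub>M (r *\<^sub>M x)"
      using ns rR xM by (simp add: M.smult_minus_left M.smult_one M.smult_assoc)
     also have "... = n"
      using ns S'(3)[OF ns(1)] M.smult_closed[OF ns(2) M.smult_closed[OF rR xM]] M.add_minus(3)[of n "s *\<^sub>M (r *\<^sub>M x)"]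
      by metis
     finally have "\<one> \<ominus> s \<otimes> r : m" using ns rR by (simp add: m_def)
     then have "(\<one> \<ominus> s \<otimes> r) \<oplus> s \<otimes> r : V" using L(2) SL(4) SL(7)[OF ns(2) r(1)] by blast
     then show False using L(3) ns(2) rR by (simp add: minus_eq a_assoc l_neg)
    qed
   qed (rule m)
   then obtain j where j: "j : carrier J" "j ~= 0\<^sub>J" "!!r. r : m ==> r *\<^sub>J j = 0\<^sub>J"
    "!!x. x : carrier J ==> (!!r. r : m ==> r *\<^sub>J x = 0\<^sub>J) ==> EX s:carrier R. x = s *\<^sub>J j"
    using socle_generator by metis
   have mx: "r : m" if "r : carrier R" "r *\<^sub>M x : N'" for r using that by (simp add: m_def)
   \<comment> \<open>\<open>f0\<close> kills \<open>N'\<close> and has the value \<open>j\<close> at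
     \<open>x\<close>. Its value under \<open>G\<close> is again killed by \<open>m\<close>, hence a
     multiple of \<open>j\<close> by some \<open>s\<close>.\<close>
   obtain f0 where f0: "f0 : Hom R M J" "!!n. n : N' ==> f0 n = 0\<^sub>J" "f0 x = j"
    using extend_from_cyclic[OF M N'(1) xM j(1) j(3)[OF mx]] by metis
   have van': "G f = 0\<^sub>J" if f: "f : Hom R M J" "!!n. n : N' ==> f n = 0\<^sub>J" "f x = 0\<^sub>J" for f
   proof (rule van[OF f(1)])
    fix n assume "n : N"
    then obtain n' s where "n' : N'" "s : carrier R" "n = n' +\<^sub>M s *\<^sub>M x" using gen x by blast
    then show "f n = 0\<^sub>J"
     using f S' xM by (simp add: Hom_add[OF f(1)] Hom_smult[OF f(1)] M.smult_closed J.smult_0r)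
   qed
   have "r *\<^sub>J G f0 = 0\<^sub>J" if "r : m" for r
   proof -
    have rR: "r : carrier R" using that by (simp add: m_def)
    have "G (\<lambda>x\<in>carrier M. r *\<^sub>J f0 x) = 0\<^sub>J"
     by (rule van'[OF Hom_scale[OF M.lmod J rR f0(1)]])
      (use xM S' rR f0 j(3)[OF that] in \<open>auto simp: J.smult_0r\<close>)
    then show ?thesis using functionalD(3)[OF G rR f0(1)] by simp
   qed
   then obtain s where s: "s : carrier R" "G f0 = s *\<^sub>J j"
    using j(4)[OF functionalD(1)[OF G f0(1)]] by blast
   \<comment> \<open>Evaluation at \<open>s x\<close> agrees with \<open>G\<close> at
     \<open>f0\<close>, and therefore at every functional killing \<open>N'\<close>, since its value
     at \<open>x\<close> is a multiple of \<open>j\<close>.\<close>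
   define n0 where "n0 = s *\<^sub>M x"
   have n0: "n0 : N" "n0 : carrier M" using S(7)[OF s(1) x(1)] S(3) by (auto simp: n0_def)
   have ev: "G f = f n0" if f: "f : Hom R M J" "!!n. n : N' ==> f n = 0\<^sub>J" for f
   proof -
    have "r *\<^sub>J f x = 0\<^sub>J" if "r : m" for r
     using that f(2)[of "r *\<^sub>M x"] xM by (simp add: m_def Hom_smult[OF f(1)])
    then obtain c where c: "c : carrier R" "f x = c *\<^sub>J j"
     using j(4)[OF Hom_cl[OF f(1) xM]] by blast
    have nc: "\<ominus> c : carrier R" using c(1) by simp
    let ?g = "\<lambda>y\<in>carrier M. (\<ominus> c) *\<^sub>J f0 y"
    have g: "?g : Hom R M J" by (rule Hom_scale[OF M.lmod J nc f0(1)])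
    have "G (\<lambda>y\<in>carrier M. f y +\<^sub>J ?g y) = 0\<^sub>J"
     by (rule van'[OF Hom_plus[OF M.lmod J f(1) g]])
      (use xM S'(3) f(2) f0(2,3) c j(1) nc in \<open>auto simp: J.smult_0r J.smult_neg_left J.smult_closed J.M.r_neg\<close>)
    then have "G f +\<^sub>J (\<ominus> c) *\<^sub>J G f0 = 0\<^sub>J"
     using functionalD(2)[OF G f(1) g] functionalD(3)[OF G nc f0(1)] by simp
    then have "G f = c *\<^sub>J G f0"
     using functionalD(1)[OF G f(1)] functionalD(1)[OF G f0(1)] c(1) J.minus_0_iff[of "G f" "c *\<^sub>J G f0"]
     by (simp add: J.smult_neg_left a_minus_def J.smult_closed)
    also have "... = s *\<^sub>J (c *\<^sub>J j)" using s c(1) j(1) by (simp add: m_comm flip: J.smult_assoc)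
    also have "... = f n0" using s xM by (simp add: n0_def Hom_smult[OF f(1)] c(2))
    finally show ?thesis .
   qed
   \<comment> \<open>The difference vanishes on the functionals killing \<open>N'\<close>, so the
     induction hypothesis applies to it with the smaller submodule.\<close>
   define G' where "G' f = G f \<ominus>\<^sub>J f n0" for f
   have G'c: "G f : carrier J" "f n0 : carrier J" if "f : Hom R M J" for f
    using functionalD(1)[OF G that] Hom_cl[OF that n0(2)] .
   have "functional M G'" unfolding functional_def G'_def
    using n0(2) by (auto simp: G'c functionalD[OF G] J.minus_add_add J.smult_minus_right)
   moreover have "l N' < l N" by (rule l[OF N'(1) N N'(2)])
   moreover have "G' f = 0\<^sub>J" if "f : Hom R M J" "!!n. n : N' ==> f n = 0\<^sub>J" for f
    using ev[OF that] G'c[OF that(1)] by (simp add: G'_def J.minus_0_iff)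
   ultimately obtain n where n: "n : N'" "ALL f:Hom R M J. G' f = f n"
    using less.hyps[OF _ N'(1)] by blast
   have "G f = f (n +\<^sub>M n0)" if f: "f : Hom R M J" for f
   proof -
    have "G f = G' f +\<^sub>J f n0" using G'c[OF f] by (simp add: G'_def J.add_minus)
    also have "... = f (n +\<^sub>M n0)" using n f S'(3) n0(2) by (simp add: Hom_add[OF f])
    finally show ?thesis .
   qed
   then show ?thesis using S(4)[OF _ n0(1)] n(1) N'(2) by blast
  qed
 qed
qed

lemma functional_eval: assumes M: "M : fg_mod R" and G: "functional M G"
 obtains x where "x : carrier M" "!!f. f : Hom R M J ==> G f = f x"
proof -
 interpret J: left_module R J by (rule J)
 interpret M: left_module R M by (rule fg_modD[OF M])
 have "G f = 0\<^sub>J" if f: "f : Hom R M J" "!!n. n : carrier M ==> f n = 0\<^sub>J" for f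
 proof -
  have "f = (\<lambda>x\<in>carrier M. \<zero> *\<^sub>J f x)"
   using f Hom_undefined[OF f(1)] by (auto simp: J.smult_0r)
  then have "G f = \<zero> *\<^sub>J G f" using functionalD(3)[OF G _ f(1), of "\<zero>"] by simp
  then show ?thesis using functionalD(1)[OF G f(1)] by (simp add: J.smult_0l)
 qed
 then show ?thesis using functional_eval_on_submodule[OF M M.subm_carrier G] that by blast
qed

end

section \<open>Projective covers and injective envelopes\<close>

lemma hom_to_dsum: assumes "left_module L V" "f : Hom L V M" "g : Hom L V N"
 shows "(\<lambda>x\<in>carrier V. (f x, g x)) : Hom L V (dsum M N)"
 using assms by (intro lmod_homI) (auto simp: Hom_cl Hom_add Hom_smult)

lemma dsum_maps: assumes "left_module L M" "left_module L N"
 shows "(\<lambda>x\<in>carrier M. (x, 0\<^sub>N)) : Hom L M (dsum M N)"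
  "(\<lambda>y\<in>carrier N. (0\<^sub>M, y)) : Hom L N (dsum M N)"
  "(\<lambda>z\<in>carrier M \<times> carrier N. fst z) : Hom L (dsum M N) M"
  "(\<lambda>z\<in>carrier M \<times> carrier N. snd z) : Hom L (dsum M N) N"
proof -
 interpret M: left_module L M by fact
 interpret N: left_module L N by fact
 show "(\<lambda>x\<in>carrier M. (x, 0\<^sub>N)) : Hom L M (dsum M N)"
  by (rule lmod_homI[OF assms(1)]) (auto simp: N.smult_0r)
 show "(\<lambda>y\<in>carrier N. (0\<^sub>M, y)) : Hom L N (dsum M N)"
  by (rule lmod_homI[OF assms(2)]) (auto simp: M.smult_0r)
 show "(\<lambda>z\<in>carrier M \<times> carrier N. fst z) : Hom L (dsum M N) M"
  using lmod_homI[OF lm_dsum[OF assms], of fst M] by auto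
 show "(\<lambda>z\<in>carrier M \<times> carrier N. snd z) : Hom L (dsum M N) N"
  using lmod_homI[OF lm_dsum[OF assms], of snd N] by auto
qed

text \<open>The dual basis of a finitely generated projective module. Sums over it replace tensor
  products in the computation of homomorphisms out of \<open>P\<close>.\<close>

definition dual_basis :: "'a ring => ('a, 'b) module => nat => (nat => 'b) => (nat => 'b => 'a) => bool" where
 "dual_basis L P n x \<xi> <-> (ALL k<n. x k : carrier P & \<xi> k : Hom L P (reg_mod L)) &
  (ALL p:carrier P. p = (\<Oplus>\<^bsub>P\<^esub>k\<in>{..<n}. \<xi> k p *\<^sub>P x k))"

lemma dual_basisD: assumes "dual_basis L P n x \<xi>"
 shows "k < n ==> x k : carrier P" "k < n ==> \<xi> k : Hom L P (reg_mod L)"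
  "k < n ==> p : carrier P ==> \<xi> k p : carrier L"
  "p : carrier P ==> (\<Oplus>\<^bsub>P\<^esub>k\<in>{..<n}. \<xi> k p *\<^sub>P x k) = p"
 using assms Hom_cl[of "\<xi> k" L P "reg_mod L" p] by (auto simp: dual_basis_def)

lemma dual_basis_hom:
 assumes "dual_basis L P n x \<xi>" "left_module L P" "left_module L M" "h : Hom L P M" "p : carrier P"
 shows "h p = (\<Oplus>\<^bsub>M\<^esub>k\<in>{..<n}. \<xi> k p *\<^sub>M h (x k))"
proof -
 interpret P: left_module L P by fact
 interpret M: left_module L M by fact
 note B = dual_basisD[OF assms(1)]
 have "h p = h (\<Oplus>\<^bsub>P\<^esub>k\<in>{..<n}. \<xi> k p *\<^sub>P x k)" by (simp add: B(4)[OF assms(5)])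
 also have "... = (\<Oplus>\<^bsub>M\<^esub>k\<in>{..<n}. h (\<xi> k p *\<^sub>P x k))"
  by (rule finsum_transport[OF P.M.abelian_monoid_axioms M.M.abelian_monoid_axioms])
   (use assms B in \<open>auto simp: Hom_cl Hom_add Hom_zero intro!: P.smult_closed\<close>)
 also have "... = (\<Oplus>\<^bsub>M\<^esub>k\<in>{..<n}. \<xi> k p *\<^sub>M h (x k))"
  by (rule M.M.finsum_cong')
   (use assms B in \<open>auto simp: Hom_cl Hom_smult intro!: M.smult_closed\<close>)
 finally show ?thesis .
qed

lemma dual_basis_retract: assumes "dual_basis L Q n x \<xi>" "left_module L Q" "left_module L P"
  "r : Hom L Q P" "s : Hom L P Q" "!!p. p : carrier P ==> r (s p) = p"
 shows "dual_basis L P n (%k. r (x k)) (%k. compose (carrier P) (\<xi> k) s)" unfolding dual_basis_def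
proof (intro conjI allI ballI impI)
 interpret P: left_module L P by fact
 note B = dual_basisD[OF assms(1)]
 show "r (x k) : carrier P" if "k < n" for k using B(1)[OF that] Hom_cl[OF assms(4)] by simp
 show "compose (carrier P) (\<xi> k) s : Hom L P (reg_mod L)" if "k < n" for k
  by (rule Hom_comp[OF assms(5) B(2)[OF that] assms(3)])
 fix p assume p: "p : carrier P"
 then have sp: "s p : carrier Q" by (rule Hom_cl[OF assms(5)])
 have "p = r (s p)" using assms(6)[OF p] by simp
 also have "... = (\<Oplus>\<^bsub>P\<^esub>k\<in>{..<n}. \<xi> k (s p) *\<^sub>P r (x k))"
  by (rule dual_basis_hom[OF assms(1-4) sp])
 also have "... = (\<Oplus>\<^bsub>P\<^esub>k\<in>{..<n}. compose (carrier P) (\<xi> k) s p *\<^sub>P r (x k))"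
  using p by (simp add: compose_def)
 finally show "p = (\<Oplus>\<^bsub>P\<^esub>k\<in>{..<n}. compose (carrier P) (\<xi> k) s p *\<^sub>P r (x k))" .
qed

text \<open>Free modules are built by adjoining one copy of the ring at a time; index
  \<open>n\<close> carries the new coordinate.\<close>

lemma dual_basis_dsum_reg: assumes "dual_basis L Q n x \<xi>" "left_module L Q"
 shows "EX x \<xi>. dual_basis L (dsum Q (reg_mod L)) (Suc n) x \<xi>"
proof -
 interpret Q: left_module L Q by fact
 have reg: "left_module L (reg_mod L)" by (rule lm_reg[OF Q.R.ring_axioms])
 let ?D = "dsum Q (reg_mod L)"
 have D: "left_module L ?D" by (rule lm_dsum[OF assms(2) reg])
 interpret D: left_module L ?D by (rule D)
 note B = dual_basisD[OF assms(1)] and m = dsum_maps[OF assms(2) reg]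
 define y where "y k = (if k = n then (0\<^sub>Q, \<one>\<^sub>L) else (x k, 0\<^sub>L))" for k
 define \<eta> where "\<eta> k = (if k = n then (\<lambda>z\<in>carrier ?D. snd z) else (\<lambda>z\<in>carrier ?D. \<xi> k (fst z)))" for k
 have "dual_basis L ?D (Suc n) y \<eta>" unfolding dual_basis_def
 proof (intro conjI allI ballI impI)
  show "y k : carrier ?D" if "k < Suc n" for k using that B(1)[of k] by (auto simp: y_def)
  show "\<eta> k : Hom L ?D (reg_mod L)" if k: "k < Suc n" for k
  proof (cases "k = n")
   case False
   then have "\<eta> k = compose (carrier ?D) (\<xi> k) (\<lambda>z\<in>carrier ?D. fst z)" by (auto simp: \<eta>_def compose_def)
   moreover have "compose (carrier ?D) (\<xi> k) (\<lambda>z\<in>carrier ?D. fst z) : Hom L ?D (reg_mod L)"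
    by (rule Hom_comp[OF _ B(2) D]) (use m(3) k False in auto)
   ultimately show ?thesis by simp
  qed (use m(4) in \<open>simp add: \<eta>_def\<close>)
  fix p assume "p : carrier ?D"
  then obtain q a where p: "p = (q, a)" "q : carrier Q" "a : carrier L" by auto
  have cl: "(%k. \<eta> k p \<odot>\<^bsub>?D\<^esub> y k) : {..<n} \<rightarrow> carrier ?D"
   using p B(1,3) by (auto simp: \<eta>_def y_def Q.smult_closed)
  have "(\<Oplus>\<^bsub>?D\<^esub>k\<in>{..<Suc n}. \<eta> k p \<odot>\<^bsub>?D\<^esub> y k) = \<eta> n p \<odot>\<^bsub>?D\<^esub> y n \<oplus>\<^bsub>?D\<^esub> (\<Oplus>\<^bsub>?D\<^esub>k\<in>{..<n}. \<eta> k p \<odot>\<^bsub>?D\<^esub> y k)"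
   unfolding lessThan_Suc by (rule D.M.finsum_insert) (use cl p in \<open>auto simp: \<eta>_def y_def Q.smult_0r\<close>)
  also have "\<eta> n p \<odot>\<^bsub>?D\<^esub> y n = (0\<^sub>Q, a)" using p by (simp add: \<eta>_def y_def Q.smult_0r)
  also have "(\<Oplus>\<^bsub>?D\<^esub>k\<in>{..<n}. \<eta> k p \<odot>\<^bsub>?D\<^esub> y k) = (\<Oplus>\<^bsub>?D\<^esub>k\<in>{..<n}. (\<lambda>x\<in>carrier Q. (x, \<zero>\<^bsub>reg_mod L\<^esub>)) (\<xi> k q *\<^sub>Q x k))"
   by (rule D.M.finsum_cong') (use p B(1,3) in \<open>auto simp: \<eta>_def y_def Q.smult_closed\<close>)
  also have "... = (\<lambda>x\<in>carrier Q. (x, \<zero>\<^bsub>reg_mod L\<^esub>)) (\<Oplus>\<^bsub>Q\<^esub>k\<in>{..<n}. \<xi> k q *\<^sub>Q x k)"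
   by (rule finsum_transport[OF Q.M.abelian_monoid_axioms D.M.abelian_monoid_axioms, symmetric])
    (use p B(1,3) in \<open>auto intro!: Q.smult_closed\<close>)
  also have "... = (q, 0\<^sub>L)" using p B(4) by simp
  finally show "p = (\<Oplus>\<^bsub>?D\<^esub>k\<in>{..<Suc n}. \<eta> k p \<odot>\<^bsub>?D\<^esub> y k)" using p by simp
 qed
 then show ?thesis by blast
qed

context finlen_ring
begin

lemma reg: "left_module L (reg_mod L)" by (rule lm_reg[OF ring_axioms])

lemma proj_mod_retract: assumes "proj_mod L Q" "P : modules L" "r : Hom L Q P" "s : Hom L P Q"
  "!!p. p : carrier P ==> r (s p) = p" shows "proj_mod L P" unfolding projective_mod_def
proof (intro conjI ballI impI)
 fix A B :: "'a fgm" and g f assume *: "A : modules L" "B : modules L" "g : Hom L A B" "f : Hom L P B"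
  "g ` carrier A = carrier B"
 have L: "left_module L P" "left_module L Q" using assms(1,2) by (auto simp: projective_mod_def fg_modD)
 obtain h where h: "h : Hom L Q A" "!!x. x : carrier Q ==> g (h x) = compose (carrier Q) f r x"
  by (rule proj_mod_lift[OF assms(1) *(1,2,3,5) Hom_comp[OF assms(3) *(4) L(2)]]) (rule that)
 show "EX h:Hom L P A. compose (carrier P) g h = f"
  by (rule bexI[OF _ Hom_comp[OF assms(4) h(1) L(1)]])
   (auto simp: compose_def h(2) Hom_cl[OF assms(4)] assms(5) Hom_undefined[OF *(4)])
qed (rule assms)

lemma proj_mod_dsum: assumes "proj_mod L P" "proj_mod L Q" "M : modules L" "mod_iso L M (dsum P Q)"
 shows "proj_mod L M" unfolding projective_mod_def
proof (intro conjI ballI impI)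
 fix A B :: "'a fgm" and g f assume *: "A : modules L" "B : modules L" "g : Hom L A B" "f : Hom L M B"
  "g ` carrier A = carrier B"
 have L: "left_module L P" "left_module L Q" "left_module L M" "left_module L A" "left_module L B"
  using assms(1-3) * by (auto simp: projective_mod_def fg_modD)
 note D = lm_dsum[OF L(1,2)] and m = dsum_maps[OF L(1,2)]
 interpret B: left_module L B by (rule L)
 interpret P: left_module L P by (rule L)
 interpret Q: left_module L Q by (rule L)
 obtain u v where uv: "u : Hom L M (dsum P Q)" "v : Hom L (dsum P Q) M"
  "!!x. x : carrier M ==> v (u x) = x" "!!y. y : carrier (dsum P Q) ==> u (v y) = y"
  using mod_isoE[OF assms(4) L(3) D] by metis
 have fv: "compose (carrier (dsum P Q)) f v : Hom L (dsum P Q) B" by (rule Hom_comp[OF uv(2) *(4) D])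
 obtain h1 where h1: "h1 : Hom L P A" "!!x. x : carrier P ==> g (h1 x) = compose (carrier P) (compose (carrier (dsum P Q)) f v) (\<lambda>x\<in>carrier P. (x, 0\<^sub>Q)) x"
  by (rule proj_mod_lift[OF assms(1) *(1,2,3,5) Hom_comp[OF m(1) fv L(1)]]) (rule that)
 obtain h2 where h2: "h2 : Hom L Q A" "!!x. x : carrier Q ==> g (h2 x) = compose (carrier Q) (compose (carrier (dsum P Q)) f v) (\<lambda>y\<in>carrier Q. (0\<^sub>P, y)) x"
  by (rule proj_mod_lift[OF assms(2) *(1,2,3,5) Hom_comp[OF m(2) fv L(2)]]) (rule that)
 let ?h = "compose (carrier M) (\<lambda>(x, y)\<in>carrier P \<times> carrier Q. h1 x +\<^sub>A h2 y) u"
 have h: "?h : Hom L M A" by (rule Hom_comp[OF uv(1) hom_from_dsum[OF L(1,2,4) h1(1) h2(1)] L(3)])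
 have "g (?h z) = f z" if z: "z : carrier M" for z
 proof -
  obtain x y where xy: "u z = (x, y)" "x : carrier P" "y : carrier Q" using Hom_cl[OF uv(1) z] by auto
  have "g (?h z) = f (v (x, 0\<^sub>Q)) +\<^sub>B f (v (0\<^sub>P, y))"
   using z xy h1 h2 by (simp add: compose_def Hom_add[OF *(3)] Hom_cl[OF h1(1)] Hom_cl[OF h2(1)])
  also have "... = f (v ((x, 0\<^sub>Q) \<oplus>\<^bsub>dsum P Q\<^esub> (0\<^sub>P, y)))"
   using xy P.M.zero_closed Q.M.zero_closed
   by (subst Hom_add[OF uv(2)]; (subst Hom_add[OF *(4)])?) (auto simp del: dsum_simps(3) intro!: Hom_cl[OF uv(2)])
  also have "... = f z" using xy uv(3)[OF z] by simp
  finally show ?thesis .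
 qed
 then show "EX h:Hom L M A. compose (carrier M) g h = f"
  by (intro bexI[OF _ h] Hom_eqI[OF Hom_comp[OF h *(3) L(3)] *(4)]) (simp add: compose_def)
qed (rule assms)

text \<open>The regular module on a carrier of lists. Its projectivity is freeness on the image of
  1: any value there extends to a homomorphism.\<close>

lemma regular_copy:
 obtains V :: "'a fgm" and u v where "V : modules L" "proj_mod L V"
  "u : Hom L (reg_mod L) V" "v : Hom L V (reg_mod L)"
  "!!x. x : carrier L ==> v (u x) = x" "!!y. y : carrier V ==> u (v y) = y"
proof -
 obtain V :: "'a fgm" and u v where L: "V : modules L" "u : Hom L (reg_mod L) V" "v : Hom L V (reg_mod L)"
  "!!x. x : carrier L ==> v (u x) = x" "!!y. y : carrier V ==> u (v y) = y"
  using modules_isoE[OF fg_mod_reg] by auto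
 have LL: "left_module L V" using L by (simp add: fg_modD)
 have "proj_mod L V" unfolding projective_mod_def
 proof (intro conjI ballI impI)
  fix A B :: "'a fgm" and g f assume *: "A : modules L" "B : modules L" "g : Hom L A B" "f : Hom L V B"
   "g ` carrier A = carrier B"
  have AB: "left_module L A" "left_module L B" using * by (auto simp: fg_modD)
  have u1: "u \<one> : carrier V" using Hom_cl[OF L(2)] by simp
  have "f (u \<one>) : g ` carrier A" unfolding *(5) by (rule Hom_cl[OF *(4) u1])
  then obtain a where a: "a : carrier A" "g a = f (u \<one>)" by (metis imageE)
  let ?h = "compose (carrier V) (\<lambda>r\<in>carrier L. r *\<^sub>A a) v"
  have h: "?h : Hom L V A" by (rule Hom_comp[OF L(3) hom_from_reg[OF AB(1) a(1)] LL])
  have "g (?h x) = f x" if x: "x : carrier V" for x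
  proof -
   have vx: "v x : carrier L" using Hom_cl[OF L(3) x] by simp
   have "g (?h x) = v x *\<^sub>B f (u \<one>)"
    using x vx a by (simp add: compose_def Hom_smult[OF *(3)])
   also have "... = f (v x *\<^sub>V u \<one>)" using vx u1 by (simp add: Hom_smult[OF *(4)])
   also have "v x *\<^sub>V u \<one> = u (v x)" using Hom_smult[OF L(2), of "v x" \<one>] vx by simp
   also have "f ... = f x" using L(5)[OF x] by simp
   finally show ?thesis .
  qed
  then show "EX h:Hom L V A. compose (carrier V) g h = f"
   by (intro bexI[OF _ h] Hom_eqI[OF Hom_comp[OF h *(3) LL] *(4)]) (simp add: compose_def)
 qed (rule L(1))
 then show ?thesis using that L by blast
qed

text \<open>A maximal image of such a projective in \<open>M\<close> is everything, because adding a
  copy of the ring reaches any further element \<open>y\<close>. The maximum replaces the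
  construction of a free module on a generating set.\<close>

lemma enough_dual_bases: assumes M: "M : fg_mod L"
 obtains P e n x \<xi> where "proj_mod L P" "dual_basis L P n x \<xi>" "e : Hom L P M" "e ` carrier P = carrier M"
proof -
 interpret M: left_module L M by (rule fg_modD[OF M])
 obtain V :: "'a fgm" and u v where L: "V : modules L" "proj_mod L V"
  "u : Hom L (reg_mod L) V" "v : Hom L V (reg_mod L)"
  "!!x. x : carrier L ==> v (u x) = x" "!!y. y : carrier V ==> u (v y) = y"
  using regular_copy by metis
 have LL: "left_module L V" using L by (simp add: fg_modD)
 define P where "P N <-> (EX Q e n x \<xi>. proj_mod L Q & dual_basis L Q n x \<xi> & e : Hom L Q M & N = e ` carrier Q)" for N
 have "dual_basis L (reg_mod L) 1 (%_. \<one>) (%_. \<lambda>x\<in>carrier L. x)"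
 proof -
  interpret G: left_module L "reg_mod L" by (rule reg)
  have "(\<Oplus>\<^bsub>reg_mod L\<^esub>k\<in>{..<1::nat}. p) = p" if "p : carrier L" for p
   using G.M.finsum_insert[of "{}" "0::nat" "%_. p"] that by (simp add: lessThan_Suc)
  then show ?thesis using Hom_id[OF reg] by (simp add: dual_basis_def)
 qed
 then have db: "dual_basis L V 1 (%_. u \<one>) (%_. compose (carrier V) (\<lambda>x\<in>carrier L. x) v)"
  by (rule dual_basis_retract[OF _ reg LL L(3,4,6)])
 have "P ((\<lambda>x\<in>carrier V. 0\<^sub>M) ` carrier V)"
  unfolding P_def using L(2) db Hom_0map[OF LL M.lmod] by blast
 then obtain N where N: "submodule N L M" "P N" "!!N'. submodule N' L M ==> P N' ==> N <= N' ==> N' = N"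
  using finlen_max[of L M _ P] M subm_range[OF LL M.lmod Hom_0map[OF LL M.lmod]] by (metis fg_mod_iff)
 obtain Q e n x \<xi> where Q: "proj_mod L Q" "dual_basis L Q n x \<xi>" "e : Hom L Q M" "N = e ` carrier Q"
  using N(2) unfolding P_def by blast
 have Qm: "Q : modules L" and LQ: "left_module L Q" using Q(1) by (auto simp: projective_mod_def fg_modD)
 interpret Q: left_module L Q by (rule LQ)
 have "carrier M <= N"
 proof
  fix y assume y: "y : carrier M"
  let ?D = "dsum Q (reg_mod L)"
  have D: "left_module L ?D" by (rule lm_dsum[OF LQ reg])
  obtain W :: "'a fgm" and a b where W: "W : modules L" "a : Hom L ?D W" "b : Hom L W ?D"
   "!!x. x : carrier ?D ==> b (a x) = x" "!!y. y : carrier W ==> a (b y) = y"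
   using modules_isoE[OF fg_mod_dsum[OF Qm fg_mod_reg]] by metis
  have LW: "left_module L W" using W by (simp add: fg_modD)
  have QL: "left_module L (dsum Q V)" by (rule lm_dsum[OF LQ LL])
  have dd: "mod_iso L ?D (dsum Q V)"
  proof (rule mod_isoI)
   show "restrict (%(q, l). (q, u l)) (carrier ?D) : Hom L ?D (dsum Q V)" by (rule lmod_homI[OF D])
     (use Hom_cl[OF L(3)] Hom_add[OF L(3)] Hom_smult[OF L(3)] in auto)
   show "restrict (%(q, l). (q, v l)) (carrier (dsum Q V)) : Hom L (dsum Q V) ?D"
    by (rule lmod_homI[OF QL]) (use Hom_cl[OF L(4)] Hom_add[OF L(4)] Hom_smult[OF L(4)] in auto)
  qed (use L(5,6) Hom_cl[OF L(3)] Hom_cl[OF L(4)] in auto)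
  have "proj_mod L W"
   by (rule proj_mod_dsum[OF Q(1) L(2) W(1) mod_iso_trans[OF mod_isoI[OF W(3,2,5,4)] dd LW D QL]])
  moreover obtain x' \<xi>' where "dual_basis L ?D (Suc n) x' \<xi>'" using dual_basis_dsum_reg[OF Q(2) LQ] by blast
  note dual_basis_retract[OF this D LW W(2,3,5)]
  moreover define h where "h = compose (carrier W) (\<lambda>(x, r)\<in>carrier Q \<times> carrier (reg_mod L). e x +\<^sub>M (\<lambda>r\<in>carrier L. r *\<^sub>M y) r) b"
  have h: "h : Hom L W M" unfolding h_def
   by (rule Hom_comp[OF W(3) hom_from_dsum[OF LQ reg M.lmod Q(3) hom_from_reg[OF M.lmod y]] LW])
  ultimately have "P (h ` carrier W)" unfolding P_def by blast
  have hq: "h (a (q, r)) = e q +\<^sub>M r *\<^sub>M y" "h (a (q, r)) : h ` carrier W" if "q : carrier Q" "r : carrier L" for q r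
  proof -
   have "a (q, r) : carrier W" using that Hom_cl[OF W(2), of "(q, r)"] by simp
   then show "h (a (q, r)) : h ` carrier W" by (rule imageI)
   show "h (a (q, r)) = e q +\<^sub>M r *\<^sub>M y"
    using that \<open>a (q, r) : carrier W\<close> by (simp add: h_def compose_def W(4))
  qed
  have "N <= h ` carrier W"
   using hq[of _ \<zero>] y Hom_cl[OF Q(3)] unfolding Q(4) by (auto simp: M.smult_0l)
  then have "h ` carrier W = N"
   using N(3)[OF subm_range[OF LW M.lmod h] \<open>P (h ` carrier W)\<close>] by blast
  moreover have "y : h ` carrier W"
   using hq[of "0\<^sub>Q" \<one>] y Hom_zero[OF LQ M.lmod Q(3)] by (simp add: M.smult_one)
  ultimately show "y : N" by simp
 qed
 then have "e ` carrier Q = carrier M" using Q(4) submD(1)[OF N(1)] by blast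
 then show ?thesis using that Q by blast
qed

text \<open>A projective module is a retract of a projective with a dual basis, and dual bases pass
  to retracts.\<close>

lemma projective_dual_basis: assumes "proj_mod L P"
 obtains n x \<xi> where "dual_basis L P n x \<xi>"
proof -
 have P: "P : modules L" "left_module L P" using assms by (auto simp: projective_mod_def fg_modD)
 obtain Q e n x \<xi> where Q: "proj_mod L Q" "dual_basis L Q n x \<xi>" "e : Hom L Q P" "e ` carrier Q = carrier P"
  using enough_dual_bases[OF P(1)] by metis
 have Qm: "Q : modules L" "left_module L Q" using Q(1) by (auto simp: projective_mod_def fg_modD)
 obtain s where s: "s : Hom L P Q" "!!p. p : carrier P ==> e (s p) = (\<lambda>x\<in>carrier P. x) p"
  by (rule proj_mod_lift[OF assms Qm(1) P(1) Q(3,4) Hom_id[OF P(2)]]) (rule that)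
 then show ?thesis using dual_basis_retract[OF Q(2) Qm(2) P(2) Q(3) s(1)] that by auto
qed

text \<open>The cover is carried by a submodule \<open>N\<close> of \<open>P\<close> minimal with
  image all of \<open>M\<close>. Lifting \<open>e\<close> through \<open>N\<close> gives a map
  \<open>h\<close> from \<open>P\<close> to \<open>N\<close>; minimality makes it surjective on
  \<open>N\<close>, hence bijective there by finite length, so \<open>N\<close> is a retract of
  \<open>P\<close>.\<close>

lemma projective_cover_exists: assumes M: "M : fg_mod L"
 obtains P e where "projective_cover L P e M"
proof -
 interpret M: left_module L M by (rule fg_modD[OF M])
 obtain P e where P: "proj_mod L P" "e : Hom L P M" "e ` carrier P = carrier M"
  using enough_dual_bases[OF M] by metis
 have Pm: "P : modules L" "left_module L P" using P(1) by (auto simp: projective_mod_def fg_modD)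
 interpret P: left_module L P by (rule Pm)
 obtain N where N: "submodule N L P" "e ` N = carrier M" "!!N'. submodule N' L P ==> e ` N' = carrier M ==> N' <= N ==> N' = N"
  using finlen_min[of L P "carrier P" "%N. e ` N = carrier M"] Pm(1) P(3) P.subm_carrier by (metis fg_mod_iff)
 note S = submD[OF N(1)]
 let ?N = "sub_mod P N"
 have Nm: "?N : modules L" "left_module L ?N" "finlen L ?N"
  using fg_mod_sub[OF Pm(1) N(1)] by (auto simp: fg_mod_iff)
 let ?e = "compose N e (\<lambda>x\<in>N. x)"
 have e: "?e : Hom L ?N M" using Hom_comp[OF sub_mod_incl[OF Pm(2) N(1)] P(2) Nm(2)] by simp
 have eN: "?e ` carrier ?N = carrier M" using N(2) by (auto simp: compose_def)
 obtain h where h: "h : Hom L P ?N" "!!x. x : carrier P ==> ?e (h x) = e x"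
  by (rule proj_mod_lift[OF P(1) Nm(1) M e eN P(2)]) (rule that)
 have hN: "h x : N" if "x : carrier P" for x using Hom_cl[OF h(1) that] by simp
 have he: "e (h x) = e x" if "x : carrier P" for x using h(2)[OF that] hN[OF that] by (simp add: compose_def)
 let ?k = "compose N h (\<lambda>x\<in>N. x)"
 have k: "?k : Hom L ?N ?N" using Hom_comp[OF sub_mod_incl[OF Pm(2) N(1)] h(1) Nm(2)] by simp
 have "h ` N = N"
 proof (rule N(3))
  show "submodule (h ` N) L P" by (rule subm_image[OF Pm(2) Pm(2) Hom_from_sub[OF h(1) N(1)] N(1)])
  show "e ` (h ` N) = carrier M" using N(2) he S(3) by (auto simp: image_image)
 qed (use hN S(3) in auto)
 then have "?k ` carrier ?N = carrier ?N" by (simp add: compose_def)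
 moreover from this have "inj_on ?k (carrier ?N)" by (rule finlen_surj_inj[OF Nm(2,3) k])
 ultimately have "mod_iso L ?N ?N" unfolding mod_iso_def bij_betw_def using k by blast
 obtain k' where k': "k' : Hom L ?N ?N" "!!x. x : carrier ?N ==> ?k (k' x) = (\<lambda>x\<in>carrier ?N. x) x"
  by (rule hom_factor_inj[OF Nm(2) Nm(2) Nm(2) k \<open>inj_on ?k (carrier ?N)\<close> Hom_id[OF Nm(2)]])
   (use \<open>?k ` carrier ?N = carrier ?N\<close> in auto)
 have "proj_mod L ?N"
 proof (rule proj_mod_retract[OF P(1) Nm(1) h(1)])
  show "k' : Hom L ?N P" by (rule Hom_from_sub[OF k'(1) N(1)])
  show "h (k' p) = p" if "p : carrier ?N" for p
   using k'(2)[OF that] that Hom_cl[OF k'(1) that] by (simp add: compose_def)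
 qed
 moreover have "N' = carrier ?N" if "submodule N' L ?N" "?e ` N' = carrier M" for N'
 proof -
  have N': "submodule N' L P" "N' <= N" using that(1) unfolding subm_sub_mod_iff[OF N(1) Pm(2)] by auto
  have "?e ` N' = e ` N'" using N'(2) by (force simp: compose_def)
  then show ?thesis using N(3)[OF N'(1) _ N'(2)] that(2) by simp
 qed
 ultimately have "projective_cover L ?N ?e M" unfolding projective_cover_def using e eN by blast
 then show ?thesis using that by blast
qed

text \<open>The envelope is taken as a quotient \<open>Q\<close> of \<open>I0\<close>: for
  \<open>K\<close> maximal with zero intersection with the image of \<open>X\<close>, the module
  \<open>X\<close> becomes essential in \<open>I0\<close> modulo \<open>K\<close>. Extending
  \<open>i\<close> along \<open>j\<close> gives \<open>h\<close>, and \<open>q h\<close> fixes the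
  image of \<open>X\<close>; so it is injective by essentiality, bijective by finite length, and
  \<open>Q\<close> is a retract of \<open>I0\<close>.\<close>

lemma injective_envelope_from_embedding:
 assumes X: "X : fg_mod L" and I0: "inj_mod L (I0 :: 'a fgm)" and i: "i : Hom L X I0" "inj_on i (carrier X)"
 obtains I :: "'a fgm" and j where "I : modules L" "injective_envelope L X j I"
proof -
 interpret X: left_module L X by (rule fg_modD[OF X])
 have I0m: "I0 : modules L" "left_module L I0" "finlen L I0" using I0 by (auto simp: injective_mod_def fg_mod_iff)
 interpret I0: left_module L I0 by (rule I0m)
 have i0: "i 0\<^sub>X = 0\<^sub>I0" by (rule Hom_zero[OF X.lmod I0m(2) i(1)])
 have "{0\<^sub>I0} \<inter> i ` carrier X = {0\<^sub>I0}" using i0 by (auto intro: rev_image_eqI)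
 then obtain K where K: "submodule K L I0" "K \<inter> i ` carrier X = {0\<^sub>I0}"
  "!!N. submodule N L I0 ==> N \<inter> i ` carrier X = {0\<^sub>I0} ==> K <= N ==> N = K"
  using finlen_max[OF I0m(3,2) I0.zero_submodule, of "%K. K \<inter> i ` carrier X = {0\<^sub>I0}"] by metis
 define p where "p = (\<lambda>x\<in>carrier I0. K +>\<^sub>I0 x)"
 note Qt = quot_mod[OF I0m(2) K(1), folded p_def]
 obtain Q :: "'a fgm" and a b where Q: "Q : modules L" "a : Hom L (quot_mod I0 K) Q" "b : Hom L Q (quot_mod I0 K)"
  "!!x. x : carrier (quot_mod I0 K) ==> b (a x) = x" "!!y. y : carrier Q ==> a (b y) = y"
  using modules_isoE[OF fg_mod_quot[OF I0m(1) K(1)]] by metis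
 have LQ: "left_module L Q" "finlen L Q" using Q(1) by (auto simp: fg_mod_iff)
 interpret Q: left_module L Q by (rule LQ)
 define q where "q = compose (carrier I0) a p"
 have q: "q : Hom L I0 Q" unfolding q_def by (rule Hom_comp[OF Qt(2) Q(2) I0m(2)])
 have qK: "q x = 0\<^sub>Q <-> x : K" if "x : carrier I0" for x
 proof -
  have px: "p x : carrier (quot_mod I0 K)" by (rule Hom_cl[OF Qt(2) that])
  have "a (p x) = 0\<^sub>Q <-> p x = \<zero>\<^bsub>quot_mod I0 K\<^esub>"
   using Q(4)[OF px] Hom_zero[OF Qt(1) LQ(1) Q(2)] Hom_zero[OF LQ(1) Qt(1) Q(3)] by metis
  then show ?thesis using Qt(4) that by (auto simp: q_def compose_def aker_eq)
 qed
 have qs: "q ` carrier I0 = carrier Q"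
 proof
  show "carrier Q <= q ` carrier I0"
  proof
   fix y assume y: "y : carrier Q"
   then obtain x where "x : carrier I0" "b y = p x" using Hom_cl[OF Q(3) y] Qt(3) by (metis imageE)
   then show "y : q ` carrier I0" using Q(5)[OF y] by (intro image_eqI[of _ _ x]) (auto simp: q_def compose_def)
  qed
 qed (use Hom_cl[OF q] in auto)
 define j where "j = compose (carrier X) q i"
 have j: "j : Hom L X Q" unfolding j_def by (rule Hom_comp[OF i(1) q X.lmod])
 have ji: "j x = q (i x)" if "x : carrier X" for x using that by (simp add: j_def compose_def)
 have jinj: "inj_on j (carrier X)" unfolding inj_iff_ker[OF X.lmod LQ(1) j]
 proof (intro ballI impI)
  fix x assume x: "x : carrier X" "j x = 0\<^sub>Q"
  then have "i x : K" using qK Hom_cl[OF i(1)] by (simp add: ji)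
  then have "i x = 0\<^sub>I0" using K(2) x(1) by blast
  then show "x = 0\<^sub>X" using i(2) x(1) unfolding inj_iff_ker[OF X.lmod I0m(2) i(1)] by blast
 qed
 have ess: "N = {0\<^sub>Q}" if N: "submodule N L Q" "N \<inter> j ` carrier X = {0\<^sub>Q}" for N
 proof -
  note S = submD[OF N(1)]
  let ?N = "{x : carrier I0. q x : N}"
  have sub: "submodule ?N L I0" by (rule subm_preimage[OF I0m(2) LQ(1) q N(1)])
  have "?N = K"
  proof (rule K(3)[OF sub])
   show "K <= ?N" 
   proof
    fix x assume x: "x : K"
    then have "x : carrier I0" by (rule submD(3)[OF K(1)])
    moreover from this have "q x = 0\<^sub>Q" using qK x by blast
    ultimately show "x : ?N" using S(2) by simp
   qed
   show "?N \<inter> i ` carrier X = {0\<^sub>I0}"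
   proof
    show "?N \<inter> i ` carrier X <= {0\<^sub>I0}"
    proof
     fix y assume "y : ?N \<inter> i ` carrier X"
     then obtain x where x: "x : carrier X" "y = i x" "q (i x) : N" by auto
     then have "j x : N \<inter> j ` carrier X" using ji[OF x(1)] imageI[OF x(1), of j] by simp
     then have "j x = 0\<^sub>Q" unfolding N(2) by simp
     then have "x = 0\<^sub>X" using jinj x(1) unfolding inj_iff_ker[OF X.lmod LQ(1) j] by blast
     then show "y : {0\<^sub>I0}" using x(2) i0 by simp
    qed
    show "{0\<^sub>I0} <= ?N \<inter> i ` carrier X" using submD(2)[OF sub] K(2) by blast
   qed
  qed
  have "z = 0\<^sub>Q" if z: "z : N" for z
  proof -
   have "z : q ` carrier I0" using S(3)[OF z] qs by simp
   then obtain x where x: "x : carrier I0" "z = q x" by blast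
   then have "x : K" using z \<open>?N = K\<close> by blast
   then show ?thesis using qK x by simp
  qed
  then show ?thesis using S(2) by blast
 qed
 obtain h where h: "h : Hom L Q I0" "!!x. x : carrier X ==> h (j x) = i x"
  by (rule inj_mod_extend[OF I0 X Q(1) j jinj i(1)]) (rule that)
 define k where "k = compose (carrier Q) q h"
 have k: "k : Hom L Q Q" unfolding k_def by (rule Hom_comp[OF h(1) q LQ(1)])
 have kj: "k (j x) = j x" if "x : carrier X" for x
  using that h(2) ji Hom_cl[OF j] by (simp add: k_def compose_def)
 have "a_kernel Q Q k = {0\<^sub>Q}"
 proof (rule ess[OF subm_kernel[OF LQ(1) LQ(1) k]])
  show "a_kernel Q Q k \<inter> j ` carrier X = {0\<^sub>Q}"
  proof
   show "a_kernel Q Q k \<inter> j ` carrier X <= {0\<^sub>Q}" using kj by (auto simp: aker_eq)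
   show "{0\<^sub>Q} <= a_kernel Q Q k \<inter> j ` carrier X"
    using submD(2)[OF subm_kernel[OF LQ(1) LQ(1) k]] Hom_zero[OF X.lmod LQ(1) j]
    by (auto intro: rev_image_eqI)
  qed
 qed
 then have kinj: "inj_on k (carrier Q)" unfolding inj_iff_ker[OF LQ(1) LQ(1) k] aker_eq by blast
 have ks: "k ` carrier Q = carrier Q" by (rule finlen_inj_surj[OF LQ k kinj])
 obtain k' where k': "k' : Hom L Q Q" "!!x. x : carrier Q ==> k' (k x) = (\<lambda>x\<in>carrier Q. x) x"
  by (rule hom_factor_surj[OF LQ(1) LQ(1) LQ(1) k ks Hom_id[OF LQ(1)]])
   (use kinj in \<open>auto simp: inj_iff_ker[OF LQ(1) LQ(1) k]\<close>)
 have "inj_mod L Q" unfolding injective_mod_def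
 proof (intro conjI ballI impI)
  fix A B :: "'a fgm" and g f assume *: "A : modules L" "B : modules L" "g : Hom L A B" "f : Hom L A Q"
   "inj_on g (carrier A)"
  have AB: "left_module L A" "left_module L B" using * by (auto simp: fg_modD)
  obtain t where t: "t : Hom L B I0" "!!x. x : carrier A ==> t (g x) = compose (carrier A) h f x"
   by (rule inj_mod_extend[OF I0 *(1,2,3,5) Hom_comp[OF *(4) h(1) AB(1)]]) (rule that)
  let ?t = "compose (carrier B) k' (compose (carrier B) q t)"
  have t': "?t : Hom L B Q" by (intro Hom_comp[OF Hom_comp[OF t(1) q AB(2)] k'(1) AB(2)])
  have "?t (g x) = f x" if x: "x : carrier A" for x
  proof -
   have fx: "f x : carrier Q" by (rule Hom_cl[OF *(4) x])
   have "?t (g x) = k' (k (f x))"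
    using x fx Hom_cl[OF *(3) x] t(2)[OF x] by (simp add: compose_def k_def)
   then show ?thesis using k'(2)[OF fx] fx by simp
  qed
  then show "EX h:Hom L B Q. compose (carrier A) h g = f"
   by (intro bexI[OF _ t'] Hom_eqI[OF Hom_comp[OF *(3) t' AB(1)] *(4)]) (simp add: compose_def)
 qed (rule Q(1))
 then have "injective_envelope L X j Q" unfolding injective_envelope_def using j jinj ess by blast
 then show ?thesis using that Q(1) by blast
qed

end

section \<open>Artin algebras\<close>

lemma restrict_scalars_simps [simp]:
 "carrier (rs \<phi> M) = carrier M" "\<zero>\<^bsub>rs \<phi> M\<^esub> = 0\<^sub>M"
 "add (rs \<phi> M) = add M" "r \<odot>\<^bsub>rs \<phi> M\<^esub> x = \<phi> r *\<^sub>M x"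
 by (simp_all add: restrict_scalars_def)

lemma opp_simps [simp]:
 "carrier (opp L) = carrier L" "\<zero>\<^bsub>opp L\<^esub> = 0\<^sub>L" "\<one>\<^bsub>opp L\<^esub> = \<one>\<^sub>L"
 "add (opp L) = add L" "x \<otimes>\<^bsub>opp L\<^esub> y = y \<otimes>\<^sub>L x"
 by (simp_all add: opp_def)

lemma opp_opp [simp]: "opp (opp L) = L" by (simp add: opp_def)

lemma ring_opp: assumes "ring L" shows "ring (opp L)"
proof -
 interpret ring L by fact
 show ?thesis
 proof (rule ringI)
  show "abelian_group (opp L)"
   by (rule abelian_groupI) (auto simp: a_ac intro: bexI[of _ "\<ominus>\<^sub>L _"] simp: l_neg)
  show "monoid (opp L)" by (rule monoidI) (auto simp: m_assoc)
 qed (auto simp: l_distr r_distr)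
qed

context artin_algebra
begin

lemma phi_closed: "r : carrier R ==> \<phi> r : carrier \<Lambda>"
 by (rule ring_hom_closed[OF structure_map])

lemma lm_restrict: assumes "left_module \<Lambda> M" shows "left_module R (rs \<phi> M)"
proof -
 interpret M: left_module \<Lambda> M by fact
 have "abelian_group (rs \<phi> M)"
  by (rule abelian_groupI) (auto simp: M.M.a_ac intro: bexI[of _ "\<ominus>\<^sub>M _"] simp: M.M.l_neg)
 then show ?thesis by (intro left_module.intro left_module_axioms.intro R.ring_axioms)
   (auto simp: phi_closed M.smult_closed M.smult_l_distr M.smult_r_distr M.smult_assoc M.smult_one
    ring_hom_add[OF structure_map] ring_hom_mult[OF structure_map] ring_hom_one[OF structure_map])
qed

lemma restrict_submodule: assumes "left_module \<Lambda> M" "submodule N \<Lambda> M"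
 shows "submodule N R (rs \<phi> M)"
proof -
 interpret M: left_module R "rs \<phi> M" by (rule lm_restrict[OF assms(1)])
 show ?thesis using submD[OF assms(2)] phi_closed by (intro M.submoduleI) auto
qed

lemma restrict_hom: "f : Hom \<Lambda> M N ==> f : Hom R (rs \<phi> M) (rs \<phi> N)"
 using phi_closed by (auto simp: lmod_hom_def)

text \<open>A rank on the \<open>R\<close>-submodules is in particular one on the
  \<open>\<Lambda>\<close>-submodules.\<close>

lemma finlen_restrict: "left_module \<Lambda> M ==> finlen R (rs \<phi> M) ==> finlen \<Lambda> M"
 unfolding finlen_def using restrict_submodule by metis

text \<open>Products of generators of \<open>\<Lambda>\<close> over \<open>R\<close> with generators
  of \<open>M\<close> over \<open>\<Lambda>\<close> generate \<open>M\<close> over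
  \<open>R\<close>.\<close>

lemma fg_restrict: assumes "M : fg_mod \<Lambda>" shows "rs \<phi> M : fg_mod R"
proof -
 interpret M: left_module \<Lambda> M by (rule fg_modD[OF assms])
 have L: "left_module R (rs \<phi> M)" by (rule lm_restrict[OF M.lmod])
 have LA: "left_module \<Lambda> (reg_mod \<Lambda>)" by (rule lm_reg[OF A.ring_axioms])
 have LR: "left_module R (rs \<phi> (reg_mod \<Lambda>))" by (rule lm_restrict[OF LA])
 obtain A where A: "finite A" "A <= carrier M" "!!N. submodule N \<Lambda> M ==> A <= N ==> N = carrier M"
  using fg_modD(2)[OF assms] unfolding fin_gen_iff[OF M.lmod] by blast
 obtain B where B: "finite B" "B <= carrier \<Lambda>"
  "!!N. submodule N R (rs \<phi> (reg_mod \<Lambda>)) ==> B <= N ==> N = carrier \<Lambda>"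
  using module_finite unfolding fin_gen_iff[OF LR] by auto
 have "N = carrier M" if N: "submodule N R (rs \<phi> M)" "(%(b, a). b *\<^sub>M a) ` (B \<times> A) <= N" for N
 proof -
  note S = submD[OF N(1), simplified]
  have *: "b *\<^sub>M a : N" if a: "a : A" and b: "b : carrier \<Lambda>" for a b
  proof -
   have aM: "a : carrier M" using A(2) a by blast
   define S where "S = {b : carrier (rs \<phi> (reg_mod \<Lambda>)). (\<lambda>b\<in>carrier \<Lambda>. b *\<^sub>M a) b : N}"
   have "submodule S R (rs \<phi> (reg_mod \<Lambda>))" unfolding S_def
    by (rule subm_preimage[OF LR L restrict_hom[OF hom_from_reg[OF M.lmod aM]] N(1)])
   moreover have "B <= S" using B(2) N(2) a by (auto simp: S_def)
   ultimately have "S = carrier \<Lambda>" by (rule B(3))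
   then have "b : S" using b by simp
   then show ?thesis using b by (simp add: S_def)
  qed
  \<comment> \<open>The largest \<open>\<Lambda>\<close>-submodule inside \<open>N\<close>; it
    contains the generators \<open>A\<close> and is therefore all of \<open>M\<close>.\<close>
  let ?K = "{m : carrier M. ALL b:carrier \<Lambda>. b *\<^sub>M m : N}"
  have "submodule ?K \<Lambda> M"
   by (rule M.submoduleI) (auto simp: M.smult_0r S M.smult_r_distr M.smult_closed simp flip: M.smult_assoc)
  moreover have "A <= ?K" using * A(2) by auto
  ultimately have "?K = carrier M" by (rule A(3))
  then have "m : N" if "m : carrier M" for m
   using that M.smult_one[of m] A.one_closed by (metis (no_types, lifting) mem_Collect_eq)
  then show ?thesis using S(1) by blast
 qed
 then have "fin_gen R (rs \<phi> M)" unfolding fin_gen_iff[OF L] using A(1,2) B(1,2)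
  by (intro exI[of _ "(%(b, a). b *\<^sub>M a) ` (B \<times> A)"]) (auto intro!: M.smult_closed)
 then show ?thesis using L by (simp add: fg_mod_def)
qed

end

sublocale artin_algebra < RA: artinian_cring R by unfold_locales (rule artinian)

sublocale artin_algebra < LA: finlen_ring \<Lambda>
proof unfold_locales
 have "reg_mod \<Lambda> : fg_mod \<Lambda>"
 proof -
  have L: "left_module \<Lambda> (reg_mod \<Lambda>)" by (rule lm_reg[OF A.ring_axioms])
  have "N = carrier \<Lambda>" if N: "submodule N \<Lambda> (reg_mod \<Lambda>)" "{\<one>\<^sub>\<Lambda>} <= N" for N
   using submD(7)[OF N(1), of _ "\<one>\<^sub>\<Lambda>"] submD(1)[OF N(1)] N(2) by force
  then have "fin_gen \<Lambda> (reg_mod \<Lambda>)"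
   unfolding fin_gen_iff[OF L] by (intro exI[of _ "{\<one>\<^sub>\<Lambda>}"]) simp
  then show ?thesis unfolding fg_mod_def using L by simp
 qed
 then show "finlen \<Lambda> (reg_mod \<Lambda>)"
  using fg_restrict[of "reg_mod \<Lambda>"] finlen_restrict[of "reg_mod \<Lambda>"] fg_modD(1)[of "reg_mod \<Lambda>" \<Lambda>]
  by (simp add: RA.fg_mod_iff)
qed

text \<open>As the image of \<open>R\<close> is central, the ring and its opposite carry the same
  action of \<open>R\<close>. This makes every result on left modules available for right
  modules.\<close>

lemma artin_algebra_opp: assumes "artin_algebra R L \<phi>" shows "artin_algebra R (opp L) \<phi>"
proof -
 interpret artin_algebra R L \<phi> by fact
 have O: "ring (opp L)" by (rule ring_opp[OF A.ring_axioms])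
 have hom: "\<phi> : ring_hom R (opp L)"
 proof (rule ring_hom_memI)
  show "\<phi> (x \<otimes>\<^sub>R y) = \<phi> x \<otimes>\<^bsub>opp L\<^esub> \<phi> y" if "x : carrier R" "y : carrier R" for x y
   using central[OF that(1) phi_closed[OF that(2)]] that by (simp add: ring_hom_mult[OF structure_map])
 qed (simp_all add: phi_closed ring_hom_add[OF structure_map] ring_hom_one[OF structure_map])
 let ?M = "rs \<phi> (reg_mod L)" and ?O = "rs \<phi> (reg_mod (opp L))"
 have LM: "left_module R ?M" by (rule lm_restrict[OF lm_reg[OF A.ring_axioms]])
 interpret LM: left_module R ?M by (rule LM)
 have ag: "abelian_group ?O"
  by (rule abelian_groupI) (auto simp: A.a_ac intro: bexI[of _ "\<ominus>\<^sub>L _"] simp: A.l_neg)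
 have sm: "r \<odot>\<^bsub>?O\<^esub> x = r \<odot>\<^bsub>?M\<^esub> x" if "r : carrier R" "x : carrier L" for r x
  using that central by simp
 have LO: "left_module R ?O" by (intro left_module.intro left_module_axioms.intro R.ring_axioms ag)
   (use LM.smult_closed LM.smult_l_distr LM.smult_r_distr LM.smult_assoc LM.smult_one central phi_closed in \<open>auto\<close>)
 interpret LO: left_module R ?O by (rule LO)
 have "submodule N R ?M" if N: "submodule N R ?O" for N
  by (rule LM.submoduleI) (use submD[OF N] sm in auto)
 then have "fin_gen R ?O"
  using module_finite unfolding fin_gen_iff[OF LM] fin_gen_iff[OF LO] by (metis restrict_scalars_simps(1) reg_mod_simps(1) opp_simps(1))
 then show ?thesis using artinian hom central
  by (intro artin_algebra.intro artin_algebra_axioms.intro R.cring_axioms O) auto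
qed

section \<open>Duals and Hom modules, and their description by dual bases\<close>

lemma dual_simps [simp]: "carrier (dual R \<phi> J M) = Hom R (rs \<phi> M) J"
 "\<zero>\<^bsub>dual R \<phi> J M\<^esub> = (\<lambda>x\<in>carrier M. 0\<^sub>J)"
 "f \<oplus>\<^bsub>dual R \<phi> J M\<^esub> g = (\<lambda>x\<in>carrier M. f x +\<^sub>J g x)"
 "a \<odot>\<^bsub>dual R \<phi> J M\<^esub> f = (\<lambda>x\<in>carrier M. f (a *\<^sub>M x))"
 by (simp_all add: dual_def)

lemma star_simps [simp]: "carrier (star L P) = Hom L P (reg_mod L)"
 "\<zero>\<^bsub>star L P\<^esub> = (\<lambda>x\<in>carrier P. 0\<^sub>L)"
 "f \<oplus>\<^bsub>star L P\<^esub> g = (\<lambda>x\<in>carrier P. f x +\<^sub>L g x)"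
 "a \<odot>\<^bsub>star L P\<^esub> f = (\<lambda>x\<in>carrier P. f x \<otimes>\<^sub>L a)"
 by (simp_all add: star_def)

lemma lm_star: assumes "left_module L P" shows "left_module (opp L) (star L P)"
proof -
 interpret P: left_module L P by fact
 have reg: "left_module L (reg_mod L)" by (rule lm_reg[OF P.R.ring_axioms])
 have cl: "f x : carrier L" if "f : Hom L P (reg_mod L)" "x : carrier P" for f x
  using Hom_cl[OF that] by simp
 have plus: "(\<lambda>x\<in>carrier P. f x +\<^sub>L g x) : Hom L P (reg_mod L)"
  if "f : Hom L P (reg_mod L)" "g : Hom L P (reg_mod L)" for f g
  using Hom_plus[OF assms reg that] by simp
 have zero: "(\<lambda>x\<in>carrier P. 0\<^sub>L) : Hom L P (reg_mod L)"
  using Hom_0map[OF assms reg] by simp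
 have "abelian_group (star L P)"
 proof (rule abelian_groupI)
  fix f assume "f : carrier (star L P)"
  then have f: "f : Hom L P (reg_mod L)" by simp
  have "(\<lambda>x\<in>carrier P. \<ominus>\<^sub>L f x) : Hom L P (reg_mod L)"
   using Hom_uminus[OF assms reg f] by simp
  then show "EX g:carrier (star L P). g \<oplus>\<^bsub>star L P\<^esub> f = \<zero>\<^bsub>star L P\<^esub>"
   by (intro bexI[of _ "\<lambda>x\<in>carrier P. \<ominus>\<^sub>L f x"]) (auto simp: cl[OF f] P.R.l_neg intro!: restrict_ext)
 next
  fix f assume "f : carrier (star L P)"
  then show "\<zero>\<^bsub>star L P\<^esub> \<oplus>\<^bsub>star L P\<^esub> f = f"
   using plus[OF zero] by (intro Hom_eqI[of _ L P "reg_mod L"]) (auto simp: cl)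
 qed (use plus zero cl in \<open>auto simp: P.R.a_ac intro!: restrict_ext\<close>)
 moreover have smult: "(\<lambda>x\<in>carrier P. f x \<otimes>\<^sub>L a) : Hom L P (reg_mod L)"
  if "a : carrier L" and f: "f : Hom L P (reg_mod L)" for a f by (rule lmod_homI[OF assms])
   (use that in \<open>auto simp: cl Hom_add[OF f] Hom_smult[OF f] P.R.l_distr P.R.m_assoc\<close>)
 ultimately show ?thesis
 proof (intro left_module.intro left_module_axioms.intro ring_opp P.R.ring_axioms)
  fix f assume "f : carrier (star L P)"
  then show "\<one>\<^bsub>opp L\<^esub> \<odot>\<^bsub>star L P\<^esub> f = f"
   using smult[of "\<one>\<^sub>L" f] by (intro Hom_eqI[of _ L P "reg_mod L"]) (auto simp: cl)
 qed (use smult cl in \<open>auto simp: P.R.l_distr P.R.r_distr P.R.m_assoc intro!: restrict_ext\<close>)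
qed

text \<open>The same set as in \<open>hom_group\<close>, now as a module over \<open>R\<close>, so
  that finite length and functionals into \<open>J\<close> become available.\<close>

definition hom_mod :: "'a ring => ('r => 'a) => ('a, 'b) module => ('a, 'c) module => ('r, 'b => 'c) module" where
 "hom_mod L \<phi> M N = \<lparr>carrier = Hom L M N, monoid.mult = undefined, one = undefined,
  ring.zero = (\<lambda>x\<in>carrier M. 0\<^sub>N), add = (%f g. \<lambda>x\<in>carrier M. f x +\<^sub>N g x),
  smult = (%r f. \<lambda>x\<in>carrier M. \<phi> r *\<^sub>N f x)\<rparr>"

lemma hom_mod_simps [simp]: "carrier (hom_mod L \<phi> M N) = Hom L M N"
 "\<zero>\<^bsub>hom_mod L \<phi> M N\<^esub> = (\<lambda>x\<in>carrier M. 0\<^sub>N)"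
 "f \<oplus>\<^bsub>hom_mod L \<phi> M N\<^esub> g = (\<lambda>x\<in>carrier M. f x +\<^sub>N g x)"
 "r \<odot>\<^bsub>hom_mod L \<phi> M N\<^esub> f = (\<lambda>x\<in>carrier M. \<phi> r *\<^sub>N f x)"
 by (simp_all add: hom_mod_def)

context artin_algebra
begin

lemma lm_hom_mod: assumes "left_module \<Lambda> M" "left_module \<Lambda> N"
 shows "left_module R (hom_mod \<Lambda> \<phi> M N)"
proof -
 interpret M: left_module \<Lambda> M by fact
 interpret N: left_module \<Lambda> N by fact
 have cl: "f x : carrier N" if "f : Hom \<Lambda> M N" "x : carrier M" for f x
  by (rule Hom_cl[OF that])
 note plus = Hom_plus[OF assms] and zero = Hom_0map[OF assms]
 have "abelian_group (hom_mod \<Lambda> \<phi> M N)"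
 proof (rule abelian_groupI)
  fix f assume "f : carrier (hom_mod \<Lambda> \<phi> M N)"
  then have f: "f : Hom \<Lambda> M N" by simp
  show "EX g:carrier (hom_mod \<Lambda> \<phi> M N). g \<oplus>\<^bsub>hom_mod \<Lambda> \<phi> M N\<^esub> f = \<zero>\<^bsub>hom_mod \<Lambda> \<phi> M N\<^esub>"
   using Hom_uminus[OF assms f]
   by (intro bexI[of _ "\<lambda>x\<in>carrier M. \<ominus>\<^sub>N f x"]) (auto simp: cl[OF f] N.M.l_neg intro!: restrict_ext)
 next
  fix f assume "f : carrier (hom_mod \<Lambda> \<phi> M N)"
  then show "\<zero>\<^bsub>hom_mod \<Lambda> \<phi> M N\<^esub> \<oplus>\<^bsub>hom_mod \<Lambda> \<phi> M N\<^esub> f = f"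
   using plus[OF zero] by (intro Hom_eqI[of _ \<Lambda> M N]) (auto simp: cl)
 qed (use plus zero cl in \<open>auto simp: N.M.a_ac intro!: restrict_ext\<close>)
 moreover have smult: "(\<lambda>x\<in>carrier M. \<phi> r *\<^sub>N f x) : Hom \<Lambda> M N"
  if r: "r : carrier R" and f: "f : Hom \<Lambda> M N" for r f
 proof (rule lmod_homI[OF assms(1)])
  fix a x assume ax: "a : carrier \<Lambda>" "x : carrier M"
  then show "\<phi> r *\<^sub>N f (a *\<^sub>M x) = a *\<^sub>N (\<phi> r *\<^sub>N f x)"
   using central[OF r ax(1)] by (simp add: Hom_smult[OF f] cl[OF f] phi_closed r flip: N.smult_assoc)
 qed (use r in \<open>auto simp: cl[OF f] phi_closed Hom_add[OF f] N.smult_r_distr N.smult_closed\<close>)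
 ultimately show ?thesis
 proof (intro left_module.intro left_module_axioms.intro R.ring_axioms)
  fix f assume "f : carrier (hom_mod \<Lambda> \<phi> M N)"
  then show "\<one> \<odot>\<^bsub>hom_mod \<Lambda> \<phi> M N\<^esub> f = f"
   using smult[of "\<one>" f] by (intro Hom_eqI[of _ \<Lambda> M N]) (auto simp: cl ring_hom_one[OF structure_map] N.smult_one)
 qed (use smult cl phi_closed in \<open>auto simp: N.smult_l_distr N.smult_r_distr N.smult_assoc
   ring_hom_add[OF structure_map] ring_hom_mult[OF structure_map] intro!: restrict_ext\<close>)
qed

text \<open>Evaluations at generators of \<open>M\<close> are jointly injective with values in
  \<open>N\<close>, which has finite length over \<open>R\<close>.\<close>

lemma hom_mod_fg: assumes M: "M : fg_mod \<Lambda>" and N: "N : fg_mod \<Lambda>"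
 shows "hom_mod \<Lambda> \<phi> M N : fg_mod R"
proof -
 note LM = fg_modD(1)[OF M] and LN = fg_modD(1)[OF N]
 obtain A where A: "finite A" "A <= carrier M" "!!N. submodule N \<Lambda> M ==> A <= N ==> N = carrier M"
  using fg_modD(2)[OF M] unfolding fin_gen_iff[OF LM] by blast
 have H: "left_module R (hom_mod \<Lambda> \<phi> M N)" by (rule lm_hom_mod[OF LM LN])
 have "finlen R (hom_mod \<Lambda> \<phi> M N)"
 proof (rule finlen_jointly_injective[OF A(1) H, of "rs \<phi> N" "%a. \<lambda>f\<in>carrier (hom_mod \<Lambda> \<phi> M N). f a"])
  show "finlen R (rs \<phi> N)" using fg_restrict[OF N] by (simp add: RA.fg_mod_iff)
  show "left_module R (rs \<phi> N)" by (rule lm_restrict[OF LN])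
  show "(\<lambda>f\<in>carrier (hom_mod \<Lambda> \<phi> M N). f a) : Hom R (hom_mod \<Lambda> \<phi> M N) (rs \<phi> N)" if "a : A" for a
   by (rule lmod_homI[OF H]) (use A(2) that in \<open>auto simp: Hom_cl\<close>)
  fix f assume f: "f : carrier (hom_mod \<Lambda> \<phi> M N)"
   and fa: "!!a. a : A ==> (\<lambda>f\<in>carrier (hom_mod \<Lambda> \<phi> M N). f a) f = \<zero>\<^bsub>rs \<phi> N\<^esub>"
  then have f': "f : Hom \<Lambda> M N" by simp
  have "a_kernel M N f = carrier M"
   by (rule A(3)[OF subm_kernel[OF LM LN f']]) (use A(2) fa f in \<open>auto simp: aker_eq\<close>)
  then show "f = \<zero>\<^bsub>hom_mod \<Lambda> \<phi> M N\<^esub>"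
   by (intro Hom_eqI[OF f']) (use Hom_0map[OF LM LN] in \<open>auto simp: aker_eq\<close>)
 qed
 then show ?thesis using H by (simp add: RA.fg_mod_iff)
qed

text \<open>The canonical map from the tensor product of the dual of \<open>P\<close> with
  \<open>M\<close> to the homomorphisms is onto; here the tensor mapped to \<open>h\<close> is
  written out.\<close>

lemma dual_basis_hom_mod:
 assumes B: "dual_basis \<Lambda> P n x \<xi>" and P: "left_module \<Lambda> P" and M: "left_module \<Lambda> M" and h: "h : Hom \<Lambda> P M"
 shows "h = (\<Oplus>\<^bsub>hom_mod \<Lambda> \<phi> P M\<^esub>k\<in>{..<n}. (\<lambda>p\<in>carrier P. \<xi> k p *\<^sub>M h (x k)))"
proof -
 interpret H: left_module R "hom_mod \<Lambda> \<phi> P M" by (rule lm_hom_mod[OF P M])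
 interpret M: left_module \<Lambda> M by (rule M)
 note D = dual_basisD[OF B]
 have t: "(\<lambda>p\<in>carrier P. \<xi> k p *\<^sub>M h (x k)) : Hom \<Lambda> P M" if "k < n" for k
  using Hom_comp[OF D(2)[OF that] hom_from_reg[OF M Hom_cl[OF h D(1)[OF that]]] P]
  by (rule back_subst[of "%f. f : Hom \<Lambda> P M"]) (use D(3)[OF that] in \<open>auto simp: compose_def\<close>)
 have S: "(\<Oplus>\<^bsub>hom_mod \<Lambda> \<phi> P M\<^esub>k\<in>{..<n}. (\<lambda>p\<in>carrier P. \<xi> k p *\<^sub>M h (x k))) : Hom \<Lambda> P M"
  using H.M.finsum_closed[of "%k. (\<lambda>p\<in>carrier P. \<xi> k p *\<^sub>M h (x k))" "{..<n}"] t by auto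
 show ?thesis
 proof (rule Hom_eqI[OF h S])
  fix p assume p: "p : carrier P"
  have "(\<Oplus>\<^bsub>hom_mod \<Lambda> \<phi> P M\<^esub>k\<in>{..<n}. (\<lambda>p\<in>carrier P. \<xi> k p *\<^sub>M h (x k))) p
   = (\<Oplus>\<^bsub>M\<^esub>k\<in>{..<n}. (\<lambda>p\<in>carrier P. \<xi> k p *\<^sub>M h (x k)) p)"
   by (rule finsum_transport[OF H.M.abelian_monoid_axioms M.M.abelian_monoid_axioms, of "%f. f p"])
    (use p t in \<open>auto simp: Hom_cl\<close>)
  also have "... = h p" using p by (simp add: dual_basis_hom[OF B P M h p])
  finally show "h p = (\<Oplus>\<^bsub>hom_mod \<Lambda> \<phi> P M\<^esub>k\<in>{..<n}. (\<lambda>p\<in>carrier P. \<xi> k p *\<^sub>M h (x k))) p" by simp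
 qed
qed

text \<open>The case of the regular module, read as generation of the right module
  \<open>star\<close> by the forms \<open>\<xi> k\<close>, with coefficients acting on the
  right.\<close>

lemma dual_basis_star:
 assumes B: "dual_basis \<Lambda> P n x \<xi>" and P: "left_module \<Lambda> P" and h: "h : Hom \<Lambda> P (reg_mod \<Lambda>)"
 shows "h = (\<Oplus>\<^bsub>star \<Lambda> P\<^esub>k\<in>{..<n}. h (x k) \<odot>\<^bsub>star \<Lambda> P\<^esub> \<xi> k)"
proof -
 have reg: "left_module \<Lambda> (reg_mod \<Lambda>)" by (rule lm_reg[OF A.ring_axioms])
 interpret H: left_module "opp \<Lambda>" "star \<Lambda> P" by (rule lm_star[OF P])
 interpret M: left_module \<Lambda> "reg_mod \<Lambda>" by (rule reg)
 note D = dual_basisD[OF B]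
 have t: "h (x k) \<odot>\<^bsub>star \<Lambda> P\<^esub> \<xi> k : carrier (star \<Lambda> P)" if "k < n" for k
  by (rule H.smult_closed) (use D(1,2)[OF that] Hom_cl[OF h] in auto)
 have S: "(\<Oplus>\<^bsub>star \<Lambda> P\<^esub>k\<in>{..<n}. h (x k) \<odot>\<^bsub>star \<Lambda> P\<^esub> \<xi> k) : Hom \<Lambda> P (reg_mod \<Lambda>)"
  using H.M.finsum_closed[of "%k. h (x k) \<odot>\<^bsub>star \<Lambda> P\<^esub> \<xi> k" "{..<n}"] t by auto
 show ?thesis
 proof (rule Hom_eqI[OF h S])
  fix p assume p: "p : carrier P"
  have "(\<Oplus>\<^bsub>star \<Lambda> P\<^esub>k\<in>{..<n}. h (x k) \<odot>\<^bsub>star \<Lambda> P\<^esub> \<xi> k) p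
   = (\<Oplus>\<^bsub>reg_mod \<Lambda>\<^esub>k\<in>{..<n}. (h (x k) \<odot>\<^bsub>star \<Lambda> P\<^esub> \<xi> k) p)"
   by (rule finsum_transport[OF H.M.abelian_monoid_axioms M.M.abelian_monoid_axioms, of "%f. f p"])
    (use p t Hom_cl[of _ \<Lambda> P "reg_mod \<Lambda>" p] in \<open>auto\<close>)
  also have "... = h p" using p by (simp add: dual_basis_hom[OF B P reg h p])
  finally show "h p = (\<Oplus>\<^bsub>star \<Lambda> P\<^esub>k\<in>{..<n}. h (x k) \<odot>\<^bsub>star \<Lambda> P\<^esub> \<xi> k) p" by simp
 qed
qed

end

section \<open>Auslander--Reiten theory: the defect formula\<close>

lemma short_exactD:
 assumes "short_exact L A f B g C" "left_module L B" "left_module L C" "left_module L A"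
 shows "f : Hom L A B" "g : Hom L B C" "inj_on f (carrier A)" "g ` carrier B = carrier C"
  "!!b. b : carrier B ==> g b = 0\<^sub>C <-> b : f ` carrier A"
  "!!a. a : carrier A ==> g (f a) = 0\<^sub>C" "f ` carrier A = a_kernel B C g"
 using assms by (auto simp: short_exact_def aker_eq)

lemma short_exact_factor_sub:
 assumes "short_exact L A f B g C" "left_module L A" "left_module L B" "left_module L C" "left_module L X"
  and "u : Hom L X B" "!!x. x : carrier X ==> g (u x) = 0\<^sub>C"
 obtains w where "w : Hom L X A" "!!x. x : carrier X ==> f (w x) = u x"
 using hom_factor_inj[OF assms(2,3,5) short_exactD(1,3)[OF assms(1,3,4,2)] assms(6)]
  short_exactD(5)[OF assms(1,3,4,2)] assms(6,7) Hom_cl[OF assms(6)] by metis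

lemma short_exact_factor_quot:
 assumes "short_exact L A f B g C" "left_module L A" "left_module L B" "left_module L C" "left_module L X"
  and "u : Hom L B X" "!!x. x : carrier A ==> u (f x) = 0\<^sub>X"
 obtains w where "w : Hom L C X" "!!x. x : carrier B ==> w (g x) = u x"
proof -
 note S = short_exactD[OF assms(1,3,4,2)]
 show ?thesis
  by (rule hom_factor_surj[OF assms(3,4,5) S(2,4) assms(6)]) (use S(5) assms(7) that in auto)
qed

text \<open>Vanishing at \<open>Y\<close> of the covariant defect, the cokernel of the restriction
  from maps on \<open>B\<close> to maps on \<open>A\<close>. Only its vanishing is ever used, so the
  defect functor itself is not formed.\<close>

definition extends :: "'a ring => ('a, 'b) module => ('b => 'c) => ('a, 'c) module => ('a, 'd) module => bool" where
 "extends L A f B Y <-> (ALL u:Hom L A Y. EX v:Hom L B Y. ALL a:carrier A. v (f a) = u a)"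

text \<open>Vanishing at \<open>X\<close> of the contravariant defect.\<close>

definition lifts :: "'a ring => ('a, 'd) module => ('a, 'b) module => ('b => 'c) => ('a, 'c) module => bool" where
 "lifts L X B g C <-> (ALL u:Hom L X C. EX v:Hom L X B. ALL x:carrier X. g (v x) = u x)"

lemma extendsE: assumes "extends L A f B Y" "u : Hom L A Y"
 obtains v where "v : Hom L B Y" "!!a. a : carrier A ==> v (f a) = u a"
 using assms unfolding extends_def by blast

lemma liftsE: assumes "lifts L X B g C" "u : Hom L X C"
 obtains v where "v : Hom L X B" "!!x. x : carrier X ==> g (v x) = u x"
 using assms unfolding lifts_def by blast

lemma extends_retract: assumes "extends L A f B Y" and s: "s : Hom L Q Y" and r: "r : Hom L Y Q"
  and rs: "!!x. x : carrier Q ==> r (s x) = x"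
  and L: "left_module L A" "left_module L B" and f: "!!x. x : carrier A ==> f x : carrier B"
 shows "extends L A f B Q" unfolding extends_def
proof
 fix u assume u: "u : Hom L A Q"
 obtain v where v: "v : Hom L B Y" "!!x. x : carrier A ==> v (f x) = compose (carrier A) s u x"
  using extendsE[OF assms(1) Hom_comp[OF u s L(1)]] by metis
 show "EX v:Hom L B Q. ALL a:carrier A. v (f a) = u a"
  by (rule bexI[OF _ Hom_comp[OF v(1) r L(2)]]) (simp add: compose_def f v(2) rs Hom_cl[OF u])
qed

locale artin_duality = artin_algebra R L \<phi>
 for R :: "'r ring" (structure) and L :: "'a ring" (structure) and \<phi> :: "'r => 'a" +
 fixes J :: "('r, 'j) module" assumes dualizing_J: "dualizing_module R J"

sublocale artin_duality < D: dualizing R J by unfold_locales (rule dualizing_J)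

lemma artin_duality_opp: "artin_duality R L \<phi> J ==> artin_duality R (opp L) \<phi> J"
 by (simp add: artin_duality_def artin_duality_axioms_def artin_algebra_opp)

context artin_duality
begin

lemma lm_dual: assumes M: "left_module L M" shows "left_module (opp L) (dual R \<phi> J M)"
proof -
 interpret M: left_module L M by fact
 interpret J: left_module R J by (rule D.J)
 note LM = lm_restrict[OF M]
 have cl: "f x : carrier J" if "f : Hom R (rs \<phi> M) J" "x : carrier M" for f x
  using Hom_cl[OF that(1)] that(2) by simp
 have plus: "(\<lambda>x\<in>carrier M. f x +\<^sub>J g x) : Hom R (rs \<phi> M) J"
  if "f : Hom R (rs \<phi> M) J" "g : Hom R (rs \<phi> M) J" for f g
  using Hom_plus[OF LM D.J that] by simp
 have zero: "(\<lambda>x\<in>carrier M. 0\<^sub>J) : Hom R (rs \<phi> M) J"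
  using Hom_0map[OF LM D.J] by simp
 have "abelian_group (dual R \<phi> J M)"
 proof (rule abelian_groupI)
  fix f assume "f : carrier (dual R \<phi> J M)"
  then have f: "f : Hom R (rs \<phi> M) J" by simp
  have "(\<lambda>x\<in>carrier M. \<ominus>\<^sub>J f x) : Hom R (rs \<phi> M) J"
   using Hom_uminus[OF LM D.J f] by simp
  then show "EX g:carrier (dual R \<phi> J M). g \<oplus>\<^bsub>dual R \<phi> J M\<^esub> f = \<zero>\<^bsub>dual R \<phi> J M\<^esub>"
   by (intro bexI[of _ "\<lambda>x\<in>carrier M. \<ominus>\<^sub>J f x"]) (auto simp: cl[OF f] J.M.l_neg intro!: restrict_ext)
 next
  fix f assume "f : carrier (dual R \<phi> J M)"
  then show "\<zero>\<^bsub>dual R \<phi> J M\<^esub> \<oplus>\<^bsub>dual R \<phi> J M\<^esub> f = f"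
   using plus[OF zero] by (intro Hom_eqI[of _ R "rs \<phi> M" J]) (auto simp: cl)
 qed (use plus zero cl in \<open>auto simp: J.M.a_ac intro!: restrict_ext\<close>)
 moreover have smult: "(\<lambda>x\<in>carrier M. f (a *\<^sub>M x)) : Hom R (rs \<phi> M) J"
  if a: "a : carrier L" and f: "f : Hom R (rs \<phi> M) J" for a f
 proof -
  have "restrict (%x. f (a *\<^sub>M x)) (carrier (rs \<phi> M)) : Hom R (rs \<phi> M) J"
  proof (rule lmod_homI[OF LM])
   fix r x assume rx: "r : carrier R" "x : carrier (rs \<phi> M)"
   then have "a *\<^sub>M (\<phi> r *\<^sub>M x) = \<phi> r *\<^sub>M (a *\<^sub>M x)"
    using a central[OF rx(1) a] by (simp add: phi_closed flip: M.smult_assoc)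
   then show "f (a *\<^sub>M (r \<odot>\<^bsub>rs \<phi> M\<^esub> x)) = r *\<^sub>J f (a *\<^sub>M x)"
    using Hom_smult[OF f rx(1), of "a *\<^sub>M x"] a rx by (simp add: M.smult_closed)
  next
   fix x y assume "x : carrier (rs \<phi> M)" "y : carrier (rs \<phi> M)"
   then show "f (a *\<^sub>M (x \<oplus>\<^bsub>rs \<phi> M\<^esub> y)) = f (a *\<^sub>M x) +\<^sub>J f (a *\<^sub>M y)"
    using Hom_add[OF f, of "a *\<^sub>M x" "a *\<^sub>M y"] a by (simp add: M.smult_closed M.smult_r_distr)
  qed (use a in \<open>auto simp: cl[OF f] M.smult_closed\<close>)
  then show ?thesis by simp
 qed
 have neutral: "\<one>\<^bsub>opp L\<^esub> \<odot>\<^bsub>dual R \<phi> J M\<^esub> f = f" if "f : carrier (dual R \<phi> J M)" for f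
  using that smult[of "\<one>\<^sub>L" f]
  by (intro Hom_eqI[of _ R "rs \<phi> M" J]) (auto simp: cl M.smult_one)
 show ?thesis
  by (intro left_module.intro left_module_axioms.intro ring_opp A.ring_axioms \<open>abelian_group (dual R \<phi> J M)\<close> neutral)
   (use smult cl in \<open>auto simp: M.smult_closed M.smult_l_distr M.smult_assoc intro!: restrict_ext
    Hom_add[of _ R "rs \<phi> M" J, simplified]\<close>)
qed

text \<open>Evaluations at generators of \<open>M\<close> over \<open>R\<close> embed the dual into
  finitely many copies of \<open>J\<close>.\<close>

lemma dual_fg: assumes M: "M : fg_mod L" shows "dual R \<phi> J M : fg_mod (opp L)"
proof -
 interpret O: artin_algebra R "opp L" \<phi> by (rule artin_algebra_opp) unfold_locales
 interpret M: left_module L M by (rule fg_modD[OF M])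
 interpret J: left_module R J by (rule D.J)
 let ?H = "rs \<phi> (dual R \<phi> J M)"
 have L: "left_module (opp L) (dual R \<phi> J M)" by (rule lm_dual[OF M.lmod])
 have H: "left_module R ?H" by (rule O.lm_restrict[OF L])
 note LM = lm_restrict[OF M.lmod]
 obtain A where A: "finite A" "A <= carrier M" "!!N. submodule N R (rs \<phi> M) ==> A <= N ==> N = carrier M"
  using fg_modD(2)[OF fg_restrict[OF M]] unfolding fin_gen_iff[OF LM] by auto
 have "finlen R ?H"
 proof (rule finlen_jointly_injective[OF A(1) H _ D.J, of "%a. \<lambda>f\<in>carrier ?H. f a"])
  show "finlen R J" using D.J_fg by (simp add: RA.fg_mod_iff)
  show "(\<lambda>f\<in>carrier ?H. f a) : Hom R ?H J" if "a : A" for a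
  proof (rule lmod_homI[OF H])
   fix r f assume "r : carrier R" "f : carrier ?H"
   moreover have "a : carrier M" using A(2) that by blast
   ultimately show "(r \<odot>\<^bsub>?H\<^esub> f) a = r *\<^sub>J f a"
    using Hom_smult[of f R "rs \<phi> M" J r a] by simp
  qed (use A(2) that Hom_cl[of _ R "rs \<phi> M" J a] in auto)
  fix f assume f: "f : carrier ?H" "!!a. a : A ==> (\<lambda>f\<in>carrier ?H. f a) f = 0\<^sub>J"
  then have f': "f : Hom R (rs \<phi> M) J" by simp
  have "a_kernel (rs \<phi> M) J f = carrier M"
   by (rule A(3)[OF subm_kernel[OF LM D.J f']]) (use A(2) f in \<open>auto simp: aker_eq\<close>)
  then show "f = \<zero>\<^bsub>?H\<^esub>"
   using Hom_0map[OF LM D.J] by (intro Hom_eqI[OF f']) (auto simp: aker_eq)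
 qed
 then have "finlen (opp L) (dual R \<phi> J M)" by (rule O.finlen_restrict[OF L])
 then show ?thesis using L by (simp add: O.LA.fg_mod_iff)
qed

lemma dual_separates: assumes M: "M : fg_mod L" and x: "x : carrier M" "x ~= 0\<^sub>M"
 obtains f where "f : Hom R (rs \<phi> M) J" "f x ~= 0\<^sub>J"
proof -
 have M': "rs \<phi> M : fg_mod R" by (rule fg_restrict[OF M])
 show ?thesis
  by (rule D.separation[OF M' left_module.zero_submodule[OF fg_modD(1)[OF M']], of x]) (use x that in auto)
qed

lemma dual_eqI: assumes M: "M : fg_mod L" and x: "x : carrier M" "y : carrier M"
  and eq: "!!f. f : Hom R (rs \<phi> M) J ==> f x = f y" shows "x = y"
proof (rule ccontr)
 interpret M: left_module L M by (rule fg_modD[OF M])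
 interpret J: left_module R J by (rule D.J)
 have LM: "left_module R (rs \<phi> M)" by (rule lm_restrict[OF M.lmod])
 have mi: "x \<ominus>\<^bsub>rs \<phi> M\<^esub> y = x \<ominus>\<^sub>M y" by (simp add: a_minus_def a_inv_def m_inv_def)
 assume "x ~= y"
 then have "x \<ominus>\<^sub>M y ~= 0\<^sub>M" using x by (simp add: M.minus_0_iff)
 then obtain f where f: "f : Hom R (rs \<phi> M) J" "f (x \<ominus>\<^sub>M y) ~= 0\<^sub>J"
  using dual_separates[OF M] x by (metis M.M.minus_closed)
 then show False using Hom_minus[OF LM D.J f(1), of x y] eq[OF f(1)] x Hom_cl[OF f(1), of y]
  by (simp add: mi J.minus_0_iff)
qed

text \<open>Reflexivity over \<open>R\<close>. The scalar action on the dual moves scalars into the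
  argument; for \<open>R\<close>-linear functionals this is the same as multiplying the
  values.\<close>

lemma dual_eval: assumes M: "M : fg_mod L" and G: "G : Hom R (rs \<phi> (dual R \<phi> J M)) J"
 obtains x where "x : carrier M" "!!f. f : Hom R (rs \<phi> M) J ==> G f = f x"
proof -
 have "D.functional (rs \<phi> M) G" unfolding D.functional_def
 proof (intro conjI ballI)
  fix f assume f: "f : Hom R (rs \<phi> M) J"
  show "G f : carrier J" using Hom_cl[OF G] f by simp
  show "G (\<lambda>x\<in>carrier (rs \<phi> M). f x +\<^sub>J g x) = G f +\<^sub>J G g"
   if "g : Hom R (rs \<phi> M) J" for g using Hom_add[OF G, of f g] f that by simp
  show "G (\<lambda>x\<in>carrier (rs \<phi> M). r *\<^sub>J f x) = r *\<^sub>J G f" if r: "r : carrier R" for r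
  proof -
   have "(\<lambda>x\<in>carrier M. r *\<^sub>J f x) = (\<lambda>x\<in>carrier M. f (\<phi> r *\<^sub>M x))"
    using Hom_smult[OF f r] by (auto intro!: restrict_ext)
   then show ?thesis using Hom_smult[OF G r, of f] f by simp
  qed
 qed
 then show ?thesis using D.functional_eval[OF fg_restrict[OF M]] that by (metis restrict_scalars_simps(1))
qed

text \<open>Homomorphisms from \<open>N\<close> to the dual of \<open>M\<close> and from
  \<open>M\<close> to the dual of \<open>N\<close> are both the balanced pairings of the two modules
  with values in \<open>J\<close>.\<close>

lemma dual_flip:
 assumes M: "left_module L M" and N: "left_module (opp L) N" and \<alpha>: "\<alpha> : Hom (opp L) N (dual R \<phi> J M)"
 shows "(\<lambda>x\<in>carrier M. \<lambda>y\<in>carrier N. \<alpha> y x) : Hom L M (dual R \<phi> J N)"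
proof -
 interpret O: artin_algebra R "opp L" \<phi> by (rule artin_algebra_opp) unfold_locales
 interpret M: left_module L M by (rule M)
 interpret N: left_module "opp L" N by (rule N)
 have \<alpha>c: "\<alpha> y : Hom R (rs \<phi> M) J" if "y : carrier N" for y
  using Hom_cl[OF \<alpha> that] by simp
 have c: "\<alpha> y x : carrier J" if "x : carrier M" "y : carrier N" for x y
  using Hom_cl[OF \<alpha>c[OF that(2)]] that by simp
 show "(\<lambda>x\<in>carrier M. \<lambda>y\<in>carrier N. \<alpha> y x) : Hom L M (dual R \<phi> J N)"
 proof (rule lmod_homI[OF M])
  fix x assume x: "x : carrier M"
  have "restrict (%y. \<alpha> y x) (carrier (rs \<phi> N)) : Hom R (rs \<phi> N) J"
   by (rule lmod_homI[OF O.lm_restrict[OF N]])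
    (use x c Hom_add[OF \<alpha>] Hom_smult[OF \<alpha>] Hom_smult[OF \<alpha>c, of _ _ x] phi_closed in auto)
  then show "(\<lambda>y\<in>carrier N. \<alpha> y x) : carrier (dual R \<phi> J N)" by simp
 qed (use Hom_add[OF \<alpha>c] Hom_smult[OF \<alpha>] N.smult_closed in \<open>auto intro!: restrict_ext\<close>)
qed

text \<open>The duality is full. For fixed \<open>y\<close>, the value of \<open>\<alpha> f\<close>
  at \<open>y\<close> depends linearly on \<open>f\<close>, so by reflexivity it is evaluation at
  some \<open>\<rho> y\<close>; functionals separate points, which makes \<open>\<rho>\<close>
  linear.\<close>

lemma dual_adjoint: assumes M: "M : fg_mod L" and N: "left_module L N"
  and \<alpha>: "\<alpha> : Hom (opp L) (dual R \<phi> J M) (dual R \<phi> J N)"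
 obtains \<rho> where "\<rho> : Hom L N M"
  "!!f y. f : Hom R (rs \<phi> M) J ==> y : carrier N ==> \<alpha> f y = f (\<rho> y)"
proof -
 interpret M: left_module L M by (rule fg_modD[OF M])
 interpret N: left_module L N by (rule N)
 note LM = lm_dual[OF M.lmod]
 have ac: "\<alpha> f : Hom R (rs \<phi> N) J" if "f : Hom R (rs \<phi> M) J" for f
  using Hom_cl[OF \<alpha>, of f] that by simp
 have "EX x:carrier M. ALL f:Hom R (rs \<phi> M) J. \<alpha> f y = f x" if y: "y : carrier N" for y
 proof -
  have "(\<lambda>f\<in>carrier (dual R \<phi> J M). \<alpha> f y) : Hom R (rs \<phi> (dual R \<phi> J M)) J"
   using Hom_cl[OF dual_flip[OF N LM \<alpha>] y] y by simp
  from dual_eval[OF M this] show ?thesis by (metis dual_simps(1) restrict_apply')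
 qed
 then obtain \<rho> where \<rho>: "!!y. y : carrier N ==> \<rho> y : carrier M"
  "!!y f. y : carrier N ==> f : Hom R (rs \<phi> M) J ==> \<alpha> f y = f (\<rho> y)" by metis
 have "restrict \<rho> (carrier N) : Hom L N M"
 proof (rule lmod_homI[OF N])
  show "\<rho> (x +\<^sub>N y) = \<rho> x +\<^sub>M \<rho> y" if "x : carrier N" "y : carrier N" for x y
  proof (rule dual_eqI[OF M])
   fix f assume f: "f : Hom R (rs \<phi> M) J"
   show "f (\<rho> (x +\<^sub>N y)) = f (\<rho> x +\<^sub>M \<rho> y)"
    using Hom_add[OF f, of "\<rho> x" "\<rho> y"] Hom_add[OF ac[OF f], of x y] that f
    by (simp add: \<rho>(1) flip: \<rho>(2))
  qed (use that \<rho> in auto)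
  show "\<rho> (a *\<^sub>N y) = a *\<^sub>M \<rho> y" if "a : carrier L" "y : carrier N" for a y
  proof (rule dual_eqI[OF M])
   fix f assume f: "f : Hom R (rs \<phi> M) J"
   have af: "a \<odot>\<^bsub>dual R \<phi> J M\<^esub> f : Hom R (rs \<phi> M) J"
    using left_module.smult_closed[OF lm_dual[OF M.lmod], of a f] f that by simp
   have "f (\<rho> (a *\<^sub>N y)) = (a \<odot>\<^bsub>dual R \<phi> J N\<^esub> \<alpha> f) y"
    using f that by (simp add: N.smult_closed flip: \<rho>(2))
   also have "... = \<alpha> (a \<odot>\<^bsub>dual R \<phi> J M\<^esub> f) y"
    using Hom_smult[OF \<alpha>, of a f] f that by simp
   also have "... = (a \<odot>\<^bsub>dual R \<phi> J M\<^esub> f) (\<rho> y)" by (rule \<rho>(2)[OF that(2) af])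
   also have "... = f (a *\<^sub>M \<rho> y)" using \<rho>(1) that by simp
   finally show "f (\<rho> (a *\<^sub>N y)) = f (a *\<^sub>M \<rho> y)" .
  qed (use that \<rho> in \<open>auto simp: N.smult_closed M.smult_closed\<close>)
 qed (rule \<rho>(1))
 then show ?thesis by (rule that) (simp add: \<rho>(2))
qed

end

context artin_duality
begin

text \<open>The isomorphism \<open>D Hom(P, M) \<cong> Hom(P\<^sup>*, D M)\<close> for projective \<open>P\<close> is used here only
 through dual bases: a functional on \<open>Hom(P1, A)\<close> that detects the obstruction to a lift of \<open>u\<close>
 turns into a homomorphism \<open>A \<rightarrow> D T\<close>, and its extension to \<open>B\<close> forces the functional to vanish
 on that obstruction.\<close>

lemma transpose_defect: assumes P0: "proj_mod L P0" and P1: "proj_mod L P1"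
  and d: "d : Hom L P1 P0" and Z: "left_module L Z" and e: "e : Hom L P0 Z"
  and ex: "e ` carrier P0 = carrier Z" "d ` carrier P1 = a_kernel P0 Z e"
  and T: "left_module (opp L) T" and \<theta>: "\<theta> : Hom (opp L) (star L P1) T"
  and \<theta>_onto: "\<theta> ` carrier (star L P1) = carrier T"
  and \<theta>_ker: "a_kernel (star L P1) T \<theta> = (%f. compose (carrier P1) f d) ` carrier (star L P0)"
  and A: "A : fg_mod L" and B: "B : fg_mod L" and C: "C : fg_mod L"
  and ses: "short_exact L A f B g C" and extend: "extends L A f B (dual R \<phi> J T)"
 shows "lifts L Z B g C" unfolding lifts_def
proof
 fix u assume u: "u : Hom L Z C"
 have P0m: "P0 : modules L" "left_module L P0" and P1m: "P1 : modules L" "left_module L P1"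
  using P0 P1 by (auto simp: projective_mod_def fg_modD)
 note LA = fg_modD(1)[OF A] and LB = fg_modD(1)[OF B] and LC = fg_modD(1)[OF C]
 interpret A: left_module L A by (rule LA)
 interpret B: left_module L B by (rule LB)
 interpret C: left_module L C by (rule LC)
 interpret P0: left_module L P0 by (rule P0m)
 interpret P1: left_module L P1 by (rule P1m)
 interpret T: left_module "opp L" T by (rule T)
 interpret J: left_module R J by (rule D.J)
 interpret O: artin_algebra R "opp L" \<phi> by (rule artin_algebra_opp) unfold_locales
 interpret st: left_module "opp L" "star L P1" by (rule lm_star[OF P1m(2)])
 have regL: "left_module L (reg_mod L)" by (rule lm_reg[OF A.ring_axioms])
 note S = short_exactD[OF ses LB LC LA]
 obtain n x \<xi> where b1: "dual_basis L P1 n x \<xi>" using LA.projective_dual_basis[OF P1] by metis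
 obtain m y \<psi> where b0: "dual_basis L P0 m y \<psi>" using LA.projective_dual_basis[OF P0] by metis
 note B1 = dual_basisD[OF b1] and B0 = dual_basisD[OF b0]
 have ed: "e (d p) = 0\<^sub>Z" if "p : carrier P1" for p using ex(2) that by (auto simp: aker_eq)
 \<comment> \<open>Projectivity of \<open>P0\<close> lifts \<open>u e\<close> to \<open>B\<close>.
   On the image of \<open>d\<close> the lift lands in \<open>A\<close>, which gives
   \<open>w\<close>. This is the obstruction: \<open>u\<close> lifts once \<open>w\<close> factors
   through \<open>d\<close>.\<close>
 obtain v0 where v0: "v0 : Hom L P0 B" "!!p. p : carrier P0 ==> g (v0 p) = compose (carrier P0) u e p"
  by (rule proj_mod_lift[OF P0 B C S(2,4) Hom_comp[OF e u P0m(2)]]) (rule that)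
 have u0: "u 0\<^sub>Z = 0\<^sub>C" by (rule Hom_zero[OF Z LC u])
 obtain w where w: "w : Hom L P1 A" "!!p. p : carrier P1 ==> f (w p) = compose (carrier P1) v0 d p"
  by (rule short_exact_factor_sub[OF ses LA LB LC P1m(2) Hom_comp[OF d v0(1) P1m(2)]])
   (auto simp: compose_def v0(2) Hom_cl[OF d] ed u0 intro: that)
 let ?H = "hom_mod L \<phi> P1 A"
 have H: "?H : fg_mod R" by (rule hom_mod_fg[OF P1m(1) A])
 interpret H: left_module R ?H by (rule fg_modD[OF H])
 define N where "N = (%h. compose (carrier P1) h d) ` Hom L P0 A"
 have "w : N"
 proof (rule ccontr)
  assume wN: "w ~: N"
  interpret H0: left_module R "hom_mod L \<phi> P0 A" by (rule lm_hom_mod[OF P0m(2) LA])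
  have dstar: "(\<lambda>h\<in>carrier (hom_mod L \<phi> P0 A). compose (carrier P1) h d) : Hom R (hom_mod L \<phi> P0 A) ?H"
   by (rule lmod_homI[OF H0.lmod])
    (auto simp: compose_def Hom_cl[OF d] Hom_comp[OF d _ P1m(2), unfolded compose_def] intro!: restrict_ext)
  have Nsub: "submodule N R ?H" using subm_range[OF H0.lmod H.lmod dstar] by (simp add: N_def)
  \<comment> \<open>\<open>J\<close> cogenerates, so some functional on the maps from
    \<open>P1\<close> to \<open>A\<close> vanishes on those factoring through \<open>d\<close> but
    not at \<open>w\<close>.\<close>
  obtain \<Xi> where X: "\<Xi> : Hom R ?H J" "!!h. h : N ==> \<Xi> h = 0\<^sub>J" "\<Xi> w ~= 0\<^sub>J"
   using D.separation[OF H Nsub, of w] w(1) wN by (metis hom_mod_simps(1))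
  \<comment> \<open>The image in the maps from \<open>P1\<close> to \<open>A\<close> of the tensor
    of a form \<open>\<chi>\<close> with an element \<open>a\<close>.\<close>
  define mk where "mk \<chi> a = (\<lambda>p\<in>carrier P1. \<chi> p *\<^sub>A a)" for \<chi> a
  have \<chi>c: "\<chi> p : carrier L" if "\<chi> : Hom L P1 (reg_mod L)" "p : carrier P1" for \<chi> p
   using Hom_cl[OF that] by simp
  have mk: "mk \<chi> a : Hom L P1 A" if "\<chi> : Hom L P1 (reg_mod L)" "a : carrier A" for \<chi> a
   using Hom_comp[OF that(1) hom_from_reg[OF LA that(2)] P1m(2)]
   by (rule back_subst[of "%h. h : Hom L P1 A"]) (use \<chi>c[OF that(1)] in \<open>auto simp: mk_def compose_def\<close>)
  \<comment> \<open>For fixed \<open>a\<close> the functional is linear in \<open>\<chi>\<close> and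
    vanishes on forms that factor through \<open>d\<close>, so it descends along
    \<open>\<theta>\<close> to \<open>T\<close>.\<close>
  have "EX c:carrier (dual R \<phi> J T). ALL \<chi>:Hom L P1 (reg_mod L). c (\<theta> \<chi>) = \<Xi> (mk \<chi> a)" if a: "a : carrier A" for a
  proof -
   let ?s = "rs \<phi> (star L P1)" and ?T = "rs \<phi> T"
   have Ls: "left_module R ?s" and LT: "left_module R ?T"
    by (rule O.lm_restrict, rule st.lmod, rule O.lm_restrict, rule T)
   have q: "(\<lambda>\<chi>\<in>carrier ?s. \<Xi> (mk \<chi> a)) : Hom R ?s J"
   proof (rule lmod_homI[OF Ls])
    show "\<Xi> (mk \<chi> a) : carrier J" if "\<chi> : carrier ?s" for \<chi>
     using Hom_cl[OF X(1)] mk[of \<chi> a] a that by simp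
    show "\<Xi> (mk (\<chi> \<oplus>\<^bsub>?s\<^esub> \<chi>') a) = \<Xi> (mk \<chi> a) +\<^sub>J \<Xi> (mk \<chi>' a)" if "\<chi> : carrier ?s" "\<chi>' : carrier ?s" for \<chi> \<chi>'
    proof -
     have "mk (\<chi> \<oplus>\<^bsub>?s\<^esub> \<chi>') a = mk \<chi> a \<oplus>\<^bsub>?H\<^esub> mk \<chi>' a"
      using that a by (auto simp: mk_def \<chi>c A.smult_l_distr intro!: restrict_ext)
     then show ?thesis using Hom_add[OF X(1), of "mk \<chi> a" "mk \<chi>' a"] mk a that by simp
    qed
    show "\<Xi> (mk (r \<odot>\<^bsub>?s\<^esub> \<chi>) a) = r *\<^sub>J \<Xi> (mk \<chi> a)" if "r : carrier R" "\<chi> : carrier ?s" for r \<chi>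
    proof -
     have "mk (r \<odot>\<^bsub>?s\<^esub> \<chi>) a = r \<odot>\<^bsub>?H\<^esub> mk \<chi> a"
      using that a central[OF that(1)] by (auto simp: mk_def \<chi>c phi_closed A.smult_assoc[symmetric] intro!: restrict_ext)
     then show ?thesis using Hom_smult[OF X(1), of r "mk \<chi> a"] mk a that by simp
    qed
   qed
   have ker: "(\<lambda>\<chi>\<in>carrier ?s. \<Xi> (mk \<chi> a)) \<chi> = 0\<^sub>J" if \<chi>: "\<chi> : carrier ?s" "\<theta> \<chi> = \<zero>\<^bsub>?T\<^esub>" for \<chi>
   proof -
    have "\<chi> : a_kernel (star L P1) T \<theta>" using \<chi> by (simp add: aker_eq)
    then obtain \<eta> where \<eta>: "\<eta> : Hom L P0 (reg_mod L)" "\<chi> = compose (carrier P1) \<eta> d" unfolding \<theta>_ker by auto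
    have "compose (carrier P0) (\<lambda>b\<in>carrier L. b *\<^sub>A a) \<eta> : Hom L P0 A"
     by (rule Hom_comp[OF \<eta>(1) hom_from_reg[OF LA a] P0m(2)])
    moreover have "mk \<chi> a = compose (carrier P1) (compose (carrier P0) (\<lambda>b\<in>carrier L. b *\<^sub>A a) \<eta>) d"
     using Hom_cl[OF \<eta>(1)] Hom_cl[OF d] by (auto simp: mk_def \<eta>(2) compose_def intro!: restrict_ext)
    ultimately have "mk \<chi> a : N" unfolding N_def by blast
    then show ?thesis using X(2) \<chi>(1) by simp
   qed
   obtain c where c: "c : Hom R ?T J" "!!\<chi>. \<chi> : carrier ?s ==> c (\<theta> \<chi>) = (\<lambda>\<chi>\<in>carrier ?s. \<Xi> (mk \<chi> a)) \<chi>"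
    by (rule hom_factor_surj[OF Ls LT D.J O.restrict_hom[OF \<theta>] _ q]) (use \<theta>_onto ker that in auto)
   then show ?thesis by (intro bexI[of _ c]) auto
  qed
  then obtain \<alpha> where \<alpha>: "!!a. a : carrier A ==> \<alpha> a : carrier (dual R \<phi> J T)"
   "!!a \<chi>. a : carrier A ==> \<chi> : Hom L P1 (reg_mod L) ==> \<alpha> a (\<theta> \<chi>) = \<Xi> (mk \<chi> a)" by metis
  have \<theta>c: "\<theta> \<chi> : carrier T" if "\<chi> : Hom L P1 (reg_mod L)" for \<chi>
   using Hom_cl[OF \<theta>] that by simp
  have eqT: "c = c'" if "c : Hom R (rs \<phi> T) J" "c' : Hom R (rs \<phi> T) J"
   "!!\<chi>. \<chi> : Hom L P1 (reg_mod L) ==> c (\<theta> \<chi>) = c' (\<theta> \<chi>)" for c c'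
  proof (rule Hom_eqI[OF that(1,2)])
   fix t assume "t : carrier (rs \<phi> T)"
   then obtain \<chi> where "\<chi> : Hom L P1 (reg_mod L)" "t = \<theta> \<chi>" using \<theta>_onto by auto
   then show "c t = c' t" using that(3) by simp
  qed
  interpret DT: left_module L "dual R \<phi> J T"
   using artin_duality.lm_dual[OF artin_duality_opp[OF artin_duality_axioms] T] by simp
  \<comment> \<open>Letting \<open>a\<close> vary gives the homomorphism from \<open>A\<close> to
    the dual of \<open>T\<close> to which the extension hypothesis applies.\<close>
  have \<alpha>h: "restrict \<alpha> (carrier A) : Hom L A (dual R \<phi> J T)"
  proof (rule lmod_homI[OF LA \<alpha>(1)])
   fix a a' assume a: "a : carrier A" "a' : carrier A"
   show "\<alpha> (a +\<^sub>A a') = \<alpha> a \<oplus>\<^bsub>dual R \<phi> J T\<^esub> \<alpha> a'"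
   proof (rule eqT)
    show "\<alpha> a \<oplus>\<^bsub>dual R \<phi> J T\<^esub> \<alpha> a' : Hom R (rs \<phi> T) J"
     using DT.M.a_closed[OF \<alpha>(1)[OF a(1)] \<alpha>(1)[OF a(2)]] by simp
    fix \<chi> assume \<chi>: "\<chi> : Hom L P1 (reg_mod L)"
    have "mk \<chi> (a +\<^sub>A a') = mk \<chi> a \<oplus>\<^bsub>?H\<^esub> mk \<chi> a'"
     using \<chi> a by (auto simp: mk_def \<chi>c A.smult_r_distr intro!: restrict_ext)
    then show "\<alpha> (a +\<^sub>A a') (\<theta> \<chi>) = (\<alpha> a \<oplus>\<^bsub>dual R \<phi> J T\<^esub> \<alpha> a') (\<theta> \<chi>)"
     using Hom_add[OF X(1), of "mk \<chi> a" "mk \<chi> a'"] mk \<chi> a by (simp add: \<alpha>(2) \<theta>c)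
   qed (use \<alpha>(1)[of "a +\<^sub>A a'"] a in simp)
  next
   fix l a assume l: "l : carrier L" "a : carrier A"
   show "\<alpha> (l *\<^sub>A a) = l \<odot>\<^bsub>dual R \<phi> J T\<^esub> \<alpha> a"
   proof (rule eqT)
    show "l \<odot>\<^bsub>dual R \<phi> J T\<^esub> \<alpha> a : Hom R (rs \<phi> T) J"
     using DT.smult_closed[OF l(1) \<alpha>(1)[OF l(2)]] by simp
    fix \<chi> assume \<chi>: "\<chi> : Hom L P1 (reg_mod L)"
    have l\<chi>: "l \<odot>\<^bsub>star L P1\<^esub> \<chi> : Hom L P1 (reg_mod L)"
     using st.smult_closed[of l \<chi>] l(1) \<chi> by simp
    have "mk \<chi> (l *\<^sub>A a) = mk (l \<odot>\<^bsub>star L P1\<^esub> \<chi>) a"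
     using \<chi> l by (auto simp: mk_def \<chi>c A.smult_assoc intro!: restrict_ext)
    moreover have "l *\<^sub>T \<theta> \<chi> = \<theta> (l \<odot>\<^bsub>star L P1\<^esub> \<chi>)"
     using Hom_smult[OF \<theta>, of l \<chi>] l(1) \<chi> by simp
    ultimately show "\<alpha> (l *\<^sub>A a) (\<theta> \<chi>) = (l \<odot>\<^bsub>dual R \<phi> J T\<^esub> \<alpha> a) (\<theta> \<chi>)"
     using \<alpha>(2)[OF A.smult_closed[OF l] \<chi>] \<alpha>(2)[OF l(2) l\<chi>] \<theta>c[OF \<chi>] by simp
   qed (use \<alpha>(1)[OF A.smult_closed[OF l]] in simp)
  qed
  obtain \<beta> where \<beta>: "\<beta> : Hom L B (dual R \<phi> J T)" "!!a. a : carrier A ==> \<beta> (f a) = \<alpha> a"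
   using extendsE[OF extend \<alpha>h] by auto
  have \<beta>c: "\<beta> b t : carrier J" if "b : carrier B" "t : carrier T" for b t
   using Hom_cl[of "\<beta> b" R "rs \<phi> T" J t] Hom_cl[OF \<beta>(1) that(1)] that(2) by simp
  have \<beta>t: "\<beta> b : Hom R (rs \<phi> T) J" if "b : carrier B" for b
   using Hom_cl[OF \<beta>(1) that] by simp
  \<comment> \<open>The extension \<open>\<beta>\<close> paired with a map on \<open>P0\<close>,
    contracted over the dual basis of \<open>P1\<close>. At \<open>v0\<close> it computes
    \<open>\<Xi> w\<close>, because \<open>\<beta>\<close> extends \<open>\<alpha>\<close> and
    \<open>f w = v0 d\<close>.\<close>
  define \<Phi> where "\<Phi> h = (\<Oplus>\<^bsub>J\<^esub>k\<in>{..<n}. \<beta> (h (d (x k))) (\<theta> (\<xi> k)))" for h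
  have dx: "d (x k) : carrier P0" if "k < n" for k using Hom_cl[OF d B1(1)[OF that]] .
  have \<Phi>w: "\<Xi> w = \<Phi> v0"
  proof -
   have wx: "w (x k) : carrier A" if "k < n" for k using Hom_cl[OF w(1) B1(1)[OF that]] .
   have "w = (\<Oplus>\<^bsub>?H\<^esub>k\<in>{..<n}. mk (\<xi> k) (w (x k)))"
    using dual_basis_hom_mod[OF b1 P1m(2) LA w(1)] by (simp add: mk_def)
   then have "\<Xi> w = \<Xi> (\<Oplus>\<^bsub>?H\<^esub>k\<in>{..<n}. mk (\<xi> k) (w (x k)))" by simp
   also have "... = (\<Oplus>\<^bsub>J\<^esub>k\<in>{..<n}. \<Xi> (mk (\<xi> k) (w (x k))))"
    by (rule finsum_transport[OF H.M.abelian_monoid_axioms J.M.abelian_monoid_axioms])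
     (use Hom_cl[OF X(1)] Hom_add[OF X(1)] Hom_zero[OF H.lmod D.J X(1)] mk B1(2) wx in
      \<open>auto simp del: hom_mod_simps(2,3)\<close>)
   also have "... = \<Phi> v0" unfolding \<Phi>_def
   proof (rule J.M.finsum_cong')
    fix k assume "k : {..<n}"
    then have k: "k < n" by simp
    have "\<Xi> (mk (\<xi> k) (w (x k))) = \<beta> (f (w (x k))) (\<theta> (\<xi> k))" using \<alpha>(2)[OF wx[OF k] B1(2)[OF k]] \<beta>(2)[OF wx[OF k]] by simp
    then show "\<Xi> (mk (\<xi> k) (w (x k))) = \<beta> (v0 (d (x k))) (\<theta> (\<xi> k))" using w(2)[OF B1(1)[OF k]] B1(1)[OF k] by (simp add: compose_def)
   qed (use \<beta>c Hom_cl[OF v0(1)] dx \<theta>c B1(2) in auto)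
   finally show ?thesis .
  qed
  \<comment> \<open>On a map \<open>\<eta>\<close> times \<open>b\<close> the sum collapses to
    \<open>\<beta> b\<close> at \<open>\<theta>\<close> of \<open>\<eta> d\<close>, and
    \<open>\<theta>\<close> kills the forms that factor through \<open>d\<close>.\<close>
  have term0: "\<Phi> (\<lambda>p\<in>carrier P0. \<eta> p *\<^sub>B b) = 0\<^sub>J" if \<eta>: "\<eta> : Hom L P0 (reg_mod L)" and b: "b : carrier B" for \<eta> b
  proof -
   let ?c = "compose (carrier P1) \<eta> d"
   have c: "?c : Hom L P1 (reg_mod L)" by (rule Hom_comp[OF d \<eta> P1m(2)])
   have cx: "?c (x k) = \<eta> (d (x k))" "?c (x k) : carrier L" if "k < n" for k
    using B1(1)[OF that] \<chi>c[OF c B1(1)[OF that]] by (auto simp: compose_def)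
   have sc: "?c (x k) \<odot>\<^bsub>star L P1\<^esub> \<xi> k : Hom L P1 (reg_mod L)" if "k < n" for k
    using st.smult_closed[of "?c (x k)" "\<xi> k"] cx(2)[OF that] B1(2)[OF that] by (simp del: star_simps(4))
   have "\<Phi> (\<lambda>p\<in>carrier P0. \<eta> p *\<^sub>B b) = (\<Oplus>\<^bsub>J\<^esub>k\<in>{..<n}. \<beta> b (?c (x k) *\<^sub>T \<theta> (\<xi> k)))"
    unfolding \<Phi>_def
   proof (rule J.M.finsum_cong')
    fix k assume "k : {..<n}"
    then have k: "k < n" by simp
    show "\<beta> ((\<lambda>p\<in>carrier P0. \<eta> p *\<^sub>B b) (d (x k))) (\<theta> (\<xi> k)) = \<beta> b (?c (x k) *\<^sub>T \<theta> (\<xi> k))"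
     using dx[OF k] cx[OF k] b \<theta>c[OF B1(2)[OF k]] by (simp add: Hom_smult[OF \<beta>(1)])
   qed (use b cx \<theta>c B1(2) in \<open>auto intro!: \<beta>c T.smult_closed\<close>)
   also have "... = \<beta> b (\<Oplus>\<^bsub>T\<^esub>k\<in>{..<n}. ?c (x k) *\<^sub>T \<theta> (\<xi> k))"
    by (rule finsum_transport[OF T.M.abelian_monoid_axioms J.M.abelian_monoid_axioms, symmetric])
     (use Hom_cl[OF \<beta>t[OF b]] Hom_add[OF \<beta>t[OF b]]
      Hom_zero[OF O.lm_restrict[OF T] D.J \<beta>t[OF b]] cx \<theta>c B1(2) in \<open>auto intro!: T.smult_closed\<close>)
   also have "(\<Oplus>\<^bsub>T\<^esub>k\<in>{..<n}. ?c (x k) *\<^sub>T \<theta> (\<xi> k)) = (\<Oplus>\<^bsub>T\<^esub>k\<in>{..<n}. \<theta> (?c (x k) \<odot>\<^bsub>star L P1\<^esub> \<xi> k))"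
   proof (rule T.M.finsum_cong')
    fix k assume "k : {..<n}"
    then have k: "k < n" by simp
    show "?c (x k) *\<^sub>T \<theta> (\<xi> k) = \<theta> (?c (x k) \<odot>\<^bsub>star L P1\<^esub> \<xi> k)"
     using Hom_smult[OF \<theta>, of "?c (x k)" "\<xi> k"] cx(2)[OF k] B1(2)[OF k] by simp
   next
    show "(%k. \<theta> (?c (x k) \<odot>\<^bsub>star L P1\<^esub> \<xi> k)) : {..<n} \<rightarrow> carrier T"
     using sc \<theta>c by (auto simp del: star_simps(4))
   qed simp
   also have "... = \<theta> (\<Oplus>\<^bsub>star L P1\<^esub>k\<in>{..<n}. ?c (x k) \<odot>\<^bsub>star L P1\<^esub> \<xi> k)"
    by (rule finsum_transport[OF st.M.abelian_monoid_axioms T.M.abelian_monoid_axioms, symmetric])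
     (use Hom_cl[OF \<theta>] Hom_add[OF \<theta>] Hom_zero[OF st.lmod T \<theta>] sc in
      \<open>auto simp del: star_simps(2-4)\<close>)
   also have "... = \<theta> ?c" using dual_basis_star[OF b1 P1m(2) c] by simp
   also have "... = 0\<^sub>T"
   proof -
    have "?c : a_kernel (star L P1) T \<theta>" unfolding \<theta>_ker using \<eta> by auto
    then show ?thesis by (simp add: aker_eq)
   qed
   also have "\<beta> b 0\<^sub>T = 0\<^sub>J"
    using Hom_zero[OF O.lm_restrict[OF T] D.J \<beta>t[OF b]] by simp
   finally show ?thesis .
  qed
  \<comment> \<open>The dual basis of \<open>P0\<close> writes \<open>v0\<close> as a sum of maps of
    the kind just treated.\<close>
  have "\<Phi> v0 = 0\<^sub>J"
  proof -
   interpret HB: left_module R "hom_mod L \<phi> P0 B" by (rule lm_hom_mod[OF P0m(2) LB])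
   have vy: "v0 (y k) : carrier B" if "k < m" for k using Hom_cl[OF v0(1) B0(1)[OF that]] .
   have tm: "(\<lambda>p\<in>carrier P0. \<psi> k p *\<^sub>B v0 (y k)) : Hom L P0 B" if "k < m" for k
    using Hom_comp[OF B0(2)[OF that] hom_from_reg[OF LB vy[OF that]] P0m(2)]
    by (rule back_subst[of "%h. h : Hom L P0 B"]) (use B0(3)[OF that] in \<open>auto simp: compose_def\<close>)
   have bt: "\<beta> (h (d (x k))) (\<theta> (\<xi> k)) : carrier J" if "h : Hom L P0 B" "k < n" for h k
    using \<beta>c[OF Hom_cl[OF that(1) dx[OF that(2)]] \<theta>c[OF B1(2)[OF that(2)]]] .
   have "v0 = (\<Oplus>\<^bsub>hom_mod L \<phi> P0 B\<^esub>k\<in>{..<m}. (\<lambda>p\<in>carrier P0. \<psi> k p *\<^sub>B v0 (y k)))"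
    by (rule dual_basis_hom_mod[OF b0 P0m(2) LB v0(1)])
   then have "\<Phi> v0 = \<Phi> (\<Oplus>\<^bsub>hom_mod L \<phi> P0 B\<^esub>k\<in>{..<m}. (\<lambda>p\<in>carrier P0. \<psi> k p *\<^sub>B v0 (y k)))" by simp
   also have "... = (\<Oplus>\<^bsub>J\<^esub>k\<in>{..<m}. \<Phi> (\<lambda>p\<in>carrier P0. \<psi> k p *\<^sub>B v0 (y k)))"
   proof (rule finsum_transport[OF HB.M.abelian_monoid_axioms J.M.abelian_monoid_axioms])
    show "\<Phi> : carrier (hom_mod L \<phi> P0 B) \<rightarrow> carrier J"
     using bt by (auto simp: \<Phi>_def intro!: J.M.finsum_closed)
    fix h h' assume h: "h : carrier (hom_mod L \<phi> P0 B)" "h' : carrier (hom_mod L \<phi> P0 B)"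
    have "\<Phi> (h \<oplus>\<^bsub>hom_mod L \<phi> P0 B\<^esub> h') = (\<Oplus>\<^bsub>J\<^esub>k\<in>{..<n}. \<beta> (h (d (x k))) (\<theta> (\<xi> k)) +\<^sub>J \<beta> (h' (d (x k))) (\<theta> (\<xi> k)))"
     unfolding \<Phi>_def
    proof (rule J.M.finsum_cong')
     fix k assume "k : {..<n}"
     then have k: "k < n" by simp
     show "\<beta> ((h \<oplus>\<^bsub>hom_mod L \<phi> P0 B\<^esub> h') (d (x k))) (\<theta> (\<xi> k)) = \<beta> (h (d (x k))) (\<theta> (\<xi> k)) +\<^sub>J \<beta> (h' (d (x k))) (\<theta> (\<xi> k))"
      using h dx[OF k] Hom_cl[of h L P0 B "d (x k)"] Hom_cl[of h' L P0 B "d (x k)"] \<theta>c[OF B1(2)[OF k]]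
      by (simp add: Hom_add[OF \<beta>(1)])
    qed (use bt h in auto)
    also have "... = \<Phi> h +\<^sub>J \<Phi> h'"
     unfolding \<Phi>_def by (rule J.M.finsum_addf) (use bt h in auto)
    finally show "\<Phi> (h \<oplus>\<^bsub>hom_mod L \<phi> P0 B\<^esub> h') = \<Phi> h +\<^sub>J \<Phi> h'" .
   next
    have "\<beta> 0\<^sub>B = \<zero>\<^bsub>dual R \<phi> J T\<^esub>" by (rule Hom_zero[OF LB DT.lmod \<beta>(1)])
    then have "\<beta> 0\<^sub>B (\<theta> (\<xi> k)) = 0\<^sub>J" if "k < n" for k using \<theta>c[OF B1(2)[OF that]] by simp
    then show "\<Phi> \<zero>\<^bsub>hom_mod L \<phi> P0 B\<^esub> = 0\<^sub>J"
     unfolding \<Phi>_def using dx by (intro J.M.add.finprod_one_eqI) simp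
   qed (use tm in \<open>auto simp del: restrict_apply\<close>)
   also have "... = 0\<^sub>J" by (rule J.M.add.finprod_one_eqI) (use term0 B0(2) vy in auto)
   finally show ?thesis .
  qed
  then show False using X(3) \<Phi>w by simp
 qed
 then obtain h where h: "h : Hom L P0 A" "w = compose (carrier P1) h d" unfolding N_def by blast
 \<comment> \<open>Subtracting \<open>f h\<close> makes the lift vanish on the image of
   \<open>d\<close> without changing its composite with \<open>g\<close>.\<close>
 let ?v = "\<lambda>p\<in>carrier P0. v0 p \<ominus>\<^sub>B compose (carrier P0) f h p"
 have v1: "?v : Hom L P0 B" by (rule Hom_diff[OF P0m(2) LB v0(1) Hom_comp[OF h(1) S(1) P0m(2)]])
 obtain v where v: "v : Hom L Z B" "!!p. p : carrier P0 ==> v (e p) = ?v p"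
 proof (rule hom_factor_surj[OF P0m(2) Z LB e ex(1) v1])
  fix p assume p: "p : carrier P0" "e p = 0\<^sub>Z"
  then have "p : d ` carrier P1" unfolding ex(2) by (simp add: aker_eq)
  then obtain q where q: "q : carrier P1" "p = d q" by blast
  have "f (h (d q)) = v0 (d q)" using w(2)[OF q(1)] q(1) by (simp add: h(2) compose_def)
  then show "?v p = 0\<^sub>B" using q p(1) Hom_cl[OF v0(1) p(1)]
   by (simp add: compose_def B.minus_0_iff)
 qed (rule that)
 show "EX v:Hom L Z B. ALL z:carrier Z. g (v z) = u z"
 proof (intro bexI[OF _ v(1)] ballI)
  fix z assume "z : carrier Z"
  then obtain p where p: "p : carrier P0" "z = e p" using ex(1) by blast
  have hp: "h p : carrier A" "v0 p : carrier B" "f (h p) : carrier B" "u (e p) : carrier C"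
   using Hom_cl[OF h(1) p(1)] Hom_cl[OF v0(1) p(1)] Hom_cl[OF S(1)]
    Hom_cl[OF u Hom_cl[OF e p(1)]] by auto
  have "g (v z) = g (v0 p \<ominus>\<^sub>B f (h p))" using v(2)[OF p(1)] p by (simp add: compose_def)
  also have "... = g (v0 p) \<ominus>\<^sub>C 0\<^sub>C" using hp by (simp add: Hom_minus[OF LB LC S(2)] S(6))
  also have "... = u (e p)" using v0(2)[OF p(1)] p(1) hp(4) C.add_minus(3)[of "u (e p)" "0\<^sub>C"] by (simp add: compose_def)
  finally show "g (v z) = u z" using p(2) by simp
 qed
qed

end

section \<open>The defect formulas for \<open>\<tau>\<close> and its inverse\<close>

context artin_duality
begin

lemma star_map: assumes "left_module L P0" "left_module L P1" "d : Hom L P1 P0"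
 shows "(\<lambda>f\<in>carrier (star L P0). compose (carrier P1) f d) : Hom (opp L) (star L P0) (star L P1)"
proof (rule lmod_homI[OF lm_star[OF assms(1)]])
 note cl = Hom_cl[OF assms(3)]
 show "compose (carrier P1) f d : carrier (star L P1)" if "f : carrier (star L P0)" for f
  using Hom_comp[OF assms(3) _ assms(2)] that by simp
qed (use Hom_cl[OF assms(3)] in \<open>auto simp: compose_def intro!: restrict_ext\<close>)

text \<open>Turns the transpose into a surjection \<open>\<theta>\<close> with known kernel, the
  form in which the defect argument takes it.\<close>

lemma transposeE:
 assumes tr: "is_transpose L Z T" and Z: "left_module L Z" and T: "left_module (opp L) T"
 obtains P0 P1 d e \<theta> where "proj_mod L P0" "proj_mod L P1" "d : Hom L P1 P0"
  "e : Hom L P0 Z" "e ` carrier P0 = carrier Z" "d ` carrier P1 = a_kernel P0 Z e"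
  "\<theta> : Hom (opp L) (star L P1) T" "\<theta> ` carrier (star L P1) = carrier T"
  "a_kernel (star L P1) T \<theta> = (%f. compose (carrier P1) f d) ` carrier (star L P0)"
proof -
 obtain P1 d P0 e where mp: "minimal_presentation L P1 d P0 e Z"
  and iso: "mod_iso (opp L) T (quot_mod (star L P1) ((%f. compose (carrier P1) f d) ` carrier (star L P0)))"
  using tr unfolding is_transpose_def by blast
 have P: "proj_mod L P0" "proj_mod L P1" "e : Hom L P0 Z" "e ` carrier P0 = carrier Z"
  "d : Hom L P1 (sub_mod P0 (a_kernel P0 Z e))" "d ` carrier P1 = a_kernel P0 Z e"
  using mp by (auto simp: minimal_presentation_def projective_cover_def)
 have L: "left_module L P0" "left_module L P1" using P by (auto simp: projective_mod_def fg_modD)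
 have d: "d : Hom L P1 P0" by (rule Hom_from_sub[OF P(5) subm_kernel[OF L(1) Z P(3)]])
 let ?N = "(%f. compose (carrier P1) f d) ` carrier (star L P0)" and ?s = "star L P1"
 have s: "left_module (opp L) ?s" by (rule lm_star[OF L(2)])
 have N: "submodule ?N (opp L) ?s" using subm_range[OF lm_star[OF L(1)] s star_map[OF L d]] by simp
 obtain \<theta> where "\<theta> : Hom (opp L) ?s T" "\<theta> ` carrier ?s = carrier T" "a_kernel ?s T \<theta> = ?N"
  by (rule quot_mod_isoE[OF s N T iso])
 then show ?thesis by (rule that[OF P(1,2) d P(3,4,6)])
qed

lemma transpose_lifts: assumes "is_transpose L Z T" "left_module L Z" "left_module (opp L) T"
  and "A : fg_mod L" "B : fg_mod L" "C : fg_mod L" "short_exact L A f B g C"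
  and "extends L A f B (dual R \<phi> J T)" shows "lifts L Z B g C"
 by (rule transposeE[OF assms(1-3)], rule transpose_defect[OF _ _ _ assms(2) _ _ _ assms(3) _ _ _ assms(4-)]) assumption+

lemma tau_defect: assumes tau: "is_tau R \<phi> J L Z Y" and Z: "Z : modules L" and Y: "Y : modules L"
  and A: "A : modules L" and B: "B : modules L" and C: "C : modules L"
  and ses: "short_exact L A f B g C" and extend: "extends L A f B Y" shows "lifts L Z B g C"
proof -
 obtain T where T: "T : modules (opp L)" and tr: "is_transpose L Z T" and iso: "mod_iso L Y (dual R \<phi> J T)"
  using tau unfolding is_tau_def by blast
 note LZ = fg_modD(1)[OF Z] and LT = fg_modD(1)[OF T] and LY = fg_modD(1)[OF Y]
  and LA = fg_modD(1)[OF A] and LB = fg_modD(1)[OF B] and LC = fg_modD(1)[OF C]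
 have LD: "left_module L (dual R \<phi> J T)"
  using artin_duality.lm_dual[OF artin_duality_opp[OF artin_duality_axioms] LT] by simp
 obtain a b where ab: "a : Hom L Y (dual R \<phi> J T)" "b : Hom L (dual R \<phi> J T) Y"
  "!!x. x : carrier Y ==> b (a x) = x" "!!y. y : carrier (dual R \<phi> J T) ==> a (b y) = y"
  using mod_isoE[OF iso LY LD] by metis
 have ext: "extends L A f B (dual R \<phi> J T)"
  by (rule extends_retract[OF extend ab(2,1,4) LA LB]) (use short_exactD(1)[OF ses LB LC LA] Hom_cl in auto)
 show ?thesis by (rule transpose_lifts[OF tr LZ LT A B C ses ext])
qed

lemma dual_map: assumes "left_module L A" "left_module L B" "f : Hom L A B"
 shows "(\<lambda>\<xi>\<in>carrier (dual R \<phi> J B). compose (carrier A) \<xi> f) : Hom (opp L) (dual R \<phi> J B) (dual R \<phi> J A)"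
proof (rule lmod_homI[OF lm_dual[OF assms(2)]])
 note cl = Hom_cl[OF assms(3)]
 show "compose (carrier A) \<xi> f : carrier (dual R \<phi> J A)" if "\<xi> : carrier (dual R \<phi> J B)" for \<xi>
  using Hom_comp[OF restrict_hom[OF assms(3)] _ lm_restrict[OF assms(1)]] that by simp
qed (use Hom_cl[OF assms(3)] left_module.smult_closed[OF assms(1)] Hom_smult[OF assms(3)] in
  \<open>auto simp: compose_def intro!: restrict_ext\<close>)

text \<open>Exactness of the duality at this place is injectivity of \<open>J\<close> over
  \<open>R\<close>.\<close>

lemma dual_map_surj:
 assumes A: "A : fg_mod L" and B: "B : fg_mod L" and f: "f : Hom L A B" "inj_on f (carrier A)"
 shows "(\<lambda>\<xi>\<in>carrier (dual R \<phi> J B). compose (carrier A) \<xi> f) ` carrier (dual R \<phi> J B) = carrier (dual R \<phi> J A)"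
  (is "?f ` _ = _")
proof -
 have fm: "?f : Hom (opp L) (dual R \<phi> J B) (dual R \<phi> J A)" by (rule dual_map[OF fg_modD(1)[OF A] fg_modD(1)[OF B] f(1)])
 have "\<eta> : ?f ` carrier (dual R \<phi> J B)" if "\<eta> : carrier (dual R \<phi> J A)" for \<eta>
 proof -
  have \<eta>: "\<eta> : Hom R (rs \<phi> A) J" using that by simp
  obtain \<xi> where \<xi>: "\<xi> : Hom R (rs \<phi> B) J" "!!x. x : carrier (rs \<phi> A) ==> \<xi> (f x) = \<eta> x"
   by (rule inj_mod_extend[OF D.J_injective fg_restrict[OF A] fg_restrict[OF B] restrict_hom[OF f(1)] _ \<eta>])
    (use f(2) that in auto)
  have "?f \<xi> = \<eta>"
  proof (rule Hom_eqI[OF _ \<eta>])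
   show "?f \<xi> : Hom R (rs \<phi> A) J" using Hom_cl[OF fm, of \<xi>] \<xi>(1) by simp
  qed (use \<xi> in \<open>simp add: compose_def\<close>)
  then show ?thesis using \<xi>(1) by (intro image_eqI[of _ _ \<xi>]) auto
 qed
 then show ?thesis using Hom_cl[OF fm] by blast
qed

lemma dual_short_exact:
 assumes A: "A : fg_mod L" and B: "B : fg_mod L" and C: "C : fg_mod L" and ses: "short_exact L A f B g C"
 shows "short_exact (opp L) (dual R \<phi> J C) (\<lambda>\<xi>\<in>carrier (dual R \<phi> J C). compose (carrier B) \<xi> g)
  (dual R \<phi> J B) (\<lambda>\<xi>\<in>carrier (dual R \<phi> J B). compose (carrier A) \<xi> f) (dual R \<phi> J A)"
 unfolding short_exact_def
proof (intro conjI)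
 note LA = fg_modD(1)[OF A] and LB = fg_modD(1)[OF B] and LC = fg_modD(1)[OF C]
 note S = short_exactD[OF ses LB LC LA]
 let ?DA = "dual R \<phi> J A" and ?DB = "dual R \<phi> J B" and ?DC = "dual R \<phi> J C"
 let ?g = "\<lambda>\<xi>\<in>carrier ?DC. compose (carrier B) \<xi> g" and ?f = "\<lambda>\<xi>\<in>carrier ?DB. compose (carrier A) \<xi> f"
 show gm: "?g : Hom (opp L) ?DC ?DB" and fm: "?f : Hom (opp L) ?DB ?DA"
  by (intro dual_map LA LB LC S)+
 have "\<xi> = \<xi>'" if "\<xi> : carrier ?DC" "\<xi>' : carrier ?DC" "?g \<xi> = ?g \<xi>'" for \<xi> \<xi>'
 proof (rule Hom_eqI[of _ R "rs \<phi> C" J])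
  fix c assume "c : carrier (rs \<phi> C)"
  then obtain b where "b : carrier B" "c = g b" using S(4) by auto
  then show "\<xi> c = \<xi>' c" using fun_cong[OF that(3), of b] that(1,2) by (simp add: compose_def)
 qed (use that in auto)
 then show "inj_on ?g (carrier ?DC)" by (rule inj_onI)
 show "?g ` carrier ?DC = a_kernel ?DB ?DA ?f"
 proof
  show "?g ` carrier ?DC <= a_kernel ?DB ?DA ?f"
  proof
   fix \<eta> assume "\<eta> : ?g ` carrier ?DC"
   then obtain \<xi> where \<xi>: "\<xi> : Hom R (rs \<phi> C) J" "\<eta> = compose (carrier B) \<xi> g" by auto
   have \<eta>: "\<eta> : carrier ?DB" using Hom_cl[OF gm, of \<xi>] \<xi> by simp
   have "\<xi> 0\<^sub>C = 0\<^sub>J" using Hom_zero[OF lm_restrict[OF LC] D.J \<xi>(1)] by simp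
   then have "?f \<eta> = \<zero>\<^bsub>?DA\<^esub>" using \<eta> \<xi>(2) Hom_cl[OF S(1)] by (auto simp: compose_def S(6) intro!: restrict_ext)
   then show "\<eta> : a_kernel ?DB ?DA ?f" using \<eta> unfolding aker_eq by blast
  qed
  show "a_kernel ?DB ?DA ?f <= ?g ` carrier ?DC"
  proof
   fix \<eta> assume "\<eta> : a_kernel ?DB ?DA ?f"
   then have \<eta>: "\<eta> : Hom R (rs \<phi> B) J" and z: "compose (carrier A) \<eta> f = (\<lambda>x\<in>carrier A. 0\<^sub>J)"
    by (auto simp: aker_eq)
   obtain \<xi> where \<xi>: "\<xi> : Hom R (rs \<phi> C) J" "!!x. x : carrier (rs \<phi> B) ==> \<xi> (g x) = \<eta> x"
   proof (rule hom_factor_surj[OF lm_restrict[OF LB] lm_restrict[OF LC] D.J restrict_hom[OF S(2)] _ \<eta>])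
    fix x assume "x : carrier (rs \<phi> B)" "g x = \<zero>\<^bsub>rs \<phi> C\<^esub>"
    then obtain a where "a : carrier A" "x = f a" using S(5)[of x] by auto
    then show "\<eta> x = 0\<^sub>J" using fun_cong[OF z, of a] by (simp add: compose_def)
   qed (use S(4) that in auto)
   have "?g \<xi> = \<eta>"
   proof (rule Hom_eqI[OF _ \<eta>])
    show "?g \<xi> : Hom R (rs \<phi> B) J" using Hom_cl[OF gm, of \<xi>] \<xi>(1) by simp
   qed (use \<xi> in \<open>simp add: compose_def\<close>)
   then show "\<eta> : ?g ` carrier ?DC" using \<xi>(1) by (intro image_eqI[of _ _ \<xi>]) auto
  qed
 qed
 show "?f ` carrier ?DB = carrier ?DA" by (rule dual_map_surj[OF A B S(1,3)])
qed

text \<open>The formula for the transpose is applied over the opposite ring to the dual sequence,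
  with the dual of \<open>X\<close> as its module; fullness of the duality translates the maps in
  both directions.\<close>

lemma tau_inv_defect:
 assumes tau: "is_tau_inv R \<phi> J L X Y" and X: "X : modules L" and Y: "Y : modules L"
  and A: "A : modules L" and B: "B : modules L" and C: "C : modules L"
  and ses: "short_exact L A f B g C" and lift: "lifts L Y B g C"
 shows "extends L A f B X" unfolding extends_def
proof
 fix u assume u: "u : Hom L A X"
 interpret O: artin_duality R "opp L" \<phi> J by (rule artin_duality_opp[OF artin_duality_axioms])
 note LX = fg_modD(1)[OF X] and LY = fg_modD(1)[OF Y]
  and LA = fg_modD(1)[OF A] and LB = fg_modD(1)[OF B] and LC = fg_modD(1)[OF C]
 note S = short_exactD[OF ses LB LC LA]
 let ?DA = "dual R \<phi> J A" and ?DB = "dual R \<phi> J B" and ?DC = "dual R \<phi> J C" and ?DX = "dual R \<phi> J X"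
 let ?g = "\<lambda>\<xi>\<in>carrier ?DC. compose (carrier B) \<xi> g" and ?f = "\<lambda>\<xi>\<in>carrier ?DB. compose (carrier A) \<xi> f"
 let ?u = "\<lambda>\<xi>\<in>carrier ?DX. compose (carrier A) \<xi> u"
 have tr: "is_transpose (opp L) ?DX Y" using tau by (simp add: is_tau_inv_def)
 have ext: "extends (opp L) ?DC ?g ?DB (dual R \<phi> J Y)" unfolding extends_def
 proof
  fix \<alpha> assume \<alpha>: "\<alpha> : Hom (opp L) ?DC (dual R \<phi> J Y)"
  obtain \<rho> where \<rho>: "\<rho> : Hom L Y C" "!!\<xi> y. \<xi> : Hom R (rs \<phi> C) J ==> y : carrier Y ==> \<alpha> \<xi> y = \<xi> (\<rho> y)"
   using dual_adjoint[OF C LY \<alpha>] by metis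
  obtain \<sigma> where \<sigma>: "\<sigma> : Hom L Y B" "!!y. y : carrier Y ==> g (\<sigma> y) = \<rho> y" using liftsE[OF lift \<rho>(1)] by metis
  let ?\<beta> = "\<lambda>\<xi>\<in>carrier ?DB. compose (carrier Y) \<xi> \<sigma>"
  have "?\<beta> (?g \<xi>) = \<alpha> \<xi>" if \<xi>: "\<xi> : carrier ?DC" for \<xi>
  proof (rule Hom_eqI[of _ R "rs \<phi> Y" J _ J])
   have gx: "?g \<xi> : carrier ?DB" by (rule Hom_cl[OF dual_map[OF LB LC S(2)] \<xi>])
   show "?\<beta> (?g \<xi>) : Hom R (rs \<phi> Y) J" using Hom_cl[OF dual_map[OF LY LB \<sigma>(1)] gx] by simp
   show "\<alpha> \<xi> : Hom R (rs \<phi> Y) J" using Hom_cl[OF \<alpha> \<xi>] by simp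
   show "?\<beta> (?g \<xi>) y = \<alpha> \<xi> y" if "y : carrier (rs \<phi> Y)" for y
    using that \<xi> gx Hom_cl[OF \<sigma>(1)] by (simp add: compose_def \<sigma>(2) \<rho>(2))
  qed
  then show "EX \<beta>:Hom (opp L) ?DB (dual R \<phi> J Y). ALL \<xi>:carrier ?DC. \<beta> (?g \<xi>) = \<alpha> \<xi>"
   using dual_map[OF LY LB \<sigma>(1)] by blast
 qed
 have LDX: "left_module (opp L) ?DX" by (rule lm_dual[OF LX])
 have "left_module (opp (opp L)) Y" using LY by simp
 from O.transpose_lifts[OF tr LDX this dual_fg[OF C] dual_fg[OF B] dual_fg[OF A] dual_short_exact[OF A B C ses] ext]
 obtain t where t: "t : Hom (opp L) ?DX ?DB" "!!\<xi>. \<xi> : carrier ?DX ==> ?f (t \<xi>) = ?u \<xi>"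
  by (rule liftsE[OF _ dual_map[OF LA LX u]]) (rule that)
 obtain v where v: "v : Hom L B X" "!!\<xi> b. \<xi> : Hom R (rs \<phi> X) J ==> b : carrier B ==> t \<xi> b = \<xi> (v b)"
  using dual_adjoint[OF X LB t(1)] by metis
 show "EX v:Hom L B X. ALL a:carrier A. v (f a) = u a"
 proof (intro bexI[OF _ v(1)] ballI)
  fix a assume a: "a : carrier A"
  show "v (f a) = u a"
  proof (rule dual_eqI[OF X])
   fix \<xi> assume \<xi>: "\<xi> : Hom R (rs \<phi> X) J"
   have "\<xi> (v (f a)) = t \<xi> (f a)" using v(2)[OF \<xi>] Hom_cl[OF S(1) a] by simp
   also have "... = ?f (t \<xi>) a" using Hom_cl[OF t(1), of \<xi>] \<xi> a by (simp add: compose_def)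
   also have "... = \<xi> (u a)" using t(2)[of \<xi>] \<xi> a by (simp add: compose_def)
   finally show "\<xi> (v (f a)) = \<xi> (u a)" .
  qed (use Hom_cl[OF v(1)] Hom_cl[OF S(1)] Hom_cl[OF u] a in auto)
 qed
qed

text \<open>Finite generation of the right module \<open>star\<close> of \<open>P1\<close> comes
  from finite length over \<open>R\<close>, where it agrees with the module of homomorphisms from
  \<open>P1\<close> to the regular module.\<close>

lemma transpose_exists: assumes Z: "Z : fg_mod L"
 obtains T where "T : modules (opp L)" "is_transpose L Z T"
proof -
 interpret O: artin_algebra R "opp L" \<phi> by (rule artin_algebra_opp) unfold_locales
 note LZ = fg_modD(1)[OF Z]
 obtain P0 e where c0: "projective_cover L P0 e Z" using LA.projective_cover_exists[OF Z] by metis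
 then have P0: "P0 : modules L" "e : Hom L P0 Z" by (auto simp: projective_cover_def projective_mod_def)
 note L0 = fg_modD(1)[OF P0(1)]
 have K: "submodule (a_kernel P0 Z e) L P0" by (rule subm_kernel[OF L0 LZ P0(2)])
 obtain P1 d where c1: "projective_cover L P1 d (sub_mod P0 (a_kernel P0 Z e))"
  using LA.projective_cover_exists[OF LA.fg_mod_sub[OF P0(1) K]] by metis
 then have P1: "P1 : modules L" "d : Hom L P1 (sub_mod P0 (a_kernel P0 Z e))" by (auto simp: projective_cover_def projective_mod_def)
 note L1 = fg_modD(1)[OF P1(1)]
 have d: "d : Hom L P1 P0" by (rule Hom_from_sub[OF P1(2) K])
 let ?s = "star L P1"
 have s: "left_module (opp L) ?s" by (rule lm_star[OF L1])
 have LH: "left_module R (hom_mod L \<phi> P1 (reg_mod L))"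
  by (rule lm_hom_mod[OF L1 fg_modD(1)[OF LA.fg_mod_reg]])
 have Ls: "left_module R (rs \<phi> ?s)" by (rule O.lm_restrict[OF s])
 have "restrict (%f. f) (carrier (rs \<phi> ?s)) : Hom R (rs \<phi> ?s) (hom_mod L \<phi> P1 (reg_mod L))"
  by (rule lmod_homI[OF Ls]) (use Hom_cl[of _ L P1 "reg_mod L"] central in \<open>auto intro!: restrict_ext\<close>)
 then have "finlen R (rs \<phi> ?s)" by (rule finlen_inj[OF Ls LH])
   (use hom_mod_fg[OF P1(1) LA.fg_mod_reg] in \<open>auto simp: RA.fg_mod_iff inj_on_def\<close>)
 then have sfg: "?s : fg_mod (opp L)" using O.finlen_restrict[OF s] s by (simp add: O.LA.fg_mod_iff)
 let ?N = "(%f. compose (carrier P1) f d) ` carrier (star L P0)"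
 have N: "submodule ?N (opp L) ?s" using subm_range[OF lm_star[OF L0] s star_map[OF L0 L1 d]] by simp
 have Q: "quot_mod ?s ?N : fg_mod (opp L)" by (rule O.LA.fg_mod_quot[OF sfg N])
 then obtain T where T: "T : modules (opp L)" "mod_iso (opp L) (quot_mod ?s ?N) T" using modules_universal by blast
 have "mod_iso (opp L) T (quot_mod ?s ?N)" by (rule mod_iso_sym[OF T(2) fg_modD(1)[OF Q] fg_modD(1)[OF T(1)]])
 moreover have "minimal_presentation L P1 d P0 e Z" using c0 c1 by (simp add: minimal_presentation_def)
 ultimately show ?thesis using that T(1) unfolding is_transpose_def by blast
qed

lemma tau_exists: assumes "Z : modules L"
 obtains Y where "Y : modules L" "is_tau R \<phi> J L Z Y"
proof -
 obtain T where T: "T : modules (opp L)" "is_transpose L Z T" using transpose_exists[OF assms] by metis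
 have D: "dual R \<phi> J T : fg_mod L"
  using artin_duality.dual_fg[OF artin_duality_opp[OF artin_duality_axioms] T(1)] by simp
 then obtain Y where Y: "Y : modules L" "mod_iso L (dual R \<phi> J T) Y" using modules_universal by blast
 then have "mod_iso L Y (dual R \<phi> J T)" using mod_iso_sym D fg_modD(1) by metis
 then show ?thesis using that Y(1) T unfolding is_tau_def by blast
qed

lemma tau_inv_exists: assumes "X : modules L"
 obtains Y where "Y : modules L" "is_tau_inv R \<phi> J L X Y"
 using artin_duality.transpose_exists[OF artin_duality_opp[OF artin_duality_axioms] dual_fg[OF assms]] that
 unfolding is_tau_inv_def by (metis opp_opp)

end

section \<open>Vanishing of extension groups\<close>

lemma Hom_comp_ex: assumes "left_module L V" "f : Hom L V M" "g : Hom L M N"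
 obtains h where "h : Hom L V N" "!!x. x : carrier V ==> h x = g (f x)"
 using that[OF Hom_comp[OF assms(2,3,1)]] by (simp add: compose_def)

lemma Hom_diff_ex: assumes "left_module L M" "left_module L N" "f : Hom L M N" "g : Hom L M N"
 obtains h where "h : Hom L M N" "!!x. x : carrier M ==> h x = f x \<ominus>\<^sub>N g x"
 using that[OF Hom_diff[OF assms]] by simp

lemma Hom_plus_ex: assumes "left_module L M" "left_module L N" "f : Hom L M N" "g : Hom L M N"
 obtains h where "h : Hom L M N" "!!x. x : carrier M ==> h x = f x +\<^sub>N g x"
 using that[OF Hom_plus[OF assms]] by simp

definition ses :: "'a ring => 'a fgm => ('a list => 'a list) => 'a fgm => ('a list => 'a list) => 'a fgm => bool" where
 "ses L A f B g C <-> A : modules L & B : modules L & C : modules L & short_exact L A f B g C"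

lemma sesD: assumes "ses L A f B g C" shows "A : modules L" "B : modules L" "C : modules L"
  "left_module L A" "left_module L B" "left_module L C"
  "f : Hom L A B" "g : Hom L B C" "inj_on f (carrier A)" "g ` carrier B = carrier C"
  "!!a. a : carrier A ==> f a : carrier B" "!!b. b : carrier B ==> g b : carrier C"
  "!!a. a : carrier A ==> g (f a) = 0\<^sub>C"
 using assms short_exactD[of L A f B g C] Hom_cl[of f L A B] Hom_cl[of g L B C]
 by (auto simp: ses_def fg_modD)

lemma ses_surjE: assumes "ses L A f B g C" "c : carrier C"
 obtains b where "b : carrier B" "g b = c" using sesD(10)[OF assms(1)] assms(2) by (metis imageE)

lemma ses_sub:
 assumes "ses L A f B g C" "left_module L X" "u : Hom L X B" "!!x. x : carrier X ==> g (u x) = 0\<^sub>C"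
 obtains w where "w : Hom L X A" "!!x. x : carrier X ==> f (w x) = u x"
 using short_exact_factor_sub[OF _ sesD(4,5,6)[OF assms(1)] assms(2,3)] assms(1,4) unfolding ses_def by metis

lemma ses_quot:
 assumes "ses L A f B g C" "left_module L X" "u : Hom L B X" "!!x. x : carrier A ==> u (f x) = 0\<^sub>X"
 obtains w where "w : Hom L C X" "!!x. x : carrier B ==> w (g x) = u x"
 using short_exact_factor_quot[OF _ sesD(4,5,6)[OF assms(1)] assms(2,3)] assms(1,4) unfolding ses_def by metis

lemma injective_extends: assumes "inj_mod L I" "ses L A f B g C" shows "extends L A f B I"
 unfolding extends_def using inj_mod_extend[OF assms(1) sesD(1,2,7,9)[OF assms(2)]] by metis

lemma projective_lifts: assumes "proj_mod L P" "ses L A f B g C" shows "lifts L P B g C"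
 unfolding lifts_def using proj_mod_lift[OF assms(1) sesD(2,3,8,10)[OF assms(2)]] by metis

text \<open>A chase for dimension shifting: lift \<open>h g\<close> to \<open>q\<close>, restrict it
  to a map from \<open>A\<close> to \<open>A'\<close>, extend that to \<open>w\<close> on
  \<open>B\<close>, and let \<open>q - f' w\<close> descend to \<open>D\<close>. With
  \<open>B\<close> projective only the extension problem remains as a hypothesis.\<close>

lemma lifts_ladder: assumes S: "ses L A f B g D" and T: "ses L A' f' B' g' D'"
  and l: "lifts L B B' g' D'" and e: "extends L A f B A'"
 shows "lifts L D B' g' D'" unfolding lifts_def
proof
 fix h assume h: "h : Hom L D D'"
 note s = sesD[OF S] and t = sesD[OF T]
 interpret B': left_module L B' by (rule t)
 interpret D': left_module L D' by (rule t)
 obtain hg where hg: "hg : Hom L B D'" "!!x. x : carrier B ==> hg x = h (g x)"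
  by (rule Hom_comp_ex[OF s(5,8) h]) (rule that)
 obtain q where q: "q : Hom L B B'" "!!x. x : carrier B ==> g' (q x) = hg x"
  using liftsE[OF l hg(1)] by metis
 obtain qf where qf: "qf : Hom L A B'" "!!x. x : carrier A ==> qf x = q (f x)"
  by (rule Hom_comp_ex[OF s(4,7) q(1)]) (rule that)
 obtain k where k: "k : Hom L A A'" "!!x. x : carrier A ==> f' (k x) = qf x"
  by (rule ses_sub[OF T s(4) qf(1)])
   (use qf(2) q(2) hg(2) s(11,13) Hom_zero[OF s(6) t(6) h] that in auto)
 obtain w where w: "w : Hom L B A'" "!!x. x : carrier A ==> w (f x) = k x"
  using extendsE[OF e k(1)] by metis
 obtain fw where fw: "fw : Hom L B B'" "!!x. x : carrier B ==> fw x = f' (w x)"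
  by (rule Hom_comp_ex[OF s(5) w(1) t(7)]) (rule that)
 obtain r where r: "r : Hom L B B'" "!!x. x : carrier B ==> r x = q x \<ominus>\<^sub>B' fw x"
  by (rule Hom_diff_ex[OF s(5) t(5) q(1) fw(1)]) (rule that)
 note cl = Hom_cl[OF q(1)] Hom_cl[OF w(1)] Hom_cl[OF h]
 obtain v where v: "v : Hom L D B'" "!!x. x : carrier B ==> v (g x) = r x"
  by (rule ses_quot[OF S t(5) r(1)])
   (use r(2) fw(2) w(2) k(2) qf(2) s(11) cl in \<open>auto simp: B'.minus_0_iff intro: that\<close>)
 have "g' (v x) = h x" if x: "x : carrier D" for x
 proof -
  obtain y where y: "y : carrier B" "g y = x" using ses_surjE[OF S x] by metis
  have "g' (v (g y)) = g' (q y) \<ominus>\<^sub>D' g' (f' (w y))"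
   using y(1) cl t(11) by (simp add: v(2) r(2) fw(2) Hom_minus[OF t(5,6,8)])
  also have "... = h (g y)"
   using y(1) cl t(13) s(12) q(2) hg(2) D'.add_minus(3)[of "h (g y)" "0\<^sub>D'"] by simp
  finally show ?thesis using y(2) by simp
 qed
 then show "EX v:Hom L D B'. ALL x:carrier D. g' (v x) = h x" using v(1) by blast
qed

text \<open>The reverse chase: extend \<open>f' u\<close> to \<open>w\<close> on \<open>B\<close>,
  lift the induced map from \<open>D\<close> to \<open>D'\<close> to \<open>k\<close>, and
  \<open>w - k g\<close> lands in \<open>A'\<close>. With \<open>B'\<close> injective only the
  lifting problem remains.\<close>

lemma extends_ladder: assumes S: "ses L A f B g D" and T: "ses L A' f' B' g' D'"
  and e: "extends L A f B B'" and l: "lifts L D B' g' D'"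
 shows "extends L A f B A'" unfolding extends_def
proof
 fix u assume u: "u : Hom L A A'"
 note s = sesD[OF S] and t = sesD[OF T]
 interpret B': left_module L B' by (rule t)
 interpret D': left_module L D' by (rule t)
 obtain fu where fu: "fu : Hom L A B'" "!!x. x : carrier A ==> fu x = f' (u x)"
  by (rule Hom_comp_ex[OF s(4) u t(7)]) (rule that)
 obtain w where w: "w : Hom L B B'" "!!x. x : carrier A ==> w (f x) = fu x"
  using extendsE[OF e fu(1)] by metis
 obtain gw where gw: "gw : Hom L B D'" "!!x. x : carrier B ==> gw x = g' (w x)"
  by (rule Hom_comp_ex[OF s(5) w(1) t(8)]) (rule that)
 note clu = Hom_cl[OF u] and clw = Hom_cl[OF w(1)]
 obtain h where h: "h : Hom L D D'" "!!x. x : carrier B ==> h (g x) = gw x"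
  by (rule ses_quot[OF S t(6) gw(1)]) (use gw(2) w(2) fu(2) s(11) clu t(13) that in auto)
 obtain k where k: "k : Hom L D B'" "!!x. x : carrier D ==> g' (k x) = h x"
  using liftsE[OF l h(1)] by metis
 obtain kg where kg: "kg : Hom L B B'" "!!x. x : carrier B ==> kg x = k (g x)"
  by (rule Hom_comp_ex[OF s(5,8) k(1)]) (rule that)
 obtain r where r: "r : Hom L B B'" "!!x. x : carrier B ==> r x = w x \<ominus>\<^sub>B' kg x"
  by (rule Hom_diff_ex[OF s(5) t(5) w(1) kg(1)]) (rule that)
 have "g' (r x) = 0\<^sub>D'" if "x : carrier B" for x
  using that clw[OF that] Hom_cl[OF k(1) s(12)[OF that]] k(2)[OF s(12)[OF that]] h(2)[OF that] gw(2)[OF that] t(12)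
  by (simp add: r(2) kg(2) Hom_minus[OF t(5,6,8)] D'.minus_0_iff)
 then obtain v where v: "v : Hom L B A'" "!!x. x : carrier B ==> f' (v x) = r x"
  using ses_sub[OF T s(5) r(1)] by metis
 have "v (f a) = u a" if a: "a : carrier A" for a
 proof (rule inj_onD[OF t(9)])
  have "k (g (f a)) = 0\<^sub>B'" using s(13)[OF a] Hom_zero[OF s(6) t(5) k(1)] by simp
  then show "f' (v (f a)) = f' (u a)"
   using s(11)[OF a] a w(2) fu(2) t(11)[OF clu[OF a]] B'.add_minus(3)[of "f' (u a)" "0\<^sub>B'"]
   by (simp add: v(2) r(2) kg(2))
 qed (use a clu Hom_cl[OF v(1)] s(11) in auto)
 then show "EX v:Hom L B A'. ALL a:carrier A. v (f a) = u a" using v(1) by blast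
qed

text \<open>Together with \<open>extends_right\<close> this compares the two ways in which maps from
  \<open>A\<close> to \<open>D'\<close> can be inessential: by factoring through \<open>B\<close> or
  by factoring through \<open>B'\<close>.\<close>

lemma lifts_left: assumes S: "ses L A f B g D" and T: "ses L A' f' B' g' D'"
  and e: "extends L A f B D'" and l: "lifts L B B' g' D'"
 shows "lifts L A B' g' D'" unfolding lifts_def
proof
 fix u assume "u : Hom L A D'"
 then obtain w where w: "w : Hom L B D'" "!!x. x : carrier A ==> w (f x) = u x"
  using extendsE[OF e] by metis
 obtain q where q: "q : Hom L B B'" "!!x. x : carrier B ==> g' (q x) = w x"
  using liftsE[OF l w(1)] by metis
 show "EX v:Hom L A B'. ALL x:carrier A. g' (v x) = u x"
  by (rule bexI[OF _ Hom_comp[OF sesD(7)[OF S] q(1) sesD(4)[OF S]]])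
   (simp add: compose_def q(2) w(2) sesD(11)[OF S])
qed

lemma extends_right: assumes S: "ses L A f B g D" and T: "ses L A' f' B' g' D'"
  and l: "lifts L A B' g' D'" and e: "extends L A f B B'"
 shows "extends L A f B D'" unfolding extends_def
proof
 fix u assume "u : Hom L A D'"
 then obtain w where w: "w : Hom L A B'" "!!x. x : carrier A ==> g' (w x) = u x"
  using liftsE[OF l] by metis
 obtain q where q: "q : Hom L B B'" "!!x. x : carrier A ==> q (f x) = w x"
  using extendsE[OF e w(1)] by metis
 show "EX v:Hom L B D'. ALL x:carrier A. v (f x) = u x"
  by (rule bexI[OF _ Hom_comp[OF q(1) sesD(8)[OF T] sesD(5)[OF S]]])
   (simp add: compose_def q(2) w(2) sesD(11)[OF S])
qed

text \<open>Exactness of Ext at the middle of the second argument, as a chase: extend after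
  projecting to \<open>D'\<close>, lift the extension to \<open>B'\<close>, and correct the
  difference by a map into \<open>A'\<close>.\<close>

lemma extends_middle: assumes S: "ses L A f B g D" and T: "ses L A' f' B' g' D'"
  and e: "extends L A f B A'" "extends L A f B D'" and l: "lifts L B B' g' D'"
 shows "extends L A f B B'" unfolding extends_def
proof
 fix u assume u: "u : Hom L A B'"
 note s = sesD[OF S] and t = sesD[OF T]
 interpret B': left_module L B' by (rule t)
 interpret D': left_module L D' by (rule t)
 obtain gu where gu: "gu : Hom L A D'" "!!x. x : carrier A ==> gu x = g' (u x)"
  by (rule Hom_comp_ex[OF s(4) u t(8)]) (rule that)
 obtain w where w: "w : Hom L B D'" "!!x. x : carrier A ==> w (f x) = gu x"
  using extendsE[OF e(2) gu(1)] by metis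
 obtain q where q: "q : Hom L B B'" "!!x. x : carrier B ==> g' (q x) = w x"
  using liftsE[OF l w(1)] by metis
 obtain qf where qf: "qf : Hom L A B'" "!!x. x : carrier A ==> qf x = q (f x)"
  by (rule Hom_comp_ex[OF s(4,7) q(1)]) (rule that)
 obtain r where r: "r : Hom L A B'" "!!x. x : carrier A ==> r x = u x \<ominus>\<^sub>B' qf x"
  by (rule Hom_diff_ex[OF s(4) t(5) u qf(1)]) (rule that)
 note cl = Hom_cl[OF u] Hom_cl[OF qf(1)]
 have "g' (r x) = 0\<^sub>D'" if "x : carrier A" for x
  using that cl[OF that] t(12) q(2) w(2) gu(2) qf(2) s(11)
  by (simp add: r(2) Hom_minus[OF t(5,6,8)] D'.minus_0_iff)
 then obtain k where k: "k : Hom L A A'" "!!x. x : carrier A ==> f' (k x) = r x"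
  using ses_sub[OF T s(4) r(1)] by metis
 obtain p where p: "p : Hom L B A'" "!!x. x : carrier A ==> p (f x) = k x"
  using extendsE[OF e(1) k(1)] by metis
 obtain fp where fp: "fp : Hom L B B'" "!!x. x : carrier B ==> fp x = f' (p x)"
  by (rule Hom_comp_ex[OF s(5) p(1) t(7)]) (rule that)
 obtain v where v: "v : Hom L B B'" "!!x. x : carrier B ==> v x = q x +\<^sub>B' fp x"
  by (rule Hom_plus_ex[OF s(5) t(5) q(1) fp(1)]) (rule that)
 have "v (f x) = u x" if "x : carrier A" for x
  using that cl[OF that] s(11) by (simp add: v(2) fp(2) p(2) k(2) r(2) flip: qf(2)) (simp add: B'.add_minus)
 then show "EX v:Hom L B B'. ALL a:carrier A. v (f a) = u a" using v(1) by blast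
qed

text \<open>Ext in degree one, tested on all sequences ending in \<open>X\<close>, so that no
  presentation has to be chosen; \<open>ext1_zeroI\<close> shows that a projective one
  decides.\<close>

definition ext1_zero :: "'a ring => 'a fgm => 'a fgm => bool" where
 "ext1_zero L X Y <-> (ALL A f B g. ses L A f B g X --> extends L A f B Y)"

lemma ext1_zeroD: "ext1_zero L X Y ==> ses L A f B g X ==> extends L A f B Y"
 unfolding ext1_zero_def by blast

text \<open>A syzygy with respect to any surjection from a projective module: vanishing of Ext does
  not see projective summands, and resolutions can then be cut into pieces freely.\<close>

definition syz :: "'a ring => 'a fgm => 'a fgm => bool" where
 "syz L X X' <-> (EX P f g. proj_mod L P & ses L X' f P g X)"

definition cosyz :: "'a ring => 'a fgm => 'a fgm => bool" where
 "cosyz L Y Y' <-> (EX I f g. inj_mod L I & ses L Y f I g Y')"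

lemma syzD: "syz L X X' ==> X : modules L & X' : modules L" by (auto simp: syz_def dest: sesD)

lemma cosyzD: "cosyz L Y Y' ==> Y : modules L & Y' : modules L" by (auto simp: cosyz_def dest: sesD)

text \<open>\<open>ext_zero L i X Y\<close> stands for the vanishing of \<open>Ext\<close> in degree \<open>i + 1\<close>.\<close>

primrec ext_zero :: "'a ring => nat => 'a fgm => 'a fgm => bool" where
 "ext_zero L 0 X Y = ext1_zero L X Y"
| "ext_zero L (Suc i) X Y = (ALL X'. syz L X X' --> ext_zero L i X' Y)"

context finlen_ring
begin

lemma ses_kernel: assumes "B : modules L" "C : modules L" "g : Hom L B C" "g ` carrier B = carrier C"
 shows "ses L (sub_mod B (a_kernel B C g)) (\<lambda>x\<in>a_kernel B C g. x) B g C"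
proof -
 note L = fg_modD(1)[OF assms(1)] fg_modD(1)[OF assms(2)]
 have K: "submodule (a_kernel B C g) L B" by (rule subm_kernel[OF L assms(3)])
 show ?thesis unfolding ses_def short_exact_def
  using assms fg_mod_sub[OF assms(1) K] sub_mod_incl[OF L(1) K] by (auto simp: inj_on_def)
qed

lemma ses_cokernel: assumes "A : modules L" "B : modules L" "f : Hom L A B" "inj_on f (carrier A)"
 obtains C g where "ses L A f B g C"
proof -
 note L = fg_modD(1)[OF assms(1)] fg_modD(1)[OF assms(2)]
 have N: "submodule (f ` carrier A) L B" by (rule subm_range[OF L assms(3)])
 have Q: "quot_mod B (f ` carrier A) : fg_mod L" by (rule fg_mod_quot[OF assms(2) N])
 then obtain C where C: "C : modules L" "mod_iso L (quot_mod B (f ` carrier A)) C" using modules_universal by blast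
 obtain g where "g : Hom L B C" "g ` carrier B = carrier C" "a_kernel B C g = f ` carrier A"
  by (rule quot_mod_isoE[OF L(2) N fg_modD(1)[OF C(1)] mod_iso_sym[OF C(2) fg_modD(1)[OF Q] fg_modD(1)[OF C(1)]]])
 then have "ses L A f B g C" unfolding ses_def short_exact_def using assms C(1) by simp
 then show ?thesis by (rule that)
qed

lemma ex_syz: assumes "X : modules L"
 obtains X' where "syz L X X'"
proof -
 obtain P e where "proj_mod L P" "e : Hom L P X" "e ` carrier P = carrier X"
  using enough_dual_bases[OF assms] by metis
 then show ?thesis using ses_kernel[of P X e] assms that unfolding syz_def projective_mod_def by blast
qed

end

context artin_duality
begin

text \<open>An injective module containing \<open>M\<close> is \<open>D P\<close> for a projective right module \<open>P\<close> mapping onto \<open>D M\<close>.\<close>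

lemma enough_injectives: assumes M: "M : modules L"
 obtains I i where "I : modules L" "inj_mod L I" "i : Hom L M I" "inj_on i (carrier M)"
proof -
 interpret O: artin_duality R "opp L" \<phi> J by (rule artin_duality_opp[OF artin_duality_axioms])
 note LM = fg_modD(1)[OF M]
 obtain P e where P: "proj_mod (opp L) P" "e : Hom (opp L) P (dual R \<phi> J M)" "e ` carrier P = carrier (dual R \<phi> J M)"
  using O.LA.enough_dual_bases[OF dual_fg[OF M]] by metis
 have Pm: "P : modules (opp L)" "left_module (opp L) P" using P(1) by (auto simp: projective_mod_def fg_modD)
 let ?D = "dual R \<phi> J P"
 have D: "?D : fg_mod L" using O.dual_fg[OF Pm(1)] by simp
 obtain I :: "'a fgm" and a b where I: "I : modules L" "a : Hom L ?D I" "b : Hom L I ?D"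
  "!!x. x : carrier ?D ==> b (a x) = x" "!!y. y : carrier I ==> a (b y) = y"
  by (rule modules_isoE[OF D]) (rule that)
 note LI = fg_modD(1)[OF I(1)]
 let ?e = "\<lambda>x\<in>carrier M. \<lambda>y\<in>carrier P. e y x"
 have e: "?e : Hom L M ?D" by (rule dual_flip[OF LM Pm(2) P(2)])
 have i: "compose (carrier M) a ?e : Hom L M I" by (rule Hom_comp[OF e I(2) LM])
 have "inj_on (compose (carrier M) a ?e) (carrier M)" unfolding inj_iff_ker[OF LM LI i]
 proof (intro ballI impI, rule ccontr)
  fix x assume x: "x : carrier M" "compose (carrier M) a ?e x = 0\<^sub>I" "x ~= 0\<^sub>M"
  obtain \<xi> where \<xi>: "\<xi> : Hom R (rs \<phi> M) J" "\<xi> x ~= 0\<^sub>J" using dual_separates[OF M x(1,3)] by metis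
  then obtain y where y: "y : carrier P" "\<xi> = e y" using P(3) by auto
  have "?e x = \<zero>\<^bsub>?D\<^esub>"
   using I(4)[OF Hom_cl[OF e x(1)]] x(1,2) Hom_zero[OF LI fg_modD(1)[OF D] I(3)] by (simp add: compose_def del: dual_simps)
  from fun_cong[OF this, of y] show False using x(1) y \<xi>(2) by simp
 qed
 moreover have "inj_mod L I" unfolding injective_mod_def
 proof (intro conjI ballI impI)
  fix A B :: "'a fgm" and g f assume *: "A : modules L" "B : modules L" "g : Hom L A B" "f : Hom L A I"
   "inj_on g (carrier A)"
  note L = fg_modD(1)[OF *(1)] fg_modD(1)[OF *(2)] and gc = Hom_cl[OF *(3)]
  \<comment> \<open>By exchange of arguments, extending a map into the dual of \<open>P\<close>
    along \<open>g\<close> is lifting a map from \<open>P\<close> along the dual of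
    \<open>g\<close>, which is surjective.\<close>
  have "extends L A g B ?D" unfolding extends_def
  proof
   fix u assume u: "u : Hom L A ?D"
   then have u': "u : Hom (opp (opp L)) A ?D" "left_module (opp (opp L)) A" using L by simp_all
   obtain h where h: "h : Hom (opp L) P (dual R \<phi> J B)"
    "!!p. p : carrier P ==> (\<lambda>\<xi>\<in>carrier (dual R \<phi> J B). compose (carrier A) \<xi> g) (h p) = (\<lambda>x\<in>carrier P. \<lambda>y\<in>carrier A. u y x) p"
    by (rule proj_mod_lift[OF P(1) dual_fg[OF *(2)] dual_fg[OF *(1)] dual_map[OF L *(3)]
       dual_map_surj[OF *(1,2,3,5)] O.dual_flip[OF Pm(2) u'(2,1)]]) (rule that)
   have "(\<lambda>b\<in>carrier B. \<lambda>p\<in>carrier P. h p b) (g x) = u x" if x: "x : carrier A" for x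
   proof
    fix p show "(\<lambda>b\<in>carrier B. \<lambda>p\<in>carrier P. h p b) (g x) p = u x p"
     using fun_cong[OF h(2), of p x] Hom_cl[OF h(1), of p] x gc[OF x] Hom_cl[OF u x]
      Hom_undefined[of "u x" R "rs \<phi> P" J p] by (cases "p : carrier P") (auto simp: compose_def)
   qed
   then show "EX v:Hom L B ?D. ALL x:carrier A. v (g x) = u x"
    using dual_flip[OF L(2) Pm(2) h(1)] by blast
  qed
  then have "extends L A g B I" by (rule extends_retract[OF _ I(3,2) _ L]) (use I(5) gc in auto)
  then obtain h where h: "h : Hom L B I" "!!x. x : carrier A ==> h (g x) = f x"
   by (rule extendsE[OF _ *(4)]) (rule that)
  then show "EX h:Hom L B I. compose (carrier A) h g = f"
   by (intro bexI[OF _ h(1)] Hom_eqI[OF Hom_comp[OF *(3) h(1) L(1)] *(4)]) (simp add: compose_def)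
 qed (rule I)
 ultimately show ?thesis using that I(1) i by blast
qed

lemma ex_cosyz: assumes "Y : modules L"
 obtains Y' where "cosyz L Y Y'"
proof -
 obtain I i where I: "I : modules L" "inj_mod L I" "i : Hom L Y I" "inj_on i (carrier Y)"
  using enough_injectives[OF assms] by metis
 then show ?thesis using LA.ses_cokernel[OF assms I(1,3,4)] that unfolding cosyz_def by metis
qed

text \<open>The passage to sequences in the second argument, by a projective presentation of
  \<open>X\<close> and the ladder.\<close>

lemma ext1_zero_lifts: assumes e: "ext1_zero L X Y" and X: "X : modules L" and T: "ses L Y f B g D"
 shows "lifts L X B g D"
proof -
 obtain K i P p where P: "proj_mod L P" "ses L K i P p X" using LA.ex_syz[OF X] unfolding syz_def by metis
 show ?thesis by (rule lifts_ladder[OF P(2) T projective_lifts[OF P(1) T] ext1_zeroD[OF e P(2)]])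
qed

text \<open>One injective copresentation of \<open>Y\<close> decides vanishing, because the ladder
  compares it with any sequence ending in \<open>X\<close>.\<close>

lemma ext1_zeroI': assumes T: "ses L Y i I p Y'" and I: "inj_mod L I" and l: "lifts L X I p Y'"
 shows "ext1_zero L X Y"
 unfolding ext1_zero_def using extends_ladder[OF _ T injective_extends[OF I] l] by blast

lemma ext1_zeroI:
 assumes S: "ses L K i P p X" and P: "proj_mod L P" and Y: "Y : modules L" and e: "extends L K i P Y"
 shows "ext1_zero L X Y"
proof -
 obtain I j q Y' where I: "inj_mod L I" "ses L Y j I q Y'" using ex_cosyz[OF Y] unfolding cosyz_def by metis
 show ?thesis by (rule ext1_zeroI'[OF I(2,1) lifts_ladder[OF S I(2) projective_lifts[OF P I(2)] e]])
qed

text \<open>Both sides say that every map from \<open>X'\<close> to \<open>Y'\<close> is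
  inessential: it lifts to the injective module on one side, and extends to the projective module on
  the other.\<close>

lemma ext1_zero_shift: assumes "syz L X X'" "cosyz L Y Y'"
 shows "ext1_zero L X' Y <-> ext1_zero L X Y'"
proof -
 obtain P i p where P: "proj_mod L P" "ses L X' i P p X" using assms(1) unfolding syz_def by blast
 obtain I j q where I: "inj_mod L I" "ses L Y j I q Y'" using assms(2) unfolding cosyz_def by blast
 have "lifts L X' I q Y' <-> extends L X' i P Y'"
  using lifts_left[OF P(2) I(2) _ projective_lifts[OF P(1) I(2)]] extends_right[OF P(2) I(2) _ injective_extends[OF I(1) P(2)]] by blast
 moreover have "ext1_zero L X' Y <-> lifts L X' I q Y'"
  using ext1_zero_lifts[OF _ sesD(1)[OF P(2)] I(2)] ext1_zeroI'[OF I(2,1)] by blast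
 moreover have "ext1_zero L X Y' <-> extends L X' i P Y'"
  using ext1_zeroI[OF P(2,1) sesD(3)[OF I(2)]] ext1_zeroD[OF _ P(2)] by blast
 ultimately show ?thesis by blast
qed

lemma ext_zero_cosyz: assumes "cosyz L Y Y'"
 shows "X : modules L ==> ext_zero L (Suc i) X Y <-> ext_zero L i X Y'"
proof (induction i arbitrary: X)
 case 0
 then show ?case using ext1_zero_shift[OF _ assms] LA.ex_syz by (metis ext_zero.simps)
next
 case (Suc i)
 then show ?case using syzD by (metis ext_zero.simps(2))
qed

text \<open>\<open>ext_zero\<close> quantifies over all syzygies. That a single one decides is seen
  by moving a shift to the second argument, where the choice of \<open>X'\<close> does not
  enter.\<close>

lemma ext_zero_syz: assumes "syz L X X'"
 shows "Y : modules L ==> ext_zero L (Suc i) X Y <-> ext_zero L i X' Y"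
proof (induction i arbitrary: Y)
 case 0
 obtain Y' where "cosyz L Y Y'" using ex_cosyz[OF 0] by metis
 then show ?case using ext1_zero_shift assms by (metis ext_zero.simps)
next
 case (Suc i)
 obtain Y' where Y': "cosyz L Y Y'" using ex_cosyz[OF Suc.prems] by metis
 then show ?case using Suc.IH[of Y'] ext_zero_cosyz[OF Y'] assms syzD[OF assms] cosyzD[OF Y'] by metis
qed

lemma ext_zero_syz_chain: assumes "!!k. k < m ==> syz L (W k) (W (Suc k))" "Y : modules L"
 shows "ext_zero L m (W 0) Y <-> ext1_zero L (W m) Y" using assms(1)
proof (induction m arbitrary: W)
 case (Suc m)
 have "ext_zero L (Suc m) (W 0) Y <-> ext_zero L m (W (Suc 0)) Y"
  by (rule ext_zero_syz[OF Suc.prems assms(2)]) simp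
 also have "... <-> ext1_zero L (W (Suc m)) Y" using Suc.IH[of "%k. W (Suc k)"] Suc.prems by simp
 finally show ?case .
qed simp

lemma ext_zero_cosyz_chain: assumes "!!k. k < m ==> cosyz L (W k) (W (Suc k))" "X : modules L"
 shows "ext_zero L m X (W 0) <-> ext1_zero L X (W m)" using assms(1)
proof (induction m arbitrary: W)
 case (Suc m)
 have "ext_zero L (Suc m) X (W 0) <-> ext_zero L m X (W (Suc 0))"
  by (rule ext_zero_cosyz[OF Suc.prems assms(2)]) simp
 also have "... <-> ext1_zero L X (W (Suc m))" using Suc.IH[of "%k. W (Suc k)"] Suc.prems by simp
 finally show ?case .
qed simp

text \<open>In the second argument, the long exact sequence needs only a projective presentation of the first.\<close>

lemma ext1_zero_middle:
 assumes T: "ses L A f B g D" and X: "X : modules L" and "ext1_zero L X A" "ext1_zero L X D"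
 shows "ext1_zero L X B"
proof -
 obtain K i P p where P: "proj_mod L P" "ses L K i P p X" using LA.ex_syz[OF X] unfolding syz_def by metis
 show ?thesis by (rule ext1_zeroI[OF P(2,1) sesD(2)[OF T]], rule extends_middle[OF P(2) T])
   (use assms(3,4) ext1_zeroD[OF _ P(2)] projective_lifts[OF P(1) T] in auto)
qed

lemma ext_zero_middle: assumes "ses L A f B g D"
 shows "X : modules L ==> ext_zero L i X A ==> ext_zero L i X D ==> ext_zero L i X B"
 by (induction i arbitrary: X) (auto simp: syzD intro: ext1_zero_middle[OF assms])

text \<open>The part of the long exact sequence around the connecting map: if that map vanishes, Ext
  of \<open>X\<close> and \<open>A\<close> embeds into Ext of \<open>X\<close> and
  \<open>B\<close>.\<close>

lemma ext1_zero_kernel: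
 assumes T: "ses L A f B g D" and X: "X : modules L" and l: "lifts L X B g D" and e: "ext1_zero L X B"
 shows "ext1_zero L X A"
proof -
 obtain K i P p where P: "proj_mod L P" "ses L K i P p X" using LA.ex_syz[OF X] unfolding syz_def by metis
 show ?thesis by (rule ext1_zeroI[OF P(2,1) sesD(1)[OF T] extends_ladder[OF P(2) T ext1_zeroD[OF e P(2)] l]])
qed

text \<open>Dependent choice of iterated syzygies or cosyzygies. The relation power is recorded
  because the higher translates are defined by it.\<close>

lemma ex_chain: assumes X: "X : modules L" and ex: "!!X. X : modules L ==> EX Y:modules L. r X Y"
 obtains W where "W 0 = X" "!!k. r (W k) (W (Suc k))" "!!k. W k : modules L" "!!k. (r ^^ k) X (W k)"
proof -
 have "EX S. ALL k. (S k : modules L & (k = 0 --> S k = X)) & r (S k) (S (Suc k))"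
 proof (rule dependent_nat_choice)
  show "EX y. (y : modules L & (Suc k = 0 --> y = X)) & r x y" if "x : modules L & (k = 0 --> x = X)" for x k
   using ex[of x] that by auto
 qed (use X in auto)
 then obtain W where W: "W 0 = X" "!!k. r (W k) (W (Suc k))" "!!k. W k : modules L" by metis
 have "(r ^^ k) X (W k)" for k by (induction k) (use W(1,2) in auto)
 then show ?thesis using that W by blast
qed

lemma syz_chain: assumes "M : modules L"
 obtains W where "W 0 = M" "!!k. syz L (W k) (W (Suc k))" "!!k. W k : modules L"
proof -
 have ex: "EX Y:modules L. syz L X Y" if "X : modules L" for X using LA.ex_syz[OF that] syzD by metis
 show ?thesis by (rule ex_chain[where r = "syz L", OF assms ex]) (assumption | rule that)+
qed

lemma cosyz_chain: assumes "M : modules L"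
 obtains W where "W 0 = M" "!!k. cosyz L (W k) (W (Suc k))" "!!k. W k : modules L"
proof -
 have ex: "EX Y:modules L. cosyz L X Y" if "X : modules L" for X
  using ex_cosyz[OF that] cosyzD by metis
 show ?thesis by (rule ex_chain[where r = "cosyz L", OF assms ex]) (assumption | rule that)+
qed

end

section \<open>Comparison with the Ext groups of projective resolutions\<close>

lemma hom_group_simps [simp]: "carrier (hom_group L M N) = Hom L M N"
 "f \<otimes>\<^bsub>hom_group L M N\<^esub> g = (\<lambda>x\<in>carrier M. f x +\<^sub>N g x)"
 "\<one>\<^bsub>hom_group L M N\<^esub> = (\<lambda>x\<in>carrier M. 0\<^sub>N)"
 by (simp_all add: hom_group_def)

lemma hom_group_comm_group: assumes "left_module L M" "left_module L N"
 shows "comm_group (hom_group L M N)"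
proof (rule comm_groupI)
 interpret N: left_module L N by fact
 have cl: "f x : carrier N" if "f : Hom L M N" "x : carrier M" for f x by (rule Hom_cl[OF that])
 show "\<one>\<^bsub>hom_group L M N\<^esub> \<otimes>\<^bsub>hom_group L M N\<^esub> f = f" if "f : carrier (hom_group L M N)" for f
  using that Hom_plus[OF assms Hom_0map[OF assms], of f]
  by (intro Hom_eqI[of _ L M N]) (auto simp: cl)
 show "EX g:carrier (hom_group L M N). g \<otimes>\<^bsub>hom_group L M N\<^esub> f = \<one>\<^bsub>hom_group L M N\<^esub>"
  if "f : carrier (hom_group L M N)" for f using Hom_uminus[OF assms, of f] that
  by (intro bexI[of _ "\<lambda>x\<in>carrier M. \<ominus>\<^sub>N f x"]) (auto simp: cl N.M.l_neg intro!: restrict_ext)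
qed (use Hom_plus[OF assms] Hom_0map[OF assms] Hom_cl[of _ L M N] assms(2) in
  \<open>auto simp: abelian_monoid.a_assoc[OF abelian_group.axioms(1)] abelian_monoid.a_comm[OF abelian_group.axioms(1)]
   left_module_group intro!: restrict_ext\<close>)

lemma trivial_subquotient_iff: assumes "comm_group G" "subgroup Z G" "subgroup B G" "B <= Z"
 shows "trivial_group (G\<lparr>carrier := Z\<rparr> Mod B) <-> Z <= B"
proof -
 interpret G: comm_group G by fact
 let ?Z = "G\<lparr>carrier := Z\<rparr>"
 interpret Z: group ?Z by (rule subgroup.subgroup_is_group[OF assms(2) G.group_axioms])
 interpret Z: comm_group ?Z
  by unfold_locales (use subgroup.mem_carrier[OF assms(2)] in \<open>simp add: G.m_comm\<close>)
 have B: "subgroup B ?Z" by (rule G.subgroup_incl[OF assms(3,2,4)])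
 then interpret B: normal B ?Z by (rule Z.subgroup_imp_normal)
 have gr: "group (?Z Mod B)" by (rule B.factorgroup_is_group)
 have "carrier (?Z Mod B) = {B} <-> Z <= B"
 proof
  assume *: "carrier (?Z Mod B) = {B}"
  show "Z <= B"
  proof
   fix z assume z: "z : Z"
   then have "B #>\<^bsub>?Z\<^esub> z = B" using * by (auto simp: FactGroup_def RCOSETS_def)
   then show "z : B" using Z.rcos_self[of z B] B z by simp
  qed
 next
  assume "Z <= B"
  then have "B #>\<^bsub>?Z\<^esub> z = B" if "z : Z" for z using that Z.coset_join2[of z B] B by auto
  moreover have "B : carrier (?Z Mod B)" using group.is_monoid[OF gr] monoid.one_closed by (fastforce simp: FactGroup_def)
  ultimately show "carrier (?Z Mod B) = {B}" by (auto simp: FactGroup_def RCOSETS_def)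
 qed
 then show ?thesis using gr by (simp add: trivial_group_def FactGroup_def)
qed

lemma hom_group_precompose:
 assumes L: "left_module L M" "left_module L N" "left_module L Y" and d: "d : Hom L M N"
 shows "group_hom (hom_group L N Y) (hom_group L M Y) (%h. compose (carrier M) h d)"
proof (intro group_hom.intro group_hom_axioms.intro homI)
 show "group (hom_group L N Y)" "group (hom_group L M Y)"
  using hom_group_comm_group L by (metis comm_group.axioms(2))+
qed (use Hom_comp[OF d _ L(1)] Hom_cl[OF d] in \<open>auto simp: compose_def intro!: restrict_ext\<close>)

context artin_duality
begin

text \<open>The short exact sequences of consecutive syzygies are spliced at the syzygies.\<close>

lemma projective_resolution_exists: assumes X: "X : modules L"
 shows "EX P d e. projective_resolution L X P d e"
proof -
 obtain S where S: "S 0 = X" "!!k. syz L (S k) (S (Suc k))" using syz_chain[OF X] by metis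
 obtain P f g where P: "!!k. proj_mod L (P k)" "!!k. ses L (S (Suc k)) (f k) (P k) (g k) (S k)"
  using S(2) unfolding syz_def by metis
 note s = sesD[OF P(2)]
 define d where "d k = compose (carrier (P (Suc k))) (f k) (g (Suc k))" for k
 have dh: "d k : Hom L (P (Suc k)) (P k)" for k unfolding d_def by (rule Hom_comp[OF s(8,7,5)])
 have dx: "d k x = f k (g (Suc k) x)" if "x : carrier (P (Suc k))" for k x using that by (simp add: d_def compose_def)
 have im: "d k ` carrier (P (Suc k)) = f k ` carrier (S (Suc k))" for k
 proof -
  have "d k ` carrier (P (Suc k)) = f k ` (g (Suc k) ` carrier (P (Suc k)))" using dx by (auto simp: image_image)
  then show ?thesis by (simp add: s(10))
 qed
 have kg: "f k ` carrier (S (Suc k)) = a_kernel (P k) (S k) (g k)" for k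
  using P(2) unfolding ses_def short_exact_def by blast
 have "a_kernel (P (Suc k)) (P k) (d k) = a_kernel (P (Suc k)) (S (Suc k)) (g (Suc k))" for k
  using s(9)[of k] Hom_zero[OF s(4,5,7)] s(12) dx unfolding inj_iff_ker[OF s(4,5,7)]
  by (auto simp: aker_eq)
 then have "projective_resolution L X P d (g 0)"
  unfolding projective_resolution_def using P(1) s(8)[of 0] s(10)[of 0] dh im kg S(1) by simp
 then show ?thesis by blast
qed

text \<open>The resolution is cut back into syzygies. A cocycle in degree \<open>i + 1\<close>
  amounts to a map on the image of \<open>d i\<close>, a syzygy of \<open>X\<close>, and it is a
  coboundary when that map extends to \<open>P i\<close>.\<close>

lemma trivial_ext_via_iff:
 assumes X: "X : modules L" and Y: "Y : modules L" and res: "projective_resolution L X P d e"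
 shows "trivial_group (ext_via L P d (Suc i) Y) <-> ext_zero L i X Y"
proof -
 have P: "!!k. proj_mod L (P k)" "e : Hom L (P 0) X" "e ` carrier (P 0) = carrier X"
  "!!k. d k : Hom L (P (Suc k)) (P k)" "d 0 ` carrier (P 1) = a_kernel (P 0) X e"
  "!!k. d (Suc k) ` carrier (P (Suc (Suc k))) = a_kernel (P (Suc k)) (P k) (d k)"
  using res unfolding projective_resolution_def by auto
 have Pm: "P k : modules L" "left_module L (P k)" for k using P(1)[of k] by (auto simp: projective_mod_def fg_modD)
 note LY = fg_modD(1)[OF Y]
 define K where "K k = (case k of 0 => a_kernel (P 0) X e | Suc j => a_kernel (P (Suc j)) (P j) (d j))" for k
 \<comment> \<open>\<open>S 0\<close> is \<open>X\<close> itself, and \<open>S (Suc k)\<close> is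
   the image of \<open>d k\<close> inside \<open>P k\<close>, which by exactness is the kernel of
   the map before it.\<close>
 define S where "S k = (case k of 0 => X | Suc k => sub_mod (P k) (K k))" for k
 have im: "d k ` carrier (P (Suc k)) = K k" for k using P(5,6) by (cases k) (simp_all add: K_def)
 have K: "submodule (K k) L (P k)" for k unfolding im[symmetric] by (rule subm_range[OF Pm(2,2) P(4)])
 have dK: "d k : Hom L (P (Suc k)) (sub_mod (P k) (K k))" for k
  by (rule Hom_into_sub[OF P(4)]) (use im in auto)
 have "EX g. ses L (S (Suc k)) (\<lambda>x\<in>carrier (S (Suc k)). x) (P k) g (S k)" for k
 proof (cases k)
  case 0
  then show ?thesis using LA.ses_kernel[OF Pm(1) X P(2,3)] by (auto simp: S_def K_def)
 next
  case (Suc j)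
  have "ses L (sub_mod (P (Suc j)) (K (Suc j))) (\<lambda>x\<in>K (Suc j). x) (P (Suc j)) (d j) (sub_mod (P j) (K j))"
   using LA.ses_kernel[OF Pm(1) LA.fg_mod_sub[OF Pm(1) K] dK, of j] im by (simp add: K_def aker_eq)
  then show ?thesis using Suc by (auto simp: S_def)
 qed
 then obtain g where S: "!!k. ses L (S (Suc k)) (\<lambda>x\<in>carrier (S (Suc k)). x) (P k) (g k) (S k)" by metis
 have chain: "syz L (S k) (S (Suc k))" for k unfolding syz_def using P(1) S by blast
 have "ext_zero L i X Y <-> ext1_zero L (S i) Y"
  using ext_zero_syz_chain[of i S Y] chain Y by (simp add: S_def)
 also have "... <-> extends L (S (Suc i)) (\<lambda>x\<in>carrier (S (Suc i)). x) (P i) Y"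
  using ext1_zeroI[OF S P(1) Y] ext1_zeroD[OF _ S] by blast
 also have "... <-> ext_cocycles L P d (Suc i) Y <= ext_coboundaries L P d (Suc i) Y"
 proof
  let ?M = "sub_mod (P i) (K i)"
  have SM: "S (Suc i) = ?M" by (simp add: S_def)
  have LM: "left_module L ?M" by (rule lm_sub[OF Pm(2) K])
  note di = dK[of i]
  {
   assume ext: "extends L (S (Suc i)) (\<lambda>x\<in>carrier (S (Suc i)). x) (P i) Y"
   show "ext_cocycles L P d (Suc i) Y <= ext_coboundaries L P d (Suc i) Y"
   proof
    fix f assume "f : ext_cocycles L P d (Suc i) Y"
    then have f: "f : Hom L (P (Suc i)) Y" and fz: "compose (carrier (P (Suc (Suc i)))) f (d (Suc i)) = (\<lambda>x\<in>carrier (P (Suc (Suc i))). 0\<^sub>Y)"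
     by (auto simp: ext_cocycles_def)
    obtain u where u: "u : Hom L ?M Y" "!!x. x : carrier (P (Suc i)) ==> u (d i x) = f x"
    proof (rule hom_factor_surj[OF Pm(2) LM LY di _ f])
     fix x assume x: "x : carrier (P (Suc i))" "d i x = \<zero>\<^bsub>?M\<^esub>"
     then have "x : d (Suc i) ` carrier (P (Suc (Suc i)))" unfolding P(6) by (simp add: aker_eq)
     then obtain y where "y : carrier (P (Suc (Suc i)))" "x = d (Suc i) y" by blast
     then show "f x = 0\<^sub>Y" using fun_cong[OF fz, of y] by (simp add: compose_def)
    qed (use im that in auto)
    obtain h where h: "h : Hom L (P i) Y" "!!a. a : carrier ?M ==> h ((\<lambda>x\<in>carrier ?M. x) a) = u a"
     using extendsE[OF ext[unfolded SM] u(1)] by metis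
    have "f = compose (carrier (P (Suc i))) h (d i)"
     by (rule Hom_eqI[OF f Hom_comp[OF P(4) h(1) Pm(2)]]) (use h(2) u(2) Hom_cl[OF di] in \<open>simp add: compose_def\<close>)
    then show "f : ext_coboundaries L P d (Suc i) Y" using h(1) by (auto simp: ext_coboundaries_def)
   qed
  next
   assume sub: "ext_cocycles L P d (Suc i) Y <= ext_coboundaries L P d (Suc i) Y"
   show "extends L (S (Suc i)) (\<lambda>x\<in>carrier (S (Suc i)). x) (P i) Y"
    unfolding extends_def SM
   proof
    fix u assume u: "u : Hom L ?M Y"
    have f: "compose (carrier (P (Suc i))) u (d i) : Hom L (P (Suc i)) Y" by (rule Hom_comp[OF di u Pm(2)])
    have dd: "d i (d (Suc i) x) = \<zero>\<^bsub>P i\<^esub>" if "x : carrier (P (Suc (Suc i)))" for x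
     using P(6)[of i] that by (auto simp: aker_eq)
    have "compose (carrier (P (Suc i))) u (d i) : ext_cocycles L P d (Suc i) Y"
     using f Hom_cl[OF P(4)] dd Hom_zero[OF LM LY u] by (auto simp: ext_cocycles_def compose_def intro!: restrict_ext)
    then obtain h where h: "h : Hom L (P i) Y" "compose (carrier (P (Suc i))) u (d i) = compose (carrier (P (Suc i))) h (d i)"
     using sub by (auto simp: ext_coboundaries_def)
    have "h (d i x) = u (d i x)" if "x : carrier (P (Suc i))" for x
     using fun_cong[OF h(2), of x] that by (simp add: compose_def)
    then have "!!a. a : K i ==> h a = u a" unfolding im[symmetric] by auto
    then show "EX v:Hom L (P i) Y. ALL a:carrier ?M. v ((\<lambda>x\<in>carrier ?M. x) a) = u a"
     using h(1) by auto
   qed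
  }
 qed
 also have "... <-> trivial_group (ext_via L P d (Suc i) Y)" unfolding ext_via_def
 proof (rule trivial_subquotient_iff[symmetric, OF hom_group_comm_group[OF Pm(2) LY]])
  note h = hom_group_precompose[OF Pm(2) Pm(2) LY P(4)]
  show "subgroup (ext_cocycles L P d (Suc i) Y) (hom_group L (P (Suc i)) Y)"
   using group_hom.subgroup_kernel[OF h[of "Suc i"]] by (simp add: kernel_def ext_cocycles_def)
  show "subgroup (ext_coboundaries L P d (Suc i) Y) (hom_group L (P (Suc i)) Y)"
   using group_hom.img_is_subgroup[OF h[of i]] by (simp add: ext_coboundaries_def)
  have dd: "d i (d (Suc i) x) = \<zero>\<^bsub>P i\<^esub>" if "x : carrier (P (Suc (Suc i)))" for x
   using P(6)[of i] that by (auto simp: aker_eq)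
  show "ext_coboundaries L P d (Suc i) Y <= ext_cocycles L P d (Suc i) Y"
   using Hom_comp[OF P(4) _ Pm(2)] Hom_cl[OF P(4)] dd Hom_zero[of L "P i" Y, OF Pm(2) LY]
   by (auto simp: ext_coboundaries_def ext_cocycles_def compose_def intro!: restrict_ext)
 qed
 finally show ?thesis by simp
qed

text \<open>\<open>Ext\<close> is computed from a resolution picked by choice; its vanishing can be
  read off from any resolution, in particular from the picked one.\<close>

lemma trivial_Ext_iff: assumes "X : modules L" "Y : modules L"
 shows "trivial_group (Ext L (Suc i) X Y) <-> ext_zero L i X Y"
proof -
 define Q where "Q = (SOME Q. EX e. projective_resolution L X (fst Q) (snd Q) e)"
 have "EX Q e. projective_resolution L X (fst Q) (snd Q) e"
  using projective_resolution_exists[OF assms(1)] by (metis fst_conv snd_conv)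
 then have "EX e. projective_resolution L X (fst Q) (snd Q) e" unfolding Q_def by (rule someI_ex)
 then obtain e where "projective_resolution L X (fst Q) (snd Q) e" by blast
 from trivial_ext_via_iff[OF assms this] show ?thesis unfolding Ext_def Q_def[symmetric] Let_def .
qed

end

section \<open>Precluster tilting subcategories\<close>

context artin_duality
begin

lemma is_syzygy_syz: "X : modules L ==> is_syzygy L X Y ==> syz L X Y"
proof -
 assume X: "X : modules L" and "is_syzygy L X Y"
 then obtain P e where Y: "Y : modules L" and P: "proj_mod L P" "e : Hom L P X" "e ` carrier P = carrier X"
  and iso: "mod_iso L Y (sub_mod P (a_kernel P X e))"
  unfolding is_syzygy_def projective_cover_def by blast
 have Pm: "P : modules L" "left_module L P" using P(1) by (auto simp: projective_mod_def fg_modD)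
 let ?K = "sub_mod P (a_kernel P X e)"
 have K: "submodule (a_kernel P X e) L P" by (rule subm_kernel[OF Pm(2) fg_modD(1)[OF X] P(2)])
 obtain a where a: "a : Hom L Y ?K" "bij_betw a (carrier Y) (carrier ?K)" using iso unfolding mod_iso_def by blast
 have "short_exact L Y a P e X"
  unfolding short_exact_def using Hom_from_sub[OF a(1) K] P a(2) by (auto simp: bij_betw_def)
 then show ?thesis unfolding syz_def ses_def using X Y Pm P(1) by blast
qed

lemma ex_is_syzygy: assumes X: "X : modules L"
 obtains Y where "is_syzygy L X Y"
proof -
 obtain P e where c: "projective_cover L P e X" using LA.projective_cover_exists[OF X] by metis
 then have P: "P : modules L" "e : Hom L P X" by (auto simp: projective_cover_def projective_mod_def)
 have K: "submodule (a_kernel P X e) L P" by (rule subm_kernel[OF fg_modD(1)[OF P(1)] fg_modD(1)[OF X] P(2)])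
 have L: "left_module L (sub_mod P (a_kernel P X e))" by (rule lm_sub[OF fg_modD(1)[OF P(1)] K])
 have "mod_iso L (sub_mod P (a_kernel P X e)) (sub_mod P (a_kernel P X e))"
  by (rule mod_isoI[OF Hom_id[OF L] Hom_id[OF L]]) auto
 then show ?thesis using that c LA.fg_mod_sub[OF P(1) K] unfolding is_syzygy_def by blast
qed

lemma is_cosyzygy_cosyz: "X : modules L ==> is_cosyzygy L X Y ==> cosyz L X Y"
proof -
 assume X: "X : modules L" and "is_cosyzygy L X Y"
 then obtain I :: "'a fgm" and i where Y: "Y : modules L" and I: "I : modules L" "inj_mod L I" "i : Hom L X I" "inj_on i (carrier X)"
  and iso: "mod_iso L Y (quot_mod I (i ` carrier X))"
  unfolding is_cosyzygy_def injective_envelope_def by blast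
 have N: "submodule (i ` carrier X) L I" by (rule subm_range[OF fg_modD(1)[OF X] fg_modD(1)[OF I(1)] I(3)])
 obtain g where "g : Hom L I Y" "g ` carrier I = carrier Y" "a_kernel I Y g = i ` carrier X"
  by (rule quot_mod_isoE[OF fg_modD(1)[OF I(1)] N fg_modD(1)[OF Y] iso])
 then have "ses L X i I g Y" unfolding ses_def short_exact_def using X I Y by simp
 then show ?thesis unfolding cosyz_def using I(2) by blast
qed

lemma ex_is_cosyzygy: assumes X: "X : modules L"
 obtains Y where "is_cosyzygy L X Y"
proof -
 obtain I0 i where I0: "I0 : modules L" "inj_mod L I0" "i : Hom L X I0" "inj_on i (carrier X)"
  using enough_injectives[OF X] by metis
 obtain I :: "'a fgm" and j where I: "I : modules L" "injective_envelope L X j I"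
  using LA.injective_envelope_from_embedding[OF X I0(2,3,4)] by metis
 have j: "j : Hom L X I" using I(2) by (simp add: injective_envelope_def)
 have N: "submodule (j ` carrier X) L I" by (rule subm_range[OF fg_modD(1)[OF X] fg_modD(1)[OF I(1)] j])
 have Q: "quot_mod I (j ` carrier X) : fg_mod L" by (rule LA.fg_mod_quot[OF I(1) N])
 obtain Y where Y: "Y : modules L" "mod_iso L (quot_mod I (j ` carrier X)) Y" using modules_universal[OF Q] by blast
 have "mod_iso L Y (quot_mod I (j ` carrier X))" by (rule mod_iso_sym[OF Y(2) fg_modD(1)[OF Q] fg_modD(1)[OF Y(1)]])
 then show ?thesis using that Y(1) I unfolding is_cosyzygy_def by blast
qed

end

locale precluster = artin_duality R L \<phi> J
 for R :: "'r ring" (structure) and L :: "'a ring" (structure) and \<phi> :: "'r => 'a" and J :: "('r, 'j) module" +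
 fixes n :: nat and C :: "'a fgm set"
 assumes n: "n >= 1" and pct: "precluster_tilting R \<phi> J L n C"
begin

lemma pctD: shows "mod_subcategory L C" "EX X:C. mod_iso L X (reg_mod L)"
  "EX X:C. mod_iso L X (dual R \<phi> J (reg_mod (opp L)))"
  "ALL X:C. ALL Y:modules L. is_tau_n R \<phi> J L n X Y --> Y : C"
  "ALL X:C. ALL Y:modules L. is_tau_n_inv R \<phi> J L n X Y --> Y : C"
  "ALL X:C. ALL Y:C. ALL i. 0 < i & i < n --> trivial_group (Ext L i X Y)" "functorially_finite L C"
 by (insert pct[unfolded precluster_tilting_def], (elim conjE, assumption)+)

lemma C_modules: "X : C ==> X : modules L"
 and C_iso: "X : C ==> Y : modules L ==> mod_iso L X Y ==> Y : C"
 and C_zero: "X : modules L ==> carrier X = {0\<^sub>X} ==> X : C"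
 and C_dsum: "X : modules L ==> Y : modules L ==> Z : modules L ==> mod_iso L Z (dsum X Y) ==> Z : C <-> X : C & Y : C"
 using pctD(1)[unfolded mod_subcategory_def] by blast+

lemma C_tau: "X : C ==> Y : modules L ==> is_tau_n R \<phi> J L n X Y ==> Y : C"
 and C_tau_inv: "X : C ==> Y : modules L ==> is_tau_n_inv R \<phi> J L n X Y ==> Y : C"
 using pctD(4,5) by blast+

lemma C_ext: "X : C ==> Y : C ==> Suc i < n ==> ext_zero L i X Y"
proof -
 assume *: "X : C" "Y : C" "Suc i < n"
 then have "trivial_group (Ext L (Suc i) X Y)" using pctD(6) by simp
 then show ?thesis using trivial_Ext_iff C_modules * by blast
qed

lemma left_approx: "X : modules L ==> EX i E. left_approximation L C X i E"
 and right_approx: "X : modules L ==> EX E p. right_approximation L C E p X"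
 using pctD(7) unfolding functorially_finite_def by blast+

text \<open>Injectivity comes from the copy of the dual of the regular module in \<open>C\<close>,
  which cogenerates: maps into it factor through the approximation, so a nonzero element of the
  kernel would be killed by all of them.\<close>

lemma left_approximationD: assumes "left_approximation L C X i E" "X : modules L"
 shows "E : C" "i : Hom L X E" "inj_on i (carrier X)" "Y : C ==> extends L X i E Y"
proof -
 show E: "E : C" and i: "i : Hom L X E" using assms by (auto simp: left_approximation_def)
 have ext: "extends L X i E Y" if Y: "Y : C" for Y unfolding extends_def
 proof
  fix u assume "u : Hom L X Y"
  then obtain g where "g : Hom L E Y" "compose (carrier X) g i = u"
   using assms(1)[unfolded left_approximation_def] Y by blast
  then show "EX v:Hom L E Y. ALL a:carrier X. v (i a) = u a" by (auto simp: compose_def)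
 qed
 then show "Y : C ==> extends L X i E Y" .
 note LX = fg_modD(1)[OF assms(2)] and LE = fg_modD(1)[OF C_modules[OF E]]
 interpret O: artin_duality R "opp L" \<phi> J by (rule artin_duality_opp[OF artin_duality_axioms])
 let ?D = "dual R \<phi> J (reg_mod (opp L))"
 have Dfg: "?D : fg_mod L" using O.dual_fg[OF O.LA.fg_mod_reg] by simp
 obtain X0 where X0: "X0 : C" "mod_iso L X0 ?D" using pctD(3) by blast
 obtain a b where ab: "b : Hom L X0 ?D" "a : Hom L ?D X0"
  "!!x. x : carrier X0 ==> a (b x) = x" "!!y. y : carrier ?D ==> b (a y) = y"
  by (rule mod_isoE[OF X0(2) fg_modD(1)[OF C_modules[OF X0(1)]] fg_modD(1)[OF Dfg]]) (rule that)
 show "inj_on i (carrier X)" unfolding inj_iff_ker[OF LX LE i]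
 proof (intro ballI impI, rule ccontr)
  fix x assume x: "x : carrier X" "i x = 0\<^sub>E" "x ~= 0\<^sub>X"
  obtain \<xi> where \<xi>: "\<xi> : Hom R (rs \<phi> X) J" "\<xi> x ~= 0\<^sub>J" using dual_separates[OF assms(2) x(1,3)] by metis
  \<comment> \<open>\<open>h\<close> sends \<open>x\<close> to the functional that takes a ring
    element \<open>r\<close> to \<open>\<xi> (r x)\<close>. At 1 this has the nonzero value
    \<open>\<xi> x\<close>.\<close>
  define h where "h = (\<lambda>x\<in>carrier X. \<lambda>r\<in>carrier (reg_mod (opp L)). (\<lambda>r\<in>carrier (opp L). r \<odot>\<^bsub>dual R \<phi> J X\<^esub> \<xi>) r x)"
  have h1: "h : Hom L X ?D"
   unfolding h_def by (rule dual_flip[OF LX fg_modD(1)[OF O.LA.fg_mod_reg] hom_from_reg[OF lm_dual[OF LX]]]) (use \<xi> in simp)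
  have "h x \<one>\<^sub>L = \<xi> x" using x(1) by (simp add: h_def left_module.smult_one[OF LX])
  then have h: "h : Hom L X ?D" "h x ~= \<zero>\<^bsub>?D\<^esub>" using h1 \<xi>(2) by auto
  obtain v where v: "v : Hom L E X0" "!!y. y : carrier X ==> v (i y) = compose (carrier X) a h y"
   using extendsE[OF ext[OF X0(1)] Hom_comp[OF h(1) ab(2) LX]] by metis
  have "a (h x) = 0\<^sub>X0"
   using v(2)[OF x(1)] x Hom_zero[OF LE fg_modD(1)[OF C_modules[OF X0(1)]] v(1)] by (simp add: compose_def)
  then have "h x = b 0\<^sub>X0" using ab(4)[OF Hom_cl[OF h(1) x(1)]] by simp
  then show False using h(2) Hom_zero[OF fg_modD(1)[OF C_modules[OF X0(1)]] fg_modD(1)[OF Dfg] ab(1)] by simp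
 qed
qed

text \<open>Surjectivity comes from the copy of the regular module in \<open>C\<close>: the map
  taking 1 to a given \<open>x\<close> factors through the approximation.\<close>

lemma right_approximationD: assumes "right_approximation L C E p X" "X : modules L"
 shows "E : C" "p : Hom L E X" "p ` carrier E = carrier X" "Y : C ==> lifts L Y E p X"
proof -
 show E: "E : C" and p: "p : Hom L E X" using assms by (auto simp: right_approximation_def)
 have lif: "lifts L Y E p X" if Y: "Y : C" for Y unfolding lifts_def
 proof
  fix u assume "u : Hom L Y X"
  then obtain g where "g : Hom L Y E" "compose (carrier Y) p g = u"
   using assms(1)[unfolded right_approximation_def] Y by blast
  then show "EX v:Hom L Y E. ALL a:carrier Y. p (v a) = u a" by (auto simp: compose_def)
 qed
 then show "Y : C ==> lifts L Y E p X" .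
 note LX = fg_modD(1)[OF assms(2)]
 interpret X: left_module L X by (rule LX)
 have reg: "left_module L (reg_mod L)" by (rule fg_modD(1)[OF LA.fg_mod_reg])
 obtain X0 where X0: "X0 : C" "mod_iso L X0 (reg_mod L)" using pctD(2) by blast
 obtain a b where ab: "b : Hom L X0 (reg_mod L)" "a : Hom L (reg_mod L) X0"
  "!!x. x : carrier X0 ==> a (b x) = x" "!!y. y : carrier (reg_mod L) ==> b (a y) = y"
  by (rule mod_isoE[OF X0(2) fg_modD(1)[OF C_modules[OF X0(1)]] reg]) (rule that)
 have "x : p ` carrier E" if x: "x : carrier X" for x
 proof -
  obtain v where v: "v : Hom L X0 E" "!!y. y : carrier X0 ==> p (v y) = compose (carrier X0) (\<lambda>r\<in>carrier L. r *\<^sub>X x) b y"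
   using liftsE[OF lif[OF X0(1)] Hom_comp[OF ab(1) hom_from_reg[OF LX x] fg_modD(1)[OF C_modules[OF X0(1)]]]] by metis
  have o: "\<one>\<^sub>L : carrier (reg_mod L)" by simp
  have "p (v (a \<one>\<^sub>L)) = x"
   using v(2)[OF Hom_cl[OF ab(2) o]] Hom_cl[OF ab(2) o] ab(4)[OF o] x by (simp add: compose_def X.smult_one)
  then show ?thesis using Hom_cl[OF v(1) Hom_cl[OF ab(2) o]] by blast
 qed
 then show "p ` carrier E = carrier X" using Hom_cl[OF p] by blast
qed

text \<open>Retracts are turned into summands in the sense of \<open>mod_subcategory\<close>:
  \<open>E\<close> is the direct sum of \<open>X\<close> and the kernel of \<open>r\<close>, with
  second projection \<open>1 - i r\<close>.\<close>

lemma C_retract: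
 assumes E: "E : C" and X: "X : modules L" and i: "i : Hom L X E" and r: "r : Hom L E X"
  and ri: "!!x. x : carrier X ==> r (i x) = x" shows "X : C"
proof -
 note Em = C_modules[OF E]
 note LE = fg_modD(1)[OF Em] and LX = fg_modD(1)[OF X]
 interpret E: left_module L E by (rule LE)
 interpret X: left_module L X by (rule LX)
 let ?K = "a_kernel E X r"
 have K: "submodule ?K L E" by (rule subm_kernel[OF LE LX r])
 have Km: "sub_mod E ?K : modules L" by (rule LA.fg_mod_sub[OF Em K])
 note LK = fg_modD(1)[OF Km]
 obtain ir where ir: "ir : Hom L E E" "!!x. x : carrier E ==> ir x = i (r x)"
  by (rule Hom_comp_ex[OF LE r i]) (rule that)
 obtain k where k: "k : Hom L E E" "!!x. x : carrier E ==> k x = x \<ominus>\<^sub>E ir x"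
  by (rule Hom_diff_ex[OF LE LE Hom_id[OF LE] ir(1)]) (use that in auto)
 note cl = Hom_cl[OF r] Hom_cl[OF i] Hom_cl[OF k(1)]
 have kK: "k x : ?K" if x: "x : carrier E" for x
 proof -
  have "r (k x) = r x \<ominus>\<^sub>X r (i (r x))" using x cl by (simp add: k(2) ir(2) Hom_minus[OF LE LX r])
  then show ?thesis using x cl by (simp add: aker_eq ri X.minus_0_iff)
 qed
 have ki: "k (i x) = 0\<^sub>E" if "x : carrier X" for x
  using that cl by (simp add: k(2) ir(2) ri E.minus_0_iff)
 have kk: "k x = x" if "x : ?K" for x
 proof -
  have x: "x : carrier E" "r x = 0\<^sub>X" using that by (auto simp: aker_eq)
  then show ?thesis using E.add_minus(3)[OF x(1) E.M.zero_closed] by (simp add: k(2) ir(2) Hom_zero[OF LX LE i])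
 qed
 have "mod_iso L E (dsum X (sub_mod E ?K))"
 proof (rule mod_isoI)
  show "(\<lambda>x\<in>carrier E. (r x, k x)) : Hom L E (dsum X (sub_mod E ?K))"
   by (rule hom_to_dsum[OF LE r Hom_into_sub[OF k(1) kK]])
  let ?g = "\<lambda>(x, y)\<in>carrier X \<times> carrier (sub_mod E ?K). i x +\<^sub>E (\<lambda>x\<in>?K. x) y"
  show "?g : Hom L (dsum X (sub_mod E ?K)) E"
   by (rule hom_from_dsum[OF LX LK LE i sub_mod_incl[OF LE K]])
  show "?g ((\<lambda>x\<in>carrier E. (r x, k x)) x) = x" if "x : carrier E" for x
   using that cl kK[OF that] k(2)[OF that] ir(2)[OF that] E.add_minus(2)[of x "i (r x)"] by simp
  show "(\<lambda>x\<in>carrier E. (r x, k x)) (?g z) = z" if z: "z : carrier (dsum X (sub_mod E ?K))" for z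
  proof -
   obtain x y where xy: "z = (x, y)" "x : carrier X" "y : ?K" using z by auto
   have y: "y : carrier E" "r y = 0\<^sub>X" using xy(3) by (auto simp: aker_eq)
   have "r (i x +\<^sub>E y) = x" using xy y cl by (simp add: Hom_add[OF r] ri)
   moreover have "k (i x +\<^sub>E y) = y" using xy y cl by (simp add: Hom_add[OF k(1)] ki kk)
   ultimately show ?thesis using xy y cl by simp
  qed
 qed
 then show ?thesis using C_dsum[OF X Km Em] E by blast
qed

text \<open>The left approximation of an injective module is a monomorphism and therefore
  splits.\<close>

lemma injective_in_C: assumes I: "inj_mod L I" shows "I : C"
proof -
 have Im: "I : modules L" using I by (simp add: injective_mod_def)
 obtain E i where a: "left_approximation L C I i E" using left_approx[OF Im] by blast
 note d = left_approximationD[OF a Im]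
 obtain r where "r : Hom L E I" "!!x. x : carrier I ==> r (i x) = (\<lambda>x\<in>carrier I. x) x"
  by (rule inj_mod_extend[OF I Im C_modules[OF d(1)] d(2,3) Hom_id[OF fg_modD(1)[OF Im]]]) (rule that)
 then show ?thesis using C_retract[OF d(1) Im d(2)] by simp
qed

lemma Zcat_iff: "X : Zcat L n C <-> X : modules L & (ALL Y:C. ALL i. Suc i < n --> ext_zero L i Y X)"
proof -
 have "(ALL i. 0 < i & i < n --> trivial_group (Ext L i Y X)) <-> (ALL i. Suc i < n --> ext_zero L i Y X)"
  if "Y : C" "X : modules L" for Y
  using trivial_Ext_iff[OF C_modules[OF that(1)] that(2)] by (metis gr0_conv_Suc zero_less_Suc)
 then show ?thesis unfolding Zcat_def by auto
qed

text \<open>Iterated minimal syzygies followed by \<open>\<tau>\<close> are what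
  \<open>is_tau_n\<close> asks for, so the last module lies in \<open>C\<close>; after that the
  syzygies are weakened to \<open>syz\<close>.\<close>

lemma tau_n_chain: assumes X: "X : C"
 obtains W Y where "W 0 = X" "!!k. syz L (W k) (W (Suc k))" "!!k. W k : modules L" "Y : C" "is_tau R \<phi> J L (W (n - 1)) Y"
proof -
 have ex: "EX Y:modules L. is_syzygy L X Y" if "X : modules L" for X
  using ex_is_syzygy[OF that] unfolding is_syzygy_def by metis
 obtain W where W: "W 0 = X" "!!k. is_syzygy L (W k) (W (Suc k))" "!!k. W k : modules L" "!!k. (is_syzygy L ^^ k) X (W k)"
  by (rule ex_chain[where r = "is_syzygy L", OF C_modules[OF X] ex]) (assumption | rule that)+
 obtain Y where Y: "Y : modules L" "is_tau R \<phi> J L (W (n - 1)) Y" using tau_exists[OF W(3)] by metis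
 have "Y : C" using C_tau[OF X Y(1)] W(4) Y(2) unfolding is_tau_n_def by blast
 then show ?thesis using that W(1,3) Y is_syzygy_syz[OF W(3) W(2)] by blast
qed

lemma tau_n_inv_chain: assumes X: "X : C"
 obtains W Y where "W 0 = X" "!!k. cosyz L (W k) (W (Suc k))" "!!k. W k : modules L" "Y : C" "is_tau_inv R \<phi> J L (W (n - 1)) Y"
proof -
 have ex: "EX Y:modules L. is_cosyzygy L X Y" if "X : modules L" for X
  using ex_is_cosyzygy[OF that] unfolding is_cosyzygy_def by metis
 obtain W where W: "W 0 = X" "!!k. is_cosyzygy L (W k) (W (Suc k))" "!!k. W k : modules L" "!!k. (is_cosyzygy L ^^ k) X (W k)"
  by (rule ex_chain[where r = "is_cosyzygy L", OF C_modules[OF X] ex]) (assumption | rule that)+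
 obtain Y where Y: "Y : modules L" "is_tau_inv R \<phi> J L (W (n - 1)) Y" using tau_inv_exists[OF W(3)] by metis
 have "Y : C" using C_tau_inv[OF X Y(1)] W(4) Y(2) unfolding is_tau_n_inv_def by blast
 then show ?thesis using that W(1,3) Y is_cosyzygy_cosyz[OF W(3) W(2)] by blast
qed

lemma C_Zcat: "X : C ==> X : Zcat L n C" by (simp add: Zcat_iff C_modules C_ext)

lemma Zcat_mod: "X : Zcat L n C ==> X : modules L" by (simp add: Zcat_iff)

lemma Zcat_extension: "ses L A f B g D ==> A : Zcat L n C ==> D : Zcat L n C ==> B : Zcat L n C"
 unfolding Zcat_iff using ext_zero_middle C_modules sesD(2) by blast

text \<open>Ext of \<open>X\<close> and \<open>A\<close> in degree \<open>i + 1\<close> is governed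
  by lifting maps from the syzygy \<open>W i\<close>. For positive \<open>i\<close> the lifts exist
  because Ext of \<open>X\<close> and \<open>D\<close> vanishes in degree \<open>i\<close>; for
  \<open>i = 0\<close> they are the hypothesis.\<close>

lemma Zcat_kernel:
 assumes T: "ses L A f B g D" and B: "B : Zcat L n C" and D: "D : Zcat L n C" and l: "!!Y. Y : C ==> lifts L Y B g D"
 shows "A : Zcat L n C" unfolding Zcat_iff
proof (intro conjI ballI allI impI)
 fix X i assume X: "X : C" and i: "Suc i < n"
 obtain W where W: "W 0 = X" "!!k. syz L (W k) (W (Suc k))" "!!k. W k : modules L" using syz_chain[OF C_modules[OF X]] by metis
 have ext: "ext1_zero L (W k) M" if "M : Zcat L n C" "Suc k < n" for k M
  using ext_zero_syz_chain[of k W M] W(1,2) that X by (simp add: Zcat_iff)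
 have "lifts L (W i) B g D"
 proof (cases i)
  case (Suc k)
  obtain P j p where P: "proj_mod L P" "ses L (W i) j P p (W k)" using W(2)[of k] Suc unfolding syz_def by metis
  show ?thesis by (rule lifts_left[OF P(2) T ext1_zeroD[OF ext[OF D] P(2)] projective_lifts[OF P(1) T]]) (use i Suc in simp)
 qed (use W(1) l X in simp)
 then have "ext1_zero L (W i) A" by (rule ext1_zero_kernel[OF T W(3) _ ext[OF B i]])
 then show "ext_zero L i X A" using ext_zero_syz_chain[of i W A] W(1,2) sesD(1)[OF T] by simp
qed (use sesD[OF T] in simp)

text \<open>Higher Auslander--Reiten duality is used in the form of the defect formulas for the last syzygy
 \<open>\<Omega>\<^sup>n\<^sup>-\<^sup>1 Y\<close> and the last cosyzygy of an object of \<open>C\<close>; the statement is then carried down to lower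
 degrees by dimension shifting.\<close>

lemma Zcat_cokernel:
 assumes T: "ses L A f B g D" and A: "A : Zcat L n C" and B: "B : Zcat L n C" and e: "!!Y. Y : C ==> extends L A f B Y"
 shows "D : Zcat L n C" unfolding Zcat_iff
proof (intro conjI ballI allI impI)
 note t = sesD[OF T]
 fix X i assume X: "X : C" and i: "Suc i < n"
 obtain W Y where W: "W 0 = X" "!!k. syz L (W k) (W (Suc k))" "!!k. W k : modules L"
  and Y: "Y : C" "is_tau R \<phi> J L (W (n - 1)) Y" using tau_n_chain[OF X] by metis
 have ext: "ext1_zero L (W k) M" if "M : Zcat L n C" "Suc k < n" for k M
  using ext_zero_syz_chain[of k W M] W(1,2) that X by (simp add: Zcat_iff)
 obtain P j p where P: "proj_mod L P" "ses L (W (Suc i)) j P p (W i)" using W(2) unfolding syz_def by metis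
 \<comment> \<open>Below the top degree, vanishing of Ext of \<open>X\<close> and \<open>A\<close>
   gives the lifts. At \<open>Suc i = n - 1\<close> the defect formula takes over:
   \<open>\<tau>\<close> of this syzygy lies in \<open>C\<close>, and maps into it extend by
   hypothesis.\<close>
 have "lifts L (W (Suc i)) B g D"
 proof (cases "Suc (Suc i) < n")
  case True
  then show ?thesis by (rule ext1_zero_lifts[OF ext[OF A] W(3) T])
 next
  case False
  then have "Suc i = n - 1" using i by simp
  then show ?thesis using tau_defect[OF Y(2) W(3) C_modules[OF Y(1)] t(1-3) _ e[OF Y(1)]] T by (simp add: ses_def)
 qed
 then have "extends L (W (Suc i)) j P D" by (rule extends_right[OF P(2) T _ ext1_zeroD[OF ext[OF B i] P(2)]])
 then have "ext1_zero L (W i) D" by (rule ext1_zeroI[OF P(2,1) t(3)])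
 then show "ext_zero L i X D" using ext_zero_syz_chain[of i W D] W(1,2) t(3) by simp
qed (use sesD[OF T] in simp)

text \<open>The step from vanishing in the second argument to vanishing in the first. With injective
  coresolutions \<open>V\<close> of \<open>M\<close> and \<open>W\<close> of \<open>X\<close>, maps
  from \<open>V k\<close> to the next cosyzygy of \<open>X\<close> have to be lifted for
  \<open>k = 0\<close>; the defect formula does this for \<open>k = n - 2\<close>, and dimension
  shifting descends from there.\<close>

lemma Zcat_ext1_zero: assumes M: "M : Zcat L n C" and X: "X : C" and n2: "Suc 0 < n"
 shows "ext1_zero L M X"
proof -
 note Mm = Zcat_mod[OF M]
 obtain W Y where W: "W 0 = X" "!!k. cosyz L (W k) (W (Suc k))" "!!k. W k : modules L"
  and Y: "Y : C" "is_tau_inv R \<phi> J L (W (n - 1)) Y" using tau_n_inv_chain[OF X] by metis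
 obtain V where V: "V 0 = M" "!!k. cosyz L (V k) (V (Suc k))" "!!k. V k : modules L" using cosyz_chain[OF Mm] by metis
 obtain I f g where I: "!!k. inj_mod L (I k)" "!!k. ses L (W k) (f k) (I k) (g k) (W (Suc k))"
  using W(2) unfolding cosyz_def by metis
 obtain Q a b where Q: "!!k. inj_mod L (Q k)" "!!k. ses L (V k) (a k) (Q k) (b k) (V (Suc k))"
  using V(2) unfolding cosyz_def by metis
 \<comment> \<open>Injective modules lie in \<open>C\<close>, so Ext of \<open>Q k\<close> and
   \<open>X\<close> vanishes in degree \<open>k + 1\<close>; shifted to \<open>W k\<close> this
   provides the lifts from \<open>Q k\<close>.\<close>
 have QI: "lifts L (Q k) (I k) (g k) (W (Suc k))" if "Suc k < n" for k
  using ext1_zero_lifts[OF _ sesD(2)[OF Q(2)] I(2)] ext_zero_cosyz_chain[of k W "Q k"] W(1,2) sesD(2)[OF Q(2)]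
   C_ext[OF injective_in_C[OF Q(1)] X that] by simp
 have "lifts L (V k) (I k) (g k) (W (Suc k))" if "k <= n - 2" for k using that
 proof (induction k rule: inc_induct)
  case base
  have k: "Suc (n - 2) = n - 1" "Suc (n - 2) < n" using n2 by simp_all
  \<comment> \<open>\<open>Y\<close> is a value of the inverse higher translate at \<open>X\<close>,
    hence in \<open>C\<close>; so Ext of \<open>Y\<close> and \<open>M\<close> vanishes in degree
    \<open>n - 1\<close>.\<close>
  have "ext1_zero L Y (V (n - 2))"
   using ext_zero_cosyz_chain[of "n - 2" V Y] V(1,2) M Y(1) k C_modules by (simp add: Zcat_iff)
  then have "lifts L Y (Q (n - 2)) (b (n - 2)) (V (Suc (n - 2)))" by (rule ext1_zero_lifts[OF _ C_modules[OF Y(1)] Q(2)])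
  then have "extends L (V (n - 2)) (a (n - 2)) (Q (n - 2)) (W (Suc (n - 2)))"
   using tau_inv_defect[OF Y(2) W(3) C_modules[OF Y(1)] sesD(1-3)[OF Q(2)]] Q(2) k(1) unfolding ses_def by metis
  then show ?case by (rule lifts_left[OF Q(2) I(2) _ QI[OF k(2)]])
 next
  case (step k)
  then have "extends L (V k) (a k) (Q k) (W (Suc k))"
   by (intro extends_ladder[OF Q(2) I(2) injective_extends[OF I(1) Q(2)]])
  then show ?case using step n2 by (intro lifts_left[OF Q(2) I(2) _ QI]) auto
 qed
 from ext1_zeroI'[OF I(2,1) this[of 0]] show ?thesis using V(1) W(1) by simp
qed

text \<open>For n > 1 both sides hold outright, as Ext in degree one vanishes between
  \<open>C\<close> and \<open>Zcat\<close> in either order. For n = 1 the two defect formulas give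
  the two directions, \<open>C\<close> being closed under \<open>\<tau>\<close> and its
  inverse.\<close>

lemma lifts_iff_extends: assumes T: "ses L A f B g D" and A: "A : Zcat L n C" and D: "D : Zcat L n C"
 shows "(ALL X:C. lifts L X B g D) <-> (ALL X:C. extends L A f B X)"
proof (cases "n = 1")
 case False
 then have n2: "Suc 0 < n" using n by simp
 have "lifts L X B g D" if "X : C" for X
  using ext1_zero_lifts[OF _ C_modules[OF that] T] A n2 that unfolding Zcat_iff by (metis ext_zero.simps(1))
 moreover have "extends L A f B X" if "X : C" for X by (rule ext1_zeroD[OF Zcat_ext1_zero[OF D that n2] T])
 ultimately show ?thesis by blast
next
 case True
 note t = sesD(1-3)[OF T] and se = T[unfolded ses_def, THEN conjunct2, THEN conjunct2, THEN conjunct2]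
 have "extends L A f B X" if l: "ALL X:C. lifts L X B g D" and X: "X : C" for X
 proof -
  obtain Y where Y: "Y : C" "is_tau_inv R \<phi> J L X Y" using tau_n_inv_chain[OF X] True by (metis diff_self_eq_0)
  show ?thesis using tau_inv_defect[OF Y(2) C_modules[OF X] C_modules[OF Y(1)] t se] l Y(1) by blast
 qed
 moreover have "lifts L X B g D" if e: "ALL X:C. extends L A f B X" and X: "X : C" for X
 proof -
  obtain Y where Y: "Y : C" "is_tau R \<phi> J L X Y" using tau_n_chain[OF X] True by (metis diff_self_eq_0)
  show ?thesis using tau_defect[OF Y(2) C_modules[OF X] C_modules[OF Y(1)] t se] e Y(1) by blast
 qed
 ultimately show ?thesis by blast
qed

end

section \<open>Triangulations from a generating class of triangles\<close>

context preadditive_category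
begin

abbreviation "cp == Cmp K"
abbreviation "neg X Y f == inv\<^bsub>Mor K X Y\<^esub> f"

lemma Mor_is_group: "X : Ob K ==> Y : Ob K ==> group (Mor K X Y)"
 using Mor_group comm_group.axioms(2) by blast

lemma Cmp_hom: assumes "X : Ob K" "Y : Ob K" "Z : Ob K"
 shows "f : Arr K X Y ==> group_hom (Mor K Y Z) (Mor K X Z) (%g. cp X Y Z g f)"
  "g : Arr K Y Z ==> group_hom (Mor K X Y) (Mor K X Z) (cp X Y Z g)"
 using assms by (auto intro!: group_hom.intro group_hom_axioms.intro homI simp: Mor_is_group Cmp_Arr Cmp_add_left Cmp_add_right)

lemma zero_Arr: "X : Ob K ==> Y : Ob K ==> zero_arr K X Y : Arr K X Y"
 and neg_Arr: "X : Ob K ==> Y : Ob K ==> f : Arr K X Y ==> neg X Y f : Arr K X Y"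
 and add_Arr: "X : Ob K ==> Y : Ob K ==> f : Arr K X Y ==> g : Arr K X Y ==> f \<otimes>\<^bsub>Mor K X Y\<^esub> g : Arr K X Y"
 using Mor_is_group by (simp_all add: group.is_monoid monoid.m_closed)

lemma Cmp_zero: assumes "X : Ob K" "Y : Ob K" "Z : Ob K"
 shows "f : Arr K X Y ==> cp X Y Z (zero_arr K Y Z) f = zero_arr K X Z"
  "g : Arr K Y Z ==> cp X Y Z g (zero_arr K X Y) = zero_arr K X Z"
 using group_hom.hom_one[OF Cmp_hom(1)[OF assms]] group_hom.hom_one[OF Cmp_hom(2)[OF assms]] by simp_all

lemma Cmp_neg: assumes "X : Ob K" "Y : Ob K" "Z : Ob K" "f : Arr K X Y" "g : Arr K Y Z"
 shows "cp X Y Z (neg Y Z g) f = neg X Z (cp X Y Z g f)" "cp X Y Z g (neg X Y f) = neg X Z (cp X Y Z g f)"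
 using group_hom.hom_inv[OF Cmp_hom(1)[OF assms(1-4)]] group_hom.hom_inv[OF Cmp_hom(2)[OF assms(1-3,5)]] assms by simp_all

lemmas cat = Idn_Arr Cmp_Arr Cmp_Idn_left Cmp_Idn_right zero_Arr neg_Arr add_Arr

text \<open>Composites are kept nested to the right; this lets a known composite of two arrows be
  rewritten in front of a further arrow \<open>x\<close>.\<close>

lemma reassoc:
 assumes "cp X Y Z g f = r" "W : Ob K" "X : Ob K" "Y : Ob K" "Z : Ob K" "x : Arr K W X" "f : Arr K X Y" "g : Arr K Y Z"
 shows "cp W Y Z g (cp W X Y f x) = cp W X Z r x" using Cmp_assoc[OF assms(2-8)] assms(1) by simp

lemmas assoc = Cmp_assoc[symmetric]

lemma eq_if_neg_add: 
 assumes "X : Ob K" "Y : Ob K" "f : Arr K X Y" "g : Arr K X Y" "f \<otimes>\<^bsub>Mor K X Y\<^esub> neg X Y g = zero_arr K X Y"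
 shows "f = g"
proof -
 interpret group "Mor K X Y" by (rule Mor_is_group[OF assms(1,2)])
 show ?thesis using assms(3-5) by (metis inv_equality inv_closed inv_inv)
qed

lemma iso_arrE: assumes "iso_arr K X Y f"
 obtains g where "f : Arr K X Y" "g : Arr K Y X" "cp X Y X g f = Idn K X" "cp Y X Y f g = Idn K Y" "iso_arr K Y X g"
 using assms unfolding iso_arr_def by blast

lemma iso_arrI: "f : Arr K X Y ==> g : Arr K Y X ==> cp X Y X g f = Idn K X ==> cp Y X Y f g = Idn K Y ==> iso_arr K X Y f"
 unfolding iso_arr_def by blast

lemma iso_arr_Idn: "X : Ob K ==> iso_arr K X X (Idn K X)"
 by (rule iso_arrI[where g = "Idn K X"]) (simp_all add: cat)

lemma iso_arr_Cmp:
 assumes O: "X : Ob K" "Y : Ob K" "Z : Ob K" and f: "iso_arr K X Y f" and g: "iso_arr K Y Z g"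
 shows "iso_arr K X Z (cp X Y Z g f)"
proof -
 obtain f' where f: "f : Arr K X Y" "f' : Arr K Y X" "cp X Y X f' f = Idn K X" "cp Y X Y f f' = Idn K Y" by (rule iso_arrE[OF f])
 obtain g' where g: "g : Arr K Y Z" "g' : Arr K Z Y" "cp Y Z Y g' g = Idn K Y" "cp Z Y Z g g' = Idn K Z" by (rule iso_arrE[OF g])
 show ?thesis
  by (rule iso_arrI[of _ _ _ "cp Z Y X f' g'"]) (use O f g in \<open>simp_all add: cat assoc reassoc[OF g(3)] reassoc[OF f(4)]\<close>)
qed

text \<open>The hypotheses yield a left inverse and a right inverse of \<open>f\<close>, which
  coincide by associativity.\<close>

lemma iso_arr_two_sided:
 assumes O: "X : Ob K" "Y : Ob K" and f: "f : Arr K X Y" and g: "g : Arr K Y X" "g' : Arr K Y X"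
  and 1: "iso_arr K X X (cp X Y X g f)" and 2: "iso_arr K Y Y (cp Y X Y f g')" shows "iso_arr K X Y f"
proof -
 obtain a where a: "a : Arr K X X" "cp X X X a (cp X Y X g f) = Idn K X" by (rule iso_arrE[OF 1])
 obtain b where b: "b : Arr K Y Y" "cp Y Y Y (cp Y X Y f g') b = Idn K Y" by (rule iso_arrE[OF 2])
 let ?l = "cp Y X X a g" and ?r = "cp Y Y X g' b"
 have l: "cp X Y X ?l f = Idn K X" using a O f g by (simp add: assoc)
 have r: "cp Y X Y f ?r = Idn K Y" using b O f g by (simp add: Cmp_assoc)
 have "?l = cp Y Y X ?l (cp Y X Y f ?r)" using O a g by (simp add: r cat)
 also have "... = cp Y X X (cp X Y X ?l f) ?r" using O a b f g by (intro Cmp_assoc) (simp_all add: cat)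
 also have "... = ?r" using O b g by (simp add: l cat)
 finally have "?l = ?r" .
 then show ?thesis using l r by (intro iso_arrI[of _ _ _ ?l]) (use O a b f g in \<open>simp_all add: cat\<close>)
qed

lemma square_inverse: assumes O: "X : Ob K" "Y : Ob K" "X' : Ob K" "Y' : Ob K"
  and A: "u : Arr K X Y" "u' : Arr K X' Y'" "a : Arr K X X'" "b : Arr K Y Y'" "a' : Arr K X' X" "b' : Arr K Y' Y"
  and e: "cp X Y Y' b u = cp X X' Y' u' a" and a: "cp X' X X' a a' = Idn K X'" and b: "cp Y Y' Y b' b = Idn K Y"
 shows "cp X' Y' Y b' u' = cp X' X Y u a'"
proof -
 have "cp X' Y' Y b' u' = cp X' Y' Y b' (cp X' X Y' (cp X X' Y' u' a) a')" using O A by (simp add: assoc a cat)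
 also have "... = cp X' X Y u a'" using O A by (simp add: assoc reassoc[OF b] cat flip: e)
 finally show ?thesis .
qed

end

section \<open>Triangles, their morphisms and isomorphisms\<close>

context suspended_category
begin

lemma s_group_hom: "X : Ob K ==> Y : Ob K ==> group_hom (Mor K X Y) (Mor K (S X) (S Y)) (s X Y)"
 by (simp add: group_hom_def group_hom_axioms_def Mor_is_group S_Ob s_hom)

lemma s_Arr: "X : Ob K ==> Y : Ob K ==> f : Arr K X Y ==> s X Y f : Arr K (S X) (S Y)"
 using group_hom.hom_closed[OF s_group_hom] by blast

lemma s_neg: "X : Ob K ==> Y : Ob K ==> f : Arr K X Y ==> s X Y (neg X Y f) = neg (S X) (S Y) (s X Y f)"
 using group_hom.hom_inv[OF s_group_hom] by blast

lemma s_inj: "X : Ob K ==> Y : Ob K ==> f : Arr K X Y ==> g : Arr K X Y ==> s X Y f = s X Y g ==> f = g"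
 using s_bij inj_onD unfolding bij_betw_def by metis

lemma s_surj:  assumes "X : Ob K" "Y : Ob K" "g : Arr K (S X) (S Y)"
 obtains f where "f : Arr K X Y" "g = s X Y f"
 using s_bij[OF assms(1,2)] assms(3) unfolding bij_betw_def by (metis imageE)

lemma iso_arr_s: assumes O: "X : Ob K" "Y : Ob K" and f: "f : Arr K X Y"
 shows "iso_arr K (S X) (S Y) (s X Y f) <-> iso_arr K X Y f"
proof
 assume "iso_arr K X Y f"
 then obtain g where g: "g : Arr K Y X" "cp X Y X g f = Idn K X" "cp Y X Y f g = Idn K Y" by (rule iso_arrE)
 show "iso_arr K (S X) (S Y) (s X Y f)"
  using g O f s_Cmp[of X Y X f g] s_Cmp[of Y X Y g f] by (intro iso_arrI[of _ _ _ "s Y X g"]) (simp_all add: s_Arr s_Idn)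
next
 assume "iso_arr K (S X) (S Y) (s X Y f)"
 then obtain h where h: "h : Arr K (S Y) (S X)" "cp (S X) (S Y) (S X) h (s X Y f) = Idn K (S X)" "cp (S Y) (S X) (S Y) (s X Y f) h = Idn K (S Y)" by (rule iso_arrE)
 obtain g where g: "g : Arr K Y X" "h = s Y X g" by (rule s_surj[OF O(2,1) h(1)])
 have "cp X Y X g f = Idn K X" by (rule s_inj[OF O(1,1)]) (use h g O f in \<open>simp_all add: cat s_Cmp s_Idn\<close>)
 moreover have "cp Y X Y f g = Idn K Y" by (rule s_inj[OF O(2,2)]) (use h g O f in \<open>simp_all add: cat s_Cmp s_Idn\<close>)
 ultimately show "iso_arr K X Y f" using f g by (intro iso_arrI)
qed

definition typed where
 "typed t <-> (case t of (X, Y, Z, u, v, w) => X : Ob K & Y : Ob K & Z : Ob K & u : Arr K X Y & v : Arr K Y Z & w : Arr K Z (S X))"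

definition tmor where
 "tmor t t' a b c <-> (case t of (X, Y, Z, u, v, w) => case t' of (X', Y', Z', u', v', w') =>
  a : Arr K X X' & b : Arr K Y Y' & c : Arr K Z Z' & cp X Y Y' b u = cp X X' Y' u' a & cp Y Z Z' c v = cp Y Y' Z' v' b &
  cp Z (S X) (S X') (s X X' a) w = cp Z Z' (S X') w' c)"

definition tiso where
 "tiso t t' <-> (EX a b c. tmor t t' a b c & (case t of (X, Y, Z, u, v, w) => case t' of (X', Y', Z', u', v', w') =>
  iso_arr K X X' a & iso_arr K Y Y' b & iso_arr K Z Z' c))"

lemmas simps = typed_def tmor_def tiso_def split

lemma square_paste: assumes "X : Ob K" "Y : Ob K" "X' : Ob K" "Y' : Ob K" "X'' : Ob K" "Y'' : Ob K"
  "u : Arr K X Y" "u' : Arr K X' Y'" "u'' : Arr K X'' Y''" "a : Arr K X X'" "a' : Arr K X' X''" "b : Arr K Y Y'" "b' : Arr K Y' Y''"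
  "cp X Y Y' b u = cp X X' Y' u' a" "cp X' Y' Y'' b' u' = cp X' X'' Y'' u'' a'"
 shows "cp X Y Y'' (cp Y Y' Y'' b' b) u = cp X X'' Y'' u'' (cp X X' X'' a' a)"
proof -
 show ?thesis using assms(1-13) by (simp add: assoc assms(14) reassoc[OF assms(15)])
qed

lemma tmor_Cmp:
 assumes "typed (X, Y, Z, u, v, w)" "typed (X', Y', Z', u', v', w')" "typed (X'', Y'', Z'', u'', v'', w'')"
  and "tmor (X, Y, Z, u, v, w) (X', Y', Z', u', v', w') a b c" "tmor (X', Y', Z', u', v', w') (X'', Y'', Z'', u'', v'', w'') a' b' c'"
 shows "tmor (X, Y, Z, u, v, w) (X'', Y'', Z'', u'', v'', w'') (cp X X' X'' a' a) (cp Y Y' Y'' b' b) (cp Z Z' Z'' c' c)"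
proof -
 note * = assms[unfolded simps]
 have "cp X Y Y'' (cp Y Y' Y'' b' b) u = cp X X'' Y'' u'' (cp X X' X'' a' a)" by (rule square_paste[of _ _ X' Y' _ _ _ u']) (use * in auto)
 moreover have "cp Y Z Z'' (cp Z Z' Z'' c' c) v = cp Y Y'' Z'' v'' (cp Y Y' Y'' b' b)" by (rule square_paste[of _ _ Y' Z' _ _ _ v']) (use * in auto)
 moreover have "cp Z (S X) (S X'') (cp (S X) (S X') (S X'') (s X' X'' a') (s X X' a)) w = cp Z Z'' (S X'') w'' (cp Z Z' Z'' c' c)"
  by (rule square_paste[of _ _ Z' "S X'" _ _ _ w']) (use * in \<open>auto simp: S_Ob s_Arr\<close>)
 ultimately show ?thesis using * by (simp add: simps cat s_Cmp)
qed

lemma tmor_inverse: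
 assumes "typed (X, Y, Z, u, v, w)" "typed (X', Y', Z', u', v', w')" "tmor (X, Y, Z, u, v, w) (X', Y', Z', u', v', w') a b c"
  and "a' : Arr K X' X" "b' : Arr K Y' Y" "c' : Arr K Z' Z" "cp X X' X a' a = Idn K X" "cp Y Y' Y b' b = Idn K Y" "cp Z Z' Z c' c = Idn K Z"
  "cp X' X X' a a' = Idn K X'" "cp Y' Y Y' b b' = Idn K Y'" "cp Z' Z Z' c c' = Idn K Z'"
 shows "tmor (X', Y', Z', u', v', w') (X, Y, Z, u, v, w) a' b' c'"
proof -
 note * = assms[unfolded simps]
 have "cp X' Y' Y b' u' = cp X' X Y u a'" by (rule square_inverse[where a = a and b = b]) (use * in auto)
 moreover have "cp Y' Z' Z c' v' = cp Y' Y Z v b'" by (rule square_inverse[where a = b and b = c]) (use * in auto)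
 moreover have "cp (S X) (S X') (S X) (s X' X a') (s X X' a) = Idn K (S X)" using * by (simp flip: s_Cmp add: s_Idn)
 then have "cp Z' (S X') (S X) (s X' X a') w' = cp Z' Z (S X) w c'"
  by (rule square_inverse[where a = c and b = "s X X' a", rotated -1]) (use * in \<open>auto simp: S_Ob s_Arr\<close>)
 ultimately show ?thesis using * by (simp add: simps)
qed

lemma tiso_sym: "typed t ==> typed t' ==> tiso t t' ==> tiso t' t"
proof -
 assume t: "typed t" "typed t'" "tiso t t'"
 obtain X Y Z u v w where T: "t = (X, Y, Z, u, v, w)" by (cases t)
 obtain X' Y' Z' u' v' w' where T': "t' = (X', Y', Z', u', v', w')" by (cases t')
 obtain a b c where m: "tmor t t' a b c" "iso_arr K X X' a" "iso_arr K Y Y' b" "iso_arr K Z Z' c" using t(3) by (auto simp: tiso_def T T')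
 obtain a' where a: "a' : Arr K X' X" "cp X X' X a' a = Idn K X" "cp X' X X' a a' = Idn K X'" "iso_arr K X' X a'" by (rule iso_arrE[OF m(2)])
 obtain b' where b: "b' : Arr K Y' Y" "cp Y Y' Y b' b = Idn K Y" "cp Y' Y Y' b b' = Idn K Y'" "iso_arr K Y' Y b'" by (rule iso_arrE[OF m(3)])
 obtain c' where c: "c' : Arr K Z' Z" "cp Z Z' Z c' c = Idn K Z" "cp Z' Z Z' c c' = Idn K Z'" "iso_arr K Z' Z c'" by (rule iso_arrE[OF m(4)])
 have "tmor t' t a' b' c'" unfolding T T' by (rule tmor_inverse[OF t(1,2)[unfolded T T'] m(1)[unfolded T T']]) (fact a b c)+
 then show "tiso t' t" using a b c unfolding tiso_def T T' by auto
qed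

lemma tiso_trans: "typed t ==> typed t' ==> typed t'' ==> tiso t t' ==> tiso t' t'' ==> tiso t t''"
proof -
 assume t: "typed t" "typed t'" "typed t''" "tiso t t'" "tiso t' t''"
 obtain X Y Z u v w where T: "t = (X, Y, Z, u, v, w)" by (cases t)
 obtain X' Y' Z' u' v' w' where T': "t' = (X', Y', Z', u', v', w')" by (cases t')
 obtain X'' Y'' Z'' u'' v'' w'' where T'': "t'' = (X'', Y'', Z'', u'', v'', w'')" by (cases t'')
 obtain a b c where m: "tmor t t' a b c" "iso_arr K X X' a" "iso_arr K Y Y' b" "iso_arr K Z Z' c" using t(4) by (auto simp: tiso_def T T')
 obtain a' b' c' where m': "tmor t' t'' a' b' c'" "iso_arr K X' X'' a'" "iso_arr K Y' Y'' b'" "iso_arr K Z' Z'' c'" using t(5) by (auto simp: tiso_def T' T'')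
 have "tmor t t'' (cp X X' X'' a' a) (cp Y Y' Y'' b' b) (cp Z Z' Z'' c' c)"
  unfolding T T'' by (rule tmor_Cmp[OF t(1-3)[unfolded T T' T''] m(1)[unfolded T T'] m'(1)[unfolded T' T'']])
 moreover have "X : Ob K" "X' : Ob K" "X'' : Ob K" "Y : Ob K" "Y' : Ob K" "Y'' : Ob K" "Z : Ob K" "Z' : Ob K" "Z'' : Ob K"
  using t(1-3) by (auto simp: T T' T'' typed_def)
 ultimately show "tiso t t''" using m(2-4) m'(2-4) iso_arr_Cmp unfolding tiso_def T T' T'' by (auto; metis)
qed

end

section \<open>Exact structures relative to a class of objects\<close>

lemma (in preadditive_category) arr_simps: assumes "X : Ob K" "Y : Ob K"
 shows "neg X Y (zero_arr K X Y) = zero_arr K X Y"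
  "f : Arr K X Y ==> f \<otimes>\<^bsub>Mor K X Y\<^esub> zero_arr K X Y = f" "f : Arr K X Y ==> zero_arr K X Y \<otimes>\<^bsub>Mor K X Y\<^esub> f = f"
  "f : Arr K X Y ==> f \<otimes>\<^bsub>Mor K X Y\<^esub> neg X Y f = zero_arr K X Y" "f : Arr K X Y ==> neg X Y f \<otimes>\<^bsub>Mor K X Y\<^esub> f = zero_arr K X Y"
  "f : Arr K X Y ==> neg X Y (neg X Y f) = f"
  "f : Arr K X Y ==> g : Arr K X Y ==> (f \<otimes>\<^bsub>Mor K X Y\<^esub> neg X Y g) \<otimes>\<^bsub>Mor K X Y\<^esub> g = f"
proof -
 interpret comm_group "Mor K X Y" by (rule Mor_group[OF assms])
 show "neg X Y (zero_arr K X Y) = zero_arr K X Y"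
  "f : Arr K X Y ==> f \<otimes>\<^bsub>Mor K X Y\<^esub> zero_arr K X Y = f" "f : Arr K X Y ==> zero_arr K X Y \<otimes>\<^bsub>Mor K X Y\<^esub> f = f"
  "f : Arr K X Y ==> f \<otimes>\<^bsub>Mor K X Y\<^esub> neg X Y f = zero_arr K X Y" "f : Arr K X Y ==> neg X Y f \<otimes>\<^bsub>Mor K X Y\<^esub> f = zero_arr K X Y"
  "f : Arr K X Y ==> neg X Y (neg X Y f) = f"
  "f : Arr K X Y ==> g : Arr K X Y ==> (f \<otimes>\<^bsub>Mor K X Y\<^esub> neg X Y g) \<otimes>\<^bsub>Mor K X Y\<^esub> g = f"
  by (simp_all add: m_assoc)
qed

text \<open>Only extension of maps into \<open>Pr\<close> is demanded, a condition visibly stable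
  under composition and pushout; that such a map is a kernel is left to the axioms of
  \<open>relative_exact\<close>.\<close>

definition rel_inflation :: "('o, 'm) preadd_cat => 'o set => 'o => 'm => 'o => bool" where
 "rel_inflation K Pr A f B <-> A : Ob K & B : Ob K & f : Arr K A B &
  (ALL P:Pr. ALL h:Arr K A P. EX k:Arr K B P. Cmp K A B P k f = h)"

definition rel_deflation :: "('o, 'm) preadd_cat => 'o set => 'o => 'm => 'o => bool" where
 "rel_deflation K Pr B g D <-> B : Ob K & D : Ob K & g : Arr K B D &
  (ALL P:Pr. ALL h:Arr K P D. EX k:Arr K P B. Cmp K P B D g k = h)"

definition rel_conflations :: "('o, 'm) preadd_cat => 'o set => ('o, 'm) seqs" where
 "rel_conflations K Pr = {(A, f, B, g, D). rel_inflation K Pr A f B & rel_deflation K Pr B g D &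
  kernel_of K A f B g D & cokernel_of K A f B g D}"

text \<open>Self-dual conditions from which Quillen's axioms follow formally. \<open>Pr\<close> will
  be \<open>C\<close>; the module-theoretic content is that relative inflations and deflations have
  cokernels and kernels which satisfy the dual condition.\<close>

locale relative_exact = additive_category K for K :: "('o, 'm) preadd_cat" +
 fixes Pr :: "'o set" assumes Pr_Ob: "P : Pr ==> P : Ob K"
  and Pr_retract: "P : Pr ==> X : Ob K ==> i : Arr K X P ==> r : Arr K P X ==> Cmp K X P X r i = Idn K X ==> X : Pr"
  and ex_cokernel: "rel_inflation K Pr A f B ==> EX g D. (A, f, B, g, D) : rel_conflations K Pr"
  and ex_kernel: "rel_deflation K Pr B g D ==> EX A f. (A, f, B, g, D) : rel_conflations K Pr"
  and ex_inflation: "X : Ob K ==> EX P:Pr. EX f. rel_inflation K Pr X f P"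
  and ex_deflation: "X : Ob K ==> EX P:Pr. EX g. rel_deflation K Pr P g X"
begin

abbreviation "E == rel_conflations K Pr"
abbreviation "infl == rel_inflation K Pr"
abbreviation "defl == rel_deflation K Pr"

lemma conflD: assumes "(A, f, B, g, D) : E"
 shows "A : Ob K" "B : Ob K" "D : Ob K" "f : Arr K A B" "g : Arr K B D" "cp A B D g f = zero_arr K A D"
 using assms by (auto simp: rel_conflations_def rel_inflation_def rel_deflation_def kernel_of_def)

lemma confl_infl: "(A, f, B, g, D) : E ==> infl A f B"
 and confl_defl: "(A, f, B, g, D) : E ==> defl B g D" by (simp_all add: rel_conflations_def)

lemma inflD: "infl A f B ==> A : Ob K & B : Ob K & f : Arr K A B"
 and deflD: "defl B g D ==> B : Ob K & D : Ob K & g : Arr K B D"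
 by (auto simp: rel_inflation_def rel_deflation_def)

lemma inflE: assumes "infl A f B" "P : Pr" "h : Arr K A P"
 obtains k where "k : Arr K B P" "cp A B P k f = h" using assms unfolding rel_inflation_def by blast

lemma deflE: assumes "defl B g D" "P : Pr" "h : Arr K P D"
 obtains k where "k : Arr K P B" "cp P B D g k = h" using assms unfolding rel_deflation_def by blast

lemma injective: "P : Pr ==> (A, f, B, g, D) : E ==> h : Arr K A P ==> EX k:Arr K B P. cp A B P k f = h"
 and projective: "P : Pr ==> (A, f, B, g, D) : E ==> h : Arr K P D ==> EX k:Arr K P B. cp P B D g k = h"
 using confl_infl confl_defl inflE deflE by metis+

lemma cokernelE:
 assumes "(A, f, B, g, D) : E" "X : Ob K" "h : Arr K B X" "cp A B X h f = zero_arr K A X"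
 obtains k where "k : Arr K D X" "cp B D X k g = h"
 using assms unfolding rel_conflations_def cokernel_of_def by blast

lemma kernelE:
 assumes "(A, f, B, g, D) : E" "X : Ob K" "h : Arr K X B" "cp X B D g h = zero_arr K X D"
 obtains k where "k : Arr K X A" "cp X A B f k = h"
 using assms unfolding rel_conflations_def kernel_of_def by blast

lemma deflation_epi:
 assumes E: "(A, f, B, g, D) : E" and X: "X : Ob K" and h: "h : Arr K D X" "k : Arr K D X" and e: "cp B D X h g = cp B D X k g"
 shows "h = k"
proof -
 note c = conflD[OF E]
 have "cp A B X (cp B D X k g) f = zero_arr K A X" "cp B D X k g : Arr K B X" using c X h by (simp_all add: assoc Cmp_zero cat)
 then have "EX! m. m : Arr K D X & cp B D X m g = cp B D X k g"
  using E X unfolding rel_conflations_def cokernel_of_def by blast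
 then show ?thesis using h e by blast
qed

lemma inflation_mono:
 assumes E: "(A, f, B, g, D) : E" and X: "X : Ob K" and h: "h : Arr K X A" "k : Arr K X A" and e: "cp X A B f h = cp X A B f k"
 shows "h = k"
proof -
 note c = conflD[OF E]
 have "cp X B D g (cp X A B f k) = zero_arr K X D" "cp X A B f k : Arr K X B" using c X h by (simp_all add: Cmp_zero reassoc[OF c(6)] cat)
 then have "EX! m. m : Arr K X A & cp X A B f m = cp X A B f k"
  using E X unfolding rel_conflations_def kernel_of_def by blast
 then show ?thesis using h e by blast
qed

text \<open>Kernels are unique up to isomorphism, so \<open>f\<close> inherits the remaining
  conditions from the kernel supplied by the axioms.\<close>

lemma confl_if_kernel: assumes g: "defl B g D" and A: "A : Ob K" and k: "kernel_of K A f B g D"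
 shows "(A, f, B, g, D) : E"
proof -
 obtain A' f' where E: "(A', f', B, g, D) : E" using ex_kernel[OF g] by blast
 note c = conflD[OF E]
 have f: "f : Arr K A B" "cp A B D g f = zero_arr K A D" using k unfolding kernel_of_def by auto
 obtain a where a: "a : Arr K A' A" "cp A' A B f a = f'" using k c unfolding kernel_of_def by blast
 obtain b where b: "b : Arr K A A'" "cp A A' B f' b = f" by (rule kernelE[OF E A f])
 have "infl A f B" unfolding rel_inflation_def
 proof (intro conjI ballI A c f)
  fix P h assume P: "P : Pr" and h: "h : Arr K A P"
  obtain v where v: "v : Arr K B P" "cp A' B P v f' = cp A' A P h a"
   by (rule inflE[OF confl_infl[OF E] P]) (use a h A c Pr_Ob[OF P] cat in blast)
  have ba: "cp A A' A a b = Idn K A"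
  proof -
   have "cp A A B f (cp A A' A a b) = f" using A c f a b by (simp add: reassoc[OF a(2)])
   moreover have "EX! m. m : Arr K A A & cp A A B f m = f" using k A f unfolding kernel_of_def by blast
   ultimately show ?thesis using A c a b f by (metis cat(1,2,4))
  qed
  have "cp A B P v f = cp A A' P (cp A' B P v f') b" using A c v(1) b Pr_Ob[OF P] by (simp add: assoc)
  also have "... = h" using A c v(2) a b h Pr_Ob[OF P] by (simp add: assoc ba cat)
  finally show "EX k:Arr K B P. cp A B P k f = h" using v(1) by blast
 qed
 moreover have "cokernel_of K A f B g D" unfolding cokernel_of_def
 proof (intro conjI ballI impI f c)
  fix X h assume X: "X : Ob K" and h: "h : Arr K B X" "cp A B X h f = zero_arr K A X"
  have "cp A' B X h (cp A' A B f a) = zero_arr K A' X" using A c X a(1) f h by (simp add: reassoc[OF h(2)] Cmp_zero)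
  then show "EX! k. k : Arr K D X & cp B D X k g = h"
   using cokernelE[OF E X h(1)] deflation_epi[OF E X] unfolding a(2) by metis
 qed
 ultimately show ?thesis using g k by (simp add: rel_conflations_def)
qed

text \<open>The dual transport, along uniqueness of cokernels.\<close>

lemma confl_if_cokernel: assumes f: "infl A f B" and D: "D : Ob K" and k: "cokernel_of K A f B g D"
 shows "(A, f, B, g, D) : E"
proof -
 obtain g' D' where E: "(A, f, B, g', D') : E" using ex_cokernel[OF f] by blast
 note c = conflD[OF E]
 have g: "g : Arr K B D" "cp A B D g f = zero_arr K A D" using k unfolding cokernel_of_def by auto
 obtain a where a: "a : Arr K D D'" "cp B D D' a g = g'" using k c unfolding cokernel_of_def by blast
 obtain b where b: "b : Arr K D' D" "cp B D' D b g' = g" by (rule cokernelE[OF E D g])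
 have ba: "cp D D' D b a = Idn K D"
 proof -
  have "cp B D D (cp D D' D b a) g = g" using D c g a b by (simp add: assoc)
  moreover have "EX! m. m : Arr K D D & cp B D D m g = g" using k D g unfolding cokernel_of_def by blast
  ultimately show ?thesis using D c a b g by (metis cat(1,2,3))
 qed
 have "defl B g D" unfolding rel_deflation_def
 proof (intro conjI ballI D c g)
  fix P h assume P: "P : Pr" and h: "h : Arr K P D"
  obtain v where v: "v : Arr K P B" "cp P B D' g' v = cp P D D' a h"
   by (rule deflE[OF confl_defl[OF E] P]) (use a h D c Pr_Ob[OF P] cat in blast)
  have "cp P B D g v = cp P D' D b (cp P B D' g' v)" using D c v(1) b Pr_Ob[OF P] by (simp add: reassoc[OF b(2)])
  also have "... = h" using D c v(2) a b h Pr_Ob[OF P] by (simp add: reassoc[OF ba] cat)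
  finally show "EX k:Arr K P B. cp P B D g k = h" using v(1) by blast
 qed
 moreover have "kernel_of K A f B g D" unfolding kernel_of_def
 proof (intro conjI ballI impI g c)
  fix X h assume X: "X : Ob K" and h: "h : Arr K X B" "cp X B D g h = zero_arr K X D"
  have "cp X B D' (cp B D D' a g) h = zero_arr K X D'" using D c X a(1) g h by (simp add: assoc Cmp_zero)
  then show "EX! k. k : Arr K X A & cp X A B f k = h"
   using kernelE[OF E X h(1)] inflation_mono[OF E X] unfolding a(2) by metis
 qed
 ultimately show ?thesis using f k by (simp add: rel_conflations_def)
qed

lemma infl_Cmp: "infl A f B ==> infl B g D ==> infl A (cp A B D g f) D"
 unfolding rel_inflation_def by (auto simp: cat assoc dest: Pr_Ob) (metis Pr_Ob assoc)

lemma defl_Cmp: "defl A f B ==> defl B g D ==> defl A (cp A B D g f) D"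
 unfolding rel_deflation_def by (auto simp: cat assoc dest: Pr_Ob) (metis Pr_Ob assoc)

lemma biproductD: assumes "biproduct K X Y B i j p q"
 shows "B : Ob K" "i : Arr K X B" "j : Arr K Y B" "p : Arr K B X" "q : Arr K B Y"
  "cp X B X p i = Idn K X" "cp Y B Y q j = Idn K Y" "cp X B Y q i = zero_arr K X Y" "cp Y B X p j = zero_arr K Y X"
  "cp B X B i p \<otimes>\<^bsub>Mor K B B\<^esub> cp B Y B j q = Idn K B"
 using assms unfolding biproduct_def by blast+

lemma biproduct_decomp: assumes b: "biproduct K X Y B i j p q" and O: "X : Ob K" "Y : Ob K" "Z : Ob K"
 shows "r : Arr K B Z ==> r = cp B X Z (cp X B Z r i) p \<otimes>\<^bsub>Mor K B Z\<^esub> cp B Y Z (cp Y B Z r j) q"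
  "r : Arr K Z B ==> r = cp Z X B i (cp Z B X p r) \<otimes>\<^bsub>Mor K Z B\<^esub> cp Z Y B j (cp Z B Y q r)"
proof -
 note b = biproductD[OF b]
 show "r = cp B X Z (cp X B Z r i) p \<otimes>\<^bsub>Mor K B Z\<^esub> cp B Y Z (cp Y B Z r j) q" if "r : Arr K B Z"
  using Cmp_add_right[of B B Z "cp B X B i p" "cp B Y B j q" r] that b(1-5) O by (simp add: b(10) cat assoc)
 show "r = cp Z X B i (cp Z B X p r) \<otimes>\<^bsub>Mor K Z B\<^esub> cp Z Y B j (cp Z B Y q r)" if "r : Arr K Z B"
  using Cmp_add_left[of Z B B r "cp B X B i p" "cp B Y B j q"] that b(1-5) O by (simp add: b(10) cat assoc)
qed

text \<open>Maps into \<open>Pr\<close> already extend along the first component, so pairing an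
  inflation with any \<open>h\<close> is again an inflation. With \<open>B\<close> in
  \<open>Pr\<close> this is the mapping cone of \<open>h\<close>.\<close>

lemma cone: assumes f: "infl A f B" and A': "A' : Ob K" and h: "h : Arr K A A'"
 shows "EX P j1 j2 q1 q2 k Q. biproduct K B A' P j1 j2 q1 q2 & (A, cp A B P j1 f \<otimes>\<^bsub>Mor K A P\<^esub> cp A A' P j2 h, P, k, Q) : E"
proof -
 note F = inflD[OF f]
 obtain P j1 j2 q1 q2 where b: "biproduct K B A' P j1 j2 q1 q2" using has_biproducts F A' by blast
 note B = biproductD[OF b]
 have "infl A (cp A B P j1 f \<otimes>\<^bsub>Mor K A P\<^esub> cp A A' P j2 h) P"
  unfolding rel_inflation_def
 proof (intro conjI ballI)
  fix W t assume W: "W : Pr" and t: "t : Arr K A W"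
  obtain v where v: "v : Arr K B W" "cp A B W v f = t" by (rule inflE[OF f W t])
  have "cp A P W (cp P B W v q1) (cp A B P j1 f \<otimes>\<^bsub>Mor K A P\<^esub> cp A A' P j2 h) = t"
   using B(1-5) F A' h v t Pr_Ob[OF W]
   by (simp add: cat assoc Cmp_add_right reassoc[OF B(6)] reassoc[OF B(9)] Cmp_zero arr_simps)
  then show "EX k:Arr K P W. cp A P W k (cp A B P j1 f \<otimes>\<^bsub>Mor K A P\<^esub> cp A A' P j2 h) = t"
   using B v Pr_Ob[OF W] F by (intro bexI[of _ "cp P B W v q1"]) (simp_all add: cat)
 qed (use B F A' h in \<open>simp_all add: cat\<close>)
 then show ?thesis using ex_cokernel b by blast
qed

text \<open>The third isomorphism theorem for conflations, source of the octahedron. Extension along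
  \<open>f\<close> is solved on \<open>Z\<close> first, by a map that vanishes on \<open>X\<close>
  and therefore descends to \<open>D\<close>.\<close>

lemma noether:
 assumes u: "(X, u, Y, j, A) : E" and v: "(Y, v, Z, l, B) : E" and vu: "(X, cp X Y Z v u, Z, k, D) : E"
  and f: "f : Arr K A D" "cp Y A D f j = cp Y Z D k v" and g: "g : Arr K D B" "cp Z D B g k = l"
 shows "(A, f, D, g, B) : E"
proof -
 note U = conflD[OF u] and V = conflD[OF v] and W = conflD[OF vu]
 have "infl A f D" unfolding rel_inflation_def
 proof (intro conjI ballI f U W)
  fix P h assume P: "P : Pr" and h: "h : Arr K A P"
  note O = Pr_Ob[OF P]
  obtain w where w: "w : Arr K Z P" "cp Y Z P w v = cp Y A P h j"
   by (rule inflE[OF confl_infl[OF v] P]) (use U h O cat in blast)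
  have "cp X Z P w (cp X Y Z v u) = zero_arr K X P"
   using U V(1-5) w(1) h O by (simp add: reassoc[OF w(2)] assoc Cmp_zero)
  then obtain m where m: "m : Arr K D P" "cp Z D P m k = w" using cokernelE[OF vu O w(1)] by metis
  have "cp Y A P (cp A D P m f) j = cp Y A P h j"
   using U(1-5) V(1-5) W(1-5) m f h O w(2) by (simp add: assoc reassoc[OF m(2)])
  then have "cp A D P m f = h" by (rule deflation_epi[OF u O, rotated 2]) (use U(1-5) W(1-5) m(1) f h O in \<open>simp_all add: cat\<close>)
  then show "EX k:Arr K D P. cp A D P k f = h" using m(1) by blast
 qed
 moreover have "cokernel_of K A f D g B" unfolding cokernel_of_def
 proof (intro conjI ballI impI f g)
  have "cp Y A B (cp A D B g f) j = cp Y A B (zero_arr K A B) j"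
   using U(1-5) V W(1-5) f g(1) by (simp add: assoc Cmp_zero reassoc[OF g(2)])
  then show "cp A D B g f = zero_arr K A B" by (rule deflation_epi[OF u V(3), rotated 2]) (use U(1-5) V(1-5) W(1-5) f g(1) in \<open>simp_all add: cat\<close>)
  fix T h assume T: "T : Ob K" and h: "h : Arr K D T" "cp A D T h f = zero_arr K A T"
  have "cp Y Z T (cp Z D T h k) v = zero_arr K Y T"
   using U(1-5) V(1-5) W(1-5) f(1) h T by (simp add: assoc Cmp_zero reassoc[OF h(2)] flip: f(2))
  then obtain m where m: "m : Arr K B T" "cp Z B T m l = cp Z D T h k"
   using cokernelE[OF v T] W h(1) T cat by metis
  have *: "cp D B T n g = h <-> cp Z B T n l = cp Z D T h k" if n: "n : Arr K B T" for n
  proof -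
   have "cp Z D T (cp D B T n g) k = cp Z B T n l" using V(1-5) W(1-5) g n T by (simp add: assoc)
   then show ?thesis using deflation_epi[OF vu T, of "cp D B T n g" h] W(3) V(3) g(1) n h(1) T cat by metis
  qed
  show "EX! n. n : Arr K B T & cp D B T n g = h" using * m deflation_epi[OF v T] by metis
 qed
 ultimately show ?thesis using confl_if_cokernel V by blast
qed

text \<open>The conflation attached to a pushout square, with a sign that makes the two composites
  cancel. With \<open>A\<close> in \<open>Pr\<close> it represents the rotated triangle.\<close>

lemma rotation:
 assumes u: "(X, u, Y, v, Z) : E" and f: "(X, f, A, g, T) : E" and h: "h : Arr K Y A" "cp X Y A h u = f"
  and w: "w : Arr K Z T" "cp Y Z T w v = cp Y A T g h"
 shows "EX P j1 j2 q1 q2. biproduct K Z A P j1 j2 q1 q2 &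
  (Y, cp Y Z P j1 v \<otimes>\<^bsub>Mor K Y P\<^esub> cp Y A P j2 h, P, cp P Z T w q1 \<otimes>\<^bsub>Mor K P T\<^esub> neg P T (cp P A T g q2), T) : E"
proof -
 note U = conflD[OF u] and F = conflD[OF f]
 obtain P j1 j2 q1 q2 where b: "biproduct K Z A P j1 j2 q1 q2" using has_biproducts U F by blast
 note B = biproductD[OF b]
 let ?a = "cp Y Z P j1 v \<otimes>\<^bsub>Mor K Y P\<^esub> cp Y A P j2 h" and ?b = "cp P Z T w q1 \<otimes>\<^bsub>Mor K P T\<^esub> neg P T (cp P A T g q2)"
 note A = U(1-5) F(1-5) B(1-5) h(1) w(1)
 have a: "?a : Arr K Y P" "cp Y P Z q1 ?a = v" "cp Y P A q2 ?a = h" and b1: "?b : Arr K P T" "cp Z P T ?b j1 = w" "cp A P T ?b j2 = neg A T g"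
 proof -
  show "?a : Arr K Y P" "cp Y P Z q1 ?a = v" "cp Y P A q2 ?a = h" "?b : Arr K P T" "cp Z P T ?b j1 = w" "cp A P T ?b j2 = neg A T g"
   using A by (simp_all add: cat assoc Cmp_add_right Cmp_add_left Cmp_neg Cmp_zero B(6-9)
     reassoc[OF B(6)] reassoc[OF B(7)] reassoc[OF B(8)] reassoc[OF B(9)] arr_simps)
 qed
 have "infl Y ?a P" unfolding rel_inflation_def
 proof (intro conjI ballI a U B)
  fix W t assume W: "W : Pr" and t: "t : Arr K Y W"
  note O = Pr_Ob[OF W]
  \<comment> \<open>The composite of \<open>t\<close> with \<open>u\<close> is extended along
    \<open>f\<close> first; what then remains of \<open>t\<close> kills \<open>u\<close> and
    descends to \<open>Z\<close>.\<close>
  obtain s where s: "s : Arr K A W" "cp X A W s f = cp X Y W t u"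
   by (rule inflE[OF confl_infl[OF f] W]) (use U t O cat in blast)
  have "cp X Y W (t \<otimes>\<^bsub>Mor K Y W\<^esub> neg Y W (cp Y A W s h)) u = zero_arr K X W"
   using A O s t by (simp add: cat assoc h(2) Cmp_add_left Cmp_neg arr_simps)
  then obtain m where m: "m : Arr K Z W" "cp Y Z W m v = t \<otimes>\<^bsub>Mor K Y W\<^esub> neg Y W (cp Y A W s h)"
   by (rule cokernelE[OF u O, rotated]) (use A O s t in \<open>auto simp: cat\<close>)
  let ?k = "cp P Z W m q1 \<otimes>\<^bsub>Mor K P W\<^esub> cp P A W s q2"
  have "cp Y P W ?k ?a = cp Y Z W m v \<otimes>\<^bsub>Mor K Y W\<^esub> cp Y A W s h"
   using A O s(1) m(1) a by (simp add: cat assoc Cmp_add_left)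
  also have "... = t" using A O s t by (simp add: m(2) cat arr_simps)
  finally show "EX k:Arr K P W. cp Y P W k ?a = t" using A O s m(1) by (intro bexI[of _ ?k]) (auto simp: cat)
 qed
 moreover have "cokernel_of K Y ?a P ?b T" unfolding cokernel_of_def
 proof (intro conjI ballI impI a b1)
  show "cp Y P T ?b ?a = zero_arr K Y T" using A a by (simp add: cat assoc Cmp_add_left Cmp_neg w(2) arr_simps)
  fix T' r assume T': "T' : Ob K" and r: "r : Arr K P T'" "cp Y P T' r ?a = zero_arr K Y T'"
  define r1 r2 where "r1 = cp Z P T' r j1" and "r2 = neg A T' (cp A P T' r j2)"
  have rr: "r1 : Arr K Z T'" "r2 : Arr K A T'" "cp A P T' r j2 = neg A T' r2" using A T' r by (simp_all add: r1_def r2_def cat arr_simps)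
  have "cp Y Z T' r1 v \<otimes>\<^bsub>Mor K Y T'\<^esub> neg Y T' (cp Y A T' r2 h) = zero_arr K Y T'"
   using r A T' by (simp add: r1_def r2_def cat assoc Cmp_add_right Cmp_neg arr_simps)
  then have e: "cp Y Z T' r1 v = cp Y A T' r2 h" by (rule eq_if_neg_add[of Y T', rotated -1]) (use A T' rr in \<open>simp_all add: cat\<close>)
  have "cp X A T' r2 f = cp X Y T' (cp Y Z T' r1 v) u" using A T' rr by (simp add: e assoc h(2))
  then have "cp X A T' r2 f = zero_arr K X T'" using A T' rr U(6) by (simp add: assoc Cmp_zero)
  then obtain k where k: "k : Arr K T T'" "cp A T T' k g = r2" using cokernelE[OF f T' rr(2)] by metis
  have "cp Y Z T' r1 v = cp Y Z T' (cp Z T T' k w) v" using A T' k by (simp add: e assoc w(2) reassoc[OF k(2)])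
  then have kw: "cp Z T T' k w = r1" using deflation_epi[OF u T' _ rr(1)] A T' k(1) cat by metis
  have kb: "cp P T T' k ?b : Arr K P T'" using A T' k(1) b1(1) cat by blast
  have "cp Z P T' (cp P T T' k ?b) j1 = cp Z P T' r j1" "cp A P T' (cp P T T' k ?b) j2 = cp A P T' r j2"
   using A T' k(1) b1(1) by (simp_all add: assoc b1(2,3) kw k(2) rr(3) Cmp_neg flip: r1_def)
  then have "cp P T T' k ?b = r"
   using biproduct_decomp(1)[OF b U(3) F(2) T' kb] biproduct_decomp(1)[OF b U(3) F(2) T' r(1)] by simp
  moreover have "k' = k" if k': "k' : Arr K T T'" "cp P T T' k' ?b = r" for k'
  proof (rule deflation_epi[OF f T' k'(1) k(1)])
   have "cp A P T' (cp P T T' k' ?b) j2 = neg A T' (cp A T T' k' g)" using A T' k'(1) b1 by (simp add: assoc Cmp_neg)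
   then show "cp A T T' k' g = cp A T T' k g" using A T' k' rr arr_simps(6)[of A T'] by (metis cat(2) k(2))
  qed
  ultimately show "EX! k. k : Arr K T T' & cp P T T' k ?b = r" using k(1) by blast
 qed
 ultimately show ?thesis using confl_if_cokernel F b by blast
qed

text \<open>The pushout is the cokernel of the pair of \<open>f\<close> and \<open>-h\<close>, an
  inflation by \<open>cone\<close>.\<close>

lemma pushout_ex: assumes f: "infl A f B" and A': "A' : Ob K" and h: "h : Arr K A A'"
 shows "EX f' h' B'. pushout K A f B h A' f' h' B' & infl A' f' B'"
proof -
 note F = inflD[OF f]
 have h': "neg A A' h : Arr K A A'" using F A' h by (simp add: cat)
 obtain P j1 j2 q1 q2 k Q where b: "biproduct K B A' P j1 j2 q1 q2"
  and c: "(A, cp A B P j1 f \<otimes>\<^bsub>Mor K A P\<^esub> cp A A' P j2 (neg A A' h), P, k, Q) : E" (is "(_, ?u, _) : _")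
  using cone[OF f A' h'] by blast
 note B = biproductD[OF b] and C = conflD[OF c]
 let ?f = "cp A' P Q k j2" and ?h = "cp B P Q k j1"
 have "cp A A' Q ?f h = cp A B Q ?h f"
  by (rule eq_if_neg_add[of A Q, symmetric, rotated -1]) (use C(6) F A' h B(1-3) C(3,5) in \<open>simp_all add: cat assoc Cmp_add_right Cmp_neg\<close>)
 moreover have univ: "EX! w. w : Arr K Q X & cp A' Q X w ?f = s & cp B Q X w ?h = t"
  if X: "X : Ob K" and s: "s : Arr K A' X" and t: "t : Arr K B X" and e: "cp A A' X s h = cp A B X t f" for X s t
 proof -
  let ?m = "cp P B X t q1 \<otimes>\<^bsub>Mor K P X\<^esub> cp P A' X s q2"
  have m: "?m : Arr K P X" "cp B P X ?m j1 = t" "cp A' P X ?m j2 = s"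
   using B F A' X s t by (simp_all add: cat assoc Cmp_add_left Cmp_zero arr_simps)
  have "cp A P X ?m ?u = zero_arr K A X"
   using B(1-3) F A' h X s t m by (simp add: cat Cmp_add_right Cmp_assoc Cmp_neg e arr_simps)
  then obtain w where w: "w : Arr K Q X" "cp P Q X w k = ?m" using cokernelE[OF c X m(1)] by metis
  show ?thesis
  proof (rule ex1I[of _ w])
   show "w : Arr K Q X & cp A' Q X w ?f = s & cp B Q X w ?h = t"
    using w B(1-3) C(3,5) F A' X m by (simp add: Cmp_assoc)
   fix v assume v: "v : Arr K Q X & cp A' Q X v ?f = s & cp B Q X v ?h = t"
   have vk: "cp P Q X v k : Arr K P X" using v C B X cat by blast
   have "cp P Q X v k = ?m"
    using biproduct_decomp(1)[OF b _ A' X vk] v B(1-3) C(3,5) F A' X by (simp add: assoc)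
   then show "v = w" using deflation_epi[OF c X] v w by metis
  qed
 qed
 moreover have "infl A' ?f Q" unfolding rel_inflation_def
 proof (intro conjI ballI A' C)
  fix W t assume W: "W : Pr" and t: "t : Arr K A' W"
  obtain v where v: "v : Arr K B W" "cp A B W v f = cp A A' W t h"
   by (rule inflE[OF f W]) (use F A' h t Pr_Ob[OF W] cat in blast)
  show "EX w:Arr K Q W. cp A' Q W w ?f = t" using univ[OF Pr_Ob[OF W] t v(1) v(2)[symmetric]] by blast
 qed (use A' B C cat in blast)
 ultimately show ?thesis
  unfolding pushout_def using B(1-3) C(3,5) F A' by (intro exI[of _ ?f] exI[of _ ?h] exI[of _ Q]) (simp add: cat)
qed

text \<open>The pullback is the kernel of the pair of \<open>g\<close> and \<open>-h\<close>, a
  deflation since lifts along \<open>g\<close> alone already suffice.\<close>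

lemma pullback_ex: assumes g: "defl B g D" and C': "C' : Ob K" and h: "h : Arr K C' D"
 shows "EX g' h' B'. pullback K B g D h C' g' h' B' & defl B' g' C'"
proof -
 note G = deflD[OF g]
 obtain P j1 j2 q1 q2 where b: "biproduct K B C' P j1 j2 q1 q2" using has_biproducts G C' by blast
 note B = biproductD[OF b]
 let ?t = "cp P B D g q1 \<otimes>\<^bsub>Mor K P D\<^esub> neg P D (cp P C' D h q2)"
 have t: "?t : Arr K P D" "cp B P D ?t j1 = g" "cp C' P D ?t j2 = neg C' D h"
  using B G C' h by (simp_all add: cat assoc Cmp_add_left Cmp_neg Cmp_zero arr_simps)
 have "defl P ?t D" unfolding rel_deflation_def
 proof (intro conjI ballI t B)
  fix W r assume W: "W : Pr" and r: "r : Arr K W D"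
  obtain v where v: "v : Arr K W B" "cp W B D g v = r" by (rule deflE[OF g W r])
  show "EX k:Arr K W P. cp W P D ?t k = r"
   using v G B(1,2) t(1) Pr_Ob[OF W] by (intro bexI[of _ "cp W B P j1 v"]) (simp_all add: cat Cmp_assoc t(2))
 qed (use G in blast)
 then obtain N k where c: "(N, k, P, ?t, D) : E" using ex_kernel by blast
 note C = conflD[OF c]
 let ?g = "cp N P C' q2 k" and ?h = "cp N P B q1 k"
 have "cp N C' D h ?g = cp N B D g ?h"
  by (rule eq_if_neg_add[of N D, symmetric, rotated -1]) (use C(6) G C' h B(1-5) C(1,4) in \<open>simp_all add: cat assoc Cmp_add_left Cmp_neg\<close>)
 moreover have univ: "EX! w. w : Arr K X N & cp X N C' ?g w = s & cp X N B ?h w = r"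
  if X: "X : Ob K" and s: "s : Arr K X C'" and r: "r : Arr K X B" and e: "cp X C' D h s = cp X B D g r" for X s r
 proof -
  let ?m = "cp X B P j1 r \<otimes>\<^bsub>Mor K X P\<^esub> cp X C' P j2 s"
  have m: "?m : Arr K X P" "cp X P B q1 ?m = r" "cp X P C' q2 ?m = s"
   using B G C' X s r by (simp_all add: cat Cmp_assoc Cmp_add_right Cmp_zero arr_simps)
  have "cp X P D ?t ?m = zero_arr K X D"
   using B(1-3) G C' h X s r t by (simp add: cat Cmp_add_right Cmp_assoc Cmp_neg e arr_simps)
  then obtain w where w: "w : Arr K X N" "cp X N P k w = ?m" using kernelE[OF c X m(1)] by metis
  show ?thesis
  proof (rule ex1I[of _ w])
   show "w : Arr K X N & cp X N C' ?g w = s & cp X N B ?h w = r"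
    using w B(1,4,5) C(1,4) G C' X m by (simp add: assoc)
   fix v assume v: "v : Arr K X N & cp X N C' ?g v = s & cp X N B ?h v = r"
   have kv: "cp X N P k v : Arr K X P" using v C B X cat by blast
   have "cp X N P k v = ?m"
    using biproduct_decomp(2)[OF b _ C' X kv] v B(1,4,5) C(1,4) G C' X by (simp add: Cmp_assoc)
   then show "v = w" using inflation_mono[OF c X] v w by metis
  qed
 qed
 moreover have "defl N ?g C'" unfolding rel_deflation_def
 proof (intro conjI ballI C' C)
  fix W r assume W: "W : Pr" and r: "r : Arr K W C'"
  obtain v where v: "v : Arr K W B" "cp W B D g v = cp W C' D h r"
   by (rule deflE[OF g W]) (use G C' h r Pr_Ob[OF W] cat in blast)
  show "EX w:Arr K W N. cp W N C' ?g w = r" using univ[OF Pr_Ob[OF W] r v(1) v(2)[symmetric]] by blast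
 qed (use C' B C cat in blast)
 ultimately show ?thesis
  unfolding pullback_def using B(1,4,5) C(1,4) G C' by (intro exI[of _ ?g] exI[of _ ?h] exI[of _ N]) (simp add: cat)
qed

lemma confl_iso: assumes E: "(A, f, B, g, D) : E" and O: "A' : Ob K" "B' : Ob K" "D' : Ob K"
  and iso: "iso_arr K A A' a" "iso_arr K B B' b" "iso_arr K D D' d" and f': "f' : Arr K A' B'" and g': "g' : Arr K B' D'"
  and bf: "cp A B B' b f = cp A A' B' f' a" and dg: "cp B D D' d g = cp B B' D' g' b"
 shows "(A', f', B', g', D') : E"
proof (rule confl_if_kernel)
 note c = conflD[OF E]
 obtain a' where a: "a : Arr K A A'" "a' : Arr K A' A" "cp A A' A a' a = Idn K A" "cp A' A A' a a' = Idn K A'" by (rule iso_arrE[OF iso(1)])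
 obtain b' where b: "b : Arr K B B'" "b' : Arr K B' B" "cp B B' B b' b = Idn K B" "cp B' B B' b b' = Idn K B'" by (rule iso_arrE[OF iso(2)])
 obtain d' where d: "d : Arr K D D'" "d' : Arr K D' D" "cp D D' D d' d = Idn K D" "cp D' D D' d d' = Idn K D'" by (rule iso_arrE[OF iso(3)])
 note A = c(1-5) O a(1,2) b(1,2) d(1,2) f' g'
 have f1: "cp A' B' B b' f' = cp A' A B f a'"
  by (rule square_inverse[where a = a and b = b]) (use A bf a(4) b(3) in auto)
 have g1: "cp B' D' D d' g' = cp B' B D g b'"
  by (rule square_inverse[where a = b and b = d]) (use A dg b(4) d(3) in auto)
 show "A' : Ob K" by (rule O)
 show "defl B' g' D'" unfolding rel_deflation_def
 proof (intro conjI ballI O g')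
  fix P h assume P: "P : Pr" and h: "h : Arr K P D'"
  obtain v where v: "v : Arr K P B" "cp P B D g v = cp P D' D d' h"
   by (rule deflE[OF confl_defl[OF E] P]) (use A h Pr_Ob[OF P] cat in blast)
  have "cp P B' D' g' (cp P B B' b v) = cp P D D' d (cp P B D g v)" using A v(1) Pr_Ob[OF P] by (simp add: Cmp_assoc dg)
  also have "... = h" using A h Pr_Ob[OF P] by (simp add: v(2) reassoc[OF d(4)] cat)
  finally show "EX k:Arr K P B'. cp P B' D' g' k = h" using A v(1) Pr_Ob[OF P] cat by blast
 qed
 show "kernel_of K A' f' B' g' D'" unfolding kernel_of_def
 proof (intro conjI ballI impI f' g')
  have "cp A' B' D' g' f' = cp A' A D' (cp A B' D' g' (cp A A' B' f' a)) a'" using A by (simp add: assoc a(4) cat)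
  also have "... = zero_arr K A' D'" using A c(6) by (simp add: assoc reassoc[OF dg[symmetric]] reassoc[OF c(6)] Cmp_zero flip: bf)
  finally show "cp A' B' D' g' f' = zero_arr K A' D'" .
  fix X h assume X: "X : Ob K" and h: "h : Arr K X B'" "cp X B' D' g' h = zero_arr K X D'"
  have bh: "cp X B' B b' h : Arr K X B" using A X h(1) cat by blast
  have "cp X B D g (cp X B' B b' h) = cp X D' D d' (cp X B' D' g' h)" using A X h(1) by (simp add: Cmp_assoc g1)
  then have "cp X B D g (cp X B' B b' h) = zero_arr K X D" using A X by (simp add: h(2) Cmp_zero)
  then obtain k where k: "k : Arr K X A" "cp X A B f k = cp X B' B b' h" by (rule kernelE[OF E X bh])
  show "EX! k. k : Arr K X A' & cp X A' B' f' k = h"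
  proof (rule ex1I[of _ "cp X A A' a k"])
   have "cp X A' B' f' (cp X A A' a k) = cp X B B' b (cp X A B f k)" using A X k(1) by (simp add: Cmp_assoc bf)
   also have "... = h" using A X h(1) by (simp add: k(2) reassoc[OF b(4)] cat)
   finally show "cp X A A' a k : Arr K X A' & cp X A' B' f' (cp X A A' a k) = h" using A X k(1) cat by blast
   fix m assume m: "m : Arr K X A' & cp X A' B' f' m = h"
   have "cp X A B f (cp X A' A a' m) = cp X A B f k" using A X m by (simp add: Cmp_assoc k(2) flip: f1) (simp add: assoc)
   then have "cp X A' A a' m = k" using inflation_mono[OF E X] A X m k(1) cat by metis
   then show "m = cp X A A' a k" using A X m reassoc[OF a(4), of X m] by (simp add: cat)
  qed
 qed
qed

lemma inflation_iff: "inflation E A f B <-> infl A f B"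
 and deflation_iff: "deflation E B g D <-> defl B g D"
 using ex_cokernel ex_kernel confl_infl confl_defl unfolding inflation_def deflation_def by blast+

text \<open>A projective object splits the deflation onto it from an object of \<open>Pr\<close>,
  and \<open>Pr\<close> is closed under retracts.\<close>

lemma projectives_eq: "projectives K E = Pr"
proof (intro equalityI subsetI)
 fix X assume "X : projectives K E"
 then have X: "X : Ob K" and l: "!!A f B g C h. (A, f, B, g, C) : E ==> h : Arr K X C ==> EX k:Arr K X B. cp X B C g k = h"
  unfolding projectives_def by blast+
 obtain P g where "P : Pr" "defl P g X" using ex_deflation[OF X] by blast
 then show "X : Pr" using ex_kernel l[OF _ Idn_Arr[OF X]] Pr_retract[OF _ X] deflD by meson
qed (auto simp: projectives_def Pr_Ob dest!: confl_defl elim: deflE)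

lemma injectives_eq: "injectives K E = Pr"
proof (intro equalityI subsetI)
 fix X assume "X : injectives K E"
 then have X: "X : Ob K" and l: "!!A f B g C h. (A, f, B, g, C) : E ==> h : Arr K A X ==> EX k:Arr K B X. cp A B X k f = h"
  unfolding injectives_def by blast+
 obtain P f where "P : Pr" "infl X f P" using ex_inflation[OF X] by blast
 then show "X : Pr" using ex_cokernel l[OF _ Idn_Arr[OF X]] Pr_retract[OF _ X] inflD by meson
qed (auto simp: injectives_def Pr_Ob dest!: confl_infl elim: inflE)

theorem frobenius: "frobenius_category K E"
proof
 show "inflation E A (Idn K A) A" "deflation E A (Idn K A) A" if "A : Ob K" for A
  using that by (auto simp: inflation_iff deflation_iff rel_inflation_def rel_deflation_def cat Pr_Ob)
 show "A : Ob K & B : Ob K & D : Ob K & kernel_of K A f B g D & cokernel_of K A f B g D" if "(A, f, B, g, D) : E" for A f B g D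
  using that conflD(1-3)[OF that] unfolding rel_conflations_def by blast
qed (auto simp: inflation_iff deflation_iff projectives_eq injectives_eq infl_Cmp defl_Cmp pushout_ex pullback_ex ex_inflation ex_deflation
 intro: confl_iso)

end

text \<open>Conditions on a class \<open>T\<close> of standard triangles under which its isomorphism
  closure is a triangulation. Cones, rotations and octahedra are asked for only after replacing
  objects by isomorphic ones, since a standard triangle need not exist on a given morphism. The weak
  cokernel condition is what makes the five lemma available.\<close>

locale pretriangulation = suspended_category +
 fixes T :: "('a, 'b) triangles" assumes T_type: "t : T ==> typed t"
  and T_Cmp: "(X, Y, Z, u, v, w) : T ==> cp X Y Z v u = zero_arr K X Z"
  and T_cone: "X : Ob K ==> Y : Ob K ==> u : Arr K X Y ==>
   EX Y' Z b v w. iso_arr K Y Y' b & (X, Y', Z, cp X Y Y' b u, v, w) : T"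
  and T_mor: "(X, Y, Z, u, v, w) : T ==> (X', Y', Z', u', v', w') : T ==> a : Arr K X X' ==> b : Arr K Y Y' ==>
   cp X Y Y' b u = cp X X' Y' u' a ==> EX c. tmor (X, Y, Z, u, v, w) (X', Y', Z', u', v', w') a b c"
  and T_weak_cokernel: "(X, Y, Z, u, v, w) : T ==> F : Ob K ==> f : Arr K Z F ==> cp Y Z F f v = zero_arr K Y F ==>
   EX k:Arr K (S X) F. f = cp Z (S X) F k w" and T_rotate: "(X, Y, Z, u, v, w) : T ==>
   EX Z' c w'. iso_arr K Z Z' c & (Y, Z', S X, cp Y Z Z' c v, w', neg (S X) (S Y) (s X Y u)) : T & cp Z Z' (S X) w' c = w"
  and T_octahedron: "X : Ob K ==> Y : Ob K ==> Z : Ob K ==> u : Arr K X Y ==> v : Arr K Y Z ==>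
   EX Y1 Z1 b d v1 A B C i i' j j' k k' f g. iso_arr K Y Y1 b & iso_arr K Z Z1 d & v1 : Arr K Y1 Z1 & cp Y Y1 Z1 v1 b = cp Y Z Z1 d v &
    (X, Y1, A, cp X Y Y1 b u, i, i') : T & (Y1, Z1, B, v1, j, j') : T & (X, Z1, C, cp X Y1 Z1 v1 (cp X Y Y1 b u), k, k') : T &
    (A, C, B, f, g, cp B (S Y1) (S A) (s Y1 A i) j') : T &
    cp Y1 A C f i = cp Y1 Z1 C k v1 & cp A C (S X) k' f = i' & cp Z1 C B g k = j &
    cp C B (S Y1) j' g = cp C (S X) (S Y1) (s X Y1 (cp X Y Y1 b u)) k'"
begin

definition dtri where "dtri = {t. typed t & (EX t0:T. tiso t t0)}"

lemma dtri_typed: "t : dtri ==> typed t" by (simp add: dtri_def)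

lemma T_distinguished: "t : T ==> typed t' ==> tiso t' t ==> t' : dtri" by (auto simp: dtri_def)

lemma dtri_iso: assumes t: "t : dtri" and t': "typed t'" and i: "tiso t' t" shows "t' : dtri"
 using assms tiso_trans[OF t' dtri_typed[OF t] T_type i] unfolding dtri_def by blast

lemma dtriE: assumes "(X, Y, Z, u, v, w) : dtri"
 obtains X' Y' Z' u' v' w' a b c a' b' c' where "(X', Y', Z', u', v', w') : T" "typed (X', Y', Z', u', v', w')"
  "tmor (X, Y, Z, u, v, w) (X', Y', Z', u', v', w') a b c" "tmor (X', Y', Z', u', v', w') (X, Y, Z, u, v, w) a' b' c'"
  "cp X X' X a' a = Idn K X" "cp Y Y' Y b' b = Idn K Y" "cp Z Z' Z c' c = Idn K Z"
  "iso_arr K X X' a" "iso_arr K Y Y' b" "iso_arr K Z Z' c"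
proof -
 obtain X' Y' Z' u' v' w' a b c where t: "(X', Y', Z', u', v', w') : T" and m: "tmor (X, Y, Z, u, v, w) (X', Y', Z', u', v', w') a b c"
  and i: "iso_arr K X X' a" "iso_arr K Y Y' b" "iso_arr K Z Z' c"
  using assms by (auto simp: dtri_def tiso_def)
 obtain a' where a: "a' : Arr K X' X" "cp X X' X a' a = Idn K X" "cp X' X X' a a' = Idn K X'" by (rule iso_arrE[OF i(1)])
 obtain b' where b: "b' : Arr K Y' Y" "cp Y Y' Y b' b = Idn K Y" "cp Y' Y Y' b b' = Idn K Y'" by (rule iso_arrE[OF i(2)])
 obtain c' where c: "c' : Arr K Z' Z" "cp Z Z' Z c' c = Idn K Z" "cp Z' Z Z' c c' = Idn K Z'" by (rule iso_arrE[OF i(3)])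
 show ?thesis
  by (rule that[OF t T_type[OF t] m tmor_inverse[OF dtri_typed[OF assms] T_type[OF t] m a(1) b(1) c(1) a(2) b(2) c(2) a(3) b(3) c(3)] a(2) b(2) c(2) i])
qed

text \<open>The square is conjugated into \<open>T\<close> by the chosen isomorphisms, completed
  there and carried back.\<close>

lemma dtri_mor: assumes t: "(X, Y, Z, u, v, w) : dtri" and t': "(X', Y', Z', u', v', w') : dtri"
  and ab: "a : Arr K X X'" "b : Arr K Y Y'" "cp X Y Y' b u = cp X X' Y' u' a"
 obtains c where "tmor (X, Y, Z, u, v, w) (X', Y', Z', u', v', w') a b c"
proof -
 note ty = dtri_typed[OF t] dtri_typed[OF t']
 obtain X0 Y0 Z0 u0 v0 w0 a0 b0 c0 a1 b1 c1 where 0: "(X0, Y0, Z0, u0, v0, w0) : T" "typed (X0, Y0, Z0, u0, v0, w0)"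
  "tmor (X, Y, Z, u, v, w) (X0, Y0, Z0, u0, v0, w0) a0 b0 c0" "tmor (X0, Y0, Z0, u0, v0, w0) (X, Y, Z, u, v, w) a1 b1 c1"
  "cp X X0 X a1 a0 = Idn K X" "cp Y Y0 Y b1 b0 = Idn K Y" by (rule dtriE[OF t])
 obtain X2 Y2 Z2 u2 v2 w2 a2 b2 c2 a3 b3 c3 where 2: "(X2, Y2, Z2, u2, v2, w2) : T" "typed (X2, Y2, Z2, u2, v2, w2)"
  "tmor (X', Y', Z', u', v', w') (X2, Y2, Z2, u2, v2, w2) a2 b2 c2" "tmor (X2, Y2, Z2, u2, v2, w2) (X', Y', Z', u', v', w') a3 b3 c3"
  "cp X' X2 X' a3 a2 = Idn K X'" "cp Y' Y2 Y' b3 b2 = Idn K Y'" by (rule dtriE[OF t'])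
 note * = ty[unfolded typed_def split] 0(2-6)[unfolded simps] 2(2-6)[unfolded simps]
 let ?a = "cp X0 X' X2 a2 (cp X0 X X' a a1)" and ?b = "cp Y0 Y' Y2 b2 (cp Y0 Y Y' b b1)"
 have "cp X0 Y' Y2 b2 (cp X0 Y Y' b (cp X0 Y0 Y b1 u0)) = cp X0 Y' Y2 b2 (cp X0 X Y' (cp X Y Y' b u) a1)" using * ab(1,2) by (simp add: assoc)
 also have "... = cp X0 X2 Y2 u2 ?a"
  unfolding ab(3) using * ab(1,2) by (simp add: assoc cat reassoc[of _ _ _ b2 u' "cp X' X2 Y2 u2 a2"])
 finally have "cp X0 Y0 Y2 ?b u0 = cp X0 X2 Y2 u2 ?a" using * ab(1,2) by (simp add: assoc cat)
 with T_mor[OF 0(1) 2(1), of ?a ?b] obtain c where c: "tmor (X0, Y0, Z0, u0, v0, w0) (X2, Y2, Z2, u2, v2, w2) ?a ?b c"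
  using * ab(1,2) by (force simp: cat)
 note m = tmor_Cmp[OF ty(1) 2(2) ty(2) tmor_Cmp[OF ty(1) 0(2) 2(2) 0(3) c] 2(4)]
 moreover have "cp X X2 X' a3 (cp X X0 X2 ?a a0) = a" "cp Y Y2 Y' b3 (cp Y Y0 Y2 ?b b0) = b"
  using * ab(1,2) by (simp_all add: assoc cat reassoc[OF 2(5)] reassoc[OF 2(6)])
 ultimately show ?thesis using that by simp
qed

lemma dtri_weak_cokernel:
 assumes t: "(X, Y, Z, u, v, w) : dtri" and F: "F : Ob K" "f : Arr K Z F" "cp Y Z F f v = zero_arr K Y F"
 obtains k where "k : Arr K (S X) F" "f = cp Z (S X) F k w"
proof -
 note ty = dtri_typed[OF t]
 obtain X0 Y0 Z0 u0 v0 w0 a0 b0 c0 a1 b1 c1 where 0: "(X0, Y0, Z0, u0, v0, w0) : T" "typed (X0, Y0, Z0, u0, v0, w0)"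
  "tmor (X, Y, Z, u, v, w) (X0, Y0, Z0, u0, v0, w0) a0 b0 c0" "tmor (X0, Y0, Z0, u0, v0, w0) (X, Y, Z, u, v, w) a1 b1 c1"
  "cp X X0 X a1 a0 = Idn K X" "cp Y Y0 Y b1 b0 = Idn K Y" "cp Z Z0 Z c1 c0 = Idn K Z" by (rule dtriE[OF t])
 note * = ty[unfolded typed_def split] 0(2-7)[unfolded simps]
 have "cp Y0 Z0 F (cp Z0 Z F f c1) v0 = zero_arr K Y0 F" using * F by (simp add: assoc reassoc[OF F(3)] Cmp_zero)
 then obtain k where k: "k : Arr K (S X0) F" "cp Z0 Z F f c1 = cp Z0 (S X0) F k w0"
  using T_weak_cokernel[OF 0(1) F(1), of "cp Z0 Z F f c1"] * F by (auto simp: cat)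
 have "f = cp Z Z0 F (cp Z0 Z F f c1) c0" using * F by (simp add: assoc cat)
 also have "... = cp Z (S X) F (cp (S X) (S X0) F k (s X X0 a0)) w" unfolding k(2) using * F k(1) by (simp add: assoc S_Ob s_Arr)
 finally show ?thesis by (rule that[rotated]) (use * F k(1) in \<open>simp add: S_Ob s_Arr cat\<close>)
qed

text \<open>An endomorphism of a triangle that is the identity on the first two objects is \<open>1 + d\<close> with \<open>d d = 0\<close>.\<close>

lemma dtri_endo_iso:
 assumes t: "(X, Y, Z, u, v, w) : dtri" and m: "tmor (X, Y, Z, u, v, w) (X, Y, Z, u, v, w) (Idn K X) (Idn K Y) e"
 shows "iso_arr K Z Z e"
proof -
 note ty = dtri_typed[OF t, unfolded typed_def split] and m = m[unfolded simps]
 have O: "Z : Ob K" "Y : Ob K" "X : Ob K" "S X : Ob K" and e: "e : Arr K Z Z" and vw: "v : Arr K Y Z" "w : Arr K Z (S X)" using ty m by (auto simp: S_Ob)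
 interpret G: comm_group "Mor K Z Z" by (rule Mor_group[OF O(1,1)])
 interpret GY: comm_group "Mor K Y Z" by (rule Mor_group[OF O(2,1)])
 interpret GS: comm_group "Mor K Z (S X)" by (rule Mor_group[OF O(1,4)])
 define d where "d = e \<otimes>\<^bsub>Mor K Z Z\<^esub> neg Z Z (Idn K Z)"
 have d: "d : Arr K Z Z" using O e by (simp add: d_def cat)
 have ed: "e = Idn K Z \<otimes>\<^bsub>Mor K Z Z\<^esub> d" using O e by (simp add: d_def cat G.m_lcomm[of "Idn K Z"])
 \<comment> \<open>As \<open>d v = 0\<close>, the map \<open>d\<close> factors as
   \<open>k w\<close>; since also \<open>w d = 0\<close>, it follows that \<open>d d = 0\<close>,
   and \<open>1 - d\<close> is the inverse.\<close>
 have "cp Y Z Z d v = zero_arr K Y Z" using O e vw m by (simp add: d_def Cmp_add_left Cmp_neg cat)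
 then obtain k where k: "k : Arr K (S X) Z" "d = cp Z (S X) Z k w" using dtri_weak_cokernel[OF t O(1) d] by blast
 have "cp Z Z (S X) w d = zero_arr K Z (S X)" using O e vw m by (simp add: d_def Cmp_add_right Cmp_neg cat s_Idn)
 then have dd: "cp Z Z Z d d = zero_arr K Z Z" using O vw d k(1) by (subst (1) k(2)) (simp add: assoc Cmp_zero)
 show ?thesis
 proof (rule iso_arrI[OF e])
  let ?f = "Idn K Z \<otimes>\<^bsub>Mor K Z Z\<^esub> neg Z Z d"
  show "?f : Arr K Z Z" using O d by (simp add: cat)
  show "cp Z Z Z ?f e = Idn K Z" "cp Z Z Z e ?f = Idn K Z"
   unfolding ed using O d by (simp_all add: Cmp_add_left Cmp_add_right Cmp_neg cat dd G.m_assoc)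
 qed
qed

text \<open>Fill-ins are not unique, but one over the inverse square composes with \<open>c\<close>
  to endomorphisms of triangles over identities. These are isomorphisms, which is enough for
  \<open>c\<close>.\<close>

lemma dtri_five: assumes t: "(X, Y, Z, u, v, w) : dtri" and t': "(X', Y', Z', u', v', w') : dtri"
  and m: "tmor (X, Y, Z, u, v, w) (X', Y', Z', u', v', w') a b c" and a: "iso_arr K X X' a" and b: "iso_arr K Y Y' b"
 shows "iso_arr K Z Z' c"
proof -
 note ty = dtri_typed[OF t] dtri_typed[OF t']
 note * = ty[unfolded typed_def split] m[unfolded simps]
 obtain a' where a': "a' : Arr K X' X" "cp X X' X a' a = Idn K X" "cp X' X X' a a' = Idn K X'" by (rule iso_arrE[OF a])
 obtain b' where b': "b' : Arr K Y' Y" "cp Y Y' Y b' b = Idn K Y" "cp Y' Y Y' b b' = Idn K Y'" by (rule iso_arrE[OF b])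
 have "cp X' Y' Y b' u' = cp X' X Y u a'" by (rule square_inverse[where a = a and b = b]) (use * a' b' in auto)
 then obtain d where d: "tmor (X', Y', Z', u', v', w') (X, Y, Z, u, v, w) a' b' d" by (rule dtri_mor[OF t' t a'(1) b'(1)])
 show ?thesis
 proof (rule iso_arr_two_sided)
  show "iso_arr K Z Z (cp Z Z' Z d c)" using dtri_endo_iso[OF t] tmor_Cmp[OF ty ty(1) m d] a' b' by simp
  show "iso_arr K Z' Z' (cp Z' Z Z' c d)" using dtri_endo_iso[OF t'] tmor_Cmp[OF ty(2,1,2) d m] a' b' by simp
 qed (use * d[unfolded simps] in auto)
qed

lemma dtri_rotate: assumes t: "(X, Y, Z, u, v, w) : dtri"
 shows "(Y, Z, S X, v, w, neg (S X) (S Y) (s X Y u)) : dtri"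
proof -
 note ty = dtri_typed[OF t]
 obtain X0 Y0 Z0 u0 v0 w0 a b c a1 b1 c1 where 0: "(X0, Y0, Z0, u0, v0, w0) : T" "typed (X0, Y0, Z0, u0, v0, w0)"
  "tmor (X, Y, Z, u, v, w) (X0, Y0, Z0, u0, v0, w0) a b c" "iso_arr K X X0 a" "iso_arr K Y Y0 b" "iso_arr K Z Z0 c" by (rule dtriE[OF t])
 obtain Z1 d w1 where 1: "iso_arr K Z0 Z1 d" "(Y0, Z1, S X0, cp Y0 Z0 Z1 d v0, w1, neg (S X0) (S Y0) (s X0 Y0 u0)) : T" "cp Z0 Z1 (S X0) w1 d = w0"
  using T_rotate[OF 0(1)] by blast
 have d: "d : Arr K Z0 Z1" using 1(1) by (simp add: iso_arr_def)
 note * = ty[unfolded typed_def split] 0(2,3)[unfolded simps] T_type[OF 1(2), unfolded simps] d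
 have "cp (S X) (S X0) (S Y0) (s X0 Y0 u0) (s X X0 a) = cp (S X) (S Y) (S Y0) (s Y Y0 b) (s X Y u)"
  using * s_Cmp[of X X0 Y0 a u0] s_Cmp[of X Y Y0 u b] by simp
 moreover have "cp Z Z1 (S X0) w1 (cp Z Z0 Z1 d c) = cp Z Z0 (S X0) w0 c" using * by (simp add: reassoc[OF 1(3)] S_Ob)
 ultimately have "tmor (Y, Z, S X, v, w, neg (S X) (S Y) (s X Y u))
  (Y0, Z1, S X0, cp Y0 Z0 Z1 d v0, w1, neg (S X0) (S Y0) (s X0 Y0 u0)) b (cp Z Z0 Z1 d c) (s X X0 a)"
  using * by (simp add: simps assoc cat S_Ob s_Arr Cmp_neg s_neg)
 then have "tiso (Y, Z, S X, v, w, neg (S X) (S Y) (s X Y u)) (Y0, Z1, S X0, cp Y0 Z0 Z1 d v0, w1, neg (S X0) (S Y0) (s X0 Y0 u0))"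
  unfolding tiso_def split using 0(4-6) iso_arr_s[of X X0 a] iso_arr_Cmp[OF _ _ _ 0(6) 1(1)] * by blast
 moreover have "typed (Y, Z, S X, v, w, neg (S X) (S Y) (s X Y u))" using * by (simp add: simps S_Ob s_Arr cat)
 ultimately show ?thesis using T_distinguished[OF 1(2)] by blast
qed

lemma dtri_cone: assumes "X : Ob K" "Y : Ob K" "u : Arr K X Y"
 obtains Z v w where "(X, Y, Z, u, v, w) : dtri"
proof -
 obtain Y' Z b v w where 0: "iso_arr K Y Y' b" "(X, Y', Z, cp X Y Y' b u, v, w) : T" using T_cone[OF assms] by blast
 have b: "b : Arr K Y Y'" using 0(1) by (simp add: iso_arr_def)
 note * = T_type[OF 0(2), unfolded simps] assms b
 have "tmor (X, Y, Z, u, cp Y Y' Z v b, w) (X, Y', Z, cp X Y Y' b u, v, w) (Idn K X) b (Idn K Z)"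
  using * by (simp add: simps cat s_Idn S_Ob)
 then have "tiso (X, Y, Z, u, cp Y Y' Z v b, w) (X, Y', Z, cp X Y Y' b u, v, w)"
  unfolding tiso_def split using 0(1) iso_arr_Idn * by blast
 moreover have "typed (X, Y, Z, u, cp Y Y' Z v b, w)" using * by (simp add: simps cat)
 ultimately show ?thesis using that T_distinguished[OF 0(2)] by blast
qed

lemma dtri_Cmp: assumes t: "(X, Y, Z, u, v, w) : dtri" shows "cp X Y Z v u = zero_arr K X Z"
proof -
 note ty = dtri_typed[OF t]
 obtain X0 Y0 Z0 u0 v0 w0 a0 b0 c0 a1 b1 c1 where 0: "(X0, Y0, Z0, u0, v0, w0) : T" "typed (X0, Y0, Z0, u0, v0, w0)"
  "tmor (X, Y, Z, u, v, w) (X0, Y0, Z0, u0, v0, w0) a0 b0 c0" "tmor (X0, Y0, Z0, u0, v0, w0) (X, Y, Z, u, v, w) a1 b1 c1"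
  "cp X X0 X a1 a0 = Idn K X" "cp Y Y0 Y b1 b0 = Idn K Y" "cp Z Z0 Z c1 c0 = Idn K Z" by (rule dtriE[OF t])
 note * = ty[unfolded typed_def split] 0(2-7)[unfolded simps]
 have "cp X Y Z v u = cp X Z0 Z c1 (cp X Z Z0 c0 (cp X Y Z v u))" using * by (simp add: reassoc[OF 0(7)] cat)
 also have "cp X Z Z0 c0 (cp X Y Z v u) = cp X X0 Z0 (cp X0 Y0 Z0 v0 u0) a0"
  using * by (simp add: assoc reassoc[of Y Z Z0 c0 v "cp Y Y0 Z0 v0 b0"])
 also have "cp X X0 Z0 (cp X0 Y0 Z0 v0 u0) a0 = zero_arr K X Z0" using * by (simp add: T_Cmp[OF 0(1)] Cmp_zero)
 also have "cp X Z0 Z c1 (zero_arr K X Z0) = zero_arr K X Z" using * by (simp add: Cmp_zero)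
 finally show ?thesis .
qed

text \<open>In a triangle on the identity the third object \<open>Z0\<close> vanishes:
  \<open>v\<close> is zero, so the identity of \<open>Z0\<close> factors through \<open>w\<close>,
  and two rotations show that \<open>w\<close> is zero as well.\<close>

lemma dtri_Idn: assumes X: "X : Ob K" and Z: "zero_object K Z"
 shows "(X, X, Z, Idn K X, zero_arr K X Z, zero_arr K Z (S X)) : dtri"
proof -
 obtain Z0 v w where t: "(X, X, Z0, Idn K X, v, w) : dtri" using dtri_cone[OF X X Idn_Arr[OF X]] by blast
 note * = dtri_typed[OF t, unfolded typed_def split]
 have ZO: "Z : Ob K" using Z by (simp add: zero_object_def)
 have "v = zero_arr K X Z0" using dtri_Cmp[OF t] * by (simp add: cat)
 then have "cp X Z0 Z0 (Idn K Z0) v = zero_arr K X Z0" using * by (simp add: cat)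
 then obtain k where k: "k : Arr K (S X) Z0" "Idn K Z0 = cp Z0 (S X) Z0 k w"
  using dtri_weak_cokernel[OF t] * Idn_Arr by blast
 note r = dtri_rotate[OF t]
 have "neg Z0 (S X) w = zero_arr K Z0 (S X)"
  using dtri_Cmp[OF dtri_rotate[OF t]] dtri_Cmp[OF dtri_rotate[OF dtri_rotate[OF t]]] * X
  by (simp add: s_Idn cat S_Ob Cmp_neg)
 then have "w = zero_arr K Z0 (S X)" using * Mor_is_group[of Z0 "S X"] group.inv_inv[of "Mor K Z0 (S X)" w] by (simp add: S_Ob group.is_monoid monoid.inv_one)
 then have id: "Idn K Z0 = zero_arr K Z0 Z0" using k * by (simp add: Cmp_zero S_Ob)
 have z: "Idn K Z = zero_arr K Z Z" using Z Idn_Arr[OF ZO] ZO unfolding zero_object_def by blast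
 have "tmor (X, X, Z, Idn K X, zero_arr K X Z, zero_arr K Z (S X)) (X, X, Z0, Idn K X, v, w) (Idn K X) (Idn K X) (zero_arr K Z Z0)"
  using * ZO by (simp add: simps cat \<open>v = _\<close> \<open>w = _\<close> Cmp_zero S_Ob s_Idn)
 moreover have "iso_arr K Z Z0 (zero_arr K Z Z0)"
  by (rule iso_arrI[where g = "zero_arr K Z0 Z"]) (use * ZO in \<open>simp_all add: cat Cmp_zero id z\<close>)
 ultimately have "tiso (X, X, Z, Idn K X, zero_arr K X Z, zero_arr K Z (S X)) (X, X, Z0, Idn K X, v, w)"
  unfolding tiso_def split using iso_arr_Idn[OF X] by blast
 moreover have "typed (X, X, Z, Idn K X, zero_arr K X Z, zero_arr K Z (S X))" using X ZO by (simp add: simps cat S_Ob)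
 ultimately show ?thesis using dtri_iso[OF t] by blast
qed

text \<open>Three rotations turn both triangles into their suspensions up to sign, where the five lemma applies.\<close>

lemma dtri_rotate_back:
 assumes ty: "typed (X, Y, Z, u, v, w)" and t: "(Y, Z, S X, v, w, neg (S X) (S Y) (s X Y u)) : dtri"
 shows "(X, Y, Z, u, v, w) : dtri"
proof -
 note * = ty[unfolded typed_def split]
 obtain Z' v' w' where t': "(X, Y, Z', u, v', w') : dtri" using dtri_cone[of X Y u] * by blast
 note ** = dtri_typed[OF t', unfolded typed_def split]
 let ?n = "%X Y f. neg (S X) (S Y) (s X Y f)"
 note r = dtri_rotate[OF dtri_rotate[OF t]]
 note r' = dtri_rotate[OF dtri_rotate[OF dtri_rotate[OF t']]]
 obtain c where c: "tmor (S X, S Y, S Z, ?n X Y u, ?n Y Z v, ?n Z (S X) w) (S X, S Y, S Z', ?n X Y u, ?n Y Z' v', ?n Z' (S X) w') (Idn K (S X)) (Idn K (S Y)) c"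
  by (rule dtri_mor[OF r r']) (use * in \<open>auto simp: cat S_Ob s_Arr\<close>)
 have i: "iso_arr K (S Z) (S Z') c" by (rule dtri_five[OF r r' c]) (use * in \<open>simp_all add: iso_arr_Idn S_Ob\<close>)
 \<comment> \<open>The suspension is full, so \<open>c\<close> comes from some \<open>d\<close>; by
   faithfulness the suspended squares give back the original ones.\<close>
 obtain d where d: "d : Arr K Z Z'" "c = s Z Z' d" using s_surj[of Z Z' c] * ** i by (auto simp: iso_arr_def)
 note m = c[unfolded simps d]
 have "s Y Z' (neg Y Z' (cp Y Z Z' d v)) = s Y Z' (neg Y Z' v')"
  using m * ** d by (simp add: s_Cmp s_neg S_Ob s_Arr cat Cmp_neg)
 then have "neg Y Z' (cp Y Z Z' d v) = neg Y Z' v'" by (rule s_inj[rotated -1]) (use * ** d in \<open>auto simp: cat\<close>)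
 then have v: "cp Y Z Z' d v = v'" using group.inv_inj[OF Mor_is_group[of Y Z']] * ** d by (simp add: inj_on_def cat)
 have "s Z (S X) (neg Z (S X) w) = s Z (S X) (neg Z (S X) (cp Z Z' (S X) w' d))"
  using m * ** d by (simp add: s_Cmp s_neg S_Ob s_Arr cat Cmp_neg s_Idn)
 then have "neg Z (S X) w = neg Z (S X) (cp Z Z' (S X) w' d)" by (rule s_inj[rotated -1]) (use * ** d in \<open>auto simp: cat S_Ob\<close>)
 then have w: "w = cp Z Z' (S X) w' d" using group.inv_inj[OF Mor_is_group[of Z "S X"]] * ** d by (simp add: inj_on_def cat S_Ob)
 have "tmor (X, Y, Z, u, v, w) (X, Y, Z', u, v', w') (Idn K X) (Idn K Y) d"
  using * ** d v w by (simp add: simps cat s_Idn S_Ob)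
 moreover have "iso_arr K Z Z' d" using i iso_arr_s[of Z Z' d] d * ** by simp
 ultimately have "tiso (X, Y, Z, u, v, w) (X, Y, Z', u, v', w')"
  unfolding tiso_def split using iso_arr_Idn * by blast
 then show ?thesis by (rule dtri_iso[OF t' ty])
qed

text \<open>The octahedron is given only for replacements of \<open>Y\<close> and \<open>Z\<close>.
  The five lemma compares the three given triangles with the replaced ones, and conjugation by
  \<open>\<alpha>\<close>, \<open>\<beta>\<close> and \<open>\<gamma>\<close> carries the answer
  back.\<close>

lemma dtri_octahedron: assumes t1: "(X, Y, Z', u, i, i') : dtri" and t2: "(Y, Z, X', v, j, j') : dtri"
  and t3: "(X, Z, Y', cp X Y Z v u, k, k') : dtri"
 shows "EX f:Arr K Z' Y'. EX g:Arr K Y' X'. (Z', Y', X', f, g, cp X' (S Y) (S Z') (s Y Z' i) j') : dtri &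
  cp Y Z' Y' f i = cp Y Z Y' k v & cp Z' Y' (S X) k' f = i' & cp Z Y' X' g k = j &
  cp Y' X' (S Y) j' g = cp Y' (S X) (S Y) (s X Y u) k'"
proof -
 note 1 = dtri_typed[OF t1, unfolded typed_def split] dtri_typed[OF t2, unfolded typed_def split] dtri_typed[OF t3, unfolded typed_def split]
 have O: "X : Ob K" "Y : Ob K" "Z : Ob K" and uv: "u : Arr K X Y" "v : Arr K Y Z" using 1 by auto
 obtain Y1 Z1 b d v1 A B C i1 i1' j1 j1' k1 k1' f g where b: "iso_arr K Y Y1 b" and d: "iso_arr K Z Z1 d" and v1: "v1 : Arr K Y1 Z1"
  and bd: "cp Y Y1 Z1 v1 b = cp Y Z Z1 d v" and T: "(X, Y1, A, cp X Y Y1 b u, i1, i1') : T" "(Y1, Z1, B, v1, j1, j1') : T"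
   "(X, Z1, C, cp X Y1 Z1 v1 (cp X Y Y1 b u), k1, k1') : T" "(A, C, B, f, g, cp B (S Y1) (S A) (s Y1 A i1) j1') : T"
  and e: "cp Y1 A C f i1 = cp Y1 Z1 C k1 v1" "cp A C (S X) k1' f = i1'" "cp Z1 C B g k1 = j1"
   "cp C B (S Y1) j1' g = cp C (S X) (S Y1) (s X Y1 (cp X Y Y1 b u)) k1'"
  using T_octahedron[OF O uv] by blast
 have "tiso t t" if "typed t" for t
  using that iso_arr_Idn unfolding tiso_def tmor_def typed_def by (cases t) (auto intro!: exI simp: cat s_Idn S_Ob)
 then have TD: "t : dtri" if "t : T" for t using T_distinguished[OF that T_type[OF that]] T_type[OF that] by blast
 have bA: "b : Arr K Y Y1" "d : Arr K Z Z1" using b d by (auto simp: iso_arr_def)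
 note 2 = T_type[OF T(1), unfolded typed_def split] T_type[OF T(2), unfolded typed_def split] T_type[OF T(3), unfolded typed_def split] T_type[OF T(4), unfolded typed_def split]
 note * = O uv 1 2 bA v1
 obtain \<alpha> where a: "tmor (X, Y, Z', u, i, i') (X, Y1, A, cp X Y Y1 b u, i1, i1') (Idn K X) b \<alpha>"
  by (rule dtri_mor[OF t1 TD[OF T(1)]]) (use * in \<open>auto simp: cat\<close>)
 obtain \<beta> where B: "tmor (Y, Z, X', v, j, j') (Y1, Z1, B, v1, j1, j1') b d \<beta>"
  by (rule dtri_mor[OF t2 TD[OF T(2)]]) (use * bd in \<open>auto simp: cat\<close>)
 obtain \<gamma> where c: "tmor (X, Z, Y', cp X Y Z v u, k, k') (X, Z1, C, cp X Y1 Z1 v1 (cp X Y Y1 b u), k1, k1') (Idn K X) d \<gamma>"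
  by (rule dtri_mor[OF t3 TD[OF T(3)]]) (use * in \<open>auto simp: cat reassoc[OF bd] assoc\<close>)
 note m = a[unfolded simps] B[unfolded simps] c[unfolded simps]
 have ai: "iso_arr K Z' A \<alpha>" by (rule dtri_five[OF t1 TD[OF T(1)] a iso_arr_Idn[OF O(1)] b])
 have bi: "iso_arr K X' B \<beta>" by (rule dtri_five[OF t2 TD[OF T(2)] B b d])
 have ci: "iso_arr K Y' C \<gamma>" by (rule dtri_five[OF t3 TD[OF T(3)] c iso_arr_Idn[OF O(1)] d])
 obtain \<beta>' where B': "\<beta>' : Arr K B X'" "cp X' B X' \<beta>' \<beta> = Idn K X'" "cp B X' B \<beta> \<beta>' = Idn K B" by (rule iso_arrE[OF bi])
 obtain \<gamma>' where c': "\<gamma>' : Arr K C Y'" "cp Y' C Y' \<gamma>' \<gamma> = Idn K Y'" "cp C Y' C \<gamma> \<gamma>' = Idn K C" by (rule iso_arrE[OF ci])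
 obtain b' where b': "b' : Arr K Y1 Y" "cp Y Y1 Y b' b = Idn K Y" by (rule iso_arrE[OF b])
 let ?f = "cp Z' C Y' \<gamma>' (cp Z' A C f \<alpha>)" and ?g = "cp Y' B X' \<beta>' (cp Y' C B g \<gamma>)"
 note ** = * m B' c'
 have aA: "\<alpha> : Arr K Z' A" "\<beta> : Arr K X' B" "\<gamma> : Arr K Y' C"
  and mi: "cp Y Z' A \<alpha> i = cp Y Y1 A i1 b" and mj: "cp Z X' B \<beta> j = cp Z Z1 B j1 d" and mk: "cp Z Y' C \<gamma> k = cp Z Z1 C k1 d"
  using m by auto
 note cs = assoc cat s_Arr S_Ob reassoc[OF B'(2)] reassoc[OF B'(3)] reassoc[OF c'(2)] reassoc[OF c'(3)]
  reassoc[OF e(1)] reassoc[OF e(2)] reassoc[OF e(3)] reassoc[OF e(4)]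
 have fg: "?f : Arr K Z' Y'" "?g : Arr K Y' X'" using ** by (simp_all add: cat)
 have si: "cp (S Y) (S Z') (S A) (s Z' A \<alpha>) (s Y Z' i) = cp (S Y) (S Y1) (S A) (s Y1 A i1) (s Y Y1 b)"
  using ** s_Cmp[of Y Z' A i \<alpha>] s_Cmp[of Y Y1 A b i1] by simp
 have jw: "cp X' (S Y) (S Y1) (s Y Y1 b) j' = cp X' B (S Y1) j1' \<beta>" using ** by blast
 have "tmor (Z', Y', X', ?f, ?g, cp X' (S Y) (S Z') (s Y Z' i) j') (A, C, B, f, g, cp B (S Y1) (S A) (s Y1 A i1) j1') \<alpha> \<gamma> \<beta>"
  unfolding tmor_def split using ** fg by (simp add: cs reassoc[OF si] jw)
 then have "tiso (Z', Y', X', ?f, ?g, cp X' (S Y) (S Z') (s Y Z' i) j') (A, C, B, f, g, cp B (S Y1) (S A) (s Y1 A i1) j1')"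
  unfolding tiso_def split using ai bi ci by blast
 moreover have "typed (Z', Y', X', ?f, ?g, cp X' (S Y) (S Z') (s Y Z' i) j')" using ** fg by (simp add: typed_def cat s_Arr S_Ob)
 ultimately have "(Z', Y', X', ?f, ?g, cp X' (S Y) (S Z') (s Y Z' i) j') : dtri" using T_distinguished[OF T(4)] by blast
 moreover have "cp Y Z' Y' ?f i = cp Y Z Y' k v"
 proof -
  have "cp Y Z' Y' ?f i = cp Y C Y' \<gamma>' (cp Y Z C (cp Z Y' C \<gamma> k) v)" unfolding mk using * aA c' by (simp add: assoc cat mi reassoc[OF e(1)] bd)
  also have "... = cp Y Z Y' k v" using * aA c' by (simp add: assoc cat reassoc[OF c'(2)])
  finally show ?thesis .
 qed
 moreover have k': "k' = cp Y' C (S X) k1' \<gamma>" "i' = cp Z' A (S X) i1' \<alpha>" using ** by (simp_all add: s_Idn cat S_Ob)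
 then have "cp Z' Y' (S X) k' ?f = i'" using ** by (simp add: cs)
 moreover have "cp Z Y' X' ?g k = j"
 proof -
  have "cp Z Y' X' ?g k = cp Z B X' \<beta>' (cp Z X' B \<beta> j)" unfolding mj using * aA B' by (simp add: assoc cat mk reassoc[OF e(3)])
  also have "... = j" using * aA B' by (simp add: cat reassoc[OF B'(2)])
  finally show ?thesis .
 qed
 moreover have "cp Y' X' (S Y) j' ?g = cp Y' (S X) (S Y) (s X Y u) k'"
 proof -
  \<comment> \<open>The last identity is checked after composing with the suspension of
    \<open>b\<close>, which is then cancelled by its left inverse.\<close>
  have sb: "cp (S Y) (S Y1) (S Y) (s Y1 Y b') (s Y Y1 b) = Idn K (S Y)" using b' * by (simp add: s_Idn flip: s_Cmp)
  have "cp Y' (S Y) (S Y1) (s Y Y1 b) (cp Y' X' (S Y) j' ?g) = cp Y' C (S Y1) (cp C B (S Y1) j1' g) \<gamma>"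
   using * aA B' c' by (simp add: assoc cat s_Arr S_Ob reassoc[OF jw] reassoc[OF B'(3)])
  also have "... = cp Y' (S Y) (S Y1) (s Y Y1 b) (cp Y' (S X) (S Y) (s X Y u) k')"
   unfolding e(4) k' using * aA by (simp add: s_Cmp assoc cat s_Arr S_Ob)
  finally have "cp Y' (S Y) (S Y1) (s Y Y1 b) (cp Y' X' (S Y) j' ?g) = cp Y' (S Y) (S Y1) (s Y Y1 b) (cp Y' (S X) (S Y) (s X Y u) k')" .
  moreover have "cp Y' (S Y1) (S Y) (s Y1 Y b') (cp Y' (S Y) (S Y1) (s Y Y1 b) x) = x" if "x : Arr K Y' (S Y)" for x
   using that * b' by (simp add: reassoc[OF sb] s_Arr S_Ob cat)
  moreover have "cp Y' X' (S Y) j' ?g : Arr K Y' (S Y)" "cp Y' (S X) (S Y) (s X Y u) k' : Arr K Y' (S Y)"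
   using 1 fg s_Arr[OF O(1,2) uv(1)] S_Ob[OF O(1)] S_Ob[OF O(2)] by (blast intro: Cmp_Arr)+
  ultimately show ?thesis by metis
 qed
 ultimately show ?thesis using fg by blast
qed

theorem triangulated: "triangulated_category K S s dtri"
proof
 fix X Y Z u v w assume t: "(X, Y, Z, u, v, w) : dtri"
 note * = dtri_typed[OF t, unfolded typed_def split]
 show "X : Ob K & Y : Ob K & Z : Ob K & u : Arr K X Y & v : Arr K Y Z & w : Arr K Z (S X)" by (rule *)
 fix X' Y' Z' u' v' w' a b c
 {
  assume "X' : Ob K" "Y' : Ob K" "Z' : Ob K" "u' : Arr K X' Y'" "v' : Arr K Y' Z'" "w' : Arr K Z' (S X')"
   and i: "iso_arr K X X' a" "iso_arr K Y Y' b" "iso_arr K Z Z' c"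
   and e: "cp X Y Y' b u = cp X X' Y' u' a" "cp Y Z Z' c v = cp Y Y' Z' v' b" "cp Z (S X) (S X') (s X X' a) w = cp Z Z' (S X') w' c"
  then have ty: "typed (X', Y', Z', u', v', w')" by (simp add: typed_def)
  have "tiso (X, Y, Z, u, v, w) (X', Y', Z', u', v', w')" using i e unfolding tiso_def tmor_def split by (auto simp: iso_arr_def)
  then show "(X', Y', Z', u', v', w') : dtri" by (rule dtri_iso[OF t ty tiso_sym[OF dtri_typed[OF t] ty]])
 next
  assume t': "(X', Y', Z', u', v', w') : dtri" and ab: "a : Arr K X X'" "b : Arr K Y Y'" "cp X Y Y' b u = cp X X' Y' u' a"
  show "EX c:Arr K Z Z'. cp Y Z Z' c v = cp Y Y' Z' v' b & cp Z (S X) (S X') (s X X' a) w = cp Z Z' (S X') w' c"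
   by (rule dtri_mor[OF t t' ab]) (auto simp: tmor_def)
 }
next
 fix X Y Z u v w assume *: "X : Ob K" "Y : Ob K" "Z : Ob K" "u : Arr K X Y" "v : Arr K Y Z" "w : Arr K Z (S X)"
 then show "(X, Y, Z, u, v, w) : dtri <-> (Y, Z, S X, v, w, neg (S X) (S Y) (s X Y u)) : dtri"
  using dtri_rotate dtri_rotate_back by (auto simp: typed_def)
next
 fix X Y u assume *: "X : Ob K" "Y : Ob K" "u : Arr K X Y"
 show "EX Z v w. (X, Y, Z, u, v, w) : dtri" by (rule dtri_cone[OF *]) blast
qed (auto simp: dtri_Idn intro: dtri_octahedron)

end

section \<open>Stable categories\<close>

locale stable_category = relative_exact K Pr for K :: "('o, 'm) preadd_cat" and Pr :: "'o set" +
 fixes I S :: "'o => 'o" and i p :: "'o => 'm"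
 assumes suspension: "X : Ob K ==> I X : Pr & (X, i X, I X, p X, S X) : E"
begin

abbreviation "N == factor_ideal K Pr"
abbreviation "q X Y f == N X Y #>\<^bsub>Mor K X Y\<^esub> f"
abbreviation "U == quotient_category K N"
abbreviation "sub X Y f g == f \<otimes>\<^bsub>Mor K X Y\<^esub> neg X Y g"

lemma NI: "W : Pr ==> g : Arr K X W ==> h : Arr K W Y ==> cp X W Y h g : N X Y"
 unfolding factor_ideal_def by blast

text \<open>The intermediate object is injective with respect to conflations, so a null map factors
  through every inflation out of its source, with a null second factor.\<close>

lemma N_factor: assumes O: "X : Ob K" "Y : Ob K" and E: "(X, u, B, v, D) : E" and f: "f : N X Y"
 obtains k where "k : N B Y" "k : Arr K B Y" "f = cp X B Y k u"
proof -
 obtain W g h where W: "W : Pr" "g : Arr K X W" "h : Arr K W Y" "f = cp X W Y h g" using f unfolding factor_ideal_def by blast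
 obtain g' where g': "g' : Arr K B W" "cp X B W g' u = g" using injective[OF W(1) E W(2)] by blast
 note c = conflD[OF E] Pr_Ob[OF W(1)]
 show ?thesis
  by (rule that[OF NI[OF W(1) g'(1) W(3)]]) (use O W g' c in \<open>simp_all add: cat assoc\<close>)
qed

lemma N_iff: assumes O: "X : Ob K" "Y : Ob K"
 shows "f : N X Y <-> (EX k:Arr K (I X) Y. f = cp X (I X) Y k (i X))"
 using N_factor[OF O conjunct2[OF suspension[OF O(1)]]] NI conflD(4)[OF conjunct2[OF suspension[OF O(1)]]] suspension[OF O(1)] by metis

lemma N_ideal: assumes O: "X : Ob K" "Y : Ob K" "Z : Ob K"
 shows "f : N X Y ==> g : Arr K Y Z ==> cp X Y Z g f : N X Z" "f : Arr K X Y ==> g : N Y Z ==> cp X Y Z g f : N X Z"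
proof -
 { assume "f : N X Y" and g: "g : Arr K Y Z"
  then obtain W a b where W: "W : Pr" "a : Arr K X W" "b : Arr K W Y" "f = cp X W Y b a" unfolding factor_ideal_def by blast
  then show "cp X Y Z g f : N X Z" using NI[OF W(1,2), of "cp W Y Z g b" Z] O g Pr_Ob[OF W(1)] by (simp add: assoc cat) }
 { assume "g : N Y Z" and f: "f : Arr K X Y"
  then obtain W a b where W: "W : Pr" "a : Arr K Y W" "b : Arr K W Z" "g = cp Y W Z b a" unfolding factor_ideal_def by blast
  then show "cp X Y Z g f : N X Z" using NI[OF W(1) _ W(3), of "cp X Y W a f" X] O f Pr_Ob[OF W(1)] by (simp add: assoc cat) }
qed

text \<open>Null maps on \<open>X\<close> are those factoring through the single map
  \<open>i X\<close>, hence the image of a group homomorphism; this takes the place of direct sums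
  of intermediate objects.\<close>

lemma N_subgroup: assumes O: "X : Ob K" "Y : Ob K" shows "subgroup (N X Y) (Mor K X Y)"
proof -
 have IX: "I X : Ob K" "i X : Arr K X (I X)" using suspension[OF O(1)] conflD Pr_Ob by blast+
 have "N X Y = (%k. cp X (I X) Y k (i X)) ` Arr K (I X) Y" using N_iff[OF O] by blast
 then show ?thesis using group_hom.img_is_subgroup[OF Cmp_hom(1)[OF O(1) IX(1) O(2) IX(2)]] by simp
qed

lemma N_normal: "X : Ob K ==> Y : Ob K ==> N X Y \<lhd> Mor K X Y"
 using comm_group.subgroup_imp_normal[OF Mor_group] N_subgroup by blast

lemma q_eq_iff: assumes O: "X : Ob K" "Y : Ob K" and f: "f : Arr K X Y" "g : Arr K X Y"
 shows "q X Y f = q X Y g <-> sub X Y f g : N X Y"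
proof -
 interpret group "Mor K X Y" by (rule Mor_is_group[OF O])
 note S = N_subgroup[OF O]
 show ?thesis
  using subgroup.rcos_module[OF S is_group f(2,1)] repr_independence[OF _ f(2) S] repr_independenceD[OF S f(1)] by metis
qed

lemma U_simps [simp]: "Ob U = Ob K" "Idn U X = q X X (Idn K X)" "zero_arr U X Y = N X Y" "Mor U X Y = Mor K X Y Mod N X Y"
 by (simp_all add: quotient_category_def)

lemma Arr_U: "carrier (Mor K X Y Mod N X Y) = q X Y ` Arr K X Y" by (simp add: carrier_FactGroup)

lemma q_Arr: "f : Arr K X Y ==> q X Y f : carrier (Mor K X Y Mod N X Y)" by (simp add: Arr_U)

lemma q_add: "X : Ob K ==> Y : Ob K ==> f : Arr K X Y ==> g : Arr K X Y ==>
  q X Y f \<otimes>\<^bsub>Mor K X Y Mod N X Y\<^esub> q X Y g = q X Y (f \<otimes>\<^bsub>Mor K X Y\<^esub> g)"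
 by (simp add: normal.rcos_sum[OF N_normal])

lemma q_null: "X : Ob K ==> Y : Ob K ==> f : N X Y ==> q X Y f = N X Y"
 using group.coset_join2[OF Mor_is_group] N_subgroup subgroup.mem_carrier by metis

lemma q_null_iff: "X : Ob K ==> Y : Ob K ==> f : Arr K X Y ==> q X Y f = N X Y <-> f : N X Y"
 using group.coset_join1[OF Mor_is_group] N_subgroup q_null by metis

lemma q_zero: "X : Ob K ==> Y : Ob K ==> q X Y (zero_arr K X Y) = N X Y"
 using q_null N_subgroup subgroup.one_closed by metis

lemma q_hom: "X : Ob K ==> Y : Ob K ==> group_hom (Mor K X Y) (Mor K X Y Mod N X Y) (q X Y)"
 using normal.r_coset_hom_Mod[OF N_normal] normal.factorgroup_is_group[OF N_normal] by (simp add: group_hom_def group_hom_axioms_def Mor_is_group)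

lemma q_neg: "X : Ob K ==> Y : Ob K ==> f : Arr K X Y ==> inv\<^bsub>Mor K X Y Mod N X Y\<^esub> q X Y f = q X Y (neg X Y f)"
 using group_hom.hom_inv[OF q_hom] by metis

text \<open>Changing representatives alters the composite only by null maps, so the union in the
  definition of composition is a single coset.\<close>

lemma q_Cmp: assumes O: "X : Ob K" "Y : Ob K" "Z : Ob K" and f: "f : Arr K X Y" and g: "g : Arr K Y Z"
 shows "Cmp U X Y Z (q Y Z g) (q X Y f) = q X Z (cp X Y Z g f)"
proof -
 interpret group "Mor K X Y" by (rule Mor_is_group[OF O(1,2)])
 interpret G: group "Mor K Y Z" by (rule Mor_is_group[OF O(2,3)])
 have *: "q X Z (cp X Y Z g' f') = q X Z (cp X Y Z g f)" if "f' : q X Y f" "g' : q Y Z g" for f' g'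
 proof -
  obtain a b where ab: "a : N X Y" "f' = a \<otimes>\<^bsub>Mor K X Y\<^esub> f" "b : N Y Z" "g' = b \<otimes>\<^bsub>Mor K Y Z\<^esub> g"
   using \<open>f' : _\<close> \<open>g' : _\<close> unfolding r_coset_def by blast
  have A: "a : Arr K X Y" "b : Arr K Y Z" using ab N_subgroup O subgroup.mem_carrier by metis+
  interpret XZ: comm_group "Mor K X Z" by (rule Mor_group[OF O(1,3)])
  let ?n = "cp X Y Z b a \<otimes>\<^bsub>Mor K X Z\<^esub> (cp X Y Z g a \<otimes>\<^bsub>Mor K X Z\<^esub> cp X Y Z b f)"
  have n: "?n : N X Z" using O f g A ab by (intro subgroup.m_closed[OF N_subgroup] N_ideal(1)[of X Y Z a b] N_ideal(1)[of X Y Z a g] N_ideal(2)[of X Y Z f b]) auto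
  have "cp X Y Z g' f' = ?n \<otimes>\<^bsub>Mor K X Z\<^esub> cp X Y Z g f"
   using O f g A by (simp add: ab Cmp_add_left Cmp_add_right cat XZ.m_assoc)
  moreover have c: "cp X Y Z g f : Arr K X Z" "?n : Arr K X Z" using O f g A by (simp_all add: cat)
  ultimately have "sub X Z (cp X Y Z g' f') (cp X Y Z g f) = ?n" by (simp add: XZ.m_assoc del: XZ.m_closed)
  moreover have "cp X Y Z g' f' : Arr K X Z" using O f g A by (simp add: ab cat)
  ultimately show ?thesis using q_eq_iff[OF O(1,3) _ c(1)] n by metis
 qed
 have fg: "f : q X Y f" "g : q Y Z g" using rcos_self[OF f N_subgroup[OF O(1,2)]] G.rcos_self[OF g N_subgroup[OF O(2,3)]] by blast+
 show ?thesis
  unfolding quotient_category_def preadd_cat.simps by (intro equalityI subsetI UN_I[OF fg(2)] UN_I[OF fg(1)]) (auto simp: * split: if_splits)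
qed

lemma U_ArrE: assumes "f : carrier (Mor K X Y Mod N X Y)"
 obtains f' where "f' : Arr K X Y" "f = q X Y f'" using assms by (auto simp: Arr_U)

lemma additive_U: "additive_category U"
proof -
 have "preadditive_category U"
 proof (rule preadditive_category.intro, unfold U_simps)
  fix X Y W Z assume O: "X : Ob K" "Y : Ob K" "W : Ob K" "Z : Ob K"
  note [simp] = O q_Cmp q_add q_Arr cat
  show "comm_group (Mor K X Y Mod N X Y)" using comm_group.abelian_FactGroup[OF Mor_group N_subgroup] O by blast
  show "q X X (Idn K X) : carrier (Mor K X X Mod N X X)" by simp
  fix f assume "f : carrier (Mor K X Y Mod N X Y)"
  then obtain f' where f [simp]: "f' : Arr K X Y" "f = q X Y f'" by (rule U_ArrE)
  show "Cmp U X X Y f (q X X (Idn K X)) = f" "Cmp U X Y Y (q Y Y (Idn K Y)) f = f" by simp_all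
  fix g assume "g : carrier (Mor K Y Z Mod N Y Z)"
  then obtain g' where g [simp]: "g' : Arr K Y Z" "g = q Y Z g'" by (rule U_ArrE)
  show "Cmp U X Y Z g f : carrier (Mor K X Z Mod N X Z)" by simp
  show "Cmp U X Y Z g (f \<otimes>\<^bsub>Mor K X Y Mod N X Y\<^esub> f1) = Cmp U X Y Z g f \<otimes>\<^bsub>Mor K X Z Mod N X Z\<^esub> Cmp U X Y Z g f1"
   if "f1 : carrier (Mor K X Y Mod N X Y)" for f1
   by (rule U_ArrE[OF that]) (simp add: Cmp_add_right del: mult_FactGroup)
  show "Cmp U X Y Z (g \<otimes>\<^bsub>Mor K Y Z Mod N Y Z\<^esub> g1) f = Cmp U X Y Z g f \<otimes>\<^bsub>Mor K X Z Mod N X Z\<^esub> Cmp U X Y Z g1 f"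
   if "g1 : carrier (Mor K Y Z Mod N Y Z)" for g1
   by (rule U_ArrE[OF that]) (simp add: Cmp_add_left del: mult_FactGroup)
  show "Cmp U W Y Z g (Cmp U W X Y f h) = Cmp U W X Z (Cmp U X Y Z g f) h" if "h : carrier (Mor K W X Mod N W X)" for h
   by (rule U_ArrE[OF that]) (simp add: assoc)
 qed
 moreover obtain Z where Z: "Z : Ob K" "!!X. X : Ob K ==> Arr K X Z = {zero_arr K X Z} & Arr K Z X = {zero_arr K Z X}"
  using has_zero unfolding zero_object_def by blast
 then have "zero_object U Z" unfolding zero_object_def by (simp add: Arr_U q_zero)
 moreover have "EX B i j p q. biproduct U X Y B i j p q" if O: "X : Ob K" "Y : Ob K" for X Y
 proof -
  obtain B i j p r where "biproduct K X Y B i j p r" using has_biproducts[OF O] by blast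
  then have "biproduct U X Y B (q X B i) (q Y B j) (q B X p) (q B Y r)"
   using O unfolding biproduct_def by (simp add: q_Cmp q_Arr q_add q_zero cat del: mult_FactGroup)
  then show ?thesis by blast
 qed
 ultimately show ?thesis unfolding additive_category_def additive_category_axioms_def by auto
qed

text \<open>A morphism of conflations with its middle component forgotten: for the stable category
  only the maps on the two ends matter.\<close>

definition cmor where
 "cmor F G c a <-> F : E & G : E & (case F of (X, u, Y, v, Z) => case G of (X', u', Y', v', Z') => c : Arr K X X' & a : Arr K Z Z' &
  (EX b:Arr K Y Y'. cp X Y Y' b u = cp X X' Y' u' c & cp Y Z Z' a v = cp Y Y' Z' v' b))"

lemma cmorI:
 assumes "(X, u, Y, v, Z) : E" "(X', u', Y', v', Z') : E" "c : Arr K X X'" "a : Arr K Z Z'" "b : Arr K Y Y'"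
  "cp X Y Y' b u = cp X X' Y' u' c" "cp Y Z Z' a v = cp Y Y' Z' v' b"
 shows "cmor (X, u, Y, v, Z) (X', u', Y', v', Z') c a" using assms unfolding cmor_def by auto

lemma cmorE: assumes "cmor (X, u, Y, v, Z) (X', u', Y', v', Z') c a"
 obtains b where "(X, u, Y, v, Z) : E" "(X', u', Y', v', Z') : E" "c : Arr K X X'" "a : Arr K Z Z'" "b : Arr K Y Y'"
  "cp X Y Y' b u = cp X X' Y' u' c" "cp Y Z Z' a v = cp Y Y' Z' v' b"
 using assms unfolding cmor_def by auto

lemma square_paste: assumes "X : Ob K" "Y : Ob K" "X' : Ob K" "Y' : Ob K" "X'' : Ob K" "Y'' : Ob K"
  "u : Arr K X Y" "u' : Arr K X' Y'" "u'' : Arr K X'' Y''" "a : Arr K X X'" "a' : Arr K X' X''" "b : Arr K Y Y'" "b' : Arr K Y' Y''"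
  "cp X Y Y' b u = cp X X' Y' u' a" "cp X' Y' Y'' b' u' = cp X' X'' Y'' u'' a'"
 shows "cp X Y Y'' (cp Y Y' Y'' b' b) u = cp X X'' Y'' u'' (cp X X' X'' a' a)"
 using assms(1-13) by (simp add: assoc assms(14) reassoc[OF assms(15)])

lemma cmor_Cmp:
 assumes "cmor (X, u, Y, v, Z) (X', u', Y', v', Z') c a" "cmor (X', u', Y', v', Z') (X'', u'', Y'', v'', Z'') c' a'"
 shows "cmor (X, u, Y, v, Z) (X'', u'', Y'', v'', Z'') (cp X X' X'' c' c) (cp Z Z' Z'' a' a)"
proof -
 obtain b where b: "(X, u, Y, v, Z) : E" "(X', u', Y', v', Z') : E" "c : Arr K X X'" "a : Arr K Z Z'" "b : Arr K Y Y'"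
  "cp X Y Y' b u = cp X X' Y' u' c" "cp Y Z Z' a v = cp Y Y' Z' v' b" by (rule cmorE[OF assms(1)])
 obtain b' where b': "(X'', u'', Y'', v'', Z'') : E" "c' : Arr K X' X''" "a' : Arr K Z' Z''" "b' : Arr K Y' Y''"
  "cp X' Y' Y'' b' u' = cp X' X'' Y'' u'' c'" "cp Y' Z' Z'' a' v' = cp Y' Y'' Z'' v'' b'" by (rule cmorE[OF assms(2)])
 note c = conflD[OF b(1)] conflD[OF b(2)] conflD[OF b'(1)]
 show ?thesis
 proof (rule cmorI[OF b(1) b'(1)])
  show "cp X Y Y'' (cp Y Y' Y'' b' b) u = cp X X'' Y'' u'' (cp X X' X'' c' c)"
   by (rule square_paste[of X Y X' Y' X'' Y'' u u' u'']) (use c b b' in simp_all)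
  show "cp Y Z Z'' (cp Z Z' Z'' a' a) v = cp Y Y'' Z'' v'' (cp Y Y' Y'' b' b)"
   by (rule square_paste[of Y Z Y' Z' Y'' Z'' v v' v'']) (use c b b' in simp_all)
 qed (use c b b' in \<open>simp_all add: cat\<close>)
qed

lemma cmor_add:
 assumes "cmor (X, u, Y, v, Z) (X', u', Y', v', Z') c a" "cmor (X, u, Y, v, Z) (X', u', Y', v', Z') c' a'"
 shows "cmor (X, u, Y, v, Z) (X', u', Y', v', Z') (c \<otimes>\<^bsub>Mor K X X'\<^esub> c') (a \<otimes>\<^bsub>Mor K Z Z'\<^esub> a')"
proof -
 obtain b where b: "(X, u, Y, v, Z) : E" "(X', u', Y', v', Z') : E" "c : Arr K X X'" "a : Arr K Z Z'" "b : Arr K Y Y'"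
  "cp X Y Y' b u = cp X X' Y' u' c" "cp Y Z Z' a v = cp Y Y' Z' v' b" by (rule cmorE[OF assms(1)])
 obtain b' where b': "c' : Arr K X X'" "a' : Arr K Z Z'" "b' : Arr K Y Y'"
  "cp X Y Y' b' u = cp X X' Y' u' c'" "cp Y Z Z' a' v = cp Y Y' Z' v' b'" by (rule cmorE[OF assms(2)])
 note c = conflD[OF b(1)] conflD[OF b(2)]
 show ?thesis
  by (rule cmorI[OF b(1,2), of _ _ "b \<otimes>\<^bsub>Mor K Y Y'\<^esub> b'"]) (use c b b' in \<open>simp_all add: cat Cmp_add_left Cmp_add_right\<close>)
qed

lemma cmor_neg: assumes "cmor (X, u, Y, v, Z) (X', u', Y', v', Z') c a"
 shows "cmor (X, u, Y, v, Z) (X', u', Y', v', Z') (neg X X' c) (neg Z Z' a)"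
proof -
 obtain b where b: "(X, u, Y, v, Z) : E" "(X', u', Y', v', Z') : E" "c : Arr K X X'" "a : Arr K Z Z'" "b : Arr K Y Y'"
  "cp X Y Y' b u = cp X X' Y' u' c" "cp Y Z Z' a v = cp Y Y' Z' v' b" by (rule cmorE[OF assms(1)])
 note c = conflD[OF b(1)] conflD[OF b(2)]
 show ?thesis by (rule cmorI[OF b(1,2), of _ _ "neg Y Y' b"]) (use c b in \<open>simp_all add: cat Cmp_neg\<close>)
qed

lemma cmor_Idn: "(X, u, Y, v, Z) : E ==> cmor (X, u, Y, v, Z) (X, u, Y, v, Z) (Idn K X) (Idn K Z)"
 using conflD by (intro cmorI[of _ _ _ _ _ _ _ _ _ _ _ _ "Idn K Y"]) (auto simp: cat)

lemma cmor_ex: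
 assumes E: "(X, u, Y, v, Z) : E" "(X', u', Y', v', Z') : E" and P: "Y' : Pr" and c: "c : Arr K X X'"
 obtains a where "cmor (X, u, Y, v, Z) (X', u', Y', v', Z') c a"
proof -
 note d = conflD[OF E(1)] conflD[OF E(2)]
 have "cp X X' Y' u' c : Arr K X Y'" using d c by (simp add: cat)
 then obtain b where b: "b : Arr K Y Y'" "cp X Y Y' b u = cp X X' Y' u' c" using injective[OF P E(1)] by blast
 have "cp X Y Z' (cp Y Y' Z' v' b) u = zero_arr K X Z'" using d b c by (simp add: assoc reassoc[OF d(12)] Cmp_zero)
 then obtain a where a: "a : Arr K Z Z'" "cp Y Z Z' a v = cp Y Y' Z' v' b" by (rule cokernelE[OF E(1) d(9), rotated]) (use d b in \<open>simp_all add: cat\<close>)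
 show ?thesis by (rule that[OF cmorI[OF E c a(1) b(1,2) a(2)]])
qed

text \<open>A null \<open>c\<close> factors through \<open>u\<close>, so the middle map can be
  changed to one that kills \<open>u\<close>. It then descends along \<open>v\<close>, and
  \<open>a\<close> factors through the object \<open>Y'\<close> of \<open>Pr\<close>.\<close>

lemma cmor_null:
 assumes m: "cmor (X, u, Y, v, Z) (X', u', Y', v', Z') c a" and P: "Y' : Pr" and n: "c : N X X'"
 shows "a : N Z Z'"
proof -
 obtain b where b: "(X, u, Y, v, Z) : E" "(X', u', Y', v', Z') : E" "c : Arr K X X'" "a : Arr K Z Z'" "b : Arr K Y Y'"
  "cp X Y Y' b u = cp X X' Y' u' c" "cp Y Z Z' a v = cp Y Y' Z' v' b" by (rule cmorE[OF m])
 note d = conflD[OF b(1)] conflD[OF b(2)]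
 interpret YY: group "Mor K X Y'" by (rule Mor_is_group) (use d in simp_all)
 interpret YZ: group "Mor K Y Z'" by (rule Mor_is_group) (use d in simp_all)
 obtain k where k: "k : Arr K Y X'" "c = cp X Y X' k u" by (rule N_factor[OF d(1,7) b(1) n])
 let ?r = "sub Y Y' b (cp Y X' Y' u' k)"
 have "cp X Y Y' ?r u = zero_arr K X Y'" using d b k(1) by (simp add: Cmp_add_left Cmp_neg cat assoc k(2))
 then obtain m where m: "m : Arr K Z Y'" "cp Y Z Y' m v = ?r" by (rule cokernelE[OF b(1) d(8), rotated]) (use d b k(1) in \<open>simp_all add: cat\<close>)
 have "a = cp Z Y' Z' v' m"
  by (rule deflation_epi[OF b(1) d(9)]) (use d b k(1) m in \<open>simp_all add: cat assoc Cmp_add_right Cmp_neg reassoc[OF d(12)] Cmp_zero\<close>)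
 then show ?thesis using NI[OF P m(1)] d by simp
qed

text \<open>The null case is applied to the difference of the two morphisms. Functoriality of the
  suspension and the stable identities for connecting maps are consequences.\<close>

lemma cmor_unique:
 assumes m: "cmor (X, u, Y, v, Z) (X', u', Y', v', Z') c a" "cmor (X, u, Y, v, Z) (X', u', Y', v', Z') c' a'" and P: "Y' : Pr"
  and e: "q X X' c = q X X' c'" shows "q Z Z' a = q Z Z' a'"
proof -
 have E: "(X, u, Y, v, Z) : E" "(X', u', Y', v', Z') : E" "c : Arr K X X'" "a : Arr K Z Z'" "c' : Arr K X X'" "a' : Arr K Z Z'"
  using m by (auto simp: cmor_def)
 note d = conflD[OF E(1)] conflD[OF E(2)]
 have "sub X X' c c' : N X X'" using q_eq_iff e E d by blast
 then have "sub Z Z' a a' : N Z Z'" by (rule cmor_null[OF cmor_add[OF m(1) cmor_neg[OF m(2)]] P])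
 then show ?thesis using q_eq_iff E d by blast
qed

end

text \<open>\<open>s\<close> is prescribed by every completed diagram instead of being constructed,
  matching the form of \<open>relative_cosyzygy_functor\<close>.\<close>

locale stable_suspension = stable_category +
 fixes s :: "'a => 'a => 'b set => 'b set"
 assumes s: "cmor (X, i X, I X, p X, S X) (Y, i Y, I Y, p Y, S Y) f h ==> s X Y (q X Y f) = q (S X) (S Y) h"
begin

abbreviation "susp X == (X, i X, I X, p X, S X)"

lemma suspD: assumes "X : Ob K"
 shows "susp X : E" "I X : Pr" "I X : Ob K" "S X : Ob K" "i X : Arr K X (I X)" "p X : Arr K (I X) (S X)"
  "cp X (I X) (S X) (p X) (i X) = zero_arr K X (S X)"
 using suspension[OF assms] conflD[of X "i X" "I X" "p X" "S X"] by auto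

lemma susp_cmor_ex: assumes "X : Ob K" "Y : Ob K" "f : Arr K X Y"
 obtains h where "cmor (susp X) (susp Y) f h" "h : Arr K (S X) (S Y)"
proof -
 obtain h where h: "cmor (susp X) (susp Y) f h" by (rule cmor_ex[OF suspD(1)[OF assms(1)] suspD(1)[OF assms(2)] suspD(2)[OF assms(2)] assms(3)])
 then show ?thesis by (rule that) (use h in \<open>auto simp: cmor_def\<close>)
qed

lemma suspended: "suspended_category U S s"
proof -
 interpret U: additive_category U by (rule additive_U)
 show ?thesis
 proof (intro suspended_category.intro additive_U suspended_category_axioms.intro, unfold U_simps)
  fix X Y Z assume O: "X : Ob K" "Y : Ob K" "Z : Ob K"
  note X = suspD[OF O(1)] and Y = suspD[OF O(2)] and Z = suspD[OF O(3)]
  show "S X : Ob K" by (rule X)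
  show "s X Y : hom (Mor K X Y Mod N X Y) (Mor K (S X) (S Y) Mod N (S X) (S Y))"
  proof (rule homI)
   fix f assume "f : carrier (Mor K X Y Mod N X Y)"
   then obtain f' where f: "f' : Arr K X Y" "f = q X Y f'" by (rule U_ArrE)
   obtain h where h: "cmor (susp X) (susp Y) f' h" "h : Arr K (S X) (S Y)" by (rule susp_cmor_ex[OF O(1,2) f(1)])
   then show "s X Y f : carrier (Mor K (S X) (S Y) Mod N (S X) (S Y))" by (simp add: f s q_Arr)
   fix g assume "g : carrier (Mor K X Y Mod N X Y)"
   then obtain g' where g: "g' : Arr K X Y" "g = q X Y g'" by (rule U_ArrE)
   obtain k where k: "cmor (susp X) (susp Y) g' k" "k : Arr K (S X) (S Y)" by (rule susp_cmor_ex[OF O(1,2) g(1)])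
   show "s X Y (f \<otimes>\<^bsub>Mor K X Y Mod N X Y\<^esub> g) = s X Y f \<otimes>\<^bsub>Mor K (S X) (S Y) Mod N (S X) (S Y)\<^esub> s X Y g"
    using O f g X Y h k by (simp add: q_add s[OF cmor_add[OF h(1) k(1)]] s[OF h(1)] s[OF k(1)] del: mult_FactGroup)
  qed
  show "s X X (q X X (Idn K X)) = q (S X) (S X) (Idn K (S X))" by (rule s[OF cmor_Idn[OF X(1)]])
  show "s X Z (Cmp U X Y Z g f) = Cmp U (S X) (S Y) (S Z) (s Y Z g) (s X Y f)"
   if fg: "f : carrier (Mor K X Y Mod N X Y)" "g : carrier (Mor K Y Z Mod N Y Z)" for f g
  proof -
   obtain f' where f: "f' : Arr K X Y" "f = q X Y f'" using fg(1) by (rule U_ArrE)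
   obtain g' where g: "g' : Arr K Y Z" "g = q Y Z g'" using fg(2) by (rule U_ArrE)
   obtain h where h: "cmor (susp X) (susp Y) f' h" "h : Arr K (S X) (S Y)" by (rule susp_cmor_ex[OF O(1,2) f(1)])
   obtain k where k: "cmor (susp Y) (susp Z) g' k" "k : Arr K (S Y) (S Z)" by (rule susp_cmor_ex[OF O(2,3) g(1)])
   show ?thesis using O f g X Y Z h k by (simp add: q_Cmp s[OF cmor_Cmp[OF h(1) k(1)]] s[OF h(1)] s[OF k(1)])
  qed
  show "bij_betw (s X Y) (carrier (Mor K X Y Mod N X Y)) (carrier (Mor K (S X) (S Y) Mod N (S X) (S Y)))"
  proof (rule bij_betw_imageI)
   show "inj_on (s X Y) (carrier (Mor K X Y Mod N X Y))"
   proof (rule inj_onI)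
    fix f g assume fg: "f : carrier (Mor K X Y Mod N X Y)" "g : carrier (Mor K X Y Mod N X Y)" "s X Y f = s X Y g"
    obtain f' where f: "f' : Arr K X Y" "f = q X Y f'" using fg(1) by (rule U_ArrE)
    obtain g' where g: "g' : Arr K X Y" "g = q X Y g'" using fg(2) by (rule U_ArrE)
    obtain h where h: "cmor (susp X) (susp Y) f' h" "h : Arr K (S X) (S Y)" by (rule susp_cmor_ex[OF O(1,2) f(1)])
    obtain k where k: "cmor (susp X) (susp Y) g' k" "k : Arr K (S X) (S Y)" by (rule susp_cmor_ex[OF O(1,2) g(1)])
    let ?c = "sub X Y f' g'" and ?a = "sub (S X) (S Y) h k"
    \<comment> \<open>Faithfulness: the null difference \<open>h - k\<close> factors through some
      \<open>W\<close> in \<open>Pr\<close>, and its second factor lifts along \<open>p Y\<close>.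
      Subtracting this from the middle map leaves one that factors through \<open>i Y\<close> as
      \<open>r\<close>, and the difference of \<open>f'\<close> and \<open>g'\<close> is then
      \<open>r\<close> after \<open>i X\<close>, hence null.\<close>
    have "?a : N (S X) (S Y)" using fg(3) q_eq_iff[OF X(4) Y(4) h(2) k(2)] by (simp add: f g s[OF h(1)] s[OF k(1)])
    then obtain W a b where W: "W : Pr" "a : Arr K (S X) W" "b : Arr K W (S Y)" "?a = cp (S X) W (S Y) b a"
     unfolding factor_ideal_def by blast
    obtain b' where b': "b' : Arr K W (I Y)" "cp W (I Y) (S Y) (p Y) b' = b" using projective[OF W(1) Y(1) W(3)] by blast
    obtain m where m: "?c : Arr K X Y" "m : Arr K (I X) (I Y)" "cp X (I X) (I Y) m (i X) = cp X Y (I Y) (i Y) ?c"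
     "cp (I X) (S X) (S Y) ?a (p X) = cp (I X) (I Y) (S Y) (p Y) m" by (rule cmorE[OF cmor_add[OF h(1) cmor_neg[OF k(1)]]])
    interpret G: group "Mor K (I X) (S Y)" by (rule Mor_is_group[OF X(3) Y(4)])
    let ?e = "cp (I X) W (I Y) b' (cp (I X) (S X) W a (p X))"
    have WO: "W : Ob K" by (rule Pr_Ob[OF W(1)])
    have "cp (I X) (S X) (S Y) ?a (p X) = cp (I X) W (S Y) b (cp (I X) (S X) W a (p X))"
     unfolding W(4) using X Y W(2,3) WO by (simp add: assoc)
    then have "cp (I X) (I Y) (S Y) (p Y) (sub (I X) (I Y) m ?e) = zero_arr K (I X) (S Y)"
     using X Y W(2,3) WO b' m(2) by (simp add: Cmp_add_right Cmp_neg cat reassoc[OF b'(2)] flip: m(4))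
    then obtain r where r: "r : Arr K (I X) Y" "cp (I X) Y (I Y) (i Y) r = sub (I X) (I Y) m ?e"
     by (rule kernelE[OF Y(1) X(3), rotated]) (use X Y W b' m(2) WO in \<open>simp_all add: cat\<close>)
    interpret G': group "Mor K X (I Y)" by (rule Mor_is_group[OF O(1) Y(3)])
    have "cp X (I X) (I Y) (sub (I X) (I Y) m ?e) (i X) = cp X (I X) (I Y) m (i X)"
     using O X Y W(2) b' WO m(2) by (simp add: Cmp_add_left Cmp_neg cat assoc Cmp_zero)
    then have "cp X Y (I Y) (i Y) (cp X (I X) Y r (i X)) = cp X Y (I Y) (i Y) ?c"
     unfolding m(3)[symmetric] r(2)[symmetric] using O X Y r(1) by (simp add: assoc)
    then have "cp X (I X) Y r (i X) = ?c" by (rule inflation_mono[OF Y(1) O(1) _ m(1), rotated]) (use O X Y r(1) in \<open>simp add: cat\<close>)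
    then have "?c : N X Y" using NI[OF X(2,5) r(1)] by simp
    then show "f = g" unfolding f g using q_eq_iff[OF O(1,2) f(1) g(1)] by blast
   qed
   have "h : s X Y ` carrier (Mor K X Y Mod N X Y)" if hU: "h : carrier (Mor K (S X) (S Y) Mod N (S X) (S Y))" for h
   proof -
    obtain h' where h: "h' : Arr K (S X) (S Y)" "h = q (S X) (S Y) h'" using hU by (rule U_ArrE)
    \<comment> \<open>Fullness: projectivity of \<open>I X\<close> lifts \<open>h'\<close> to the
      middle terms, and the lift restricts to the kernels.\<close>
    have "cp (I X) (S X) (S Y) h' (p X) : Arr K (I X) (S Y)" using X Y h(1) by (simp add: cat)
    then obtain b where b: "b : Arr K (I X) (I Y)" "cp (I X) (I Y) (S Y) (p Y) b = cp (I X) (S X) (S Y) h' (p X)"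
     using projective[OF X(2) Y(1)] by blast
    have "cp X (I Y) (S Y) (p Y) (cp X (I X) (I Y) b (i X)) = zero_arr K X (S Y)"
     using O X Y b(1) h(1) by (simp add: reassoc[OF b(2)] assoc Cmp_zero)
    then obtain c where c: "c : Arr K X Y" "cp X Y (I Y) (i Y) c = cp X (I X) (I Y) b (i X)"
     by (rule kernelE[OF Y(1) O(1), rotated]) (use O X Y b(1) in \<open>simp_all add: cat\<close>)
    have "s X Y (q X Y c) = h" unfolding h(2) by (rule s[OF cmorI[OF X(1) Y(1) c(1) h(1) b(1)]]) (simp_all add: b c)
    then show ?thesis using q_Arr[OF c(1)] by blast
   qed
   moreover have "s X Y ` carrier (Mor K X Y Mod N X Y) <= carrier (Mor K (S X) (S Y) Mod N (S X) (S Y))"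
   proof (rule image_subsetI)
    fix f assume "f : carrier (Mor K X Y Mod N X Y)"
    then obtain f' where f: "f' : Arr K X Y" "f = q X Y f'" by (rule U_ArrE)
    obtain h where h: "cmor (susp X) (susp Y) f' h" "h : Arr K (S X) (S Y)" by (rule susp_cmor_ex[OF O(1,2) f(1)])
    then show "s X Y f : carrier (Mor K (S X) (S Y) Mod N (S X) (S Y))" by (simp add: f s q_Arr)
   qed
   ultimately show "s X Y ` carrier (Mor K X Y Mod N X Y) = carrier (Mor K (S X) (S Y) Mod N (S X) (S Y))" by blast
  qed
  \<comment> \<open>Density: \<open>Y\<close> ends a conflation with middle term in
    \<open>Pr\<close>; comparing it with the chosen conflation of its kernel \<open>A\<close>
    identifies \<open>Y\<close> stably with \<open>S A\<close>.\<close>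
  obtain A f P g where D: "P : Pr" "(A, f, P, g, Y) : E" using ex_deflation[OF O(2)] ex_kernel by blast
  have A: "A : Ob K" using conflD[OF D(2)] by blast
  note sA = suspD[OF A]
  obtain a where a: "cmor (susp A) (A, f, P, g, Y) (Idn K A) a" by (rule cmor_ex[OF sA(1) D(2,1) Idn_Arr[OF A]])
  obtain b where b: "cmor (A, f, P, g, Y) (susp A) (Idn K A) b" by (rule cmor_ex[OF D(2) sA(1,2) Idn_Arr[OF A]])
  have ab: "a : Arr K (S A) Y" "b : Arr K Y (S A)" using a b by (auto simp: cmor_def)
  have "q (S A) (S A) (cp (S A) Y (S A) b a) = q (S A) (S A) (Idn K (S A))"
   by (rule cmor_unique[OF cmor_Cmp[OF a b] cmor_Idn[OF sA(1)] sA(2)]) (use A in \<open>simp add: cat\<close>)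
  moreover have "q Y Y (cp Y (S A) Y a b) = q Y Y (Idn K Y)"
   by (rule cmor_unique[OF cmor_Cmp[OF b a] cmor_Idn[OF D(2)] D(1)]) (use A in \<open>simp add: cat\<close>)
  ultimately have "iso_arr U (S A) Y (q (S A) Y a)"
   using ab sA O by (intro U.iso_arrI[of _ _ _ "q Y (S A) b"]) (simp_all add: q_Arr q_Cmp)
  then show "EX X:Ob K. EX f. iso_arr U (S X) Y f" using A by blast
 qed
qed

text \<open>The map \<open>w\<close> of a standard triangle comes from a morphism of conflations over the identity of \<open>X\<close>.\<close>

definition standard :: "('a, 'b set) triangles" where
 "standard = {(X, Y, Z, q X Y u, q Y Z v, q Z (S X) w) | X Y Z u v w. cmor (X, u, Y, v, Z) (susp X) (Idn K X) w}"

lemma standardI: "cmor (X, u, Y, v, Z) (susp X) (Idn K X) w ==> (X, Y, Z, q X Y u, q Y Z v, q Z (S X) w) : standard"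
 unfolding standard_def by blast

lemma standardE: assumes "(X, Y, Z, u, v, w) : standard"
 obtains u' v' w' where "u = q X Y u'" "v = q Y Z v'" "w = q Z (S X) w'" "cmor (X, u', Y, v', Z) (susp X) (Idn K X) w'"
  "(X, u', Y, v', Z) : E" "w' : Arr K Z (S X)"
 using assms unfolding standard_def by (auto simp: cmor_def)

text \<open>\<open>u\<close> is replaced by the inflation with components \<open>i X\<close> and
  \<open>u\<close> into the sum of \<open>I X\<close> and \<open>Y\<close>. Since \<open>I X\<close>
  is stably zero, the inclusion of \<open>Y\<close> is a stable isomorphism that carries
  \<open>u\<close> to it.\<close>

lemma cone_ex: assumes O: "X : Ob K" "Y : Ob K" and u: "u : Arr K X Y"
 obtains P j r u' v Z where "P : Ob K" "j : Arr K Y P" "r : Arr K P Y" "q P P (cp P Y P j r) = q P P (Idn K P)" "cp Y P Y r j = Idn K Y"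
  "(X, u', P, v, Z) : E" "q X P u' = q X P (cp X Y P j u)"
proof -
 note X = suspD[OF O(1)]
 obtain P j1 j2 q1 q2 k Q where B: "biproduct K (I X) Y P j1 j2 q1 q2"
  and E: "(X, cp X (I X) P j1 (i X) \<otimes>\<^bsub>Mor K X P\<^esub> cp X Y P j2 u, P, k, Q) : E" using cone[OF confl_infl[OF X(1)] O(2) u] by blast
 note B = B[unfolded biproduct_def]
 have P: "P : Ob K" using B by blast
 note F = group_hom.hom_mult[OF q_hom]
 interpret Gu: comm_group "Mor U X P" using additive_category.axioms(1)[OF additive_U] preadditive_category.Mor_group[of U X P] O P by simp
 interpret GP: comm_group "Mor U P P" using additive_category.axioms(1)[OF additive_U] preadditive_category.Mor_group[of U P P] P by simp
 have n1: "q X P (cp X (I X) P j1 (i X)) = N X P" using B O X P by (intro q_null NI[OF X(2)]) auto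
 have n2: "q P P (cp P (I X) P j1 q1) = N P P" using B P by (intro q_null NI[OF X(2)]) auto
 show ?thesis
 proof (rule that[OF P _ _ _ _ E])
  have "q P P (Idn K P) = q P P (cp P (I X) P j1 q1) \<otimes>\<^bsub>Mor U P P\<^esub> q P P (cp P Y P j2 q2)"
   using B O P X F[of P P "cp P (I X) P j1 q1" "cp P Y P j2 q2"] by (simp add: cat)
  then show "q P P (cp P Y P j2 q2) = q P P (Idn K P)" using B O P X GP.l_one q_Arr[of "cp P Y P j2 q2" P P] unfolding n2 by (simp add: cat)
  show "q X P (cp X (I X) P j1 (i X) \<otimes>\<^bsub>Mor K X P\<^esub> cp X Y P j2 u) = q X P (cp X Y P j2 u)"
   using B O P X u F[of X P "cp X (I X) P j1 (i X)" "cp X Y P j2 u"] Gu.l_one q_Arr[of "cp X Y P j2 u" X P] unfolding n1 by (simp add: cat)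
 qed (use B in blast)+
qed

end

lemma (in preadditive_category) Mor_cancel:
 assumes "X : Ob K" "Y : Ob K" "f : Arr K X Y" "g : Arr K X Y"
 shows "f \<otimes>\<^bsub>Mor K X Y\<^esub> (neg X Y f \<otimes>\<^bsub>Mor K X Y\<^esub> g) = g" "f \<otimes>\<^bsub>Mor K X Y\<^esub> (g \<otimes>\<^bsub>Mor K X Y\<^esub> neg X Y f) = g"
proof -
 interpret comm_group "Mor K X Y" by (rule Mor_group[OF assms(1,2)])
 show "f \<otimes>\<^bsub>Mor K X Y\<^esub> (neg X Y f \<otimes>\<^bsub>Mor K X Y\<^esub> g) = g" using assms by (simp flip: m_assoc)
 then show "f \<otimes>\<^bsub>Mor K X Y\<^esub> (g \<otimes>\<^bsub>Mor K X Y\<^esub> neg X Y f) = g" using assms by (simp add: m_comm[of g])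
qed

section \<open>Verdier's axioms for the standard triangles\<close>

context stable_suspension
begin

text \<open>The square commutes only up to a null map, which extends along the inflation
  \<open>u0\<close> to a null \<open>k\<close>. Replacing \<open>b0\<close> by \<open>b0 - k\<close>
  makes it commute strictly and keeps the class. The square with the suspension is then uniqueness
  of induced maps.\<close>

lemma standard_mor:
 assumes t: "(X, Y, Z, u, v, w) : standard" and t': "(X', Y', Z', u', v', w') : standard"
  and a: "a : Arr U X X'" and b: "b : Arr U Y Y'" and e: "Cmp U X Y Y' b u = Cmp U X X' Y' u' a"
 shows "EX c:Arr U Z Z'. Cmp U Y Z Z' c v = Cmp U Y Y' Z' v' b & Cmp U Z (S X) (S X') (s X X' a) w = Cmp U Z Z' (S X') w' c"
proof -
 obtain u0 v0 w0 where 0: "u = q X Y u0" "v = q Y Z v0" "w = q Z (S X) w0" "cmor (X, u0, Y, v0, Z) (susp X) (Idn K X) w0"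
  "(X, u0, Y, v0, Z) : E" "w0 : Arr K Z (S X)" by (rule standardE[OF t])
 obtain u1 v1 w1 where 1: "u' = q X' Y' u1" "v' = q Y' Z' v1" "w' = q Z' (S X') w1" "cmor (X', u1, Y', v1, Z') (susp X') (Idn K X') w1"
  "(X', u1, Y', v1, Z') : E" "w1 : Arr K Z' (S X')" by (rule standardE[OF t'])
 note c0 = conflD[OF 0(5)] and c1 = conflD[OF 1(5)]
 note X = suspD[OF c0(1)] and X' = suspD[OF c1(1)]
 obtain a0 where a0: "a0 : Arr K X X'" "a = q X X' a0" using a by (auto simp: Arr_U)
 obtain b0 where b0: "b0 : Arr K Y Y'" "b = q Y Y' b0" using b by (auto simp: Arr_U)
 have "q X Y' (cp X Y Y' b0 u0) = q X Y' (cp X X' Y' u1 a0)" using e c0 c1 a0 b0 by (simp add: 0 1 q_Cmp)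
 then have "sub X Y' (cp X Y Y' b0 u0) (cp X X' Y' u1 a0) : N X Y'" using c0 c1 a0 b0 by (subst (asm) q_eq_iff) (simp_all add: cat)
 then obtain k where k: "k : N Y Y'" "k : Arr K Y Y'" "sub X Y' (cp X Y Y' b0 u0) (cp X X' Y' u1 a0) = cp X Y Y' k u0"
  by (rule N_factor[OF c0(1) c1(2) 0(5)])
 let ?b = "sub Y Y' b0 k"
 interpret G: comm_group "Mor K X Y'" by (rule Mor_group[OF c0(1) c1(2)])
 interpret GY: comm_group "Mor K Y Y'" by (rule Mor_group[OF c0(2) c1(2)])
 have bA: "?b : Arr K Y Y'" using c0 c1 b0 k by (simp add: cat)
 have in2: "cp X Y Y' b0 u0 : Arr K X Y'" "cp X X' Y' u1 a0 : Arr K X Y'" using c0 c1 b0 a0 by (simp_all add: cat)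
 have bu: "cp X Y Y' ?b u0 = cp X X' Y' u1 a0"
  using c0 c1 b0 k(2) in2 by (simp add: Cmp_add_left Cmp_neg cat G.inv_mult Mor_cancel flip: k(3))
 have "sub Y Y' b0 ?b = k" using c0 c1 b0 k(2) by (simp add: GY.inv_mult Mor_cancel)
 then have qb: "q Y Y' ?b = b" unfolding b0 using q_eq_iff[OF c0(2) c1(2) b0(1) bA] k(1) by simp
 have "cp X Y Z' (cp Y Y' Z' v1 ?b) u0 = zero_arr K X Z'"
  using c0 c1 a0 bA by (simp add: assoc bu reassoc[OF c1(6)] Cmp_zero del: G.inv_mult)
 then obtain c where c: "c : Arr K Z Z'" "cp Y Z Z' c v0 = cp Y Y' Z' v1 ?b"
  by (rule cokernelE[OF 0(5) c1(3), rotated]) (use c0 c1 bA in \<open>simp_all add: cat\<close>)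
 have m: "cmor (X, u0, Y, v0, Z) (X', u1, Y', v1, Z') a0 c" by (rule cmorI[OF 0(5) 1(5) a0(1) c(1) bA bu c(2)])
 obtain h where h: "cmor (susp X) (susp X') a0 h" "h : Arr K (S X) (S X')" by (rule susp_cmor_ex[OF c0(1) c1(1) a0(1)])
 have "q Z (S X') (cp Z (S X) (S X') h w0) = q Z (S X') (cp Z Z' (S X') w1 c)"
  by (rule cmor_unique[OF cmor_Cmp[OF 0(4) h(1)] cmor_Cmp[OF m 1(4)] X'(2)]) (use c0 c1 a0 in \<open>simp add: cat\<close>)
 moreover have "Cmp U Y Z Z' (q Z Z' c) v = Cmp U Y Y' Z' v' b"
  unfolding qb[symmetric] using c0 c1 c bA by (simp add: 0 1 q_Cmp)
 ultimately show ?thesis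
  using c0 c1 c X X' h 0(6) 1(6) by (intro bexI[of _ "q Z Z' c"]) (simp_all add: 0 1 a0 q_Cmp q_Arr s[OF h(1)])
qed

text \<open>The null map \<open>f0 v0\<close> factors as \<open>h\<close> after \<open>i Y\<close>.
  Extending \<open>i Y u0\<close> to \<open>d\<close> on \<open>I X\<close> gives
  \<open>i Y = d g + r v0\<close>, and then \<open>f0 - h r\<close> equals \<open>k w0\<close>,
  where \<open>k\<close> is induced by \<open>h d\<close>. The correction \<open>h r\<close> is
  null.\<close>

lemma standard_weak_cokernel:
 assumes t: "(X, Y, Z, u, v, w) : standard" and F: "F : Ob K" "f : Arr U Z F" and e: "Cmp U Y Z F f v = N Y F"
 shows "EX k:Arr U (S X) F. f = Cmp U Z (S X) F k w"
proof -
 obtain u0 v0 w0 where 0: "u = q X Y u0" "v = q Y Z v0" "w = q Z (S X) w0" "cmor (X, u0, Y, v0, Z) (susp X) (Idn K X) w0"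
  "(X, u0, Y, v0, Z) : E" "w0 : Arr K Z (S X)" by (rule standardE[OF t])
 obtain g where g: "g : Arr K Y (I X)" "cp X Y (I X) g u0 = cp X X (I X) (i X) (Idn K X)" "cp Y Z (S X) w0 v0 = cp Y (I X) (S X) (p X) g"
  by (rule cmorE[OF 0(4)])
 note c = conflD[OF 0(5)]
 note X = suspD[OF c(1)] and Y = suspD[OF c(2)]
 obtain f0 where f0: "f0 : Arr K Z F" "f = q Z F f0" using F by (auto simp: Arr_U)
 have "cp Y Z F f0 v0 : N Y F" using e c F f0 q_null_iff[of Y F "cp Y Z F f0 v0"] by (simp add: 0 q_Cmp cat)
 then obtain h where h: "h : Arr K (I Y) F" "cp Y Z F f0 v0 = cp Y (I Y) F h (i Y)" by (rule N_factor[OF c(2) F(1) Y(1)])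
 have "cp X Y (I Y) (i Y) u0 : Arr K X (I Y)" using c Y by (simp add: cat)
 then obtain d where d: "d : Arr K (I X) (I Y)" "cp X (I X) (I Y) d (i X) = cp X Y (I Y) (i Y) u0" using injective[OF Y(2) X(1)] by blast
 interpret G: group "Mor K X (I Y)" by (rule Mor_is_group[OF c(1) Y(3)])
 interpret GY: comm_group "Mor K Y (I Y)" by (rule Mor_group[OF c(2) Y(3)])
 interpret GF: comm_group "Mor K Y F" by (rule Mor_group[OF c(2) F(1)])
 have "cp X Y (I Y) (sub Y (I Y) (i Y) (cp Y (I X) (I Y) d g)) u0 = zero_arr K X (I Y)"
  using c X Y d g by (simp add: Cmp_add_left Cmp_neg cat assoc)
 then obtain r where r: "r : Arr K Z (I Y)" "cp Y Z (I Y) r v0 = sub Y (I Y) (i Y) (cp Y (I X) (I Y) d g)"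
  by (rule cokernelE[OF 0(5) Y(3), rotated]) (use c X Y d g in \<open>simp_all add: cat\<close>)
 have "cp X (I X) F (cp (I X) (I Y) F h d) (i X) = cp X Y F (cp Y (I Y) F h (i Y)) u0" using c X Y d h(1) F by (simp add: assoc)
 also have "... = zero_arr K X F" using c f0 F by (simp add: assoc Cmp_zero flip: h(2))
 finally obtain k where k: "k : Arr K (S X) F" "cp (I X) (S X) F k (p X) = cp (I X) (I Y) F h d"
  by (rule cokernelE[OF X(1) F(1), rotated]) (use c X Y d h(1) F in \<open>simp_all add: cat\<close>)
 have hr: "cp Z (I Y) F h r : Arr K Z F" "cp Z (S X) F k w0 : Arr K Z F" using c X Y h r k F 0(6) by (simp_all add: cat)
 have 1: "cp Y Z F (cp Z (I Y) F h r) v0 = sub Y F (cp Y Z F f0 v0) (cp Y (I Y) F h (cp Y (I X) (I Y) d g))"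
  using c X Y h r d g F by (simp add: assoc Cmp_add_right Cmp_neg cat)
 have 2: "cp Y (I Y) F h (cp Y (I X) (I Y) d g) = cp Y Z F (cp Z (S X) F k w0) v0"
  using c X Y h(1) d(1) g(1,3) k F 0(6) reassoc[OF k(2) c(2) X(3,4) F(1) g(1) X(6) k(1)] by (simp add: assoc)
 have "sub Z F f0 (cp Z (I Y) F h r) = cp Z (S X) F k w0"
 proof (rule deflation_epi[OF 0(5) F(1) _ hr(2)])
  show "cp Y Z F (sub Z F f0 (cp Z (I Y) F h r)) v0 = cp Y Z F (cp Z (S X) F k w0) v0"
   using c F f0 hr by (simp add: Cmp_add_left Cmp_neg cat 1 2 GF.inv_mult Mor_cancel)
 qed (use c F f0 hr in \<open>simp add: cat\<close>)
 moreover interpret GZ: comm_group "Mor K Z F" by (rule Mor_group[OF c(3) F(1)])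
 have "sub Z F f0 (sub Z F f0 (cp Z (I Y) F h r)) = cp Z (I Y) F h r" using c F f0(1) hr(1) by (simp add: GZ.inv_mult Mor_cancel)
 ultimately have "q Z F f0 = q Z F (cp Z (S X) F k w0)"
  using q_eq_iff[OF c(3) F(1) f0(1) hr(2)] NI[OF Y(2) r(1) h(1)] by metis
 then show ?thesis using c X F k 0(6) by (intro bexI[of _ "q (S X) F k"]) (simp_all add: 0 f0 q_Cmp q_Arr)
qed

text \<open>The \<open>rotation\<close> conflation with \<open>A = I X\<close> leads from
  \<open>Y\<close> to \<open>S X\<close>, and its middle term is stably \<open>Z\<close>. The sign
  in it produces the sign in front of the suspension of \<open>u\<close>.\<close>

lemma standard_rotate: assumes t: "(X, Y, Z, u, v, w) : standard"
 shows "EX Z' c w'. iso_arr U Z Z' c & (Y, Z', S X, Cmp U Y Z Z' c v, w', inv\<^bsub>Mor U (S X) (S Y)\<^esub> (s X Y u)) : standard & Cmp U Z Z' (S X) w' c = w"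
proof -
 obtain u0 v0 w0 where 0: "u = q X Y u0" "v = q Y Z v0" "w = q Z (S X) w0" "cmor (X, u0, Y, v0, Z) (susp X) (Idn K X) w0"
  "(X, u0, Y, v0, Z) : E" "w0 : Arr K Z (S X)" by (rule standardE[OF t])
 obtain g where g: "g : Arr K Y (I X)" "cp X Y (I X) g u0 = cp X X (I X) (i X) (Idn K X)" "cp Y Z (S X) w0 v0 = cp Y (I X) (S X) (p X) g"
  by (rule cmorE[OF 0(4)])
 note c = conflD[OF 0(5)]
 note X = suspD[OF c(1)] and Y = suspD[OF c(2)]
 interpret U: additive_category U by (rule additive_U)
 obtain P j1 j2 r1 r2 where B: "biproduct K Z (I X) P j1 j2 r1 r2"
  and R: "(Y, cp Y Z P j1 v0 \<otimes>\<^bsub>Mor K Y P\<^esub> cp Y (I X) P j2 g, P,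
   cp P Z (S X) w0 r1 \<otimes>\<^bsub>Mor K P (S X)\<^esub> neg P (S X) (cp P (I X) (S X) (p X) r2), S X) : E"
  using rotation[OF 0(5) X(1) g(1) _ 0(6) g(3)] g(2) c(1) X(3,5) by (auto simp: cat)
 note B = B[unfolded biproduct_def]
 have B1: "cp (I X) P Z r1 j2 = zero_arr K (I X) Z" "cp (I X) P (I X) r2 j2 = Idn K (I X)" "cp Z P Z r1 j1 = Idn K Z" "cp Z P (I X) r2 j1 = zero_arr K Z (I X)"
  using B by blast+
 have A: "P : Ob K" "j1 : Arr K Z P" "j2 : Arr K (I X) P" "r1 : Arr K P Z" "r2 : Arr K P (I X)" using B by blast+
 let ?a = "cp Y Z P j1 v0 \<otimes>\<^bsub>Mor K Y P\<^esub> cp Y (I X) P j2 g"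
 let ?b = "cp P Z (S X) w0 r1 \<otimes>\<^bsub>Mor K P (S X)\<^esub> neg P (S X) (cp P (I X) (S X) (p X) r2)"
 interpret GX: comm_group "Mor K X P" by (rule Mor_group[OF c(1) A(1)])
 interpret GI: comm_group "Mor K (I X) (S X)" by (rule Mor_group[OF X(3,4)])
 interpret GZ: comm_group "Mor K Z (S X)" by (rule Mor_group[OF c(3) X(4)])
 interpret GY: comm_group "Mor K Y P" by (rule Mor_group[OF c(2) A(1)])
 interpret GS: comm_group "Mor K (S X) (S Y)" by (rule Mor_group[OF X(4) Y(4)])
 interpret GP: comm_group "Mor U P P" using U.Mor_group[of P P] A(1) by simp
 note cs = cat assoc Cmp_add_left Cmp_add_right Cmp_neg Cmp_zero reassoc[OF B1(1)] reassoc[OF B1(2)] reassoc[OF c(6)] B1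
 \<comment> \<open>The inclusion of \<open>I X\<close> compares the suspension of \<open>X\<close>
   with this conflation, over \<open>u0\<close> on the left and minus the identity on the right;
   followed by \<open>w1\<close> it exhibits \<open>- w1\<close> as the suspension of
   \<open>u0\<close>.\<close>
 have "cmor (susp X) (Y, ?a, P, ?b, S X) u0 (neg (S X) (S X) (Idn K (S X)))"
 proof (rule cmorI[OF X(1) R c(4) _ A(3)])
  show "cp X (I X) P j2 (i X) = cp X Y P ?a u0" using c X g A by (simp add: cs)
  show "cp (I X) (S X) (S X) (neg (S X) (S X) (Idn K (S X))) (p X) = cp (I X) P (S X) ?b j2" using c X g A 0(6) by (simp add: cs)
 qed (use X in \<open>simp add: cat\<close>)
 moreover obtain w1 where w1: "cmor (Y, ?a, P, ?b, S X) (susp Y) (Idn K Y) w1" by (rule cmor_ex[OF R Y(1,2) Idn_Arr[OF c(2)]])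
 ultimately have "cmor (susp X) (susp Y) (cp X Y Y (Idn K Y) u0) (cp (S X) (S X) (S Y) w1 (neg (S X) (S X) (Idn K (S X))))" by (rule cmor_Cmp)
 moreover have w1A: "w1 : Arr K (S X) (S Y)" using w1 by (auto simp: cmor_def)
 ultimately have "s X Y u = q (S X) (S Y) (neg (S X) (S Y) w1)" using s c X Y by (simp add: 0 cs)
 then have su: "inv\<^bsub>Mor U (S X) (S Y)\<^esub> (s X Y u) = q (S X) (S Y) w1" using w1A X Y by (simp add: q_neg cat)
 have n: "cp P (I X) P j2 r2 : N P P" "cp Y (I X) P j2 g : N Y P" using NI[OF X(2)] A g(1) by blast+
 have "q P P (Idn K P) = q P P (cp P Z P j1 r1 \<otimes>\<^bsub>Mor K P P\<^esub> cp P (I X) P j2 r2)" using B by simp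
 also have "... = q P P (cp P Z P j1 r1) \<otimes>\<^bsub>Mor U P P\<^esub> N P P"
  using A c X q_null[OF A(1,1) n(1)] by (simp add: cat flip: q_add del: mult_FactGroup)
 finally have "q P P (cp P Z P j1 r1) = q P P (Idn K P)" using GP.r_one q_Arr A c by (simp add: cat del: mult_FactGroup)
 then have "iso_arr U Z P (q Z P j1)"
  using A c B1(3) by (intro U.iso_arrI[of _ _ _ "q P Z r1"]) (simp_all add: q_Arr q_Cmp)
 moreover have "q Y P ?a = Cmp U Y Z P (q Z P j1) v"
 proof -
  have "sub Y P ?a (cp Y Z P j1 v0) = cp Y (I X) P j2 g" using A c X g(1) by (simp add: cat GY.m_assoc Mor_cancel)
  then show ?thesis using A c X g(1) n(2) by (simp add: 0 q_Cmp q_eq_iff cat)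
 qed
 moreover have "Cmp U Z P (S X) (q P (S X) ?b) (q Z P j1) = w" using A c X 0(6) by (simp add: 0(3) q_Cmp cs)
 moreover note standardI[OF w1]
 ultimately show ?thesis unfolding su by metis
qed

text \<open>First \<open>u\<close> and then \<open>v\<close>, transported to the new source, are
  turned into inflations. Their cokernels and that of the composite form a conflation by
  \<open>noether\<close>, and the identities involving the suspension are uniqueness of induced
  maps.\<close>

lemma standard_octahedron:
 assumes O: "X : Ob K" "Y : Ob K" "Z : Ob K" and uv: "u : Arr U X Y" "v : Arr U Y Z"
 shows "EX Y1 Z1 b d v1 A B C a a' j j' k k' f g. iso_arr U Y Y1 b & iso_arr U Z Z1 d & v1 : Arr U Y1 Z1 & Cmp U Y Y1 Z1 v1 b = Cmp U Y Z Z1 d v &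
    (X, Y1, A, Cmp U X Y Y1 b u, a, a') : standard & (Y1, Z1, B, v1, j, j') : standard & (X, Z1, C, Cmp U X Y1 Z1 v1 (Cmp U X Y Y1 b u), k, k') : standard &
    (A, C, B, f, g, Cmp U B (S Y1) (S A) (s Y1 A a) j') : standard &
    Cmp U Y1 A C f a = Cmp U Y1 Z1 C k v1 & Cmp U A C (S X) k' f = a' & Cmp U Z1 C B g k = j &
    Cmp U C B (S Y1) j' g = Cmp U C (S X) (S Y1) (s X Y1 (Cmp U X Y Y1 b u)) k'"
proof -
 interpret U: additive_category U by (rule additive_U)
 obtain u0 where u0: "u0 : Arr K X Y" "u = q X Y u0" using uv by (auto simp: Arr_U)
 obtain v0 where v0: "v0 : Arr K Y Z" "v = q Y Z v0" using uv by (auto simp: Arr_U)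
 obtain Y1 b r u1 \<alpha> A where Y1: "Y1 : Ob K" "b : Arr K Y Y1" "r : Arr K Y1 Y" "q Y1 Y1 (cp Y1 Y Y1 b r) = q Y1 Y1 (Idn K Y1)" "cp Y Y1 Y r b = Idn K Y"
  "(X, u1, Y1, \<alpha>, A) : E" "q X Y1 u1 = q X Y1 (cp X Y Y1 b u0)" by (rule cone_ex[OF O(1,2) u0(1)])
 have v': "cp Y1 Y Z v0 r : Arr K Y1 Z" using Y1 O v0 by (simp add: cat)
 obtain Z1 d r' v1 \<beta> B where Z1: "Z1 : Ob K" "d : Arr K Z Z1" "r' : Arr K Z1 Z" "q Z1 Z1 (cp Z1 Z Z1 d r') = q Z1 Z1 (Idn K Z1)" "cp Z Z1 Z r' d = Idn K Z"
  "(Y1, v1, Z1, \<beta>, B) : E" "q Y1 Z1 v1 = q Y1 Z1 (cp Y1 Z Z1 d (cp Y1 Y Z v0 r))" by (rule cone_ex[OF Y1(1) O(3) v'])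
 obtain \<kappa> D where W: "(X, cp X Y1 Z1 v1 u1, Z1, \<kappa>, D) : E" using ex_cokernel[OF infl_Cmp[OF confl_infl[OF Y1(6)] confl_infl[OF Z1(6)]]] by blast
 note cY = conflD[OF Y1(6)] and cZ = conflD[OF Z1(6)] and cW = conflD[OF W]
 note X = suspD[OF O(1)] and sY = suspD[OF Y1(1)] and sA = suspD[OF cY(3)]
 have "cp X Y1 D (cp Y1 Z1 D \<kappa> v1) u1 = zero_arr K X D" using cY cZ cW by (simp add: assoc)
 then obtain f where f: "f : Arr K A D" "cp Y1 A D f \<alpha> = cp Y1 Z1 D \<kappa> v1"
  by (rule cokernelE[OF Y1(6) cW(3), rotated]) (use cY cZ cW in \<open>simp_all add: cat\<close>)
 have "cp X Z1 B \<beta> (cp X Y1 Z1 v1 u1) = zero_arr K X B" using cY cZ cW by (simp add: reassoc[OF cZ(6)] Cmp_zero)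
 then obtain g where g: "g : Arr K D B" "cp Z1 D B g \<kappa> = \<beta>" by (rule cokernelE[OF W cZ(3,5)])
 have F: "(A, f, D, g, B) : E" by (rule noether[OF Y1(6) Z1(6) W f g])
 obtain a' where a': "cmor (X, u1, Y1, \<alpha>, A) (susp X) (Idn K X) a'" by (rule cmor_ex[OF Y1(6) X(1,2) Idn_Arr[OF O(1)]])
 obtain j' where j': "cmor (Y1, v1, Z1, \<beta>, B) (susp Y1) (Idn K Y1) j'" by (rule cmor_ex[OF Z1(6) sY(1,2) Idn_Arr[OF Y1(1)]])
 obtain k' where k': "cmor (X, cp X Y1 Z1 v1 u1, Z1, \<kappa>, D) (susp X) (Idn K X) k'" by (rule cmor_ex[OF W X(1,2) Idn_Arr[OF O(1)]])
 obtain w where w: "cmor (A, f, D, g, B) (susp A) (Idn K A) w" by (rule cmor_ex[OF F sA(1,2) Idn_Arr[OF cY(3)]])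
 obtain h where h: "cmor (susp Y1) (susp A) \<alpha> h" "h : Arr K (S Y1) (S A)" by (rule susp_cmor_ex[OF Y1(1) cY(3,5)])
 obtain l where l: "cmor (susp X) (susp Y1) u1 l" "l : Arr K (S X) (S Y1)" by (rule susp_cmor_ex[OF O(1) Y1(1) cY(4)])
 have Ar: "a' : Arr K A (S X)" "j' : Arr K B (S Y1)" "k' : Arr K D (S X)" "w : Arr K B (S A)" using a' j' k' w by (auto simp: cmor_def)
 have 1: "cmor (X, u1, Y1, \<alpha>, A) (X, cp X Y1 Z1 v1 u1, Z1, \<kappa>, D) (Idn K X) f"
  by (rule cmorI[OF Y1(6) W _ f(1) cZ(4) _ f(2)]) (use cY cW in \<open>simp_all add: cat\<close>)
 have 2: "cmor (X, cp X Y1 Z1 v1 u1, Z1, \<kappa>, D) (Y1, v1, Z1, \<beta>, B) u1 g"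
  by (rule cmorI[OF W Z1(6) cY(4) g(1), of "Idn K Z1"]) (use cY cZ cW g in \<open>simp_all add: cat\<close>)
 have 3: "cmor (Y1, v1, Z1, \<beta>, B) (A, f, D, g, B) \<alpha> (Idn K B)"
  by (rule cmorI[OF Z1(6) F cY(5) _ cW(5)]) (use cZ f g in \<open>simp_all add: cat\<close>)
 have e1: "q A (S X) (cp A D (S X) k' f) = q A (S X) a'" by (rule cmor_unique[OF cmor_Cmp[OF 1 k'] a' X(2)]) (use O in \<open>simp add: cat\<close>)
 have e2: "q D (S Y1) (cp D B (S Y1) j' g) = q D (S Y1) (cp D (S X) (S Y1) l k')"
  by (rule cmor_unique[OF cmor_Cmp[OF 2 j'] cmor_Cmp[OF k' l(1)] sY(2)]) (use cY in \<open>simp add: cat\<close>)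
 have e3: "q B (S A) (cp B (S Y1) (S A) h j') = q B (S A) (cp B B (S A) w (Idn K B))"
  by (rule cmor_unique[OF cmor_Cmp[OF j' h(1)] cmor_Cmp[OF 3 w] sA(2)]) (use cY in \<open>simp add: cat\<close>)
 have bu: "Cmp U X Y Y1 (q Y Y1 b) u = q X Y1 u1" using Y1 O u0 by (simp add: q_Cmp)
 have vu: "Cmp U X Y1 Z1 (q Y1 Z1 v1) (q X Y1 u1) = q X Z1 (cp X Y1 Z1 v1 u1)" using cY cZ by (simp add: q_Cmp)
 have "iso_arr U Y Y1 (q Y Y1 b)" using Y1 O by (intro U.iso_arrI[of _ _ _ "q Y1 Y r"]) (simp_all add: q_Arr q_Cmp)
 moreover have "iso_arr U Z Z1 (q Z Z1 d)" using Z1 O by (intro U.iso_arrI[of _ _ _ "q Z1 Z r'"]) (simp_all add: q_Arr q_Cmp)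
 moreover have "q Y1 Z1 v1 : Arr U Y1 Z1" using cZ by (simp add: q_Arr)
 moreover have "Cmp U Y Y1 Z1 (q Y1 Z1 v1) (q Y Y1 b) = Cmp U Y Z Z1 (q Z Z1 d) v"
  unfolding Z1(7) v0(2) using Y1 Z1(1,2) O v0(1) by (simp add: q_Cmp cat assoc)
 moreover have "(X, Y1, A, Cmp U X Y Y1 (q Y Y1 b) u, q Y1 A \<alpha>, q A (S X) a') : standard" unfolding bu by (rule standardI[OF a'])
 moreover have "(Y1, Z1, B, q Y1 Z1 v1, q Z1 B \<beta>, q B (S Y1) j') : standard" by (rule standardI[OF j'])
 moreover have "(X, Z1, D, Cmp U X Y1 Z1 (q Y1 Z1 v1) (Cmp U X Y Y1 (q Y Y1 b) u), q Z1 D \<kappa>, q D (S X) k') : standard"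
  unfolding bu vu by (rule standardI[OF k'])
 moreover have "(A, D, B, q A D f, q D B g, Cmp U B (S Y1) (S A) (s Y1 A (q Y1 A \<alpha>)) (q B (S Y1) j')) : standard"
  using standardI[OF w] cZ cY sY sA Ar h by (simp add: s[OF h(1)] q_Cmp e3 cat)
 moreover have "Cmp U Y1 A D (q A D f) (q Y1 A \<alpha>) = Cmp U Y1 Z1 D (q Z1 D \<kappa>) (q Y1 Z1 v1)" using cY cZ cW f by (simp add: q_Cmp)
 moreover have "Cmp U A D (S X) (q D (S X) k') (q A D f) = q A (S X) a'" using cY cW X Ar f by (simp add: q_Cmp e1)
 moreover have "Cmp U Z1 D B (q D B g) (q Z1 D \<kappa>) = q Z1 B \<beta>" using cZ cW g by (simp add: q_Cmp)
 moreover have "Cmp U D B (S Y1) (q B (S Y1) j') (q D B g) = Cmp U D (S X) (S Y1) (s X Y1 (Cmp U X Y Y1 (q Y Y1 b) u)) (q D (S X) k')"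
  unfolding bu s[OF l(1)] using cZ cW X sY Ar g l by (simp add: q_Cmp e2)
 ultimately show ?thesis by blast
qed

theorem stable_triangulated: "EX \<Delta>. triangulated_category U S s \<Delta>"
proof -
 interpret U: suspended_category U S s by (rule suspended)
 have "pretriangulation U S s standard"
 proof
  fix t assume "t : standard"
  then show "U.typed t" unfolding standard_def U.typed_def by (auto simp: q_Arr cmor_def dest: conflD)
 next
  fix X Y Z u v w assume t: "(X, Y, Z, u, v, w) : standard"
  obtain u0 v0 w0 where 0: "u = q X Y u0" "v = q Y Z v0" "(X, u0, Y, v0, Z) : E" by (rule standardE[OF t])
  note c = conflD[OF 0(3)]
  show "Cmp U X Y Z v u = zero_arr U X Z" using c by (simp add: 0 q_Cmp q_zero)
  show "EX k:Arr U (S X) F. f = Cmp U Z (S X) F k w" if "F : Ob U" "f : Arr U Z F" "Cmp U Y Z F f v = zero_arr U Y F" for F f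
   using standard_weak_cokernel[OF t] that by simp
  show "EX Z' c w'. iso_arr U Z Z' c & (Y, Z', S X, Cmp U Y Z Z' c v, w', inv\<^bsub>Mor U (S X) (S Y)\<^esub> s X Y u) : standard & Cmp U Z Z' (S X) w' c = w"
   by (rule standard_rotate[OF t])
  show "EX c. U.tmor (X, Y, Z, u, v, w) (X', Y', Z', u', v', w') a b c"
   if "(X', Y', Z', u', v', w') : standard" "a : Arr U X X'" "b : Arr U Y Y'" "Cmp U X Y Y' b u = Cmp U X X' Y' u' a" for X' Y' Z' u' v' w' a b
   using standard_mor[OF t that] that unfolding U.tmor_def by auto
 next
  fix X Y u assume "X : Ob U" "Y : Ob U" and u: "u : Arr U X Y"
  then have O: "X : Ob K" "Y : Ob K" by simp_all
  obtain u0 where u0: "u0 : Arr K X Y" "u = q X Y u0" using u by (auto simp: Arr_U)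
  obtain P b r u1 v Z where P: "P : Ob K" "b : Arr K Y P" "r : Arr K P Y" "q P P (cp P Y P b r) = q P P (Idn K P)" "cp Y P Y r b = Idn K Y"
   "(X, u1, P, v, Z) : E" "q X P u1 = q X P (cp X Y P b u0)" by (rule cone_ex[OF O u0(1)])
  obtain w where w: "cmor (X, u1, P, v, Z) (susp X) (Idn K X) w" by (rule cmor_ex[OF P(6) suspD(1,2)[OF O(1)] Idn_Arr[OF O(1)]])
  have "iso_arr U Y P (q Y P b)" using P O by (intro U.iso_arrI[of _ _ _ "q P Y r"]) (simp_all add: q_Arr q_Cmp)
  moreover have "Cmp U X Y P (q Y P b) u = q X P u1" using P O u0 by (simp add: q_Cmp)
  ultimately show "EX Y' Z b v w. iso_arr U Y Y' b & (X, Y', Z, Cmp U X Y Y' b u, v, w) : standard" using standardI[OF w] by metis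
 qed (use standard_octahedron in simp)
 then show ?thesis using pretriangulation.triangulated by blast
qed

end

section \<open>The Frobenius category \<open>\<Z>(C)\<close>\<close>

text \<open>Translates equations of extensional composites into pointwise ones, the form used by
  \<open>extends\<close> and \<open>lifts\<close>.\<close>

lemma comp_eq_iff: assumes "h : Hom L X Y"
 shows "compose (carrier X) g f = h <-> (ALL x:carrier X. g (f x) = h x)"
proof
 assume "ALL x:carrier X. g (f x) = h x"
 then show "compose (carrier X) g f = h" using Hom_undefined[OF assms] by (auto simp: compose_def)
qed (auto simp: compose_def)

lemma Z_category_simps [simp]:
 "Ob (full_subcategory (mod_cat L) S) = S" "Mor (full_subcategory (mod_cat L) S) = hom_group L"
 "Cmp (full_subcategory (mod_cat L) S) X Y Z g f = compose (carrier X) g f"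
 "Idn (full_subcategory (mod_cat L) S) X = (\<lambda>x\<in>carrier X. x)"
 by (simp_all add: full_subcategory_def mod_cat_def)

lemma preadditive_full_subcategory: assumes "S <= modules L"
 shows "preadditive_category (full_subcategory (mod_cat L) S)"
proof (rule preadditive_category.intro, unfold Z_category_simps hom_group_simps)
 have L: "left_module L X" if "X : S" for X using assms that by (auto simp: fg_modD)
 note [simp] = L Hom_comp Hom_id
 fix W X Y Z assume [simp]: "W : S" "X : S" "Y : S" "Z : S"
 show "comm_group (hom_group L X Y)" "(\<lambda>x\<in>carrier X. x) : Hom L X X" by (simp_all add: hom_group_comm_group)
 fix f assume f [simp]: "f : Hom L X Y"
 show "compose (carrier X) f (\<lambda>x\<in>carrier X. x) = f" "compose (carrier X) (\<lambda>x\<in>carrier Y. x) f = f"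
  by (simp_all add: comp_eq_iff[OF f] Hom_cl[OF f])
 fix g assume g [simp]: "g : Hom L Y Z"
 show "compose (carrier X) g f : Hom L X Z" by (rule Hom_comp[OF f g]) simp
 show "compose (carrier X) g (\<lambda>x\<in>carrier X. f x +\<^sub>Y f' x) =
  (\<lambda>x\<in>carrier X. compose (carrier X) g f x +\<^sub>Z compose (carrier X) g f' x)" if "f' : Hom L X Y" for f'
  using Hom_cl[OF f] Hom_cl[OF that] by (simp add: compose_def Hom_add[OF g] cong: restrict_cong)
 show "compose (carrier X) (\<lambda>x\<in>carrier Y. g x +\<^sub>Z g' x) f =
  (\<lambda>x\<in>carrier X. compose (carrier X) g f x +\<^sub>Z compose (carrier X) g' f x)" for g'
  by (simp add: compose_def Hom_cl[OF f] cong: restrict_cong)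
 show "compose (carrier W) g (compose (carrier W) f h) = compose (carrier W) (compose (carrier X) g f) h"
  if "h : Hom L W X" for h using Hom_cl[OF that] by (intro compose_assoc) auto
qed

text \<open>Exhibits a direct sum as an extension, so that extension closure of \<open>Zcat\<close>
  yields its biproducts.\<close>

lemma ses_dsum:
 assumes X: "X : modules L" and Y: "Y : modules L" and P: "P : modules L" "mod_iso L P (dsum X Y)"
 obtains i q where "ses L X i P q Y"
proof -
 note L = fg_modD(1)[OF X] fg_modD(1)[OF Y] fg_modD(1)[OF P(1)]
 interpret X: left_module L X by (rule L)
 interpret Y: left_module L Y by (rule L)
 obtain g f where i: "g : Hom L P (dsum X Y)" "f : Hom L (dsum X Y) P"
  "!!y. y : carrier P ==> f (g y) = y" "!!x. x : carrier (dsum X Y) ==> g (f x) = x"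
  by (rule mod_isoE[OF P(2) L(3) lm_dsum[OF L(1,2)]]) (rule that)
 note m = dsum_maps[OF L(1,2)] and cl = Hom_cl[OF i(1)] Hom_cl[OF i(2)]
 let ?i = "compose (carrier X) f (\<lambda>x\<in>carrier X. (x, 0\<^sub>Y))" and ?q = "compose (carrier P) (\<lambda>z\<in>carrier X \<times> carrier Y. snd z) g"
 have "ses L X ?i P ?q Y" unfolding ses_def short_exact_def
 proof (intro conjI X Y P Hom_comp[OF m(1) i(2) L(1)] Hom_comp[OF i(1) m(4) L(3)])
  show "inj_on ?i (carrier X)" by (rule inj_on_inverseI[where g = "%z. fst (g z)"]) (simp add: compose_def i(4))
  show "?i ` carrier X = a_kernel P Y ?q"
  proof (intro equalityI subsetI)
   fix z assume "z : a_kernel P Y ?q"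
   then have z: "z : carrier P" "snd (g z) = 0\<^sub>Y" using cl(1) by (auto simp: aker_eq compose_def)
   then show "z : ?i ` carrier X" using cl(1)[OF z(1)] i(3)[OF z(1)] by (intro image_eqI[of _ _ "fst (g z)"]) (auto simp: compose_def)
  qed (use cl(2) i(4) in \<open>auto simp: aker_eq compose_def\<close>)
  have "y : ?q ` carrier P" if "y : carrier Y" for y
   using cl(2) i(4) that by (intro image_eqI[of _ _ "f (0\<^sub>X, y)"]) (simp_all add: compose_def)
  then show "?q ` carrier P = carrier Y" using Hom_cl[OF Hom_comp[OF i(1) m(4) L(3)]] by blast
 qed
 then show ?thesis by (rule that)
qed

lemma biproduct_mod:
 assumes S: "S <= modules L" "X : S" "Y : S" "P : S" and iso: "mod_iso L P (dsum X Y)"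
 shows "EX i j p q. biproduct (full_subcategory (mod_cat L) S) X Y P i j p q"
proof -
 have "left_module L X" "left_module L Y" "left_module L P" using S by (auto simp: fg_modD)
 note L = this lm_dsum[OF this(1,2)]
 interpret X: left_module L X by (rule L)
 interpret Y: left_module L Y by (rule L)
 obtain g f where P: "g : Hom L P (dsum X Y)" "f : Hom L (dsum X Y) P"
  "!!y. y : carrier P ==> f (g y) = y" "!!x. x : carrier (dsum X Y) ==> g (f x) = x"
  by (rule mod_isoE[OF iso L(3,4)]) (rule that)
 note m = dsum_maps[OF L(1,2)]
 let ?i = "\<lambda>x\<in>carrier X. (x, 0\<^sub>Y)" and ?j = "\<lambda>y\<in>carrier Y. (0\<^sub>X, y)"
  and ?p = "\<lambda>z\<in>carrier X \<times> carrier Y. fst z" and ?q = "\<lambda>z\<in>carrier X \<times> carrier Y. snd z"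
 have gz: "g z : carrier X \<times> carrier Y" "fst (g z) : carrier X" "snd (g z) : carrier Y" if "z : carrier P" for z
  using Hom_cl[OF P(1) that] by auto
 have "f (fst (g z), 0\<^sub>Y) +\<^sub>P f (0\<^sub>X, snd (g z)) = z" if z: "z : carrier P" for z
  using gz(2,3)[OF z] Hom_add[OF P(2), of "(fst (g z), 0\<^sub>Y)" "(0\<^sub>X, snd (g z))"] P(3)[OF z] by simp
 then have "biproduct (full_subcategory (mod_cat L) S) X Y P (compose (carrier X) f ?i) (compose (carrier Y) f ?j)
   (compose (carrier P) ?p g) (compose (carrier P) ?q g)"
  unfolding biproduct_def using S Hom_comp[OF m(1) P(2) L(1)] Hom_comp[OF m(2) P(2) L(2)]
   Hom_comp[OF P(1) m(3) L(3)] Hom_comp[OF P(1) m(4) L(3)] gz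
   Hom_cl[OF P(2)] by (auto simp: compose_def fun_eq_iff P(4))
 then show ?thesis by blast
qed

section \<open>The relative exact structure on \<open>Zcat\<close>\<close>

context precluster
begin

abbreviation "Z == Zcat L n C"
abbreviation "ZC == Z_category L n C"

lemma lm_Z: "X : Z ==> left_module L X" using Zcat_mod fg_modD by blast

lemma rel_inflation_iff: "rel_inflation ZC C A f B <-> A : Z & B : Z & f : Hom L A B & (ALL X:C. extends L A f B X)"
 by (auto simp: rel_inflation_def extends_def comp_eq_iff)

lemma rel_deflation_iff: "rel_deflation ZC C B g D <-> B : Z & D : Z & g : Hom L B D & (ALL X:C. lifts L X B g D)"
 by (auto simp: rel_deflation_def lifts_def comp_eq_iff)

text \<open>The left approximation of \<open>A\<close> is injective and factors through
  \<open>f\<close>, so \<open>f\<close> is injective; its cokernel is taken among all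
  modules.\<close>

lemma inj_if_extends:
 assumes X: "A : modules L" "B : modules L" and f: "f : Hom L A B" and e: "!!X. X : C ==> extends L A f B X"
 obtains D g where "ses L A f B g D"
proof -
 obtain i E where a: "left_approximation L C A i E" using left_approx[OF X(1)] by blast
 note r = left_approximationD[OF a X(1)]
 obtain v where "!!x. x : carrier A ==> v (f x) = i x" using extendsE[OF e[OF r(1)] r(2)] by metis
 then have "inj_on f (carrier A)" using r(3) by (metis inj_on_def)
 then show ?thesis using LA.ses_cokernel[OF X f] that by metis
qed

text \<open>Dually, the right approximation of \<open>D\<close> is surjective and factors through
  \<open>g\<close>.\<close>

lemma surj_if_lifts:
 assumes X: "B : modules L" "D : modules L" and g: "g : Hom L B D" and l: "!!X. X : C ==> lifts L X B g D"
 obtains A f where "ses L A f B g D"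
proof -
 obtain E p where a: "right_approximation L C E p D" using right_approx[OF X(2)] by blast
 note r = right_approximationD[OF a X(2)]
 obtain v where v: "v : Hom L E B" "!!x. x : carrier E ==> g (v x) = p x" by (rule liftsE[OF l[OF r(1)] r(2)]) (rule that)
 have "y : g ` carrier B" if "y : carrier D" for y using that unfolding r(3)[symmetric] by (auto simp flip: v(2) intro: Hom_cl[OF v(1)])
 then have "g ` carrier B = carrier D" using Hom_cl[OF g] by blast
 then show ?thesis using LA.ses_kernel[OF X g] that by blast
qed

lemma kernel_cokernel: assumes S: "ses L A f B g D"
 shows "kernel_of ZC A f B g D" "cokernel_of ZC A f B g D"
proof -
 note s = sesD[OF S]
 have z: "compose (carrier A) g f = (\<lambda>x\<in>carrier A. 0\<^sub>D)"
  by (simp add: comp_eq_iff[OF Hom_0map[OF s(4,6)]] s(13))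
 show "kernel_of ZC A f B g D" unfolding kernel_of_def Z_category_simps hom_group_simps
 proof (intro conjI ballI impI s z)
  fix X h assume X: "X : Z" and h: "h : Hom L X B" and "compose (carrier X) g h = (\<lambda>x\<in>carrier X. 0\<^sub>D)"
  note L = lm_Z[OF X]
  then have "g (h x) = 0\<^sub>D" if "x : carrier X" for x
   using \<open>compose (carrier X) g h = _\<close> that by (simp add: comp_eq_iff[OF Hom_0map[OF L s(6)]])
  then obtain w where w: "w : Hom L X A" "!!x. x : carrier X ==> f (w x) = h x"
   using ses_sub[OF S L h] by metis
  show "EX! k. k : Hom L X A & compose (carrier X) f k = h"
  proof (rule ex1I[of _ w])
   fix k assume "k : Hom L X A & compose (carrier X) f k = h"
   then have k: "k : Hom L X A" "!!x. x : carrier X ==> f (k x) = f (w x)" by (auto simp: comp_eq_iff[OF h] w)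
   show "k = w"
    by (rule Hom_eqI[OF k(1) w(1)]) (rule inj_onD[OF s(9) k(2)], simp_all add: Hom_cl[OF k(1)] Hom_cl[OF w(1)])
  qed (simp add: w comp_eq_iff[OF h])
 qed
 show "cokernel_of ZC A f B g D" unfolding cokernel_of_def Z_category_simps hom_group_simps
 proof (intro conjI ballI impI s z)
  fix X h assume X: "X : Z" and h: "h : Hom L B X" and "compose (carrier A) h f = (\<lambda>x\<in>carrier A. 0\<^sub>X)"
  note L = lm_Z[OF X]
  then have "h (f x) = 0\<^sub>X" if "x : carrier A" for x
   using \<open>compose (carrier A) h f = _\<close> that by (simp add: comp_eq_iff[OF Hom_0map[OF s(4) L]])
  then obtain w where w: "w : Hom L D X" "!!x. x : carrier B ==> w (g x) = h x"
   using ses_quot[OF S L h] by metis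
  show "EX! k. k : Hom L D X & compose (carrier B) k g = h"
  proof (rule ex1I[of _ w])
   fix k assume "k : Hom L D X & compose (carrier B) k g = h"
   then have k: "k : Hom L D X" "!!x. x : carrier B ==> k (g x) = w (g x)" by (auto simp: comp_eq_iff[OF h] w)
   show "k = w" by (rule Hom_eqI[OF k(1) w(1)]) (metis ses_surjE[OF S] k(2))
  qed (simp add: w comp_eq_iff[OF h])
 qed
qed

lemma conflationI:
 assumes S: "ses L A f B g D" and "A : Z" "B : Z" "D : Z" "!!X. X : C ==> lifts L X B g D"
 shows "(A, f, B, g, D) : rel_conflations ZC C"
 using assms sesD(7,8)[OF S] lifts_iff_extends[OF S] kernel_cokernel[OF S]
 by (simp add: rel_conflations_def rel_inflation_iff rel_deflation_iff)

text \<open>A categorical kernel inside \<open>Zcat\<close> might differ from the kernel of modules.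
  It does not, because the module kernel \<open>K\<close> of a relative deflation lies in
  \<open>Zcat\<close>, where kernels are unique up to isomorphism.\<close>

lemma rel_conflations_ZC: "(A, f, B, g, D) : rel_conflations ZC C <-> A : Z & B : Z & D : Z & F_sub_exact L C A f B g D"
proof
 assume *: "A : Z & B : Z & D : Z & F_sub_exact L C A f B g D"
 then have S: "ses L A f B g D" by (auto simp: F_sub_exact_def ses_def Zcat_mod)
 have "lifts L X B g D" if "X : C" for X unfolding lifts_def
 proof
  fix u assume u: "u : Hom L X D"
  then have "u : (%h. compose (carrier X) g h) ` Hom L X B" using * that unfolding F_sub_exact_def by blast
  then show "EX v:Hom L X B. ALL x:carrier X. g (v x) = u x" by (auto simp: compose_def)
 qed
 then show "(A, f, B, g, D) : rel_conflations ZC C" using conflationI[OF S] * by blast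
next
 assume *: "(A, f, B, g, D) : rel_conflations ZC C"
 then have Z: "A : Z" "B : Z" "D : Z" and fg: "f : Hom L A B" "g : Hom L B D"
  and l: "!!X. X : C ==> lifts L X B g D" and k: "kernel_of ZC A f B g D"
  unfolding rel_conflations_def rel_inflation_iff rel_deflation_iff by auto
 note L = lm_Z[OF Z(1)] lm_Z[OF Z(2)] lm_Z[OF Z(3)]
 obtain K i where S: "ses L K i B g D" using surj_if_lifts[OF Zcat_mod[OF Z(2)] Zcat_mod[OF Z(3)] fg(2) l] by metis
 have K: "K : Z" by (rule Zcat_kernel[OF S Z(2,3) l])
 note s = sesD[OF S]
 have z: "compose (carrier A) g f = \<one>\<^bsub>hom_group L A D\<^esub>" "compose (carrier K) g i = \<one>\<^bsub>hom_group L K D\<^esub>"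
  using k kernel_cokernel(1)[OF S] unfolding kernel_of_def by auto
 obtain a where a: "a : Hom L K A" "!!x. x : carrier K ==> f (a x) = i x"
 proof -
  have "EX! a. a : Hom L K A & compose (carrier K) f a = i" using k K s(7) z(2) unfolding kernel_of_def by simp
  then show ?thesis using that by (auto simp: comp_eq_iff[OF s(7)])
 qed
 obtain b where b: "b : Hom L A K" "!!x. x : carrier A ==> i (b x) = f x"
  by (rule ses_sub[OF S L(1) fg(1)]) (use z(1) that in \<open>auto simp: comp_eq_iff[OF Hom_0map[OF L(1,3)]]\<close>)
 have ab: "a (b x) = x" if "x : carrier A" for x
 proof -
  have "EX! m. m : Hom L A A & compose (carrier A) f m = f" using k Z(1) fg(1) z(1) unfolding kernel_of_def by simp
  moreover have "compose (carrier A) f (compose (carrier A) a b) = f" "compose (carrier A) f (\<lambda>x\<in>carrier A. x) = f"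
   using Hom_cl[OF b(1)] a(2) b(2) by (auto simp: comp_eq_iff[OF fg(1)] compose_eq)
  ultimately have "compose (carrier A) a b = (\<lambda>x\<in>carrier A. x)" using Hom_comp[OF b(1) a(1) L(1)] Hom_id[OF L(1)] by blast
  then show ?thesis using that by (metis compose_eq restrict_apply')
 qed
 have "inj_on f (carrier A)"
 proof (rule inj_onI)
  fix x y assume xy: "x : carrier A" "y : carrier A" "f x = f y"
  have "b x = b y" by (rule inj_onD[OF s(9)]) (use xy in \<open>simp_all add: b(2) Hom_cl[OF b(1)]\<close>)
  then show "x = y" using ab xy(1,2) by metis
 qed
 moreover have "f ` carrier A = i ` carrier K"
  using a(2) b(2) Hom_cl[OF a(1)] Hom_cl[OF b(1)] by (metis (no_types, lifting) image_subset_iff rev_image_eqI subset_antisym)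
 ultimately have "short_exact L A f B g D" using S fg unfolding ses_def short_exact_def by simp
 moreover have "(%h. compose (carrier X) g h) ` Hom L X B = Hom L X D" if "X : C" for X
  using l[OF that] Hom_comp[OF _ fg(2) lm_Z[OF C_Zcat[OF that]]] unfolding lifts_def image_iff
  by (intro equalityI subsetI) (auto simp: image_iff, metis comp_eq_iff)
 ultimately show "A : Z & B : Z & D : Z & F_sub_exact L C A f B g D" using Z by (simp add: F_sub_exact_def)
qed

lemma Z_zero: "EX Z0. zero_object (Z_category L n C) Z0"
proof -
 obtain Y where Y: "Y : C" using pctD(2) by blast
 note L = fg_modD(1)[OF C_modules[OF Y]]
 interpret Y: left_module L Y by (rule L)
 let ?O = "sub_mod Y {0\<^sub>Y}"
 have O: "?O : modules L" by (rule LA.fg_mod_sub[OF C_modules[OF Y] Y.zero_submodule])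
 note LO = fg_modD(1)[OF O]
 have OZ: "?O : Z" by (rule C_Zcat[OF C_zero[OF O]]) simp
 moreover have "Hom L X ?O = {\<lambda>x\<in>carrier X. \<zero>\<^bsub>?O\<^esub>}" "Hom L ?O X = {\<lambda>x\<in>carrier ?O. 0\<^sub>X}"
  if "X : modules L" for X
 proof -
  note LX = fg_modD(1)[OF that]
  have "f = (\<lambda>x\<in>carrier X. \<zero>\<^bsub>?O\<^esub>)" if "f : Hom L X ?O" for f
   by (rule Hom_eqI[OF that Hom_0map[OF LX LO]]) (use Hom_cl[OF that] in simp)
  then show "Hom L X ?O = {\<lambda>x\<in>carrier X. \<zero>\<^bsub>?O\<^esub>}" using Hom_0map[OF LX LO] by blast
  have "f = (\<lambda>x\<in>carrier ?O. 0\<^sub>X)" if "f : Hom L ?O X" for f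
   by (rule Hom_eqI[OF that Hom_0map[OF LO LX]]) (use Hom_zero[OF LO LX that] in simp)
  then show "Hom L ?O X = {\<lambda>x\<in>carrier ?O. 0\<^sub>X}" using Hom_0map[OF LO LX] by blast
 qed
 ultimately show ?thesis unfolding zero_object_def using Zcat_mod by (intro exI[of _ ?O]) (simp del: sub_mod_simps)
qed

text \<open>\<open>Zcat_cokernel\<close> and \<open>Zcat_kernel\<close> keep the new ends in
  \<open>Zcat\<close>; \<open>lifts_iff_extends\<close> turns the condition on one end into that on
  the other.\<close>

lemma relative_exact_ZC: "relative_exact ZC C"
proof -
 interpret preadditive_category ZC by (rule preadditive_full_subcategory) (use Zcat_mod in blast)
 have bip: "EX P i j p q. biproduct ZC X Y P i j p q" if X: "X : Z" and Y: "Y : Z" for X Y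
 proof -
  obtain P where P: "P : modules L" "mod_iso L P (dsum X Y)"
   using modules_isoE[OF LA.fg_mod_dsum[OF Zcat_mod[OF X] Zcat_mod[OF Y]]] mod_isoI by metis
  obtain i q where S: "ses L X i P q Y" by (rule ses_dsum[OF Zcat_mod[OF X] Zcat_mod[OF Y] P])
  have "Z <= modules L" using Zcat_mod by blast
  then show ?thesis using biproduct_mod[OF _ X Y Zcat_extension[OF S X Y] P(2)] by blast
 qed
 show ?thesis
 proof
  show "EX Z0. zero_object ZC Z0" by (rule Z_zero)
  show "EX B i j p q. biproduct ZC X Y B i j p q" if "X : Ob ZC" "Y : Ob ZC" for X Y using bip that by simp
  show "P : Ob ZC" if "P : C" for P using C_Zcat that by simp
  show "X : C" if "P : C" "X : Ob ZC" "i : Arr ZC X P" "r : Arr ZC P X" "Cmp ZC X P X r i = Idn ZC X" for P X i r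
   using that C_retract[OF that(1), of X i r] Zcat_mod by (simp add: comp_eq_iff[OF Hom_id[OF lm_Z]])
  show "EX g D. (A, f, B, g, D) : rel_conflations ZC C" if f: "rel_inflation ZC C A f B" for A f B
  proof -
   have *: "A : Z" "B : Z" "f : Hom L A B" "!!X. X : C ==> extends L A f B X" using f by (auto simp: rel_inflation_iff)
   obtain D g where S: "ses L A f B g D" by (rule inj_if_extends[OF Zcat_mod[OF *(1)] Zcat_mod[OF *(2)] *(3,4)])
   have D: "D : Z" by (rule Zcat_cokernel[OF S *(1,2,4)])
   then show ?thesis using conflationI[OF S] lifts_iff_extends[OF S *(1)] * by metis
  qed
  show "EX A f. (A, f, B, g, D) : rel_conflations ZC C" if g: "rel_deflation ZC C B g D" for B g D
  proof -
   have *: "B : Z" "D : Z" "g : Hom L B D" "!!X. X : C ==> lifts L X B g D" using g by (auto simp: rel_deflation_iff)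
   obtain A f where S: "ses L A f B g D" by (rule surj_if_lifts[OF Zcat_mod[OF *(1)] Zcat_mod[OF *(2)] *(3,4)])
   have "A : Z" by (rule Zcat_kernel[OF S *(1,2,4)])
   then show ?thesis using conflationI[OF S] * by metis
  qed
  fix X assume "X : Ob ZC"
  then have X: "X : Z" "X : modules L" using Zcat_mod by simp_all
  obtain i E where a: "left_approximation L C X i E" using left_approx[OF X(2)] by blast
  show "EX P:C. EX f. rel_inflation ZC C X f P"
   using left_approximationD[OF a X(2)] X C_Zcat unfolding rel_inflation_iff by blast
  obtain E' p where a': "right_approximation L C E' p X" using right_approx[OF X(2)] by blast
  show "EX P:C. EX g. rel_deflation ZC C P g X"
   using right_approximationD[OF a' X(2)] X C_Zcat unfolding rel_deflation_iff by blast
 qed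
qed

end

section \<open>Minimal approximations and the theorem\<close>

context precluster
begin

text \<open>Among the images of the endomorphisms \<open>\<pi>\<close> of an approximation \<open>i : X \<rightarrow> E\<close> with \<open>\<pi> i = i\<close> a minimal one is a direct
 summand of \<open>E\<close>, because \<open>\<pi>\<close> maps it onto itself.\<close>

lemma minimal_left_approximation_ex: assumes X: "X : modules L"
 obtains i M where "minimal_left_approximation L C X i M"
proof -
 obtain i E where a: "left_approximation L C X i E" using left_approx[OF X] by blast
 note r = left_approximationD[OF a X]
 note Em = C_modules[OF r(1)]
 note LX = fg_modD(1)[OF X] and LE = fg_modD(1)[OF Em]
 define P where "P M <-> (EX \<pi>:Hom L E E. (ALL x:carrier X. \<pi> (i x) = i x) & M = \<pi> ` carrier E)" for M
 have "P (carrier E)" unfolding P_def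
  by (rule bexI[of _ "\<lambda>x\<in>carrier E. x"]) (use Hom_id[OF LE] Hom_cl[OF r(2)] in auto)
 moreover have "submodule (carrier E) L E" by (rule left_module.subm_carrier[OF LE])
 ultimately obtain M where M: "submodule M L E" "P M" "!!N. submodule N L E ==> P N ==> N <= M ==> N = M"
  using finlen_min[of L E "carrier E" P] Em LA.fg_mod_iff by metis
 let ?M = "sub_mod E M"
 have Mm: "?M : modules L" by (rule LA.fg_mod_sub[OF Em M(1)])
 note LM = fg_modD(1)[OF Mm]
 have fl: "finlen L ?M" using Mm LA.fg_mod_iff by blast
 obtain \<pi> where \<pi>: "\<pi> : Hom L E E" "!!x. x : carrier X ==> \<pi> (i x) = i x" "M = \<pi> ` carrier E" using M(2) unfolding P_def by auto
 have sub: "x : carrier E" if "x : M" for x using that submD(1)[OF M(1)] by blast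
 have incl: "(\<lambda>x\<in>M. x) : Hom L ?M E" by (rule sub_mod_incl[OF LE M(1)])
 have minim: "h ` carrier E = M" if "h : Hom L E E" "!!x. x : carrier X ==> h (i x) = i x" "h ` carrier E <= M" for h
  by (rule M(3)[OF subm_range[OF LE LE that(1)] _ that(3)]) (use that in \<open>auto simp: P_def\<close>)
 obtain \<pi>2 where p2: "\<pi>2 : Hom L E E" "!!x. x : carrier E ==> \<pi>2 x = \<pi> (\<pi> x)" by (rule Hom_comp_ex[OF LE \<pi>(1) \<pi>(1)]) (rule that)
 have "\<pi>2 ` carrier E = M" by (rule minim[OF p2(1)]) (use p2(2) \<pi> Hom_cl[OF \<pi>(1)] Hom_cl[OF r(2)] in auto)
 moreover have "\<pi>2 ` carrier E = \<pi> ` M" unfolding \<pi>(3) image_image using p2(2) by (intro image_cong) auto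
 ultimately have onto: "\<pi> ` M = M" by simp
 obtain \<rho> where \<rho>: "\<rho> : Hom L ?M E" "!!x. x : M ==> \<rho> x = \<pi> x" by (rule Hom_comp_ex[OF LM incl \<pi>(1)]) (use that in simp)
 have \<rho>M: "\<rho> : Hom L ?M ?M" by (rule Hom_into_sub[OF \<rho>(1)]) (use \<rho>(2) onto in auto)
 have "inj_on \<rho> (carrier ?M)" by (rule finlen_surj_inj[OF LM fl \<rho>M]) (use onto \<rho>(2) in auto)
 then have inj: "inj_on \<rho> M" by simp
 have \<pi>M: "\<pi> : Hom L E ?M" by (rule Hom_into_sub[OF \<pi>(1)]) (simp add: \<pi>(3))
 \<comment> \<open>\<open>w\<close> is \<open>\<pi>\<close> followed by the inverse of its
   restriction to \<open>M\<close>, so it is the identity on \<open>M\<close> and splits the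
   inclusion.\<close>
 obtain w where w: "w : Hom L E ?M" "!!x. x : carrier E ==> \<rho> (w x) = \<pi> x"
  by (rule hom_factor_inj[OF LM LM LE \<rho>M _ \<pi>M]) (use inj onto \<rho>(2) \<pi>(3) that in auto)
 have wM: "w x : M" if "x : carrier E" for x using Hom_cl[OF w(1) that] by simp
 have wx: "w x = x" if "x : M" for x by (rule inj_onD[OF inj]) (use that w(2) \<rho>(2) wM sub in auto)
 have MC: "?M : C" by (rule C_retract[OF r(1) Mm incl w(1)]) (simp add: wx)
 have iM: "i x : M" if "x : carrier X" for x
  using \<pi>(2)[OF that] Hom_cl[OF r(2) that] unfolding \<pi>(3) by (metis imageI)
 have i: "i : Hom L X ?M" by (rule Hom_into_sub[OF r(2) iM])
 have "left_approximation L C X i ?M" unfolding left_approximation_def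
 proof (intro conjI ballI MC i)
  fix Y f assume Y: "Y : C" and f: "f : Hom L X Y"
  obtain g where g: "g : Hom L E Y" "!!x. x : carrier X ==> g (i x) = f x" using extendsE[OF r(4)[OF Y] f] by metis
  obtain g' where g': "g' : Hom L ?M Y" "!!x. x : M ==> g' x = g x" by (rule Hom_comp_ex[OF LM incl g(1)]) (use that in simp)
  show "EX g:Hom L ?M Y. compose (carrier X) g i = f"
   using g'(1) by (rule bexI[rotated]) (simp add: comp_eq_iff[OF f] g'(2) iM g(2))
 qed
 moreover have "bij_betw h (carrier ?M) (carrier ?M)" if h: "h : Hom L ?M ?M" and hi: "compose (carrier X) h i = i" for h
 proof -
  \<comment> \<open>Composed with \<open>w\<close>, the map \<open>h\<close> becomes an endomorphism
    of \<open>E\<close> that fixes \<open>i\<close> and has image in \<open>M\<close>. By minimality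
    the image is \<open>M\<close>, so \<open>h\<close> is onto and, by finite length,
    bijective.\<close>
  obtain hw where hw: "hw : Hom L E ?M" "!!x. x : carrier E ==> hw x = h (w x)" by (rule Hom_comp_ex[OF LE w(1) h]) (rule that)
  have "h (i x) = i x" if "x : carrier X" for x using fun_cong[OF hi, of x] that by (simp add: compose_def)
  then have "hw ` carrier E = M"
   by (intro minim[OF Hom_from_sub[OF hw(1) M(1)]]) (use hw(2) wx iM sub Hom_cl[OF hw(1)] in auto)
  moreover have "hw ` carrier E = h ` w ` carrier E" using hw(2) by (simp add: image_image)
  moreover have "w ` carrier E = M" using wM wx sub by force
  ultimately have "h ` carrier ?M = carrier ?M" by simp
  then show ?thesis using finlen_surj_inj[OF LM fl h] by (simp add: bij_betw_def)
 qed
 ultimately show ?thesis using that unfolding minimal_left_approximation_def by blast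
qed

lemma stable_category_ZC: assumes a: "!!X. X : Z ==> left_approximation L C X (i X) (I X)"
  and s: "!!X. X : Z ==> ses L X (i X) (I X) (p X) (S X)" shows "stable_category ZC C I S i p"
proof (intro stable_category.intro relative_exact_ZC stable_category_axioms.intro)
 fix X assume "X : Ob ZC"
 then have X: "X : Z" by simp
 note l = left_approximationD[OF a[OF X] Zcat_mod[OF X]]
 have SZ: "S X : Z" by (rule Zcat_cokernel[OF s[OF X] X C_Zcat[OF l(1)] l(4)])
 then show "I X : C & (X, i X, I X, p X, S X) : rel_conflations ZC C"
  using conflationI[OF s[OF X] X C_Zcat[OF l(1)] SZ] lifts_iff_extends[OF s[OF X] X SZ] l(1,4) by blast
qed

lemma relative_cosyzygy_functor_data:
 assumes X: "X : Z" and "minimal_left_approximation L C X i I" "S : modules L" "p : Hom L I S"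
  "p ` carrier I = carrier S" "a_kernel I S p = i ` carrier X"
 shows "left_approximation L C X i I" "ses L X i I p S"
proof -
 show a: "left_approximation L C X i I" using assms(2) by (simp add: minimal_left_approximation_def)
 note l = left_approximationD[OF a Zcat_mod[OF X]]
 show "ses L X i I p S" unfolding ses_def short_exact_def using assms l C_modules Zcat_mod by auto
qed

text \<open>The diagram in \<open>relative_cosyzygy_functor\<close> is exactly a \<open>cmor\<close>
  between the chosen conflations, so every such pair \<open>S\<close>, \<open>s\<close> satisfies
  the locale of the stable suspension.\<close>

lemma triangulated_ZC: assumes "relative_cosyzygy_functor L n C S s"
 shows "EX \<Delta>. triangulated_category (U_category L n C) S s \<Delta>"
proof -
 obtain I i p where d: "ALL X:Z. minimal_left_approximation L C X (i X) (I X) & S X : modules L &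
    p X : Hom L (I X) (S X) & p X ` carrier (I X) = carrier (S X) & a_kernel (I X) (S X) (p X) = i X ` carrier X"
  and m: "ALL X:Z. ALL Y:Z. ALL f:Hom L X Y. ALL g:Hom L (I X) (I Y). ALL h:Hom L (S X) (S Y).
     compose (carrier X) g (i X) = compose (carrier X) (i Y) f -->
     compose (carrier (I X)) h (p X) = compose (carrier (I X)) (p Y) g -->
     s X Y (factor_ideal ZC C X Y #>\<^bsub>hom_group L X Y\<^esub> f) = factor_ideal ZC C (S X) (S Y) #>\<^bsub>hom_group L (S X) (S Y)\<^esub> h"
  using assms[unfolded relative_cosyzygy_functor_def] by (elim exE conjE) (rule that)
 have la: "left_approximation L C X (i X) (I X)" "ses L X (i X) (I X) (p X) (S X)" if "X : Z" for X
  using relative_cosyzygy_functor_data[of X "i X" "I X" "S X" "p X"] d that by metis+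
 interpret stable_category ZC C I S i p by (rule stable_category_ZC[OF la])
 have "stable_suspension ZC C I S i p s"
 proof
  fix X Y f h assume c: "cmor (X, i X, I X, p X, S X) (Y, i Y, I Y, p Y, S Y) f h"
  obtain g where "(X, i X, I X, p X, S X) : rel_conflations ZC C" "(Y, i Y, I Y, p Y, S Y) : rel_conflations ZC C" "f : Arr ZC X Y" "h : Arr ZC (S X) (S Y)" "g : Arr ZC (I X) (I Y)"
   "Cmp ZC X (I X) (I Y) g (i X) = Cmp ZC X Y (I Y) (i Y) f" "Cmp ZC (I X) (S X) (S Y) h (p X) = Cmp ZC (I X) (I Y) (S Y) (p Y) g" by (rule cmorE[OF c])
  then show "s X Y (factor_ideal ZC C X Y #>\<^bsub>Mor ZC X Y\<^esub> f) = factor_ideal ZC C (S X) (S Y) #>\<^bsub>Mor ZC (S X) (S Y)\<^esub> h"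
   using m conflD by simp
 qed
 then show ?thesis by (rule stable_suspension.stable_triangulated)
qed

lemma relative_cosyzygy_functor_ex: "EX S s. relative_cosyzygy_functor L n C S s"
proof -
 have "EX i I p S. minimal_left_approximation L C X i I & S : modules L &
    p : Hom L I S & p ` carrier I = carrier S & a_kernel I S p = i ` carrier X" if X: "X : Z" for X
 proof -
  obtain i I where a: "minimal_left_approximation L C X i I" using minimal_left_approximation_ex[OF Zcat_mod[OF X]] by blast
  then have l: "left_approximation L C X i I" by (simp add: minimal_left_approximation_def)
  note l = left_approximationD[OF l Zcat_mod[OF X]]
  obtain S p where "ses L X i I p S" using LA.ses_cokernel[OF Zcat_mod[OF X] C_modules[OF l(1)] l(2,3)] by metis
  then show ?thesis using a unfolding ses_def short_exact_def by metis
 qed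
 then obtain i I p S where d: "!!X. X : Z ==> minimal_left_approximation L C X (i X) (I X)" "!!X. X : Z ==> S X : modules L"
  "!!X. X : Z ==> p X : Hom L (I X) (S X)" "!!X. X : Z ==> p X ` carrier (I X) = carrier (S X)" "!!X. X : Z ==> a_kernel (I X) (S X) (p X) = i X ` carrier X"
  by metis
 have la: "left_approximation L C X (i X) (I X)" "ses L X (i X) (I X) (p X) (S X)" if "X : Z" for X
  using relative_cosyzygy_functor_data[of X "i X" "I X" "S X" "p X"] d that by metis+
 interpret stable_category ZC C I S i p by (rule stable_category_ZC[OF la])
 \<comment> \<open>The class of \<open>f\<close> determines that of \<open>h\<close> by
   \<open>cmor_unique\<close>, so any representing pair may be chosen.\<close>
 define s where "s X Y F = (SOME H. EX f h. cmor (X, i X, I X, p X, S X) (Y, i Y, I Y, p Y, S Y) f h & F = q X Y f & H = q (S X) (S Y) h)" for X Y F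
 have s: "s X Y (q X Y f) = q (S X) (S Y) h" if Y: "Y : Z" and c: "cmor (X, i X, I X, p X, S X) (Y, i Y, I Y, p Y, S Y) f h" for X Y f h
  unfolding s_def
 proof (rule some_equality)
  show "H = q (S X) (S Y) h" if "EX f' h'. cmor (X, i X, I X, p X, S X) (Y, i Y, I Y, p Y, S Y) f' h' & q X Y f = q X Y f' & H = q (S X) (S Y) h'" for H
   using that cmor_unique[OF c] suspension[of Y] Y by (metis Z_category_simps(1))
 qed (use c in blast)
 have "s X Y (factor_ideal ZC C X Y #>\<^bsub>hom_group L X Y\<^esub> f) = factor_ideal ZC C (S X) (S Y) #>\<^bsub>hom_group L (S X) (S Y)\<^esub> h"
  if XY: "X : Z" "Y : Z" and h: "f : Hom L X Y" "g : Hom L (I X) (I Y)" "h : Hom L (S X) (S Y)"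
   "compose (carrier X) g (i X) = compose (carrier X) (i Y) f" "compose (carrier (I X)) h (p X) = compose (carrier (I X)) (p Y) g" for X Y f g h
 proof -
  have "cmor (X, i X, I X, p X, S X) (Y, i Y, I Y, p Y, S Y) f h"
   by (rule cmorI[where b = g]) (use suspension[of X] suspension[of Y] XY h in simp_all)
  then show ?thesis using s[OF XY(2)] by simp
 qed
 then have "relative_cosyzygy_functor L n C S s"
  unfolding relative_cosyzygy_functor_def using d by (intro exI[of _ I] exI[of _ i] exI[of _ p]) blast
 then show ?thesis by blast
qed

end


theorem proposition3p12:
 fixes R :: "'r ring" and \<Lambda> :: "'a ring" and \<phi> :: "'r \<Rightarrow> 'a"
  and J :: "('r, 'j) module" and C :: "'a fgm set" and n :: nat
 assumes "artin_algebra R \<Lambda> \<phi>" and "dualizing_module R J" and "n \<ge> 1"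
  and "precluster_tilting R \<phi> J \<Lambda> n C"
 shows "extension_closed \<Lambda> (Zcat \<Lambda> n C) \<and>
  (let E = {(L, f, M, g, N). L \<in> Zcat \<Lambda> n C \<and> M \<in> Zcat \<Lambda> n C \<and> N \<in> Zcat \<Lambda> n C \<and>
               F_sub_exact \<Lambda> C L f M g N}
  in frobenius_category (Z_category \<Lambda> n C) E \<and>
    projectives (Z_category \<Lambda> n C) E = C \<and> injectives (Z_category \<Lambda> n C) E = C) \<and>
  (\<exists>S s. relative_cosyzygy_functor \<Lambda> n C S s) \<and>
  (\<forall>S s. relative_cosyzygy_functor \<Lambda> n C S s \<longrightarrow>
   (\<exists>\<Delta>. triangulated_category (U_category \<Lambda> n C) S s \<Delta>))"
proof -
 interpret artin_algebra R \<Lambda> \<phi> by fact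
 interpret precluster R \<Lambda> \<phi> J n C
  using assms by (intro precluster.intro precluster_axioms.intro artin_duality.intro artin_duality_axioms.intro) auto
 have "extension_closed \<Lambda> Z"
  unfolding extension_closed_def using Zcat_extension Zcat_mod unfolding ses_def by blast
 \<comment> \<open>The abstract conflations are literally the \<open>F\<close>-exact sequences in
   \<open>Zcat\<close>, so the Frobenius structure transfers by equality.\<close>
 moreover have "{(L, f, M, g, N). L : Z & M : Z & N : Z & F_sub_exact \<Lambda> C L f M g N} = rel_conflations ZC C"
  by (auto simp: rel_conflations_ZC)
 moreover note relative_exact.frobenius[OF relative_exact_ZC] relative_exact.projectives_eq[OF relative_exact_ZC] relative_exact.injectives_eq[OF relative_exact_ZC]
 ultimately show ?thesis using relative_cosyzygy_functor_ex triangulated_ZC by (simp add: Let_def)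
qed

end
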